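(* Let $p_0\in L^2(M)$ be a probability density with respect to $\nu$, let $X_1,\dots,X_n$ be i.i.d. with law $p_0\,d\nu$, let $\mathcal J\subset\{1,2,\dots\}$ be finite, and let $\tau_j>0$, $\eta_j\ge 0$ ($j\in\mathcal J$) be deterministic numbers. Let $\widehat g_j=\frac1n\sum_{i=1}^nK_j(\cdot,X_i)$, $g_j=P_jp_0$, $\varepsilon_j=\widehat g_j-g_j$, and suppose that for every $j\in\mathcal J$ $$\mathbb E_{p_0}\Big[\|\varepsilon_j\|_{L^2(M)}^2\mathbf 1\{\|\varepsilon_j\|_{L^2(M)}>\tau_j/2\}\Big]+\tau_j^2\,\mathbb P_{p_0}\big(\|\varepsilon_j\|_{L^2(M)}>\tau_j/2\big)\le\eta_j .$$ Let $\widetilde p_{\mathcal J}=1+\sum_{j\in\mathcal J}\mathsf S_{\tau_j}(\widehat g_j)$ and $\widetilde p_{\mathcal J}^+=\Pi_{\mathcal D}\widetilde p_{\mathcal J}$. Then $$\mathbb E_{p_0}\|\widetilde p_{\mathcal J}-p_0\|_{L^2(M)}^2\le 9\sum_{j\in\mathcal J}\min\{\|P_jp_0\|_{L^2(M)}^2,\tau_j^2\}+\sum_{j\notin\mathcal J,\,j\ge1}\|P_jp_0\|_{L^2(M)}^2+2\sum_{j\in\mathcal J}\eta_j,$$ and the same inequality holds with $\widetilde p_{\mathcal J}$ replaced by $\widetilde p_{\mathcal J}^+$.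
   Context: $(M,g)$ is a compact connected smooth Riemannian manifold without boundary, $\nu$ is Riemannian volume normalized so that $\nu(M)=1$, and $L^2(M)=L^2(M,\nu)$ (real-valued). $L=-\Delta_M$ is the nonnegative Laplace–Beltrami operator with distinct eigenvalues $0=\mu_0<\mu_1<\mu_2<\cdots$; $E_j=\ker(L-\mu_jI)$, $d_j=\dim E_j$, $P_j:L^2(M)\to E_j$ is the orthogonal projector, and $K_j(x,y)=\sum_{\ell=1}^{d_j}\phi_{j,\ell}(x)\phi_{j,\ell}(y)$ is its integral kernel, where $\{\phi_{j,\ell}\}_{\ell}$ is any orthonormal basis of $E_j$. Radial soft thresholding on $E_j$: for $\tau>0$, $\mathsf S_\tau(g)=\big(1-\tau/\|g\|_{L^2(M)}\big)_+g$ for $g\ne0$, and $\mathsf S_\tau(0)=0$. $\mathcal D=\{q\in L^2(M): q\ge0\text{ a.e.},\ \int_Mq\,d\nu=1\}$, a closed convex set, and $\Pi_{\mathcal D}$ is the $L^2(M)$-metric projection onto $\mathcal D$. *)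

theory Defs
  imports "HOL-Analysis.Analysis" "HOL-Probability.Probability"
begin

section \<open>Smooth functions on open sets of Euclidean space\<close>

definition partial_deriv :: "'n \<Rightarrow> (real ^ 'n::finite \<Rightarrow> real) \<Rightarrow> real ^ 'n \<Rightarrow> real" where
  "partial_deriv i u x = frechet_derivative u (at x) (axis i 1)"

fun Ck_on :: "nat \<Rightarrow> (real ^ 'n::finite) set \<Rightarrow> (real ^ 'n \<Rightarrow> real) \<Rightarrow> bool" where
  "Ck_on 0 S u \<longleftrightarrow> continuous_on S u"
| "Ck_on (Suc k) S u \<longleftrightarrow> u differentiable_on S \<and> (\<forall>i. Ck_on k S (partial_deriv i u))"

(* Only meant for open S: partial_deriv uses the two-sided derivative. *)
definition smooth_on :: "(real ^ 'n::finite) set \<Rightarrow> (real ^ 'n \<Rightarrow> real) \<Rightarrow> bool" where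
  "smooth_on S u \<longleftrightarrow> (\<forall>k. Ck_on k S u)"


section \<open>Compact connected Riemannian manifolds without boundary\<close>

text \<open>The points of the manifold are the elements of a Hausdorff, second countable type. A chart
  is a pair of its domain and its coordinate map; coordinates are only relevant on the domain.\<close>

type_synonym ('a, 'n) chart = "'a set \<times> ('a \<Rightarrow> real ^ 'n)"

definition coords :: "('a, 'n::finite) chart \<Rightarrow> 'a \<Rightarrow> real ^ 'n" where
  "coords c = snd c"

definition param :: "('a, 'n::finite) chart \<Rightarrow> real ^ 'n \<Rightarrow> 'a" where
  "param c = inv_into (fst c) (snd c)"

definition chart_image :: "('a, 'n::finite) chart \<Rightarrow> (real ^ 'n) set" where
  "chart_image c = coords c ` fst c"

definition transition :: "('a, 'n::finite) chart \<Rightarrow> ('a, 'n) chart \<Rightarrow> real ^ 'n \<Rightarrow> real ^ 'n" where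
  "transition c c' = coords c' \<circ> param c"

definition smooth_atlas ::
  "('a::{t2_space, second_countable_topology}, 'n::finite) chart set \<Rightarrow> bool" where
  "smooth_atlas \<A> \<longleftrightarrow>
     (\<Union>c\<in>\<A>. fst c) = UNIV \<and>
     (\<forall>c\<in>\<A>. open (fst c) \<and> open (chart_image c) \<and>
        homeomorphism (fst c) (chart_image c) (coords c) (param c)) \<and>
     (\<forall>c\<in>\<A>. \<forall>c'\<in>\<A>. \<forall>i.
        smooth_on (coords c ` (fst c \<inter> fst c')) (\<lambda>x. transition c c' x $ i))"

text \<open>\<open>G c p\<close> is the Gram matrix of the metric at the point \<open>p\<close> with respect to the coordinate
  frame of the chart \<open>c\<close>. The last clause is the transformation law of a covariant 2-tensor.\<close>

definition riemannian_metric ::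
  "('a::{t2_space, second_countable_topology}, 'n::finite) chart set
     \<Rightarrow> (('a, 'n) chart \<Rightarrow> 'a \<Rightarrow> real ^ 'n ^ 'n) \<Rightarrow> bool" where
  "riemannian_metric \<A> G \<longleftrightarrow>
     (\<forall>c\<in>\<A>. \<forall>i j. smooth_on (chart_image c) (\<lambda>x. G c (param c x) $ i $ j)) \<and>
     (\<forall>c\<in>\<A>. \<forall>p\<in>fst c. transpose (G c p) = G c p \<and> (\<forall>v. v \<noteq> 0 \<longrightarrow> 0 < v \<bullet> (G c p *v v))) \<and>
     (\<forall>c\<in>\<A>. \<forall>c'\<in>\<A>. \<forall>p\<in>fst c \<inter> fst c'.
        let J = matrix (frechet_derivative (transition c c') (at (coords c p)))
        in G c p = transpose J ** G c' p ** J)"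

definition compact_riemannian_manifold ::
  "('a::{t2_space, second_countable_topology}, 'n::finite) chart set
     \<Rightarrow> (('a, 'n) chart \<Rightarrow> 'a \<Rightarrow> real ^ 'n ^ 'n) \<Rightarrow> bool" where
  "compact_riemannian_manifold \<A> G \<longleftrightarrow>
     compact (UNIV :: 'a set) \<and> connected (UNIV :: 'a set) \<and>
     smooth_atlas \<A> \<and> riemannian_metric \<A> G"

(* By second countability these conditions determine V. *)
definition riemannian_volume ::
  "('a::{t2_space, second_countable_topology}, 'n::finite) chart set
     \<Rightarrow> (('a, 'n) chart \<Rightarrow> 'a \<Rightarrow> real ^ 'n ^ 'n) \<Rightarrow> 'a measure \<Rightarrow> bool" where
  "riemannian_volume \<A> G V \<longleftrightarrow> sets V = sets borel \<and>
     (\<forall>c\<in>\<A>. \<forall>B\<in>sets borel. B \<subseteq> fst c \<longrightarrow>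
        emeasure V B = (\<integral>\<^sup>+x\<in>coords c ` B. ennreal (sqrt (det (G c (param c x)))) \<partial>lborel))"

definition normalize_measure :: "'a measure \<Rightarrow> 'a measure" where
  "normalize_measure V = scale_measure (inverse (emeasure V (space V))) V"


section \<open>Square-integrable functions\<close>

text \<open>Elements of the space of square-integrable functions are handled through representatives;
  all notions below are invariant under almost everywhere equality, or choose a representative.\<close>

definition L2 :: "'a measure \<Rightarrow> ('a \<Rightarrow> real) set" where
  "L2 \<nu> = {f. f \<in> borel_measurable \<nu> \<and> integrable \<nu> (\<lambda>x. (f x)\<^sup>2)}"

definition l2_inner :: "'a measure \<Rightarrow> ('a \<Rightarrow> real) \<Rightarrow> ('a \<Rightarrow> real) \<Rightarrow> real" where
  "l2_inner \<nu> f h = (\<integral>x. f x * h x \<partial>\<nu>)"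

definition l2_norm :: "'a measure \<Rightarrow> ('a \<Rightarrow> real) \<Rightarrow> real" where
  "l2_norm \<nu> f = sqrt (l2_inner \<nu> f f)"

definition orth_proj :: "'a measure \<Rightarrow> ('a \<Rightarrow> real) set \<Rightarrow> ('a \<Rightarrow> real) \<Rightarrow> 'a \<Rightarrow> real" where
  "orth_proj \<nu> E f = (SOME h. h \<in> E \<and> (\<forall>e\<in>E. l2_inner \<nu> (\<lambda>x. f x - h x) e = 0))"

definition metric_proj :: "'a measure \<Rightarrow> ('a \<Rightarrow> real) set \<Rightarrow> ('a \<Rightarrow> real) \<Rightarrow> 'a \<Rightarrow> real" where
  "metric_proj \<nu> C f =
     (SOME q. q \<in> C \<and> (\<forall>r\<in>C. l2_norm \<nu> (\<lambda>x. f x - q x) \<le> l2_norm \<nu> (\<lambda>x. f x - r x)))"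

definition orthonormal_basis ::
  "'a measure \<Rightarrow> ('a \<Rightarrow> real) set \<Rightarrow> nat \<Rightarrow> (nat \<Rightarrow> 'a \<Rightarrow> real) \<Rightarrow> bool" where
  "orthonormal_basis \<nu> E d \<phi> \<longleftrightarrow>
     (\<forall>l\<in>{1..d}. \<phi> l \<in> E) \<and>
     (\<forall>l\<in>{1..d}. \<forall>m\<in>{1..d}. l2_inner \<nu> (\<phi> l) (\<phi> m) = (if l = m then 1 else 0)) \<and>
     (\<forall>f\<in>E. \<exists>a. AE x in \<nu>. f x = (\<Sum>l=1..d. a l * \<phi> l x))"

definition densities :: "'a measure \<Rightarrow> ('a \<Rightarrow> real) set" where
  "densities \<nu> = {q \<in> L2 \<nu>. (AE x in \<nu>. 0 \<le> q x) \<and> (\<integral>x. q x \<partial>\<nu>) = 1}"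

definition soft_threshold :: "'a measure \<Rightarrow> real \<Rightarrow> ('a \<Rightarrow> real) \<Rightarrow> 'a \<Rightarrow> real" where
  "soft_threshold \<nu> t g =
     (if l2_norm \<nu> g = 0 then (\<lambda>x. 0) else (\<lambda>x. max 0 (1 - t / l2_norm \<nu> g) * g x))"


section \<open>The Laplace--Beltrami operator\<close>

definition smooth_fun ::
  "('a::{t2_space, second_countable_topology}, 'n::finite) chart set \<Rightarrow> ('a \<Rightarrow> real) \<Rightarrow> bool" where
  "smooth_fun \<A> f \<longleftrightarrow> (\<forall>c\<in>\<A>. smooth_on (chart_image c) (f \<circ> param c))"

definition laplacian_in_chart ::
  "(('a, 'n::finite) chart \<Rightarrow> 'a \<Rightarrow> real ^ 'n ^ 'n) \<Rightarrow> ('a, 'n) chart \<Rightarrow> ('a \<Rightarrow> real) \<Rightarrow> 'a \<Rightarrow> real" where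
  "laplacian_in_chart G c f p =
     (let g = (\<lambda>x. G c (param c x)); w = (\<lambda>x. sqrt (det (g x)))
      in (\<Sum>i\<in>UNIV. partial_deriv i
            (\<lambda>x. w x * (\<Sum>j\<in>UNIV. matrix_inv (g x) $ i $ j * partial_deriv j (f \<circ> param c) x))
            (coords c p)) / w (coords c p))"

(* The value does not depend on the chart around p. *)
definition laplacian ::
  "('a::{t2_space, second_countable_topology}, 'n::finite) chart set
     \<Rightarrow> (('a, 'n) chart \<Rightarrow> 'a \<Rightarrow> real ^ 'n ^ 'n) \<Rightarrow> ('a \<Rightarrow> real) \<Rightarrow> 'a \<Rightarrow> real" where
  "laplacian \<A> G f p = laplacian_in_chart G (SOME c. c \<in> \<A> \<and> p \<in> fst c) f p"

text \<open>As an operator on square-integrable functions, \<open>L\<close> is the nonnegative self-adjoint extension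
  of minus the Laplacian on smooth functions (the manifold being compact without boundary, there is
  only one self-adjoint extension). It is given by its graph, in Friedrichs' form: the adjoint of
  the operator on smooth functions, restricted to the closure of the smooth functions with respect
  to the energy form \<open>\<langle>F, -\<Delta>F\<rangle>\<close>. By elliptic regularity its eigenfunctions are almost everywhere equal to smooth
  functions.\<close>

definition energy ::
  "('a::{t2_space, second_countable_topology}, 'n::finite) chart set
     \<Rightarrow> (('a, 'n) chart \<Rightarrow> 'a \<Rightarrow> real ^ 'n ^ 'n) \<Rightarrow> 'a measure \<Rightarrow> ('a \<Rightarrow> real) \<Rightarrow> real" where
  "energy \<A> G \<nu> f = l2_inner \<nu> f (\<lambda>x. - laplacian \<A> G f x)"

definition energy_domain ::
  "('a::{t2_space, second_countable_topology}, 'n::finite) chart set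
     \<Rightarrow> (('a, 'n) chart \<Rightarrow> 'a \<Rightarrow> real ^ 'n ^ 'n) \<Rightarrow> 'a measure \<Rightarrow> ('a \<Rightarrow> real) set" where
  "energy_domain \<A> G \<nu> = {f \<in> L2 \<nu>. \<exists>F :: nat \<Rightarrow> 'a \<Rightarrow> real.
     (\<forall>k. smooth_fun \<A> (F k)) \<and>
     (\<lambda>k. l2_norm \<nu> (\<lambda>x. F k x - f x)) \<longlonglongrightarrow> 0 \<and>
     (\<forall>e>0. \<exists>N. \<forall>k\<ge>N. \<forall>m\<ge>N. energy \<A> G \<nu> (\<lambda>x. F k x - F m x) < e)}"

definition laplace_beltrami ::
  "('a::{t2_space, second_countable_topology}, 'n::finite) chart set
     \<Rightarrow> (('a, 'n) chart \<Rightarrow> 'a \<Rightarrow> real ^ 'n ^ 'n) \<Rightarrow> 'a measure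
     \<Rightarrow> ('a \<Rightarrow> real) \<Rightarrow> ('a \<Rightarrow> real) \<Rightarrow> bool" where
  "laplace_beltrami \<A> G \<nu> f h \<longleftrightarrow>
     f \<in> energy_domain \<A> G \<nu> \<and> h \<in> L2 \<nu> \<and>
     (\<forall>\<psi>. smooth_fun \<A> \<psi> \<longrightarrow> l2_inner \<nu> f (\<lambda>x. - laplacian \<A> G \<psi> x) = l2_inner \<nu> h \<psi>)"

definition eigenspace ::
  "('a::{t2_space, second_countable_topology}, 'n::finite) chart set
     \<Rightarrow> (('a, 'n) chart \<Rightarrow> 'a \<Rightarrow> real ^ 'n ^ 'n) \<Rightarrow> 'a measure \<Rightarrow> real \<Rightarrow> ('a \<Rightarrow> real) set" where
  "eigenspace \<A> G \<nu> r = {f. laplace_beltrami \<A> G \<nu> f (\<lambda>x. r * f x)}"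

definition eigenvalues ::
  "('a::{t2_space, second_countable_topology}, 'n::finite) chart set
     \<Rightarrow> (('a, 'n) chart \<Rightarrow> 'a \<Rightarrow> real ^ 'n ^ 'n) \<Rightarrow> 'a measure \<Rightarrow> real set" where
  "eigenvalues \<A> G \<nu> = {r. \<exists>f\<in>eigenspace \<A> G \<nu> r. l2_norm \<nu> f \<noteq> 0}"


section \<open>The estimators\<close>

definition spectral_kernel :: "nat \<Rightarrow> (nat \<Rightarrow> 'a \<Rightarrow> real) \<Rightarrow> 'a \<Rightarrow> 'a \<Rightarrow> real" where
  "spectral_kernel d \<phi> x y = (\<Sum>l=1..d. \<phi> l x * \<phi> l y)"

definition empirical_proj ::
  "('a \<Rightarrow> 'a \<Rightarrow> real) \<Rightarrow> nat \<Rightarrow> (nat \<Rightarrow> 'w \<Rightarrow> 'a) \<Rightarrow> 'w \<Rightarrow> 'a \<Rightarrow> real" where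
  "empirical_proj K n X \<omega> x = (\<Sum>i=1..n. K x (X i \<omega>)) / real n"

definition threshold_estimator ::
  "'a measure \<Rightarrow> nat set \<Rightarrow> (nat \<Rightarrow> real) \<Rightarrow> (nat \<Rightarrow> 'w \<Rightarrow> 'a \<Rightarrow> real) \<Rightarrow> 'w \<Rightarrow> 'a \<Rightarrow> real" where
  "threshold_estimator \<nu> J \<tau> ghat \<omega> x = 1 + (\<Sum>j\<in>J. soft_threshold \<nu> (\<tau> j) (ghat j \<omega>) x)"

text \<open>Expected squared loss, as an integral with values in \<open>[0, \<infinity>]\<close>.\<close>

definition risk :: "'a measure \<Rightarrow> 'w measure \<Rightarrow> ('a \<Rightarrow> real) \<Rightarrow> ('w \<Rightarrow> 'a \<Rightarrow> real) \<Rightarrow> ennreal" where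
  "risk \<nu> \<Omega> p0 p = (\<integral>\<^sup>+\<omega>. ennreal ((l2_norm \<nu> (\<lambda>x. p \<omega> x - p0 x))\<^sup>2) \<partial>\<Omega>)"

end

theory Submission
  imports Defs "HOL-Library.Diagonal_Subsequence"
begin

text \<open>The theorem contains more than a computation with thresholds. For an empty index set \<open>J\<close> it
  says \<open>\<parallel>1 - p\<^sub>0\<parallel>\<^sup>2 \<le> \<Sum>\<^sub>j\<^sub>\<ge>\<^sub>1 \<parallel>P\<^sub>j p\<^sub>0\<parallel>\<^sup>2\<close>, that is: the eigenfunctions of the Laplacian are complete, and the
  kernel of the Laplacian consists of the constants. Most of the text establishes these two facts.

  \<^bold>\<open>Geometry.\<close> In a chart, the Laplacian is a divergence, so integration by parts against compactly
  supported functions gives \<open>\<integral> h (- \<Delta> f) = \<integral> \<Gamma> f h\<close>, where \<open>\<Gamma>\<close> is the scalar product of the gradients; a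
  partition of unity makes this global (\<open>weak_laplacian\<close>). Only \<open>\<Gamma>\<close>, a first order expression, has to
  be transformed between charts by hand: the independence of \<open>\<Delta>\<close> of the chart follows by testing.
  Smooth functions are dense (\<open>smooth_dense\<close>). Cutting coordinate balls into small cells
  and applying the Poincare inequality on each cell gives, for every \<open>\<epsilon> > 0\<close>, finitely many
  \<open>e \<in> L\<^sup>2\<close> with \<open>\<parallel>F\<parallel>\<^sup>2 \<le> C \<Sum> \<langle>F, e\<rangle>\<^sup>2 + \<epsilon> \<integral> \<Gamma> F F\<close>; this is the compactness of the embedding of the
  form domain (\<open>compactness\<close>). The same inequality shows that functions of zero energy are
  locally constant, hence constant as the manifold is connected (\<open>zero_energy_constant\<close>).

  \<^bold>\<open>Spectral theory.\<close> The locale \<open>spectral_form\<close> collects what has been proved: a dense space \<open>S\<close>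
  on which a symmetric nonnegative operator \<open>A\<close> acts, and the compactness inequality. The form of \<open>A\<close>
  is replaced by its closure; on the orthogonal complement of the eigenspaces \<open>E\<^sub>0, \<dots>, E\<^sub>N\<close> a
  minimizer of the Rayleigh quotient exists and is an eigenfunction, so the quotient is at
  least \<open>\<mu>\<^sub>N\<^sub>+\<^sub>1\<close> there (\<open>spectral_gap\<close>). By compactness the eigenvalues are unbounded, hence the part of
  a smooth \<open>F\<close> beyond \<open>E\<^sub>N\<close>, whose squared norm is at most the energy of \<open>F\<close> divided by \<open>\<mu>\<^sub>N\<^sub>+\<^sub>1\<close>, tends to
  zero (\<open>eigenfunctions_complete\<close>).

  \<^bold>\<open>Statistics.\<close> The thresholded coefficients lie in the eigenspaces, so the squared error
  splits over the eigenspaces (\<open>estimation_error_le\<close>). In one eigenspace the bound is deterministic: if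
  the deviation is at most \<open>\<tau>/2\<close>, the error is at most three times both \<open>\<tau>\<close> and the norm of the
  target, and otherwise it is at most \<open>\<tau>\<close> plus the deviation (\<open>soft_threshold_error\<close>). Taking
  expectations gives the bound, and projecting onto the closed convex set of densities does
  not increase the distance to a density (\<open>metric_proj_densities_le\<close>).\<close>

section \<open>Semi-inner products and the completeness of the space of square-integrable functions\<close>

text \<open>Scalar products on spaces of representatives are degenerate. The locale is used for the
  scalar product of \<open>L\<^sup>2\<close>, for the energy form on smooth functions, for its closure, and for the
  closure minus a multiple of the scalar product.\<close>

locale semi_inner =
  fixes V :: "('a \<Rightarrow> real) set" and ip :: "('a \<Rightarrow> real) \<Rightarrow> ('a \<Rightarrow> real) \<Rightarrow> real"
  assumes zero_mem: "(\<lambda>x. 0) \<in> V"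
    and lin_mem: "f \<in> V \<Longrightarrow> g \<in> V \<Longrightarrow> (\<lambda>x. a * f x + b * g x) \<in> V"
    and ip_sym: "f \<in> V \<Longrightarrow> g \<in> V \<Longrightarrow> ip f g = ip g f"
    and ip_lin: "f \<in> V \<Longrightarrow> g \<in> V \<Longrightarrow> h \<in> V \<Longrightarrow>
      ip (\<lambda>x. a * f x + b * g x) h = a * ip f h + b * ip g h"
    and ip_nonneg: "f \<in> V \<Longrightarrow> 0 \<le> ip f f"
begin

definition nrm :: "('a \<Rightarrow> real) \<Rightarrow> real" where "nrm f = sqrt (ip f f)"

lemma add_mem: "f \<in> V \<Longrightarrow> g \<in> V \<Longrightarrow> (\<lambda>x. f x + g x) \<in> V"
  using lin_mem[of f g 1 1] by simp

lemma diff_mem: "f \<in> V \<Longrightarrow> g \<in> V \<Longrightarrow> (\<lambda>x. f x - g x) \<in> V"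
  using lin_mem[of f g 1 "-1"] by simp

lemma scale_mem: "f \<in> V \<Longrightarrow> (\<lambda>x. a * f x) \<in> V"
  using lin_mem[of f f a 0] by simp

lemma sum_mem: "(\<And>i. i \<in> I \<Longrightarrow> f i \<in> V) \<Longrightarrow> (\<lambda>x. \<Sum>i\<in>I. f i x) \<in> V"
  by (induction I rule: infinite_finite_induct) (auto simp: zero_mem intro: add_mem)

lemma ip_add: "f \<in> V \<Longrightarrow> g \<in> V \<Longrightarrow> h \<in> V \<Longrightarrow> ip (\<lambda>x. f x + g x) h = ip f h + ip g h"
  using ip_lin[of f g h 1 1] by simp

lemma ip_diff: "f \<in> V \<Longrightarrow> g \<in> V \<Longrightarrow> h \<in> V \<Longrightarrow> ip (\<lambda>x. f x - g x) h = ip f h - ip g h"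
  using ip_lin[of f g h 1 "-1"] by simp

lemma ip_scale: "f \<in> V \<Longrightarrow> h \<in> V \<Longrightarrow> ip (\<lambda>x. a * f x) h = a * ip f h"
  using ip_lin[of f f h a 0] by simp

lemma ip_zero: "h \<in> V \<Longrightarrow> ip (\<lambda>x. 0) h = 0"
  using ip_scale[of h h 0] by simp

lemma ip_sum:
  "(\<And>i. i \<in> I \<Longrightarrow> f i \<in> V) \<Longrightarrow> h \<in> V \<Longrightarrow> ip (\<lambda>x. \<Sum>i\<in>I. f i x) h = (\<Sum>i\<in>I. ip (f i) h)"
proof (induction I rule: infinite_finite_induct)
  case (insert i I)
  then show ?case by (simp add: ip_add sum_mem)
qed (simp_all add: ip_zero)

lemma ip_add2: "f \<in> V \<Longrightarrow> g \<in> V \<Longrightarrow> h \<in> V \<Longrightarrow> ip h (\<lambda>x. f x + g x) = ip h f + ip h g"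
  by (simp add: ip_sym[of h] add_mem ip_add)

lemma ip_diff2: "f \<in> V \<Longrightarrow> g \<in> V \<Longrightarrow> h \<in> V \<Longrightarrow> ip h (\<lambda>x. f x - g x) = ip h f - ip h g"
  by (simp add: ip_sym[of h] diff_mem ip_diff)

lemma ip_scale2: "f \<in> V \<Longrightarrow> h \<in> V \<Longrightarrow> ip h (\<lambda>x. a * f x) = a * ip h f"
  by (simp add: ip_sym[of h] scale_mem ip_scale)

lemma ip_sum2:
  "(\<And>i. i \<in> I \<Longrightarrow> f i \<in> V) \<Longrightarrow> h \<in> V \<Longrightarrow> ip h (\<lambda>x. \<Sum>i\<in>I. f i x) = (\<Sum>i\<in>I. ip h (f i))"
  by (simp add: ip_sym[of h] sum_mem ip_sum)

lemma nrm_nonneg [simp]: "f \<in> V \<Longrightarrow> 0 \<le> nrm f"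
  by (simp add: nrm_def ip_nonneg)

lemma nrm_sq: "f \<in> V \<Longrightarrow> (nrm f)\<^sup>2 = ip f f"
  by (simp add: nrm_def ip_nonneg)

lemma nrm_add_sq:
  assumes "f \<in> V" "g \<in> V"
  shows "(nrm (\<lambda>x. f x + g x))\<^sup>2 = (nrm f)\<^sup>2 + 2 * ip f g + (nrm g)\<^sup>2"
  using assms by (simp add: nrm_sq add_mem ip_add ip_add2 ip_sym[of g f])

lemma nrm_diff_sq:
  assumes "f \<in> V" "g \<in> V"
  shows "(nrm (\<lambda>x. f x - g x))\<^sup>2 = (nrm f)\<^sup>2 - 2 * ip f g + (nrm g)\<^sup>2"
  using assms by (simp add: nrm_sq diff_mem ip_diff ip_diff2 ip_sym[of g f])

lemma parallelogram:
  assumes "f \<in> V" "g \<in> V"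
  shows "(nrm (\<lambda>x. f x + g x))\<^sup>2 + (nrm (\<lambda>x. f x - g x))\<^sup>2 = 2 * (nrm f)\<^sup>2 + 2 * (nrm g)\<^sup>2"
  using assms by (simp add: nrm_add_sq nrm_diff_sq)

lemma nrm_scale: "f \<in> V \<Longrightarrow> nrm (\<lambda>x. a * f x) = \<bar>a\<bar> * nrm f"
  by (simp add: nrm_def ip_scale ip_scale2 scale_mem real_sqrt_mult flip: mult.assoc power2_eq_square)

lemma nrm_minus_commute: "f \<in> V \<Longrightarrow> g \<in> V \<Longrightarrow> nrm (\<lambda>x. f x - g x) = nrm (\<lambda>x. g x - f x)"
  by (simp add: nrm_def diff_mem ip_diff ip_diff2)

text \<open>The discriminant of the nonnegative quadratic polynomial \<open>t \<mapsto> \<parallel>f + t g\<parallel>\<^sup>2\<close> is nonpositive; the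
  case \<open>\<parallel>g\<parallel> = 0\<close> is separate because the form may be degenerate.\<close>

lemma cauchy_schwarz:
  assumes f: "f \<in> V" and g: "g \<in> V"
  shows "\<bar>ip f g\<bar> \<le> nrm f * nrm g"
proof -
  have *: "0 \<le> ip f f + 2 * t * ip f g + t\<^sup>2 * ip g g" for t
  proof -
    have "0 \<le> ip (\<lambda>x. 1 * f x + t * g x) (\<lambda>x. 1 * f x + t * g x)"
      using f g lin_mem ip_nonneg by blast
    also have "\<dots> = ip f f + 2 * t * ip f g + t\<^sup>2 * ip g g"
      using f g by (simp add: ip_add ip_add2 ip_scale ip_scale2 scale_mem add_mem ip_sym[of g f]
          power2_eq_square algebra_simps)
    finally show ?thesis .
  qed
  have "(ip f g)\<^sup>2 \<le> ip f f * ip g g"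
  proof (cases "ip g g = 0")
    case True
    have "ip f g = 0"
    proof (rule ccontr)
      assume "ip f g \<noteq> 0"
      then show False
        using *[of "- (ip f f + 1) / (2 * ip f g)"] True by (simp add: field_simps)
    qed
    then show ?thesis using True by simp
  next
    case False
    then have pos: "ip g g > 0" using ip_nonneg[OF g] by simp
    from *[of "- ip f g / ip g g"] have "0 \<le> ip f f - (ip f g)\<^sup>2 / ip g g"
      using pos by (simp add: field_simps power2_eq_square)
    then show ?thesis using pos by (simp add: field_simps)
  qed
  then have "sqrt ((ip f g)\<^sup>2) \<le> sqrt (ip f f * ip g g)" by (rule real_sqrt_le_mono)
  then show ?thesis by (simp add: nrm_def real_sqrt_mult)
qed

lemma triangle:
  assumes "f \<in> V" "g \<in> V"
  shows "nrm (\<lambda>x. f x + g x) \<le> nrm f + nrm g"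
proof (rule power2_le_imp_le)
  have "ip f g \<le> nrm f * nrm g" using cauchy_schwarz[OF assms] by simp
  then show "(nrm (\<lambda>x. f x + g x))\<^sup>2 \<le> (nrm f + nrm g)\<^sup>2"
    using assms by (simp add: nrm_add_sq power2_sum)
qed (use assms in simp)

lemma triangle_diff:
  assumes "f \<in> V" "g \<in> V" "h \<in> V"
  shows "nrm (\<lambda>x. f x - h x) \<le> nrm (\<lambda>x. f x - g x) + nrm (\<lambda>x. g x - h x)"
  using triangle[of "\<lambda>x. f x - g x" "\<lambda>x. g x - h x"] assms by (simp add: diff_mem)

lemma triangle_sub:
  assumes "f \<in> V" "g \<in> V"
  shows "nrm (\<lambda>x. f x - g x) \<le> nrm f + nrm g"
  using triangle[of f "\<lambda>x. (-1) * g x"] scale_mem[of g "-1"] assms nrm_scale[of g "-1"] by simp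

lemma nrm_diff_le:
  assumes "f \<in> V" "g \<in> V"
  shows "\<bar>nrm f - nrm g\<bar> \<le> nrm (\<lambda>x. f x - g x)"
  using triangle[of "\<lambda>x. f x - g x" g] triangle[of "\<lambda>x. g x - f x" f] assms
    nrm_minus_commute[OF assms] by (simp add: diff_mem abs_le_iff)

end

lemma L2_lin: "f \<in> L2 M \<Longrightarrow> g \<in> L2 M \<Longrightarrow> (\<lambda>x. a * f x + b * g x) \<in> L2 M"
proof -
  assume f: "f \<in> L2 M" and g: "g \<in> L2 M"
  then have [measurable]: "f \<in> borel_measurable M" "g \<in> borel_measurable M"
    and i: "integrable M (\<lambda>x. (f x)\<^sup>2)" "integrable M (\<lambda>x. (g x)\<^sup>2)"
    by (auto simp: L2_def)
  have "integrable M (\<lambda>x. 2 * (a\<^sup>2 * (f x)\<^sup>2) + 2 * (b\<^sup>2 * (g x)\<^sup>2))"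
    using i by auto
  then have "integrable M (\<lambda>x. (a * f x + b * g x)\<^sup>2)"
  proof (rule Bochner_Integration.integrable_bound)
    show "AE x in M. norm ((a * f x + b * g x)\<^sup>2) \<le> norm (2 * (a\<^sup>2 * (f x)\<^sup>2) + 2 * (b\<^sup>2 * (g x)\<^sup>2))"
    proof (rule AE_I2)
      fix x
      have "(a * f x + b * g x)\<^sup>2 \<le> 2 * (a\<^sup>2 * (f x)\<^sup>2) + 2 * (b\<^sup>2 * (g x)\<^sup>2)"
        using sum_squares_bound[of "a * f x" "b * g x"] by (simp add: power2_sum power_mult_distrib)
      then show "norm ((a * f x + b * g x)\<^sup>2) \<le> norm (2 * (a\<^sup>2 * (f x)\<^sup>2) + 2 * (b\<^sup>2 * (g x)\<^sup>2))"
        by simp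
    qed
  qed measurable
  then show ?thesis by (simp add: L2_def)
qed

lemma L2_mult_integrable:
  assumes f: "f \<in> L2 M" and g: "g \<in> L2 M"
  shows "integrable M (\<lambda>x. f x * g x)"
proof -
  from f g have [measurable]: "f \<in> borel_measurable M" "g \<in> borel_measurable M"
    and i: "integrable M (\<lambda>x. (f x)\<^sup>2)" "integrable M (\<lambda>x. (g x)\<^sup>2)"
    by (auto simp: L2_def)
  have "integrable M (\<lambda>x. (f x)\<^sup>2 + (g x)\<^sup>2)" using i by auto
  then show ?thesis
  proof (rule Bochner_Integration.integrable_bound)
    show "AE x in M. norm (f x * g x) \<le> norm ((f x)\<^sup>2 + (g x)\<^sup>2)"
    proof (rule AE_I2)
      fix x
      have "2 * (\<bar>f x\<bar> * \<bar>g x\<bar>) \<le> (f x)\<^sup>2 + (g x)\<^sup>2"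
        using sum_squares_bound[of "\<bar>f x\<bar>" "\<bar>g x\<bar>"] by simp
      moreover have "0 \<le> \<bar>f x\<bar> * \<bar>g x\<bar>" by simp
      ultimately have "\<bar>f x\<bar> * \<bar>g x\<bar> \<le> (f x)\<^sup>2 + (g x)\<^sup>2" by linarith
      then show "norm (f x * g x) \<le> norm ((f x)\<^sup>2 + (g x)\<^sup>2)" by (simp add: abs_mult)
    qed
  qed measurable
qed

global_interpretation l2: semi_inner "L2 M" "l2_inner M"
  rewrites "semi_inner.nrm (l2_inner M) = l2_norm M" for M
proof -
  show s: "semi_inner (L2 M) (l2_inner M)"
  proof
    fix f g h :: "'a \<Rightarrow> real" and a b :: real
    assume "f \<in> L2 M" "g \<in> L2 M" "h \<in> L2 M"
    then have "integrable M (\<lambda>x. f x * h x)" "integrable M (\<lambda>x. g x * h x)"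
      by (auto intro: L2_mult_integrable)
    then show "l2_inner M (\<lambda>x. a * f x + b * g x) h = a * l2_inner M f h + b * l2_inner M g h"
      by (simp add: l2_inner_def distrib_right mult.assoc)
  qed (auto simp: l2_inner_def mult.commute intro: L2_lin, simp add: L2_def)
  show "semi_inner.nrm (l2_inner M) = l2_norm M"
    by (simp add: fun_eq_iff semi_inner.nrm_def[OF s] l2_norm_def)
qed

lemma l2_inner_cong_AE:
  assumes "AE x in M. f x = f' x" "AE x in M. g x = g' x"
    and [measurable]: "f \<in> borel_measurable M" "f' \<in> borel_measurable M"
      "g \<in> borel_measurable M" "g' \<in> borel_measurable M"
  shows "l2_inner M f g = l2_inner M f' g'"
  unfolding l2_inner_def using assms(1,2) by (intro integral_cong_AE) auto

lemma l2_norm_cong_AE: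
  assumes "AE x in M. f x = f' x" "f \<in> borel_measurable M" "f' \<in> borel_measurable M"
  shows "l2_norm M f = l2_norm M f'"
  unfolding l2_norm_def using l2_inner_cong_AE[OF assms(1,1)] assms by simp

lemma l2_norm_eq_0_iff: "f \<in> L2 M \<Longrightarrow> l2_norm M f = 0 \<longleftrightarrow> (AE x in M. f x = 0)"
  unfolding l2_norm_def l2_inner_def L2_def
  by (auto simp flip: power2_eq_square simp: integral_nonneg_eq_0_iff_AE)

lemma L2_measurable: "f \<in> L2 M \<Longrightarrow> f \<in> borel_measurable M"
  by (simp add: L2_def)

lemma nn_integral_l2_norm:
  assumes "f \<in> L2 M"
  shows "(\<integral>\<^sup>+x. ennreal ((f x)\<^sup>2) \<partial>M) = ennreal ((l2_norm M f)\<^sup>2)"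
  using assms unfolding l2.nrm_sq[OF assms] l2_inner_def L2_def
  by (auto simp: nn_integral_eq_integral simp flip: power2_eq_square)

lemma l2_norm_tendsto:
  assumes F: "\<And>k. F k \<in> L2 M" and f: "f \<in> L2 M" and lim: "(\<lambda>k. l2_norm M (\<lambda>x. F k x - f x)) \<longlonglongrightarrow> 0"
  shows "(\<lambda>k. l2_norm M (F k)) \<longlonglongrightarrow> l2_norm M f"
proof (rule LIM_zero_cancel, rule Lim_null_comparison[OF _ lim], intro always_eventually allI)
  fix k show "norm (l2_norm M (F k) - l2_norm M f) \<le> l2_norm M (\<lambda>x. F k x - f x)"
    using l2.nrm_diff_le[OF F f, of k] by simp
qed

lemma l2_inner_tendsto:
  assumes F: "\<And>k. F k \<in> L2 M" and f: "f \<in> L2 M" and g: "g \<in> L2 M"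
    and lim: "(\<lambda>k. l2_norm M (\<lambda>x. F k x - f x)) \<longlonglongrightarrow> 0"
  shows "(\<lambda>k. l2_inner M (F k) g) \<longlonglongrightarrow> l2_inner M f g"
proof (rule LIM_zero_cancel, rule Lim_null_comparison[OF _ tendsto_mult_left_zero[OF lim]], intro always_eventually allI)
  fix k show "norm (l2_inner M (F k) g - l2_inner M f g) \<le> l2_norm M (\<lambda>x. F k x - f x) * l2_norm M g"
    using l2.cauchy_schwarz[OF l2.diff_mem[OF F f] g, of k] by (simp add: l2.ip_diff[OF F f g])
qed

context finite_measure
begin

lemma L2_bounded:
  assumes [measurable]: "f \<in> borel_measurable M" and b: "\<And>x. x \<in> space M \<Longrightarrow> \<bar>f x\<bar> \<le> B"
  shows "f \<in> L2 M"
proof -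
  have "integrable M (\<lambda>x. (f x)\<^sup>2)"
  proof (rule integrable_const_bound[where B="B\<^sup>2"])
    show "AE x in M. norm ((f x)\<^sup>2) \<le> B\<^sup>2"
      using b by (auto intro!: AE_I2 power_mono[of "\<bar>f x\<bar>" B 2 for x, simplified])
  qed measurable
  then show ?thesis by (simp add: L2_def)
qed

lemma L2_const: "(\<lambda>x. c) \<in> L2 M"
  by (rule L2_bounded[where B="\<bar>c\<bar>"]) auto

lemma L2_integrable: "f \<in> L2 M \<Longrightarrow> integrable M f"
  using L2_mult_integrable[of f M "\<lambda>x. 1"] L2_const[of 1] by simp

lemma L1_le_l2_norm:
  assumes "f \<in> L2 M"
  shows "(\<integral>x. \<bar>f x\<bar> \<partial>M) \<le> l2_norm M f * l2_norm M (\<lambda>x. 1)"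
proof -
  have "(\<lambda>x. \<bar>f x\<bar>) \<in> L2 M" using assms by (auto simp: L2_def)
  from l2.cauchy_schwarz[OF this L2_const[of 1]]
  show ?thesis by (simp add: l2_inner_def l2_norm_def)
qed

text \<open>A Cauchy sequence has an almost everywhere convergent subsequence, since the measure is finite
  and it is Cauchy in the mean of order one as well; by Fatou's lemma the pointwise limit is
  the limit in the mean of order two.\<close>

theorem L2_complete:
  assumes F: "\<And>k. F k \<in> L2 M"
    and C: "\<And>e. e > 0 \<Longrightarrow> \<exists>N. \<forall>i\<ge>N. \<forall>j\<ge>N. l2_norm M (\<lambda>x. F i x - F j x) < e"
  obtains f where "f \<in> L2 M" "(\<lambda>k. l2_norm M (\<lambda>x. F k x - f x)) \<longlonglongrightarrow> 0"
proof -
  note Fm[measurable] = F[THEN L2_measurable]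
  define c where "c = l2_norm M (\<lambda>x. 1) + 1"
  have c: "c > 0" unfolding c_def using l2.nrm_nonneg[OF L2_const[of 1]] by linarith
  have "\<exists>N. \<forall>i\<ge>N. \<forall>j\<ge>N. (LINT x|M. norm (F i x - F j x)) < e" if "e > 0" for e
  proof -
    obtain N where N: "\<And>i j. i \<ge> N \<Longrightarrow> j \<ge> N \<Longrightarrow> l2_norm M (\<lambda>x. F i x - F j x) < e / c"
      using C[of "e / c"] c \<open>e > 0\<close> by auto
    have "(LINT x|M. norm (F i x - F j x)) < e" if "i \<ge> N" "j \<ge> N" for i j
    proof -
      have "(LINT x|M. norm (F i x - F j x)) \<le> l2_norm M (\<lambda>x. F i x - F j x) * l2_norm M (\<lambda>x. 1)"
        using L1_le_l2_norm[OF l2.diff_mem[OF F F]] by simp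
      also have "\<dots> \<le> l2_norm M (\<lambda>x. F i x - F j x) * c"
        using l2.nrm_nonneg[OF l2.diff_mem[OF F F]] by (intro mult_left_mono) (auto simp: c_def)
      also have "\<dots> < e" using N[OF that] c by (simp add: field_simps)
      finally show ?thesis .
    qed
    then show ?thesis by blast
  qed
  from cauchy_L1_AE_cauchy_subseq[OF L2_integrable[OF F] this]
  obtain r where r: "strict_mono r" and rC: "AE x in M. Cauchy (\<lambda>i. F (r i) x)" by blast
  define f where "f x = lim (\<lambda>i. F (r i) x)" for x
  have fm[measurable]: "f \<in> borel_measurable M" unfolding f_def by measurable
  have lim: "AE x in M. (\<lambda>i. F (r i) x) \<longlonglongrightarrow> f x"
    using rC by eventually_elim (simp add: f_def Cauchy_convergent_iff convergent_LIMSEQ_iff)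
  have fatou: "(\<integral>\<^sup>+x. ennreal ((F k x - f x)\<^sup>2) \<partial>M) \<le> ennreal (e\<^sup>2)"
    if "e > 0" and N: "\<forall>j\<ge>N. l2_norm M (\<lambda>x. F k x - F j x) < e" for e k N
  proof -
    have "(\<integral>\<^sup>+x. ennreal ((F k x - f x)\<^sup>2) \<partial>M)
        = (\<integral>\<^sup>+x. liminf (\<lambda>i. ennreal ((F k x - F (r i) x)\<^sup>2)) \<partial>M)"
    proof (rule nn_integral_cong_AE)
      show "AE x in M. ennreal ((F k x - f x)\<^sup>2) = liminf (\<lambda>i. ennreal ((F k x - F (r i) x)\<^sup>2))"
        using lim
      proof eventually_elim
        case (elim x)
        then have "(\<lambda>i. ennreal ((F k x - F (r i) x)\<^sup>2)) \<longlonglongrightarrow> ennreal ((F k x - f x)\<^sup>2)"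
          by (intro tendsto_intros tendsto_ennrealI)
        then show ?case by (rule lim_imp_Liminf[OF sequentially_bot, symmetric])
      qed
    qed
    also have "\<dots> \<le> liminf (\<lambda>i. \<integral>\<^sup>+x. ennreal ((F k x - F (r i) x)\<^sup>2) \<partial>M)"
      by (intro nn_integral_liminf) measurable
    also have "\<dots> = liminf (\<lambda>i. ennreal ((l2_norm M (\<lambda>x. F k x - F (r i) x))\<^sup>2))"
      by (simp add: nn_integral_l2_norm l2.diff_mem F)
    also have "\<dots> \<le> limsup (\<lambda>i. ennreal ((l2_norm M (\<lambda>x. F k x - F (r i) x))\<^sup>2))"
      by (rule Liminf_le_Limsup) simp
    also have "\<dots> \<le> ennreal (e\<^sup>2)"
    proof (rule Limsup_bounded)
      show "\<forall>\<^sub>F i in sequentially. ennreal ((l2_norm M (\<lambda>x. F k x - F (r i) x))\<^sup>2) \<le> ennreal (e\<^sup>2)"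
        unfolding eventually_sequentially
      proof (intro exI allI impI)
        fix i assume "N \<le> i"
        then have "N \<le> r i" using seq_suble[OF r, of i] by linarith
        then show "ennreal ((l2_norm M (\<lambda>x. F k x - F (r i) x))\<^sup>2) \<le> ennreal (e\<^sup>2)"
          using N l2.nrm_nonneg[OF l2.diff_mem[OF F[of k] F[of "r i"]]]
          by (intro ennreal_leI power_mono) (auto simp: less_imp_le)
      qed
    qed
    finally show ?thesis .
  qed
  have mem: "(\<lambda>x. F k x - f x) \<in> L2 M" if N: "\<forall>j\<ge>N. l2_norm M (\<lambda>x. F k x - F j x) < e" "e > 0" for e k N
  proof -
    have "(\<integral>\<^sup>+x. ennreal (norm ((F k x - f x)\<^sup>2)) \<partial>M) < \<infinity>"
      using fatou[OF N(2,1)] le_less_trans[of _ "ennreal (e\<^sup>2)" \<infinity>] by simp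
    then have "integrable M (\<lambda>x. (F k x - f x)\<^sup>2)"
      by (intro integrableI_bounded) measurable
    then show ?thesis by (simp add: L2_def)
  qed
  obtain N1 where N1: "\<forall>i\<ge>N1. \<forall>j\<ge>N1. l2_norm M (\<lambda>x. F i x - F j x) < 1" using C[of 1] by auto
  have "f \<in> L2 M"
    using l2.diff_mem[OF F[of N1] mem[of N1 N1 1]] N1 by simp
  moreover have "(\<lambda>k. l2_norm M (\<lambda>x. F k x - f x)) \<longlonglongrightarrow> 0"
  proof (rule LIMSEQ_I)
    fix e :: real assume "e > 0"
    then obtain N where N: "\<forall>i\<ge>N. \<forall>j\<ge>N. l2_norm M (\<lambda>x. F i x - F j x) < e / 2" using C[of "e/2"] by auto
    have "norm (l2_norm M (\<lambda>x. F k x - f x) - 0) < e" if "k \<ge> N" for k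
    proof -
      have Nk: "\<forall>j\<ge>N. l2_norm M (\<lambda>x. F k x - F j x) < e / 2" and e2: "e / 2 > 0"
        using N that \<open>e > 0\<close> by auto
      have m: "(\<lambda>x. F k x - f x) \<in> L2 M" using mem[OF Nk e2] .
      have "(l2_norm M (\<lambda>x. F k x - f x))\<^sup>2 \<le> (e/2)\<^sup>2"
        using fatou[OF e2 Nk] unfolding nn_integral_l2_norm[OF m]
        by (subst (asm) ennreal_le_iff) (rule zero_le_power2)
      then have "l2_norm M (\<lambda>x. F k x - f x) \<le> e / 2"
        using less_imp_le[OF e2] by (rule power2_le_imp_le)
      then show ?thesis using \<open>e > 0\<close> l2.nrm_nonneg[OF m] by simp
    qed
    then show "\<exists>N. \<forall>k\<ge>N. norm (l2_norm M (\<lambda>x. F k x - f x) - 0) < e" by blast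
  qed
  ultimately show thesis by (rule that)
qed

end

section \<open>Calculus of smooth functions of several variables\<close>

lemma partial_deriv_eq:
  "(u has_derivative D) (at x) \<Longrightarrow> partial_deriv i u x = D (axis i 1)"
  unfolding partial_deriv_def using frechet_derivative_at[of u D x] by simp

lemma has_derivative_cong_open:
  assumes "open S" "x \<in> S" "\<And>y. y \<in> S \<Longrightarrow> u y = v y"
  shows "(u has_derivative D) (at x) \<longleftrightarrow> (v has_derivative D) (at x)"
  using has_derivative_transform_within_open[of u D x UNIV S v]
    has_derivative_transform_within_open[of v D x UNIV S u] assms by auto

lemma partial_deriv_cong:
  assumes "open S" "x \<in> S" "\<And>y. y \<in> S \<Longrightarrow> u y = v y"
  shows "partial_deriv i u x = partial_deriv i v x"
  unfolding partial_deriv_def frechet_derivative_def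
  using has_derivative_cong_open[of S x u v] assms by simp

lemma frechet_derivative_expand:
  assumes "u differentiable (at x)"
  shows "frechet_derivative u (at x) v = (\<Sum>a\<in>UNIV. v $ a * partial_deriv a u x)"
proof -
  have lin: "linear (frechet_derivative u (at x))" using assms by (rule linear_frechet_derivative)
  have "frechet_derivative u (at x) v = frechet_derivative u (at x) (\<Sum>a\<in>UNIV. v $ a *\<^sub>R axis a 1)"
    using basis_expansion[of v] by (simp add: scalar_mult_eq_scaleR)
  also have "\<dots> = (\<Sum>a\<in>UNIV. v $ a * partial_deriv a u x)"
    by (simp add: linear_sum[OF lin] linear_scale[OF lin] partial_deriv_def)
  finally show ?thesis .
qed

lemma Ck_on_cong:
  assumes S: "open S"
  shows "(\<And>y. y \<in> S \<Longrightarrow> u y = v y) \<Longrightarrow> Ck_on k S u \<longleftrightarrow> Ck_on k S v"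
proof (induction k arbitrary: u v)
  case 0
  then show ?case using continuous_on_cong[of S S u v] by simp
next
  case (Suc k)
  have "u differentiable_on S \<longleftrightarrow> v differentiable_on S"
    using has_derivative_cong_open[OF S, of _ u v] Suc.prems
    by (auto simp: differentiable_on_eq_differentiable_at[OF S] differentiable_def)
  moreover have "Ck_on k S (partial_deriv i u) \<longleftrightarrow> Ck_on k S (partial_deriv i v)" for i
    using partial_deriv_cong[OF S, of _ u v] Suc.prems by (intro Suc.IH) auto
  ultimately show ?case by simp
qed

lemma Ck_on_SucD: "Ck_on (Suc k) S u \<Longrightarrow> Ck_on k S u"
  by (induction k arbitrary: u) (auto intro: differentiable_imp_continuous_on)

lemma Ck_on_mono: "Ck_on m S u \<Longrightarrow> k \<le> m \<Longrightarrow> Ck_on k S u"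
  by (induction m) (auto simp: le_Suc_eq dest: Ck_on_SucD simp del: Ck_on.simps)

lemma Ck_on_continuous: "Ck_on k S u \<Longrightarrow> continuous_on S u"
  using Ck_on_mono[of k S u 0] by simp

lemma Ck_on_Suc_open:
  "open S \<Longrightarrow> Ck_on (Suc k) S u \<longleftrightarrow> (\<forall>x\<in>S. u differentiable (at x)) \<and> (\<forall>i. Ck_on k S (partial_deriv i u))"
  by (simp add: differentiable_on_eq_differentiable_at)

text \<open>Differentiability is a local property. This glues a function that is smooth on each of two
  overlapping open sets, such as a cut-off function extended by zero.\<close>

lemma Ck_on_local:
  assumes S: "open S"
  shows "(\<And>x. x \<in> S \<Longrightarrow> \<exists>T. open T \<and> x \<in> T \<and> Ck_on k T u) \<Longrightarrow> Ck_on k S u"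
proof (induction k arbitrary: u)
  case 0
  have "isCont u x" if "x \<in> S" for x
  proof -
    from 0[OF that] obtain T where "open T" "x \<in> T" "continuous_on T u" by auto
    then show ?thesis using continuous_on_eq_continuous_at by blast
  qed
  then show ?case by (simp add: continuous_on_eq_continuous_at[OF S])
next
  case (Suc k)
  show ?case unfolding Ck_on_Suc_open[OF S]
  proof (intro conjI ballI allI)
    fix x assume "x \<in> S"
    from Suc.prems[OF this] obtain T where "open T" "x \<in> T" "Ck_on (Suc k) T u" by blast
    then show "u differentiable (at x)" using Ck_on_Suc_open[of T k u] by blast
  next
    fix i show "Ck_on k S (partial_deriv i u)"
    proof (rule Suc.IH)
      fix x assume "x \<in> S"
      from Suc.prems[OF this] obtain T where "open T" "x \<in> T" "Ck_on (Suc k) T u" by blast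
      then show "\<exists>T. open T \<and> x \<in> T \<and> Ck_on k T (partial_deriv i u)" by auto
    qed
  qed
qed

lemma Ck_on_SucI:
  assumes S: "open S" and D: "\<And>x. x \<in> S \<Longrightarrow> (u has_derivative D x) (at x)"
    and C: "\<And>i. Ck_on k S (\<lambda>x. D x (axis i 1))"
  shows "Ck_on (Suc k) S u"
  unfolding Ck_on_Suc_open[OF S]
proof (intro conjI ballI allI)
  fix x assume "x \<in> S" then show "u differentiable (at x)" using D differentiable_def by blast
next
  fix i
  have "Ck_on k S (partial_deriv i u) \<longleftrightarrow> Ck_on k S (\<lambda>x. D x (axis i 1))"
    using D partial_deriv_eq by (intro Ck_on_cong[OF S]) blast
  then show "Ck_on k S (partial_deriv i u)" using C by simp
qed

lemma Ck_on_SucE: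
  assumes "open S" "Ck_on (Suc k) S u"
  shows "x \<in> S \<Longrightarrow> (u has_derivative frechet_derivative u (at x)) (at x)"
    and "Ck_on k S (\<lambda>x. frechet_derivative u (at x) (axis i 1))"
  using assms by (auto simp: differentiable_on_eq_differentiable_at frechet_derivative_works
      simp flip: partial_deriv_def)

lemma Ck_on_const: "open S \<Longrightarrow> Ck_on k S (\<lambda>x. c)"
proof (induction k arbitrary: c)
  case (Suc k)
  show ?case by (rule Ck_on_SucI[OF \<open>open S\<close>, where D="\<lambda>x h. 0"]) (use Suc in auto)
qed simp

lemma Ck_on_component:
  fixes S :: "(real ^ 'n::finite) set"
  assumes S: "open S"
  shows "Ck_on k S (\<lambda>x. x $ a)"
proof (cases k)
  case (Suc m)
  have D: "((\<lambda>x. x $ a) has_derivative (\<lambda>h. h $ a)) (at x)" for x :: "real ^ 'n"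
    by (intro bounded_linear_imp_has_derivative bounded_linear_vec_nth)
  show ?thesis unfolding Suc
    by (rule Ck_on_SucI[OF S D Ck_on_const[OF S]])
qed (auto intro: continuous_intros)

lemma Ck_on_add: "open S \<Longrightarrow> Ck_on k S u \<Longrightarrow> Ck_on k S v \<Longrightarrow> Ck_on k S (\<lambda>x. u x + v x)"
proof (induction k arbitrary: u v)
  case (Suc k)
  show ?case
    by (rule Ck_on_SucI[OF Suc.prems(1) has_derivative_add[OF
        Ck_on_SucE(1)[OF Suc.prems(1,2)] Ck_on_SucE(1)[OF Suc.prems(1,3)]]])
      (auto intro!: Suc.IH Ck_on_SucE(2)[OF Suc.prems(1)] Suc.prems simp del: Ck_on.simps)
qed (auto intro: continuous_intros)

lemma Ck_on_mult: "open S \<Longrightarrow> Ck_on k S u \<Longrightarrow> Ck_on k S v \<Longrightarrow> Ck_on k S (\<lambda>x. u x * v x)"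
proof (induction k arbitrary: u v)
  case (Suc k)
  show ?case
    by (rule Ck_on_SucI[OF Suc.prems(1) has_derivative_mult[OF
        Ck_on_SucE(1)[OF Suc.prems(1,2)] Ck_on_SucE(1)[OF Suc.prems(1,3)]]])
      (auto intro!: Suc.IH Ck_on_add Ck_on_SucE(2)[OF Suc.prems(1)] Suc.prems
        Ck_on_SucD[OF Suc.prems(2)] Ck_on_SucD[OF Suc.prems(3)] simp del: Ck_on.simps)
qed (auto intro: continuous_intros)

lemma Ck_on_cmult: "open S \<Longrightarrow> Ck_on k S u \<Longrightarrow> Ck_on k S (\<lambda>x. c * u x)"
  by (intro Ck_on_mult Ck_on_const)

lemma Ck_on_diff: "open S \<Longrightarrow> Ck_on k S u \<Longrightarrow> Ck_on k S v \<Longrightarrow> Ck_on k S (\<lambda>x. u x - v x)"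
  using Ck_on_add[of S k u "\<lambda>x. (-1) * v x"] Ck_on_cmult[of S k v "-1"] by (simp del: Ck_on.simps)

lemma Ck_on_sum: "open S \<Longrightarrow> (\<And>i. i \<in> I \<Longrightarrow> Ck_on k S (u i)) \<Longrightarrow> Ck_on k S (\<lambda>x. \<Sum>i\<in>I. u i x)"
  by (induction I rule: infinite_finite_induct)
    (auto intro: Ck_on_add Ck_on_const simp del: Ck_on.simps)

lemma Ck_on_prod: "open S \<Longrightarrow> (\<And>i. i \<in> I \<Longrightarrow> Ck_on k S (u i)) \<Longrightarrow> Ck_on k S (\<lambda>x. \<Prod>i\<in>I. u i x)"
  by (induction I rule: infinite_finite_induct)
    (auto intro: Ck_on_mult Ck_on_const simp del: Ck_on.simps)

lemma Ck_on_inverse: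
  "open S \<Longrightarrow> Ck_on k S u \<Longrightarrow> (\<And>x. x \<in> S \<Longrightarrow> u x \<noteq> 0) \<Longrightarrow> Ck_on k S (\<lambda>x. inverse (u x))"
proof (induction k)
  case (Suc k)
  \<comment> \<open>the derivative is a product of functions already known to be \<open>k\<close> times differentiable\<close>
  have D: "((\<lambda>x. inverse (u x)) has_derivative
      (\<lambda>h. (-1) * (inverse (u x) * frechet_derivative u (at x) h * inverse (u x)))) (at x)"
    if "x \<in> S" for x
    using Deriv.has_derivative_inverse[OF Suc.prems(3)[OF that] Ck_on_SucE(1)[OF Suc.prems(1,2) that]] by simp
  have "Ck_on k S (\<lambda>x. inverse (u x))" using Suc Ck_on_SucD by blast
  then show ?case
    by (intro Ck_on_SucI[OF Suc.prems(1) D] Ck_on_mult Ck_on_SucE(2)[OF Suc.prems(1,2)]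
        Ck_on_const Suc.prems)
qed (auto intro!: continuous_intros)

lemma Ck_on_sqrt:
  "open S \<Longrightarrow> Ck_on k S u \<Longrightarrow> (\<And>x. x \<in> S \<Longrightarrow> u x > 0) \<Longrightarrow> Ck_on k S (\<lambda>x. sqrt (u x))"
proof (induction k)
  case (Suc k)
  have D: "((\<lambda>x. sqrt (u x)) has_derivative
      (\<lambda>h. frechet_derivative u (at x) h * (1/2 * inverse (sqrt (u x))))) (at x)"
    if "x \<in> S" for x
    using has_derivative_real_sqrt[OF Suc.prems(3)[OF that] Ck_on_SucE(1)[OF Suc.prems(1,2) that]]
    by (simp add: field_simps)
  have "Ck_on k S (\<lambda>x. sqrt (u x))" using Suc Ck_on_SucD by blast
  then have "Ck_on k S (\<lambda>x. inverse (sqrt (u x)))"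
    using Suc.prems(1,3) by (intro Ck_on_inverse) (force simp del: Ck_on.simps)+
  then show ?case
    by (intro Ck_on_SucI[OF Suc.prems(1) D] Ck_on_mult Ck_on_SucE(2)[OF Suc.prems(1,2)]
        Ck_on_const Suc.prems)
qed (auto intro!: continuous_intros)

lemma Ck_on_exp: "open S \<Longrightarrow> Ck_on k S u \<Longrightarrow> Ck_on k S (\<lambda>x. exp (u x))"
proof (induction k)
  case (Suc k)
  have "Ck_on k S (\<lambda>x. exp (u x))" using Suc Ck_on_SucD by blast
  then show ?case
    by (intro Ck_on_SucI[OF Suc.prems(1) has_derivative_exp[OF Ck_on_SucE(1)[OF Suc.prems]]]
        Ck_on_mult Ck_on_SucE(2)[OF Suc.prems] Suc.prems)
qed (auto intro!: continuous_intros)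

lemma has_derivative_vec_components:
  fixes \<Phi> :: "real ^ 'm::finite \<Rightarrow> real ^ 'n::finite"
  assumes "\<And>a. (\<lambda>y. \<Phi> y $ a) differentiable (at x)"
  shows "(\<Phi> has_derivative (\<lambda>h. \<chi> a. frechet_derivative (\<lambda>y. \<Phi> y $ a) (at x) h)) (at x)"
  using assms unfolding has_derivative_componentwise_within[where f=\<Phi>]
  by (auto simp: Basis_vec_def inner_axis frechet_derivative_works)

lemma has_derivative_compose_partial:
  fixes \<Phi> :: "real ^ 'm::finite \<Rightarrow> real ^ 'n::finite"
  assumes "\<And>a. (\<lambda>y. \<Phi> y $ a) differentiable (at x)" and "u differentiable (at (\<Phi> x))"
  shows "((\<lambda>y. u (\<Phi> y)) has_derivative
    (\<lambda>h. \<Sum>a\<in>UNIV. frechet_derivative (\<lambda>y. \<Phi> y $ a) (at x) h * partial_deriv a u (\<Phi> x))) (at x)"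
proof -
  have "(u has_derivative frechet_derivative u (at (\<Phi> x))) (at (\<Phi> x))"
    using assms(2) by (simp add: frechet_derivative_works)
  from has_derivative_compose[OF has_derivative_vec_components[OF assms(1)] this]
  show ?thesis using assms(2) by (simp add: frechet_derivative_expand)
qed

text \<open>By the chain rule the partial derivatives of \<open>u \<circ> \<Phi>\<close> are sums of products of partial
  derivatives of \<open>\<Phi>\<close> with functions \<open>\<partial>\<^sub>a u \<circ> \<Phi>\<close>, to which the induction hypothesis applies.\<close>

lemma Ck_on_compose:
  assumes S: "open S" and T: "open T" and \<Phi>: "\<And>x. x \<in> S \<Longrightarrow> \<Phi> x \<in> T"
  shows "Ck_on k T u \<Longrightarrow> (\<And>a. Ck_on k S (\<lambda>x. \<Phi> x $ a)) \<Longrightarrow> Ck_on k S (\<lambda>x. u (\<Phi> x))"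
proof (induction k arbitrary: u)
  case 0
  then have "continuous_on S \<Phi>"
    using continuous_on_vec_lambda[of S "\<lambda>a x. \<Phi> x $ a"] by simp
  with 0 \<Phi> show ?case by (auto intro: continuous_on_compose2)
next
  case (Suc k)
  have D: "((\<lambda>y. u (\<Phi> y)) has_derivative
    (\<lambda>h. \<Sum>a\<in>UNIV. frechet_derivative (\<lambda>y. \<Phi> y $ a) (at x) h * partial_deriv a u (\<Phi> x))) (at x)"
    if "x \<in> S" for x
  proof (rule has_derivative_compose_partial)
    show "(\<lambda>y. \<Phi> y $ a) differentiable (at x)" for a
      using Suc.prems(2)[of a] that unfolding Ck_on_Suc_open[OF S] by blast
    show "u differentiable (at (\<Phi> x))"
      using Suc.prems(1) \<Phi>[OF that] unfolding Ck_on_Suc_open[OF T] by blast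
  qed
  have "Ck_on k S (\<lambda>x. partial_deriv a u (\<Phi> x))" for a
  proof (rule Suc.IH[OF _ Ck_on_SucD[OF Suc.prems(2)]])
    show "Ck_on k T (partial_deriv a u)" using Suc.prems(1) by simp
  qed
  then show ?case
    by (intro Ck_on_SucI[OF S D] Ck_on_sum[OF S] Ck_on_mult[OF S] Ck_on_SucE(2)[OF S Suc.prems(2)])
qed

subsection \<open>A flat function\<close>

text \<open>The classical \<open>exp (-1/t)\<close>, multiplied by powers of \<open>1/t\<close> so that the family is closed under
  differentiation.\<close>

definition flat :: "nat \<Rightarrow> real \<Rightarrow> real" where
  "flat m t = (if t > 0 then (1 / t) ^ m * exp (- (1 / t)) else 0)"

lemma flat_tendsto_0: "(flat m \<longlongrightarrow> 0) (at 0)"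
proof -
  have "((\<lambda>t::real. inverse t ^ m / exp (inverse t)) \<longlongrightarrow> 0) (at_right 0)"
    using filterlim_compose[OF tendsto_power_div_exp_0 filterlim_inverse_at_top_right] .
  then have "(flat m \<longlongrightarrow> 0) (at_right 0)"
    by (rule Lim_transform_eventually)
      (auto simp: flat_def eventually_at_filter exp_minus field_simps inverse_eq_divide)
  moreover have "(flat m \<longlongrightarrow> 0) (at_left 0)"
    by (rule tendsto_eventually) (auto simp: flat_def eventually_at_filter)
  ultimately show ?thesis using filterlim_split_at[of "flat m" "nhds 0" 0] by blast
qed

lemma flat_deriv: "(flat m has_real_derivative - real m * flat (Suc m) t + flat (m + 2) t) (at t)"
proof -
  consider "t > 0" | "t < 0" | "t = 0" by linarith
  then show ?thesis
  proof cases
    case 1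
    have "((\<lambda>t. (1 / t) ^ m * exp (- (1 / t))) has_real_derivative
        - real m * flat (Suc m) t + flat (m + 2) t) (at t)"
    proof -
      have d1: "((\<lambda>t. 1 / t) has_real_derivative - (1 / t)\<^sup>2) (at t)"
        using 1 by (auto intro!: derivative_eq_intros simp: power2_eq_square)
      have "((\<lambda>t. (1 / t) ^ m * exp (- (1 / t))) has_real_derivative
          real m * (- (1 / t)\<^sup>2 * (1 / t) ^ (m - Suc 0)) * exp (- (1 / t))
          + exp (- (1 / t)) * (- (- (1 / t)\<^sup>2)) * (1 / t) ^ m) (at t)"
        by (intro DERIV_mult DERIV_power DERIV_fun_exp DERIV_minus d1)
      moreover have "real m * (- (1 / t)\<^sup>2 * (1 / t) ^ (m - Suc 0)) * exp (- (1 / t))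
          + exp (- (1 / t)) * (- (- (1 / t)\<^sup>2)) * (1 / t) ^ m
          = - real m * flat (Suc m) t + flat (m + 2) t"
      proof -
        define s where "s = 1 / t"
        have "flat k t = s ^ k * exp (- s)" for k using 1 by (simp add: flat_def s_def)
        then show ?thesis unfolding s_def[symmetric]
          by (cases m) (simp_all add: power2_eq_square algebra_simps)
      qed
      ultimately show ?thesis by simp
    qed
    then show ?thesis
      by (rule has_field_derivative_transform_within_open[where S="{0<..}"]) (use 1 in \<open>auto simp: flat_def\<close>)
  next
    case 2
    have "((\<lambda>t. 0) has_real_derivative - real m * flat (Suc m) t + flat (m + 2) t) (at t)"
      using 2 by (auto simp: flat_def)
    then show ?thesis
      by (rule has_field_derivative_transform_within_open[where S="{..<0}"]) (use 2 in \<open>auto simp: flat_def\<close>)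
  next
    case 3
    have "(\<lambda>h. (flat m (0 + h) - flat m 0) / h) = flat (Suc m)"
      by (auto simp: flat_def fun_eq_iff)
    then show ?thesis using 3 flat_tendsto_0[of "Suc m"] by (auto simp: DERIV_def flat_def)
  qed
qed

lemma Ck_on_flat: "open S \<Longrightarrow> Ck_on k S u \<Longrightarrow> Ck_on k S (\<lambda>x. flat m (u x))"
proof (induction k arbitrary: m)
  case 0
  have "continuous_on UNIV (flat m)"
    using DERIV_continuous_on[OF has_field_derivative_at_within[OF flat_deriv]] .
  moreover have "continuous_on S u" using 0 by simp
  ultimately show ?case using continuous_on_compose2[of UNIV "flat m" S u] by simp
next
  case (Suc k)
  have D: "((\<lambda>x. flat m (u x)) has_derivative
      (\<lambda>h. (- real m * flat (Suc m) (u x) + flat (m + 2) (u x)) * frechet_derivative u (at x) h)) (at x)"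
    if "x \<in> S" for x
    using has_derivative_compose[OF Ck_on_SucE(1)[OF Suc.prems that]
      has_field_derivative_imp_has_derivative[OF flat_deriv]] .
  have "Ck_on k S (\<lambda>x. flat m' (u x))" for m' using Suc Ck_on_SucD by blast
  then show ?case
    by (intro Ck_on_SucI[OF Suc.prems(1) D] Ck_on_add Ck_on_mult Ck_on_SucE(2)[OF Suc.prems]
        Ck_on_const Suc.prems)
qed

subsection \<open>The integral of a partial derivative\<close>

lemma partial_deriv_line:
  assumes "u differentiable (at (x + t *\<^sub>R v))"
  shows "((\<lambda>s. u (x + s *\<^sub>R v)) has_real_derivative (\<Sum>a\<in>UNIV. v $ a * partial_deriv a u (x + t *\<^sub>R v))) (at t)"
proof -
  have "((\<lambda>s. x + s *\<^sub>R v) has_derivative (\<lambda>h. h *\<^sub>R v)) (at t)"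
    by (auto intro!: derivative_eq_intros)
  from has_derivative_compose[OF this assms[unfolded frechet_derivative_works]]
  have "((\<lambda>s. u (x + s *\<^sub>R v)) has_derivative (\<lambda>h. frechet_derivative u (at (x + t *\<^sub>R v)) (h *\<^sub>R v))) (at t)" .
  moreover have "(\<lambda>h. frechet_derivative u (at (x + t *\<^sub>R v)) (h *\<^sub>R v))
      = (*) (\<Sum>a\<in>UNIV. v $ a * partial_deriv a u (x + t *\<^sub>R v))"
    by (auto simp: frechet_derivative_expand[OF assms] sum_distrib_left fun_eq_iff mult_ac)
  ultimately show ?thesis by (simp add: has_field_derivative_def)
qed

text \<open>The integral of every difference quotient vanishes by translation invariance, and the difference
  quotients converge boundedly to the partial derivative.\<close>

lemma integral_partial_deriv:
  fixes v :: "real ^ 'n::finite \<Rightarrow> real"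
  assumes C1: "Ck_on 1 UNIV v" and K: "compact K" and supp: "\<And>x. x \<notin> K \<Longrightarrow> v x = 0"
  shows "integrable lborel (partial_deriv i v)" "(\<integral>x. partial_deriv i v x \<partial>lborel) = 0"
proof -
  define e where "e = (axis i 1 :: real ^ 'n)"
  have ne: "norm e = 1" by (simp add: e_def)
  obtain R where R: "K \<subseteq> cball 0 R"
    using compact_imp_bounded[OF K] unfolding bounded_any_center[of K 0] by (auto simp: subset_iff)
  define B where "B = cball (0 :: real ^ 'n) (R + 1)"
  have B: "compact B" by (simp add: B_def)
  have diff: "v differentiable (at x)" for x
    using C1 Ck_on_Suc_open[OF open_UNIV, of 0 v] by (simp del: Ck_on.simps)
  have cp: "continuous_on UNIV (partial_deriv i v)" using C1 Ck_on_Suc_open[OF open_UNIV, of 0 v] by simp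
  have cv: "continuous_on UNIV v" using Ck_on_continuous[OF C1] .
  have [measurable]: "v \<in> borel_measurable borel" "partial_deriv i v \<in> borel_measurable borel"
    using cp cv by (auto intro: borel_measurable_continuous_onI)
  have p0: "partial_deriv i v x = 0" if "x \<notin> K" for x
  proof -
    have "partial_deriv i v x = partial_deriv i (\<lambda>x. 0) x"
      using that K by (intro partial_deriv_cong[of "- K"]) (auto simp: supp compact_imp_closed)
    then show ?thesis by (simp add: partial_deriv_def)
  qed
  have "bounded (partial_deriv i v ` B)"
    using cp continuous_on_subset by (intro compact_imp_bounded compact_continuous_image B) blast
  then obtain M where M: "\<And>x. x \<in> B \<Longrightarrow> \<bar>partial_deriv i v x\<bar> \<le> M"
    by (auto simp: bounded_iff)
  have KB: "K \<subseteq> B" using R by (auto simp: B_def)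
  have M': "\<bar>partial_deriv i v x\<bar> \<le> \<bar>M\<bar>" for x
    using M[of x] p0[of x] KB by (cases "x \<in> K") auto
  define g where "g k x = (v (x + (1 / real (Suc k)) *\<^sub>R e) - v x) / (1 / real (Suc k))" for k :: nat and x
  have ibl: "integrable lborel v"
  proof -
    have "(\<lambda>x. indicator K x *\<^sub>R v x) = v" using supp by (auto simp: fun_eq_iff indicator_def)
    then show ?thesis using borel_integrable_compact[OF K continuous_on_subset[OF cv subset_UNIV]] by simp
  qed
  have shift: "integrable lborel (\<lambda>x. v (x + h *\<^sub>R e))" "(\<integral>x. v (x + h *\<^sub>R e) \<partial>lborel) = (\<integral>x. v x \<partial>lborel)" for h
  proof -
    have "integrable (distr lborel borel ((+) (h *\<^sub>R e))) v" using ibl by (simp only: lborel_distr_plus)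
    then show "integrable lborel (\<lambda>x. v (x + h *\<^sub>R e))" by (simp add: integrable_distr_eq add.commute)
    have "(\<integral>x. v x \<partial>lborel) = (\<integral>x. v x \<partial>distr lborel borel ((+) (h *\<^sub>R e)))"
      by (simp only: lborel_distr_plus)
    then show "(\<integral>x. v (x + h *\<^sub>R e) \<partial>lborel) = (\<integral>x. v x \<partial>lborel)"
      by (simp add: integral_distr add.commute)
  qed
  have g0: "(\<integral>x. g k x \<partial>lborel) = 0" for k
    unfolding g_def using shift ibl by simp
  have line: "((\<lambda>s. v (x + s *\<^sub>R e)) has_real_derivative partial_deriv i v (x + t *\<^sub>R e)) (at t)" for x t
  proof -
    have "(\<Sum>a\<in>UNIV. e $ a * partial_deriv a v (x + t *\<^sub>R e)) = partial_deriv i v (x + t *\<^sub>R e)"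
      by (simp add: e_def axis_def if_distrib[of "\<lambda>c. c * _"] cong: if_cong)
    then show ?thesis using partial_deriv_line[OF diff[of "x + t *\<^sub>R e"]] by simp
  qed
  have bnd: "\<bar>g k x\<bar> \<le> \<bar>M\<bar> * indicator B x" for k x
  proof (cases "x \<in> B")
    case True
    define h where "h = 1 / real (Suc k)"
    have h: "h > 0" by (simp add: h_def)
    obtain z where "0 < z" "z < h" and z: "v (x + h *\<^sub>R e) - v (x + 0 *\<^sub>R e) = (h - 0) * partial_deriv i v (x + z *\<^sub>R e)"
      using MVT2[OF h, of "\<lambda>s. v (x + s *\<^sub>R e)" "\<lambda>s. partial_deriv i v (x + s *\<^sub>R e)"] line by blast
    have "g k x = partial_deriv i v (x + z *\<^sub>R e)"
      unfolding g_def h_def[symmetric] using z h by simp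
    then show ?thesis using True M' by simp
  next
    case False
    have "x \<notin> K" using False KB by blast
    moreover have "x + (1 / real (Suc k)) *\<^sub>R e \<notin> K"
    proof
      assume "x + (1 / real (Suc k)) *\<^sub>R e \<in> K"
      then have "norm (x + (1 / real (Suc k)) *\<^sub>R e) \<le> R" using R by auto
      moreover have "norm x \<le> norm (x + (1 / real (Suc k)) *\<^sub>R e) + norm ((1 / real (Suc k)) *\<^sub>R e)"
        by (metis add_diff_cancel_right' norm_triangle_ineq4)
      moreover have "norm ((1 / real (Suc k)) *\<^sub>R e) \<le> 1" by (simp add: ne)
      moreover have "norm x > R + 1" using False by (simp add: B_def)
      ultimately show False by linarith
    qed
    ultimately show ?thesis using False by (simp add: g_def supp)
  qed
  have lim: "(\<lambda>k. g k x) \<longlonglongrightarrow> partial_deriv i v x" for x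
  proof -
    have "((\<lambda>h. (v (x + (0 + h) *\<^sub>R e) - v (x + 0 *\<^sub>R e)) / h) \<longlongrightarrow> partial_deriv i v (x + 0 *\<^sub>R e)) (at 0)"
      using line[of x 0] unfolding DERIV_def .
    moreover have "filterlim (\<lambda>k. 1 / real (Suc k)) (at 0) sequentially"
      using lim_1_over_n[where 'a=real]
      by (auto simp: filterlim_at intro!: LIMSEQ_Suc[where f="\<lambda>n. 1 / real n"] simp del: of_nat_Suc)
    ultimately have "(\<lambda>k. (v (x + (0 + 1 / real (Suc k)) *\<^sub>R e) - v (x + 0 *\<^sub>R e)) / (1 / real (Suc k)))
        \<longlonglongrightarrow> partial_deriv i v (x + 0 *\<^sub>R e)" by (rule filterlim_compose)
    then show ?thesis by (simp add: g_def)
  qed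
  have ib: "integrable lborel (\<lambda>x. \<bar>M\<bar> * indicator B x)"
    using borel_integrable_compact[OF B, of "\<lambda>x. \<bar>M\<bar>"] by (simp add: mult.commute)
  have gm[measurable]: "g k \<in> borel_measurable borel" for k unfolding g_def by measurable
  have "partial_deriv i v \<in> borel_measurable lborel" "\<And>k. g k \<in> borel_measurable lborel"
    "AE x in lborel. (\<lambda>k. g k x) \<longlonglongrightarrow> partial_deriv i v x"
    "\<And>k. AE x in lborel. norm (g k x) \<le> \<bar>M\<bar> * indicator B x"
    using lim bnd by (simp_all add: AE_I2)
  note D = this(1,2) ib this(3,4)
  show "integrable lborel (partial_deriv i v)"
    using integrable_dominated_convergence[OF D] .
  have "(\<lambda>k. \<integral>x. g k x \<partial>lborel) \<longlonglongrightarrow> (\<integral>x. partial_deriv i v x \<partial>lborel)"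
    using integral_dominated_convergence[OF D] .
  then show "(\<integral>x. partial_deriv i v x \<partial>lborel) = 0"
    by (simp add: g0 LIMSEQ_const_iff)
qed

subsection \<open>The Poincare inequality on convex sets\<close>

definition grad_sq :: "(real ^ 'n::finite \<Rightarrow> real) \<Rightarrow> real ^ 'n \<Rightarrow> real" where
  "grad_sq u x = (\<Sum>i\<in>UNIV. (partial_deriv i u x)\<^sup>2)"

lemma grad_sq_nonneg: "0 \<le> grad_sq u x"
  by (simp add: grad_sq_def sum_nonneg)

lemma continuous_on_grad_sq: "Ck_on 1 S u \<Longrightarrow> continuous_on S (grad_sq u)"
  unfolding grad_sq_def by (auto intro!: continuous_intros)

text \<open>The variance of \<open>f\<close> on the unit interval is nonnegative.\<close>

lemma sq_integral_le:
  fixes f :: "real \<Rightarrow> real"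
  assumes "continuous_on {0..1::real} f"
  shows "(\<integral>t. indicator {0..1} t *\<^sub>R f t \<partial>lborel)\<^sup>2 \<le> (\<integral>t. indicator {0..1} t *\<^sub>R (f t)\<^sup>2 \<partial>lborel)"
proof -
  define m where "m = (\<integral>t. indicator {0..1} t *\<^sub>R f t \<partial>lborel)"
  have ic: "integrable lborel (\<lambda>t. indicator {0..1} t *\<^sub>R g t)"
    if "continuous_on {0..1} g" for g :: "real \<Rightarrow> real"
    using borel_integrable_compact[OF compact_Icc that] .
  have i: "integrable lborel (\<lambda>t. indicator {0..1} t *\<^sub>R f t)"
    "integrable lborel (\<lambda>t. indicator {0..1} t *\<^sub>R (f t)\<^sup>2)"
    "integrable lborel (\<lambda>t. indicator {0..1::real} t *\<^sub>R (1::real))"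
    by (rule ic[OF assms], rule ic[OF continuous_on_power[OF assms]], rule ic[OF continuous_on_const])
  have "0 \<le> (\<integral>t. indicator {0..1} t *\<^sub>R (f t - m)\<^sup>2 \<partial>lborel)"
    by (intro Bochner_Integration.integral_nonneg) simp
  also have "(\<lambda>t. indicator {0..1} t *\<^sub>R (f t - m)\<^sup>2)
      = (\<lambda>t. indicator {0..1} t *\<^sub>R (f t)\<^sup>2 - (2 * m) * (indicator {0..1} t *\<^sub>R f t) + m\<^sup>2 * (indicator {0..1} t *\<^sub>R 1))"
    by (auto simp: fun_eq_iff power2_diff algebra_simps)
  also have "(\<integral>t. \<dots> t \<partial>lborel) = (\<integral>t. indicator {0..1} t *\<^sub>R (f t)\<^sup>2 \<partial>lborel) - (2 * m) * m + m\<^sup>2 * 1"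
  proof -
    have "(\<integral>t. indicator {0..1::real} t *\<^sub>R (1::real) \<partial>lborel) = 1" by simp
    then show ?thesis
      using i by (subst Bochner_Integration.integral_add Bochner_Integration.integral_diff,
          (simp; fail), (simp; fail))+ (simp add: m_def)
  qed
  finally show ?thesis by (simp add: m_def power2_eq_square)
qed

text \<open>The fundamental theorem of calculus along the segment from \<open>y\<close> to \<open>x\<close>. The indicator of \<open>C\<close> is
  identically one on the segment; it is there because, after the Fubini theorem, the
  integrand is integrated over the whole space.\<close>

lemma sq_diff_le_line_integral:
  fixes u :: "real ^ 'n::finite \<Rightarrow> real"
  assumes S: "open S" and u: "Ck_on 1 S u" and C: "C \<subseteq> S" "convex C" and xy: "x \<in> C" "y \<in> C"
  shows "ennreal ((u x - u y)\<^sup>2) \<le> ennreal ((dist x y)\<^sup>2) *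
    (\<integral>\<^sup>+t. ennreal (grad_sq u (y + t *\<^sub>R (x - y))) * indicator C (y + t *\<^sub>R (x - y)) * indicator {0..1} t \<partial>lborel)"
proof -
  define v where "v = x - y"
  have inC: "y + t *\<^sub>R v \<in> C" if "0 \<le> t" "t \<le> 1" for t
    using convexD_alt[OF C(2) xy(2,1) that] by (simp add: v_def algebra_simps)
  have dS: "u differentiable (at z)" "isCont (partial_deriv i u) z" if "z \<in> S" for z i
    using u that S by (auto simp: differentiable_on_eq_differentiable_at continuous_on_eq_continuous_at)
  define \<phi> where "\<phi> t = (\<Sum>a\<in>UNIV. v $ a * partial_deriv a u (y + t *\<^sub>R v))" for t
  have ccomp: "continuous_on {0..1} (\<lambda>t. f (y + t *\<^sub>R v))" if "continuous_on S f" for f :: "_ \<Rightarrow> real"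
    using inC C(1) by (intro continuous_on_compose2[OF that] continuous_intros) auto
  have c\<phi>: "continuous_on {0..1} \<phi>"
    unfolding \<phi>_def using u by (intro continuous_intros ccomp) simp
  have cg: "continuous_on {0..1} (\<lambda>t. grad_sq u (y + t *\<^sub>R v))"
    by (intro ccomp continuous_on_grad_sq u)
  have "(\<integral>t. indicator {0..1} t *\<^sub>R \<phi> t \<partial>lborel) = u (y + 1 *\<^sub>R v) - u (y + 0 *\<^sub>R v)"
  proof (rule integral_FTC_atLeastAtMost[OF _ _ c\<phi>])
    fix t :: real assume "0 \<le> t" "t \<le> 1"
    then have "y + t *\<^sub>R v \<in> S" using inC C(1) by blast
    from partial_deriv_line[OF dS(1)[OF this]]
    show "((\<lambda>t. u (y + t *\<^sub>R v)) has_vector_derivative \<phi> t) (at t within {0..1})"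
      unfolding \<phi>_def has_real_derivative_iff_has_vector_derivative
      by (rule has_vector_derivative_at_within)
  qed simp
  then have "(u x - u y)\<^sup>2 = (\<integral>t. indicator {0..1} t *\<^sub>R \<phi> t \<partial>lborel)\<^sup>2" by (simp add: v_def)
  also have "\<dots> \<le> (\<integral>t. indicator {0..1} t *\<^sub>R (\<phi> t)\<^sup>2 \<partial>lborel)" by (rule sq_integral_le[OF c\<phi>])
  also have "\<dots> \<le> (\<integral>t. (dist x y)\<^sup>2 * (indicator {0..1} t *\<^sub>R grad_sq u (y + t *\<^sub>R v)) \<partial>lborel)"
  proof (rule integral_mono)
    show "integrable lborel (\<lambda>t. indicator {0..1} t *\<^sub>R (\<phi> t)\<^sup>2)"
      by (intro borel_integrable_compact continuous_intros c\<phi>) simp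
    show "integrable lborel (\<lambda>t. (dist x y)\<^sup>2 * (indicator {0..1} t *\<^sub>R grad_sq u (y + t *\<^sub>R v)))"
      by (intro integrable_mult_right borel_integrable_compact cg) simp
  next
    fix t :: real
    have "\<bar>v \<bullet> (\<chi> a. partial_deriv a u (y + t *\<^sub>R v))\<bar> \<le> norm v * norm (\<chi> a. partial_deriv a u (y + t *\<^sub>R v))"
      by (rule Cauchy_Schwarz_ineq2)
    then have "(v \<bullet> (\<chi> a. partial_deriv a u (y + t *\<^sub>R v)))\<^sup>2
        \<le> (norm v * norm (\<chi> a. partial_deriv a u (y + t *\<^sub>R v)))\<^sup>2"
      by (rule abs_le_square_iff[THEN iffD1, OF order_trans[OF _ abs_ge_self]])
    also have "\<dots> = (dist x y)\<^sup>2 * grad_sq u (y + t *\<^sub>R v)"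
      by (simp add: power_mult_distrib v_def dist_norm grad_sq_def power2_norm_eq_inner
          inner_vec_def power2_eq_square[of "partial_deriv _ _ _"])
    finally show "indicator {0..1} t *\<^sub>R (\<phi> t)\<^sup>2 \<le> (dist x y)\<^sup>2 * (indicator {0..1} t *\<^sub>R grad_sq u (y + t *\<^sub>R v))"
      by (auto simp: \<phi>_def inner_vec_def indicator_def)
  qed
  also have "\<dots> = (dist x y)\<^sup>2 * (\<integral>t. indicator {0..1} t *\<^sub>R grad_sq u (y + t *\<^sub>R v) \<partial>lborel)"
    by (rule integral_mult_right_zero)
  finally have "ennreal ((u x - u y)\<^sup>2)
      \<le> ennreal ((dist x y)\<^sup>2 * (\<integral>t. indicator {0..1} t *\<^sub>R grad_sq u (y + t *\<^sub>R v) \<partial>lborel))"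
    by (rule ennreal_leI)
  also have "\<dots> = ennreal ((dist x y)\<^sup>2) * ennreal (\<integral>t. indicator {0..1} t *\<^sub>R grad_sq u (y + t *\<^sub>R v) \<partial>lborel)"
    by (intro ennreal_mult Bochner_Integration.integral_nonneg) (auto simp: grad_sq_nonneg)
  also have "ennreal (\<integral>t. indicator {0..1} t *\<^sub>R grad_sq u (y + t *\<^sub>R v) \<partial>lborel)
      = (\<integral>\<^sup>+t. ennreal (indicator {0..1} t *\<^sub>R grad_sq u (y + t *\<^sub>R v)) \<partial>lborel)"
    by (intro nn_integral_eq_integral[symmetric] borel_integrable_compact cg AE_I2)
      (auto simp: grad_sq_nonneg)
  also have "\<dots> = (\<integral>\<^sup>+t. ennreal (grad_sq u (y + t *\<^sub>R v)) * indicator C (y + t *\<^sub>R v) * indicator {0..1} t \<partial>lborel)"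
    using inC by (intro nn_integral_cong) (auto simp: indicator_def)
  finally show ?thesis unfolding v_def .
qed

text \<open>Substitution multiplies the integral by \<open>t\<close> to the power of minus the dimension.\<close>

lemma nn_integral_scaled_le:
  fixes h :: "'a::euclidean_space \<Rightarrow> ennreal"
  assumes [measurable]: "h \<in> borel_measurable borel" and t: "1/2 \<le> t"
  shows "(\<integral>\<^sup>+x. h (a + t *\<^sub>R x) \<partial>lborel) \<le> ennreal (2 ^ DIM('a)) * (\<integral>\<^sup>+x. h x \<partial>lborel)"
proof -
  have "(\<integral>\<^sup>+x. h x \<partial>lborel)
      = (\<integral>\<^sup>+x. h x \<partial>density (distr lborel borel (\<lambda>x. a + t *\<^sub>R x)) (\<lambda>_. ennreal (\<bar>t\<bar> ^ DIM('a))))"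
    using t by (subst lborel_affine[of t a]) auto
  also have "\<dots> = ennreal (t ^ DIM('a)) * (\<integral>\<^sup>+x. h (a + t *\<^sub>R x) \<partial>lborel)"
    using t by (simp add: nn_integral_density nn_integral_distr nn_integral_cmult)
  finally have eq: "(\<integral>\<^sup>+x. h x \<partial>lborel) = ennreal (t ^ DIM('a)) * (\<integral>\<^sup>+x. h (a + t *\<^sub>R x) \<partial>lborel)" .
  have "1 \<le> (2 * t) ^ DIM('a)" using t by (intro one_le_power) simp
  then have "1 \<le> ennreal (2 ^ DIM('a) * t ^ DIM('a))" by (simp add: power_mult_distrib ennreal_1[symmetric] del: ennreal_1)
  then have "1 * (\<integral>\<^sup>+x. h (a + t *\<^sub>R x) \<partial>lborel)
      \<le> ennreal (2 ^ DIM('a) * t ^ DIM('a)) * (\<integral>\<^sup>+x. h (a + t *\<^sub>R x) \<partial>lborel)"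
    by (rule mult_right_mono) simp
  then show ?thesis using t by (simp add: eq ennreal_mult mult.assoc)
qed

text \<open>Integrate the bound along segments; at a point of the segment that is at least half way from
  \<open>y\<close> to \<open>x\<close>, integration over \<open>x\<close> is comparable to integration over \<open>C\<close>, and symmetrically for the
  other half.\<close>

theorem poincare_convex:
  fixes u :: "real ^ 'n::finite \<Rightarrow> real"
  assumes S: "open S" and u: "Ck_on 1 S u" and C: "C \<subseteq> S" "convex C" and Cm[measurable]: "C \<in> sets borel"
    and d: "\<And>x y. x \<in> C \<Longrightarrow> y \<in> C \<Longrightarrow> dist x y \<le> \<delta>"
  shows "(\<integral>\<^sup>+x\<in>C. (\<integral>\<^sup>+y\<in>C. ennreal ((u x - u y)\<^sup>2) \<partial>lborel) \<partial>lborel)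
    \<le> ennreal (2 ^ CARD('n) * \<delta>\<^sup>2) * emeasure lborel C * (\<integral>\<^sup>+x\<in>C. ennreal (grad_sq u x) \<partial>lborel)"
proof -
  define h where "h z = ennreal (indicator C z *\<^sub>R grad_sq u z)" for z
  have hI: "ennreal (grad_sq u z) * indicator C z = h z" for z by (simp add: h_def indicator_def)
  have hm[measurable]: "h \<in> borel_measurable borel"
    unfolding h_def using continuous_on_subset[OF continuous_on_grad_sq[OF u] C(1)]
    by (intro measurable_compose[OF borel_measurable_continuous_on_indicator measurable_ennreal] Cm)
  define H where "H = (\<integral>\<^sup>+z. h z \<partial>lborel)"
  define k where "k t x y = h (y + t *\<^sub>R (x - y)) * indicator {0..1} t * (indicator C x * indicator C y)"
    for t :: real and x y
  have km: "(\<lambda>p. k (fst p) (fst (snd p)) (snd (snd p))) \<in> borel_measurable (borel \<Otimes>\<^sub>M (borel \<Otimes>\<^sub>M borel))"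
    unfolding k_def by measurable
  note [measurable] = measurable_compose[OF _ km, of "\<lambda>p. (f p, (g p, h p))" for f g h, simplified]
  have pt: "ennreal ((u x - u y)\<^sup>2) * indicator C y * indicator C x
      \<le> ennreal (\<delta>\<^sup>2) * (\<integral>\<^sup>+t. k t x y \<partial>lborel)" for x y
  proof (cases "x \<in> C \<and> y \<in> C")
    case True
    have "ennreal ((u x - u y)\<^sup>2) \<le> ennreal ((dist x y)\<^sup>2) *
      (\<integral>\<^sup>+t. ennreal (grad_sq u (y + t *\<^sub>R (x - y))) * indicator C (y + t *\<^sub>R (x - y)) * indicator {0..1} t \<partial>lborel)"
      using sq_diff_le_line_integral[OF S u C] True by blast
    also have "\<dots> \<le> ennreal (\<delta>\<^sup>2) * (\<integral>\<^sup>+t. k t x y \<partial>lborel)"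
      using True d[of x y] by (intro mult_mono ennreal_leI power_mono) (auto simp: k_def hI)
    finally show ?thesis using True by simp
  qed auto
  \<comment> \<open>freeze the end point that is further away from the point at parameter \<open>t\<close>\<close>
  have half: "(\<integral>\<^sup>+x. \<integral>\<^sup>+y. k t x y \<partial>lborel \<partial>lborel)
      \<le> ennreal (2 ^ CARD('n)) * emeasure lborel C * H * indicator {0..1} t" for t
  proof -
    consider "t < 0 \<or> t > 1" | "0 \<le> t" "t \<le> 1/2" | "1/2 \<le> t" "t \<le> 1" by linarith
    then show ?thesis
    proof cases
      case 1 then show ?thesis by (auto simp: k_def indicator_def)
    next
      case 2
      have "(\<integral>\<^sup>+x. \<integral>\<^sup>+y. k t x y \<partial>lborel \<partial>lborel)
          \<le> (\<integral>\<^sup>+x. indicator C x * (\<integral>\<^sup>+y. h (t *\<^sub>R x + (1 - t) *\<^sub>R y) \<partial>lborel) \<partial>lborel)"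
      proof (rule nn_integral_mono)
        fix x
        have "(\<integral>\<^sup>+y. k t x y \<partial>lborel) \<le> (\<integral>\<^sup>+y. indicator C x * h (t *\<^sub>R x + (1 - t) *\<^sub>R y) \<partial>lborel)"
          by (intro nn_integral_mono) (auto simp: k_def indicator_def algebra_simps)
        then show "(\<integral>\<^sup>+y. k t x y \<partial>lborel) \<le> indicator C x * (\<integral>\<^sup>+y. h (t *\<^sub>R x + (1 - t) *\<^sub>R y) \<partial>lborel)"
          by (simp add: nn_integral_cmult)
      qed
      also have "\<dots> \<le> (\<integral>\<^sup>+x. indicator C x * (ennreal (2 ^ CARD('n)) * H) \<partial>lborel)"
        unfolding H_def using 2 nn_integral_scaled_le[OF hm, of "1 - t"]
        by (intro nn_integral_mono mult_left_mono) auto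
      also have "\<dots> = emeasure lborel C * (ennreal (2 ^ CARD('n)) * H)"
        by (simp add: nn_integral_multc)
      finally show ?thesis using 2 by (simp add: mult_ac)
    next
      case 3
      have "(\<integral>\<^sup>+x. \<integral>\<^sup>+y. k t x y \<partial>lborel \<partial>lborel) = (\<integral>\<^sup>+y. \<integral>\<^sup>+x. k t x y \<partial>lborel \<partial>lborel)"
        by (rule lborel_pair.Fubini'[symmetric]) (simp add: case_prod_beta)
      also have "\<dots> \<le> (\<integral>\<^sup>+y. indicator C y * (\<integral>\<^sup>+x. h ((1 - t) *\<^sub>R y + t *\<^sub>R x) \<partial>lborel) \<partial>lborel)"
      proof (rule nn_integral_mono)
        fix y
        have "(\<integral>\<^sup>+x. k t x y \<partial>lborel) \<le> (\<integral>\<^sup>+x. indicator C y * h ((1 - t) *\<^sub>R y + t *\<^sub>R x) \<partial>lborel)"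
          by (intro nn_integral_mono) (auto simp: k_def indicator_def algebra_simps)
        then show "(\<integral>\<^sup>+x. k t x y \<partial>lborel) \<le> indicator C y * (\<integral>\<^sup>+x. h ((1 - t) *\<^sub>R y + t *\<^sub>R x) \<partial>lborel)"
          by (simp add: nn_integral_cmult)
      qed
      also have "\<dots> \<le> (\<integral>\<^sup>+y. indicator C y * (ennreal (2 ^ CARD('n)) * H) \<partial>lborel)"
        unfolding H_def using 3 nn_integral_scaled_le[OF hm, of t]
        by (intro nn_integral_mono mult_left_mono) auto
      also have "\<dots> = emeasure lborel C * (ennreal (2 ^ CARD('n)) * H)"
        by (simp add: nn_integral_multc)
      finally show ?thesis using 3 by (simp add: mult_ac)
    qed
  qed
  have "(\<integral>\<^sup>+x\<in>C. (\<integral>\<^sup>+y\<in>C. ennreal ((u x - u y)\<^sup>2) \<partial>lborel) \<partial>lborel)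
      \<le> (\<integral>\<^sup>+x. \<integral>\<^sup>+y. ennreal (\<delta>\<^sup>2) * (\<integral>\<^sup>+t. k t x y \<partial>lborel) \<partial>lborel \<partial>lborel)"
  proof (rule nn_integral_mono)
    fix x
    have "(\<integral>\<^sup>+y\<in>C. ennreal ((u x - u y)\<^sup>2) \<partial>lborel) * indicator C x
        \<le> (\<integral>\<^sup>+y. ennreal ((u x - u y)\<^sup>2) * indicator C y * indicator C x \<partial>lborel)"
      by (cases "x \<in> C") auto
    also have "\<dots> \<le> (\<integral>\<^sup>+y. ennreal (\<delta>\<^sup>2) * (\<integral>\<^sup>+t. k t x y \<partial>lborel) \<partial>lborel)"
      by (intro nn_integral_mono pt)
    finally show "(\<integral>\<^sup>+y\<in>C. ennreal ((u x - u y)\<^sup>2) \<partial>lborel) * indicator C x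
        \<le> (\<integral>\<^sup>+y. ennreal (\<delta>\<^sup>2) * (\<integral>\<^sup>+t. k t x y \<partial>lborel) \<partial>lborel)" .
  qed
  also have "\<dots> = ennreal (\<delta>\<^sup>2) * (\<integral>\<^sup>+x. \<integral>\<^sup>+y. \<integral>\<^sup>+t. k t x y \<partial>lborel \<partial>lborel \<partial>lborel)"
    by (simp add: nn_integral_cmult)
  also have "(\<integral>\<^sup>+x. \<integral>\<^sup>+y. \<integral>\<^sup>+t. k t x y \<partial>lborel \<partial>lborel \<partial>lborel)
      = (\<integral>\<^sup>+x. \<integral>\<^sup>+t. \<integral>\<^sup>+y. k t x y \<partial>lborel \<partial>lborel \<partial>lborel)"
    by (intro nn_integral_cong lborel_pair.Fubini'[symmetric]) (simp add: case_prod_beta)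
  also have "(\<integral>\<^sup>+x. \<integral>\<^sup>+t. \<integral>\<^sup>+y. k t x y \<partial>lborel \<partial>lborel \<partial>lborel)
      = (\<integral>\<^sup>+t. \<integral>\<^sup>+x. \<integral>\<^sup>+y. k t x y \<partial>lborel \<partial>lborel \<partial>lborel)"
    by (intro lborel_pair.Fubini'[symmetric]) (simp add: case_prod_beta)
  also have "ennreal (\<delta>\<^sup>2) * \<dots>
      \<le> ennreal (\<delta>\<^sup>2) * (\<integral>\<^sup>+t. ennreal (2 ^ CARD('n)) * emeasure lborel C * H * indicator {0..1::real} t \<partial>lborel)"
    by (intro mult_left_mono nn_integral_mono half) simp
  also have "\<dots> = ennreal (\<delta>\<^sup>2) * (ennreal (2 ^ CARD('n)) * emeasure lborel C * H)"
    by (simp add: nn_integral_cmult)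
  finally show ?thesis
    unfolding H_def hI by (simp add: ennreal_mult mult_ac)
qed

section \<open>Positive definite matrices\<close>

definition pos_def :: "real ^ 'n::finite ^ 'n \<Rightarrow> bool" where
  "pos_def A \<longleftrightarrow> transpose A = A \<and> (\<forall>v. v \<noteq> 0 \<longrightarrow> 0 < v \<bullet> (A *v v))"

lemma pos_def_det_nonzero: "pos_def A \<Longrightarrow> det A \<noteq> 0"
  unfolding pos_def_def
  by (metis inner_zero_right invertible_det_nz less_irrefl matrix_left_invertible_ker invertible_left_inverse)

text \<open>The segment from the identity to \<open>A\<close> consists of positive definite matrices, so the determinant
  does not change sign along it.\<close>

lemma pos_def_det_pos:
  assumes "pos_def A" shows "det A > 0"
proof (rule ccontr)
  assume "\<not> det A > 0"
  define B where "B t = (1 - t) *\<^sub>R mat 1 + t *\<^sub>R A" for t :: real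
  have B: "pos_def (B t)" if "0 \<le> t" "t \<le> 1" for t
  proof -
    have "0 < v \<bullet> (B t *v v)" if "v \<noteq> 0" for v
    proof -
      have "v \<bullet> (B t *v v) = (1 - t) * (v \<bullet> v) + t * (v \<bullet> (A *v v))"
        by (simp add: B_def matrix_vector_mult_add_rdistrib scaleR_matrix_vector_assoc[symmetric] inner_add_right)
      moreover have "v \<bullet> v > 0" "v \<bullet> (A *v v) > 0" using that assms by (auto simp: pos_def_def)
      ultimately show ?thesis using \<open>0 \<le> t\<close> \<open>t \<le> 1\<close>
        by (cases "t = 0") (auto intro!: add_nonneg_pos mult_nonneg_nonneg)
    qed
    moreover have "transpose (B t) = B t"
      using assms by (simp add: pos_def_def B_def transpose_def mat_def vec_eq_iff)
    ultimately show ?thesis by (simp add: pos_def_def)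
  qed
  have "continuous_on {0..1} (\<lambda>t. det (B t))"
    unfolding det_def B_def by (intro continuous_intros)
  moreover have "det (B 1) \<le> 0" "0 \<le> det (B 0)" using \<open>\<not> det A > 0\<close> by (simp_all add: B_def)
  ultimately obtain t where "0 \<le> t" "t \<le> 1" "det (B t) = 0"
    using IVT2'[of "\<lambda>t. det (B t)" 1 0 0] by auto
  then show False using pos_def_det_nonzero[OF B] by blast
qed

lemma pos_def_matrix_inv:
  assumes "pos_def A"
  shows "A ** matrix_inv A = mat 1" "matrix_inv A ** A = mat 1"
proof -
  have "invertible A" using pos_def_det_nonzero[OF assms] by (simp add: invertible_det_nz)
  then have "\<exists>A'. A ** A' = mat 1 \<and> A' ** A = mat 1" by (simp add: invertible_def)
  from someI_ex[OF this] show "A ** matrix_inv A = mat 1" "matrix_inv A ** A = mat 1"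
    unfolding matrix_inv_def by auto
qed

lemma pos_def_inv:
  assumes "pos_def A" shows "pos_def (matrix_inv A)"
proof -
  note I = pos_def_matrix_inv[OF assms]
  have tA: "transpose A = A" using assms by (simp add: pos_def_def)
  have "transpose (matrix_inv A) ** A = mat 1"
    using arg_cong[OF I(1), of transpose] by (simp add: matrix_transpose_mul tA transpose_mat)
  then have t: "transpose (matrix_inv A) = matrix_inv A"
    using I(1) by (metis matrix_mul_assoc matrix_mul_lid matrix_mul_rid)
  have "0 < v \<bullet> (matrix_inv A *v v)" if "v \<noteq> 0" for v
  proof -
    define w where "w = matrix_inv A *v v"
    have v: "v = A *v w" by (simp add: w_def matrix_vector_mul_assoc I)
    then have "w \<noteq> 0" using that by auto
    then have "0 < w \<bullet> (A *v w)" using assms by (simp add: pos_def_def)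
    then show ?thesis by (simp add: v[symmetric] w_def[symmetric] inner_commute)
  qed
  with t show ?thesis by (simp add: pos_def_def)
qed

text \<open>Cramer's rule. It exhibits the entries of the inverse as rational functions of the entries
  of the matrix, which is how smoothness of the inverse metric is obtained.\<close>

lemma matrix_inv_component:
  assumes "pos_def A"
  shows "matrix_inv A $ i $ j
    = det (\<chi> a b. if b = i then axis j 1 $ a else A $ a $ b) * inverse (det A)"
proof -
  have "A *v (matrix_inv A *v axis j 1) = axis j 1"
    by (simp add: matrix_vector_mul_assoc pos_def_matrix_inv[OF assms])
  then have "matrix_inv A *v axis j 1 = (\<chi> k. det (\<chi> a b. if b = k then axis j 1 $ a else A $ a $ b) / det A)"
    using cramer[OF pos_def_det_nonzero[OF assms]] by blast
  then have "(matrix_inv A *v axis j 1) $ i = det (\<chi> a b. if b = i then axis j 1 $ a else A $ a $ b) / det A"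
    by simp
  moreover have "(matrix_inv A *v axis j 1) $ i = matrix_inv A $ i $ j"
    by (simp add: matrix_vector_mult_def axis_def if_distrib[of "\<lambda>c. _ * c"] cong: if_cong)
  ultimately show ?thesis by (simp add: divide_inverse)
qed

lemma Ck_on_det:
  assumes "open S" "\<And>i j. Ck_on k S (\<lambda>x. A x $ i $ j)"
  shows "Ck_on k S (\<lambda>x. det (A x))"
  unfolding det_def
  by (intro Ck_on_sum Ck_on_mult Ck_on_prod Ck_on_const assms)

lemma Ck_on_matrix_inv:
  assumes S: "open S" and A: "\<And>i j. Ck_on k S (\<lambda>x. A x $ i $ j)" and p: "\<And>x. x \<in> S \<Longrightarrow> pos_def (A x)"
  shows "Ck_on k S (\<lambda>x. matrix_inv (A x) $ i $ j)"
proof -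
  have "Ck_on k S (\<lambda>x. det (\<chi> a b. if b = i then axis j 1 $ a else A x $ a $ b) * inverse (det (A x)))"
  proof (intro Ck_on_mult Ck_on_inverse Ck_on_det S A)
    fix a b
    show "Ck_on k S (\<lambda>x. (\<chi> a b. if b = i then axis j 1 $ a else A x $ a $ b) $ a $ b)"
      using A[of a b] Ck_on_const[OF S] by (cases "b = i") (simp_all del: Ck_on.simps)
  qed (use p pos_def_det_nonzero in blast)
  then show ?thesis
    using Ck_on_cong[OF S, of "\<lambda>x. matrix_inv (A x) $ i $ j"] matrix_inv_component[OF p] by simp
qed

section \<open>Charts, smooth functions and bump functions\<close>

locale riemannian =
  fixes \<A> :: "('a::{t2_space, second_countable_topology}, 'n::finite) chart set"
    and G :: "('a, 'n) chart \<Rightarrow> 'a \<Rightarrow> real ^ 'n ^ 'n"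
    and V \<nu> :: "'a measure"
  assumes manifold: "compact_riemannian_manifold \<A> G"
    and volume: "riemannian_volume \<A> G V"
    and normalized: "\<nu> = normalize_measure V"
begin

lemma compact_M: "compact (UNIV :: 'a set)" and connected_M: "connected (UNIV :: 'a set)"
  using manifold by (auto simp: compact_riemannian_manifold_def)

lemma open_chart: "c \<in> \<A> \<Longrightarrow> open (fst c)" "c \<in> \<A> \<Longrightarrow> open (chart_image c)"
  using manifold by (auto simp: compact_riemannian_manifold_def smooth_atlas_def)

lemma chart_homeo: "c \<in> \<A> \<Longrightarrow> homeomorphism (fst c) (chart_image c) (coords c) (param c)"
  using manifold by (auto simp: compact_riemannian_manifold_def smooth_atlas_def)

lemma coords_in: "p \<in> fst c \<Longrightarrow> coords c p \<in> chart_image c"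
  by (simp add: chart_image_def)

lemma chart_simps [simp]:
  assumes "c \<in> \<A>"
  shows "x \<in> chart_image c \<Longrightarrow> param c x \<in> fst c" "p \<in> fst c \<Longrightarrow> param c (coords c p) = p"
    "x \<in> chart_image c \<Longrightarrow> coords c (param c x) = x"
  using chart_homeo[OF assms] by (auto simp: homeomorphism_def)

lemma continuous_chart:
  assumes "c \<in> \<A>"
  shows "continuous_on (fst c) (coords c)" "continuous_on (chart_image c) (param c)"
  using chart_homeo[OF assms] by (auto simp: homeomorphism_def)

lemma open_param_image:
  assumes c: "c \<in> \<A>" and W: "open W" "W \<subseteq> chart_image c"
  shows "open (param c ` W)"
proof -
  have "param c ` W = coords c -` W \<inter> fst c"
  proof (intro set_eqI iffI)
    fix p assume "p \<in> param c ` W" then show "p \<in> coords c -` W \<inter> fst c" using W(2) c by auto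
  next
    fix p assume "p \<in> coords c -` W \<inter> fst c"
    then have "p = param c (coords c p)" "coords c p \<in> W" using c by auto
    then show "p \<in> param c ` W" by (rule image_eqI)
  qed
  then show ?thesis
    using continuous_open_preimage[OF continuous_chart(1)[OF c] open_chart(1)[OF c] W(1)]
    by (simp add: Int_commute)
qed

lemma open_coords_image:
  assumes c: "c \<in> \<A>" and U: "open U" "U \<subseteq> fst c"
  shows "open (coords c ` U)"
proof -
  have "coords c ` U = param c -` U \<inter> chart_image c"
  proof (intro set_eqI iffI)
    fix x assume "x \<in> coords c ` U" then show "x \<in> param c -` U \<inter> chart_image c"
      using U(2) c coords_in[of _ c] by auto
  next
    fix x assume "x \<in> param c -` U \<inter> chart_image c"
    then have "x = coords c (param c x)" "param c x \<in> U" using c by auto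
    then show "x \<in> coords c ` U" by (rule image_eqI)
  qed
  then show ?thesis
    using continuous_open_preimage[OF continuous_chart(2)[OF c] open_chart(2)[OF c] U(1)]
    by (simp add: Int_commute)
qed

definition chart_at :: "'a \<Rightarrow> ('a, 'n) chart" where
  "chart_at p = (SOME c. c \<in> \<A> \<and> p \<in> fst c)"

lemma chart_at: "chart_at p \<in> \<A>" "p \<in> fst (chart_at p)"
proof -
  have "\<exists>c. c \<in> \<A> \<and> p \<in> fst c"
    using manifold unfolding compact_riemannian_manifold_def smooth_atlas_def by blast
  from someI_ex[OF this] show "chart_at p \<in> \<A>" "p \<in> fst (chart_at p)"
    by (auto simp: chart_at_def)
qed

lemma transition_smooth:
  assumes "c \<in> \<A>" "c' \<in> \<A>"
  shows "Ck_on k (coords c ` (fst c \<inter> fst c')) (\<lambda>x. transition c c' x $ i)"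
  using manifold assms
  by (auto simp: compact_riemannian_manifold_def smooth_atlas_def smooth_on_def)

lemma smooth_funD: "smooth_fun \<A> f \<Longrightarrow> c \<in> \<A> \<Longrightarrow> Ck_on k (chart_image c) (\<lambda>x. f (param c x))"
  by (simp add: smooth_fun_def smooth_on_def comp_def)

lemma smooth_funI: "(\<And>c k. c \<in> \<A> \<Longrightarrow> Ck_on k (chart_image c) (\<lambda>x. f (param c x))) \<Longrightarrow> smooth_fun \<A> f"
  by (simp add: smooth_fun_def smooth_on_def comp_def)

lemma smooth_const: "smooth_fun \<A> (\<lambda>p. a)"
  by (rule smooth_funI) (intro Ck_on_const open_chart)

lemma smooth_add: "smooth_fun \<A> f \<Longrightarrow> smooth_fun \<A> h \<Longrightarrow> smooth_fun \<A> (\<lambda>p. f p + h p)"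
  by (rule smooth_funI) (intro Ck_on_add open_chart smooth_funD)

lemma smooth_diff: "smooth_fun \<A> f \<Longrightarrow> smooth_fun \<A> h \<Longrightarrow> smooth_fun \<A> (\<lambda>p. f p - h p)"
  by (rule smooth_funI) (intro Ck_on_diff open_chart smooth_funD)

lemma smooth_mult: "smooth_fun \<A> f \<Longrightarrow> smooth_fun \<A> h \<Longrightarrow> smooth_fun \<A> (\<lambda>p. f p * h p)"
  by (rule smooth_funI) (intro Ck_on_mult open_chart smooth_funD)

lemma smooth_lin: "smooth_fun \<A> f \<Longrightarrow> smooth_fun \<A> h \<Longrightarrow> smooth_fun \<A> (\<lambda>p. a * f p + b * h p)"
  by (intro smooth_add smooth_mult smooth_const)

lemma smooth_sum: "(\<And>i. i \<in> I \<Longrightarrow> smooth_fun \<A> (f i)) \<Longrightarrow> smooth_fun \<A> (\<lambda>p. \<Sum>i\<in>I. f i p)"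
  by (rule smooth_funI) (intro Ck_on_sum open_chart smooth_funD)

lemma smooth_exp: "smooth_fun \<A> f \<Longrightarrow> smooth_fun \<A> (\<lambda>p. exp (f p))"
  by (rule smooth_funI) (intro Ck_on_exp open_chart smooth_funD)

lemma smooth_inverse: "smooth_fun \<A> f \<Longrightarrow> (\<And>p. f p \<noteq> 0) \<Longrightarrow> smooth_fun \<A> (\<lambda>p. inverse (f p))"
  by (rule smooth_funI) (intro Ck_on_inverse open_chart smooth_funD)

lemma continuous_on_charts:
  assumes "\<And>c. c \<in> \<A> \<Longrightarrow> continuous_on (fst c) f"
  shows "continuous_on (UNIV :: 'a set) f"
proof -
  have "continuous_on (\<Union>c\<in>\<A>. fst c) f"
    by (intro continuous_on_open_UN open_chart assms)
  moreover have "(\<Union>c\<in>\<A>. fst c) = UNIV" using chart_at by blast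
  ultimately show ?thesis by simp
qed

lemma continuous_on_chartI:
  assumes c: "c \<in> \<A>" and u: "continuous_on (chart_image c) u" and eq: "\<And>p. p \<in> fst c \<Longrightarrow> f p = u (coords c p)"
  shows "continuous_on (fst c) f"
proof -
  have "continuous_on (fst c) (\<lambda>p. u (coords c p))"
    by (intro continuous_on_compose2[OF u] continuous_chart c) (auto simp: chart_image_def)
  then show ?thesis using eq by (simp cong: continuous_on_cong)
qed

lemma smooth_continuous:
  assumes "smooth_fun \<A> f" shows "continuous_on UNIV f"
proof (rule continuous_on_charts)
  fix c assume c: "c \<in> \<A>"
  show "continuous_on (fst c) f"
    by (rule continuous_on_chartI[OF c Ck_on_continuous[OF smooth_funD[OF assms c]]]) (simp add: c)
qed

text \<open>The closed ball is required to lie in the chart, so that all continuous coefficients are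
  bounded on the open one.\<close>

definition admissible_ball :: "('a, 'n) chart \<Rightarrow> real ^ 'n \<Rightarrow> real \<Rightarrow> bool" where
  "admissible_ball c a r \<longleftrightarrow> c \<in> \<A> \<and> 0 < r \<and> cball a r \<subseteq> chart_image c"

lemma admissible_ballD:
  assumes "admissible_ball c a r"
  shows "c \<in> \<A>" "0 < r" "cball a r \<subseteq> chart_image c" "ball a r \<subseteq> chart_image c"
    "compact (param c ` cball a r)" "param c ` cball a r \<subseteq> fst c" "open (param c ` ball a r)"
    "param c ` ball a r \<subseteq> param c ` cball a r"
proof -
  show c: "c \<in> \<A>" "0 < r" and ci: "cball a r \<subseteq> chart_image c" using assms by (auto simp: admissible_ball_def)
  then show bi: "ball a r \<subseteq> chart_image c" using ball_subset_cball by blast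
  show "compact (param c ` cball a r)"
    using continuous_on_subset[OF continuous_chart(2)[OF c(1)] ci] by (intro compact_continuous_image) auto
  show "param c ` cball a r \<subseteq> fst c" using c ci by auto
  show "open (param c ` ball a r)" by (rule open_param_image[OF c(1) open_ball bi])
  show "param c ` ball a r \<subseteq> param c ` cball a r" using ball_subset_cball by blast
qed

lemma admissible_ball_exists:
  assumes U: "open U" "p \<in> U" and c: "c \<in> \<A>" "p \<in> fst c"
  obtains r where "admissible_ball c (coords c p) r" "param c ` cball (coords c p) r \<subseteq> U"
proof -
  have "open (coords c ` (U \<inter> fst c))"
    using U c open_chart(1)[OF c(1)] by (intro open_coords_image) auto
  then obtain r where r: "r > 0" "cball (coords c p) r \<subseteq> coords c ` (U \<inter> fst c)"
    using U c open_contains_cball by (metis IntI image_eqI)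
  then have "admissible_ball c (coords c p) r"
    unfolding admissible_ball_def using c by (auto simp: chart_image_def)
  moreover have "param c ` cball (coords c p) r \<subseteq> U" using r c by force
  ultimately show thesis using that by blast
qed

lemma admissible_cover:
  obtains I :: "'a set" and c a r where "finite I" "\<And>p. admissible_ball (c p) (a p) (r p)"
    "\<And>p. p \<in> param (c p) ` ball (a p) (r p)" "\<And>q. \<exists>p\<in>I. q \<in> param (c p) ` ball (a p) (r p)"
proof -
  have "\<exists>a r. admissible_ball (chart_at p) a r \<and> p \<in> param (chart_at p) ` ball a r" for p
  proof -
    obtain r where r: "admissible_ball (chart_at p) (coords (chart_at p) p) r"
      using admissible_ball_exists[OF open_UNIV UNIV_I chart_at] by blast
    then have "p \<in> param (chart_at p) ` ball (coords (chart_at p) p) r"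
      using admissible_ballD(2)[OF r] chart_at by (intro image_eqI[of _ _ "coords (chart_at p) p"]) auto
    with r show ?thesis by blast
  qed
  then obtain a r where ar: "\<And>p. admissible_ball (chart_at p) (a p) (r p)" "\<And>p. p \<in> param (chart_at p) ` ball (a p) (r p)"
    by metis
  define U where "U p = param (chart_at p) ` ball (a p) (r p)" for p
  have "open (U p)" for p unfolding U_def using admissible_ballD(7)[OF ar(1)] .
  moreover have "(UNIV :: 'a set) \<subseteq> (\<Union>p\<in>UNIV. U p)" using ar(2) by (auto simp: U_def)
  ultimately obtain I where I: "finite I" "(UNIV :: 'a set) \<subseteq> (\<Union>p\<in>I. U p)"
    using compactE_image[OF compact_M, of UNIV U] by auto
  show thesis
  proof (rule that[of I chart_at a r])
    show "\<exists>p\<in>I. q \<in> param (chart_at p) ` ball (a p) (r p)" for q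
      using I(2) unfolding U_def by blast
  qed (use I ar in auto)
qed

definition bump :: "('a, 'n) chart \<Rightarrow> real ^ 'n \<Rightarrow> real \<Rightarrow> 'a \<Rightarrow> real" where
  "bump c a r p = (if p \<in> fst c then flat 0 (r\<^sup>2 - (dist a (coords c p))\<^sup>2) else 0)"

lemma bump_nonneg: "0 \<le> bump c a r p"
  by (simp add: bump_def flat_def)

lemma bump_pos:
  assumes "admissible_ball c a r" "p \<in> param c ` ball a r"
  shows "0 < bump c a r p"
proof -
  note A = admissible_ballD[OF assms(1)]
  obtain x where x: "p = param c x" "x \<in> ball a r" using assms(2) by blast
  then have "x \<in> chart_image c" using A by auto
  moreover have "(dist a x)\<^sup>2 < r\<^sup>2" using x by (intro power_strict_mono) auto
  ultimately show ?thesis using x A(1) by (auto simp: bump_def flat_def)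
qed

lemma bump_zero:
  assumes "admissible_ball c a r" "p \<notin> param c ` cball a r"
  shows "bump c a r p = 0"
proof (cases "p \<in> fst c")
  case True
  note A = admissible_ballD[OF assms(1)]
  have "coords c p \<notin> cball a r" using assms(2) True A(1) by (metis chart_simps(2) image_eqI)
  then have "r\<^sup>2 \<le> (dist a (coords c p))\<^sup>2" using A(2) by (intro power_mono) auto
  then show ?thesis by (simp add: bump_def flat_def)
qed (simp add: bump_def)

text \<open>Where two chart domains meet, the bump function of one chart is seen in the other through a smooth
  transition map; away from the compact set supporting it, it vanishes.\<close>

lemma smooth_bump:
  assumes ab: "admissible_ball c a r"
  shows "smooth_fun \<A> (bump c a r)"
proof (rule smooth_funI)
  fix c' k assume c': "c' \<in> \<A>"
  note A = admissible_ballD[OF ab]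
  define u where "u x = flat 0 (r\<^sup>2 - (\<Sum>i\<in>UNIV. (x $ i - a $ i) * (x $ i - a $ i)))" for x :: "real ^ 'n"
  have u: "Ck_on k (chart_image c) u"
    unfolding u_def
    by (intro Ck_on_flat Ck_on_diff Ck_on_sum Ck_on_mult Ck_on_component Ck_on_const open_chart A)
  have bu: "bump c a r p = u (coords c p)" if "p \<in> fst c" for p
    using that by (simp add: bump_def u_def dist_norm power2_norm_eq_inner inner_vec_def
        norm_minus_commute[of a])
  define S1 where "S1 = coords c' ` (fst c' \<inter> fst c)"
  define S2 where "S2 = coords c' ` (fst c' \<inter> - param c ` cball a r)"
  note oc = open_chart(1)[OF c'] open_chart(1)[OF A(1)]
  have o1: "open S1" unfolding S1_def using oc by (intro open_coords_image c') auto
  have o2: "open S2" unfolding S2_def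
    using oc compact_imp_closed[OF A(5)] by (intro open_coords_image c') auto
  have "Ck_on k S1 (\<lambda>x. u (transition c' c x))"
  proof (rule Ck_on_compose[OF o1 open_chart(2)[OF A(1)] _ u])
    show "transition c' c x \<in> chart_image c" if x: "x \<in> S1" for x
    proof -
      obtain p where "x = coords c' p" "p \<in> fst c'" "p \<in> fst c" using x unfolding S1_def by blast
      then show ?thesis using c' by (simp add: transition_def coords_in)
    qed
    show "Ck_on k S1 (\<lambda>x. transition c' c x $ i)" for i
      unfolding S1_def by (rule transition_smooth[OF c' A(1)])
  qed
  moreover have "u (transition c' c x) = bump c a r (param c' x)" if x: "x \<in> S1" for x
  proof -
    obtain p where "x = coords c' p" "p \<in> fst c'" "p \<in> fst c" using x unfolding S1_def by blast
    then show ?thesis using c' by (simp add: transition_def bu)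
  qed
  ultimately have k1: "Ck_on k S1 (\<lambda>x. bump c a r (param c' x))"
    using Ck_on_cong[OF o1, of "\<lambda>x. u (transition c' c x)" "\<lambda>x. bump c a r (param c' x)" k] by simp
  have "bump c a r (param c' x) = 0" if x: "x \<in> S2" for x
  proof -
    obtain p where "x = coords c' p" "p \<in> fst c'" "p \<notin> param c ` cball a r" using x unfolding S2_def by blast
    then show ?thesis using c' by (simp add: bump_zero[OF ab])
  qed
  then have k2: "Ck_on k S2 (\<lambda>x. bump c a r (param c' x))"
    using Ck_on_const[OF o2, of k 0] Ck_on_cong[OF o2, of "\<lambda>x. bump c a r (param c' x)" "\<lambda>x. 0" k] by simp
  show "Ck_on k (chart_image c') (\<lambda>x. bump c a r (param c' x))"
  proof (rule Ck_on_local[OF open_chart(2)[OF c']])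
    fix x assume x: "x \<in> chart_image c'"
    then have "param c' x \<in> fst c'" "x = coords c' (param c' x)" using c' by auto
    then have "x \<in> S1 \<or> x \<in> S2" unfolding S1_def S2_def using A(6) by blast
    then show "\<exists>T. open T \<and> x \<in> T \<and> Ck_on k T (\<lambda>x. bump c a r (param c' x))"
      using o1 o2 k1 k2 by blast
  qed
qed

text \<open>The compact set \<open>K\<close> carrying \<open>b\<close> lies in the given neighbourhood; a smooth function on the whole
  manifold is obtained because \<open>K\<close> is closed.\<close>

lemma bump_exists:
  assumes "open U" "p \<in> U" "c \<in> \<A>" "p \<in> fst c"
  obtains b K where "smooth_fun \<A> b" "\<And>q. 0 \<le> b q" "b p > 0" "compact K" "K \<subseteq> U" "K \<subseteq> fst c" "\<And>q. q \<notin> K \<Longrightarrow> b q = 0"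
proof -
  obtain r where r: "admissible_ball c (coords c p) r" "param c ` cball (coords c p) r \<subseteq> U"
    using admissible_ball_exists[OF assms] by blast
  have p: "p \<in> param c ` ball (coords c p) r"
  proof (rule image_eqI[where x = "coords c p"])
    show "p = param c (coords c p)" using assms by simp
    show "coords c p \<in> ball (coords c p) r" using admissible_ballD(2)[OF r(1)] by simp
  qed
  show thesis
    by (rule that[OF smooth_bump[OF r(1)] bump_nonneg bump_pos[OF r(1) p] admissible_ballD(5)[OF r(1)] r(2)
          admissible_ballD(6)[OF r(1)] bump_zero[OF r(1)]])
qed

text \<open>A finite smooth partition of unity subordinate to the charts.\<close>

lemma partition_of_unity:
  obtains I :: "'a set" and \<rho> :: "'a \<Rightarrow> 'a \<Rightarrow> real" where "finite I" "\<And>i. i \<in> I \<Longrightarrow> smooth_fun \<A> (\<rho> i)"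
    "\<And>p. (\<Sum>i\<in>I. \<rho> i p) = 1"
    "\<And>i. i \<in> I \<Longrightarrow> \<exists>c K. c \<in> \<A> \<and> compact K \<and> K \<subseteq> fst c \<and> (\<forall>p. p \<notin> K \<longrightarrow> \<rho> i p = 0)"
proof -
  have "\<exists>b K. smooth_fun \<A> b \<and> (\<forall>q. 0 \<le> b q) \<and> b p > 0 \<and> compact K \<and> K \<subseteq> fst (chart_at p) \<and> (\<forall>q. q \<notin> K \<longrightarrow> b q = 0)" for p
    using bump_exists[OF open_UNIV UNIV_I chart_at, of p] by metis
  then obtain b K where b: "\<And>p. smooth_fun \<A> (b p)" "\<And>p q. 0 \<le> b p q" "\<And>p. b p p > 0" "\<And>p. compact (K p)"
    "\<And>p. K p \<subseteq> fst (chart_at p)" "\<And>p q. q \<notin> K p \<Longrightarrow> b p q = 0" by metis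
  define U where "U p = {q. b p q > 0}" for p
  have "open (U p)" for p
    unfolding U_def using smooth_continuous[OF b(1)] by (intro open_Collect_less) auto
  moreover have "(UNIV :: 'a set) \<subseteq> (\<Union>p\<in>UNIV. U p)" using b(3) by (auto simp: U_def)
  ultimately obtain I where I: "finite I" "(UNIV :: 'a set) \<subseteq> (\<Union>p\<in>I. U p)"
    using compactE_image[OF compact_M, of UNIV U] by auto
  define s where "s q = (\<Sum>p\<in>I. b p q)" for q
  have s: "s q > 0" for q
  proof -
    obtain p where "p \<in> I" "b p q > 0" using I(2) by (auto simp: U_def)
    then show ?thesis unfolding s_def using I(1) b(2) by (intro sum_pos2[of I p]) auto
  qed
  show thesis
  proof (rule that[of I "\<lambda>p q. b p q * inverse (s q)"])
    show "finite I" by fact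
    show "smooth_fun \<A> (\<lambda>q. b i q * inverse (s q))" for i
    proof (intro smooth_mult smooth_inverse b)
      show "smooth_fun \<A> s" unfolding s_def by (intro smooth_sum b)
      show "s p \<noteq> 0" for p using s[of p] by simp
    qed
    show "(\<Sum>i\<in>I. b i q * inverse (s q)) = 1" for q
      using less_imp_neq[OF s, of q] by (simp flip: sum_distrib_right s_def)
    show "\<exists>c K. c \<in> \<A> \<and> compact K \<and> K \<subseteq> fst c \<and> (\<forall>p. p \<notin> K \<longrightarrow> b i p * inverse (s p) = 0)" for i
      by (intro exI[of _ "chart_at i"] exI[of _ "K i"]) (simp add: b chart_at)
  qed
qed

section \<open>The volume measure in charts\<close>

lemma pos_def_G: "c \<in> \<A> \<Longrightarrow> p \<in> fst c \<Longrightarrow> pos_def (G c p)"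
  using manifold by (simp add: compact_riemannian_manifold_def riemannian_metric_def pos_def_def)

lemma Ck_on_G: "c \<in> \<A> \<Longrightarrow> Ck_on k (chart_image c) (\<lambda>x. G c (param c x) $ i $ j)"
  using manifold by (simp add: compact_riemannian_manifold_def riemannian_metric_def smooth_on_def)

definition W :: "('a, 'n) chart \<Rightarrow> real ^ 'n \<Rightarrow> real" where
  "W c x = sqrt (det (G c (param c x)))"

definition G_inv :: "('a, 'n) chart \<Rightarrow> real ^ 'n \<Rightarrow> 'n \<Rightarrow> 'n \<Rightarrow> real" where
  "G_inv c x i j = matrix_inv (G c (param c x)) $ i $ j"

lemma W_pos: "c \<in> \<A> \<Longrightarrow> x \<in> chart_image c \<Longrightarrow> 0 < W c x"
  unfolding W_def using pos_def_det_pos[OF pos_def_G] by simp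

lemma Ck_on_W: "c \<in> \<A> \<Longrightarrow> Ck_on k (chart_image c) (W c)"
  unfolding W_def
  by (intro Ck_on_sqrt Ck_on_det Ck_on_G open_chart) (auto intro!: pos_def_det_pos pos_def_G)

lemma Ck_on_G_inv: "c \<in> \<A> \<Longrightarrow> Ck_on k (chart_image c) (\<lambda>x. G_inv c x i j)"
  unfolding G_inv_def
  by (intro Ck_on_matrix_inv Ck_on_G open_chart) (auto intro!: pos_def_G)

lemma continuous_on_W: "c \<in> \<A> \<Longrightarrow> continuous_on (chart_image c) (W c)"
  using Ck_on_continuous[OF Ck_on_W] .

lemma sets_V: "sets V = sets borel" and sets_\<nu> [simp, measurable_cong]: "sets \<nu> = sets borel"
  and space_V: "space V = UNIV" and space_\<nu> [simp]: "space \<nu> = UNIV"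
proof -
  show V: "sets V = sets borel" using volume by (simp add: riemannian_volume_def)
  then show "space V = UNIV" using sets_eq_imp_space_eq by fastforce
  show n: "sets \<nu> = sets borel" by (simp add: normalized normalize_measure_def V)
  then show "space \<nu> = UNIV" using sets_eq_imp_space_eq by fastforce
qed

lemma borel_measurable_\<nu> [simp]: "borel_measurable \<nu> = borel_measurable borel"
  by (rule measurable_cong_sets) auto

lemma emeasure_V_chart:
  assumes "c \<in> \<A>" "B \<in> sets borel" "B \<subseteq> fst c"
  shows "emeasure V B = (\<integral>\<^sup>+x\<in>coords c ` B. ennreal (W c x) \<partial>lborel)"
  using volume assms by (simp add: riemannian_volume_def W_def)

lemma coords_image_iff:
  assumes "c \<in> \<A>" "B \<subseteq> fst c"
  shows "x \<in> coords c ` B \<longleftrightarrow> x \<in> chart_image c \<and> param c x \<in> B"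
proof
  assume "x \<in> coords c ` B" then show "x \<in> chart_image c \<and> param c x \<in> B"
    using assms coords_in[of _ c] by auto
next
  assume "x \<in> chart_image c \<and> param c x \<in> B"
  then have "x = coords c (param c x)" "param c x \<in> B" using assms by auto
  then show "x \<in> coords c ` B" by (rule image_eqI)
qed

lemma coords_param_image: "c \<in> \<A> \<Longrightarrow> B \<subseteq> chart_image c \<Longrightarrow> coords c ` (param c ` B) = B"
  using image_cong[of B B "\<lambda>x. coords c (param c x)" "\<lambda>x. x"] by (simp add: image_image subset_iff)

text \<open>Outside the image of the chart \<open>param c\<close> has one fixed unspecified value, because no
  point satisfies the defining predicate there; hence it is Borel measurable on the whole space.\<close>

lemma measurable_param [measurable]: "c \<in> \<A> \<Longrightarrow> param c \<in> borel_measurable borel"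
proof -
  assume c: "c \<in> \<A>"
  have "param c = (\<lambda>x. if x \<in> chart_image c then param c x else (SOME y. False))"
    by (auto simp: fun_eq_iff param_def inv_into_def chart_image_def coords_def intro!: arg_cong[of _ _ Eps])
  also have "\<dots> \<in> borel_measurable borel"
    using open_chart(2)[OF c] continuous_chart(2)[OF c]
    by (intro borel_measurable_continuous_on_if) auto
  finally show ?thesis .
qed

lemma measurable_chart_sets [measurable]:
  "c \<in> \<A> \<Longrightarrow> fst c \<in> sets borel" "c \<in> \<A> \<Longrightarrow> chart_image c \<in> sets borel"
  using open_chart by auto

lemma measurable_W: "c \<in> \<A> \<Longrightarrow> (\<lambda>x. indicator (chart_image c) x * W c x) \<in> borel_measurable borel"
  using borel_measurable_continuous_on_indicator[OF _ continuous_on_W] by simp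

lemma V_ball_finite:
  assumes ab: "admissible_ball c a r"
  shows "emeasure V (param c ` ball a r) < \<infinity>"
proof -
  note A = admissible_ballD[OF ab]
  have "bounded (W c ` cball a r)"
    using continuous_on_subset[OF continuous_on_W[OF A(1)] A(3)]
    by (intro compact_imp_bounded compact_continuous_image) auto
  then obtain B where B: "\<And>x. x \<in> cball a r \<Longrightarrow> \<bar>W c x\<bar> \<le> B"
    by (auto simp: bounded_iff simp del: mem_cball)
  have sub: "param c ` ball a r \<subseteq> fst c" using A by blast
  have "emeasure V (param c ` ball a r) = (\<integral>\<^sup>+x\<in>coords c ` (param c ` ball a r). ennreal (W c x) \<partial>lborel)"
    using A sub by (intro emeasure_V_chart) auto
  also have "coords c ` (param c ` ball a r) = ball a r"
    using A by (intro coords_param_image)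
  also have "(\<integral>\<^sup>+x\<in>ball a r. ennreal (W c x) \<partial>lborel) \<le> (\<integral>\<^sup>+x. ennreal B * indicator (cball a r) x \<partial>lborel)"
  proof (rule nn_integral_mono)
    fix x
    show "ennreal (W c x) * indicator (ball a r) x \<le> ennreal B * indicator (cball a r) x"
    proof (cases "x \<in> ball a r")
      case True
      then have "W c x \<le> B" using B[of x] by simp
      then show ?thesis using True by (simp add: ennreal_leI)
    qed simp
  qed
  also have "\<dots> = ennreal B * emeasure lborel (cball a r)"
    by (rule nn_integral_cmult_indicator) simp
  also have "\<dots> < \<infinity>"
    using emeasure_bounded_finite[of "cball a r"] by (auto simp: ennreal_mult_less_top)
  finally show ?thesis .
qed

lemma V_finite: "emeasure V UNIV < \<infinity>"
proof -
  obtain I :: "'a set" and c a r where I: "finite I" and ab: "\<And>p. admissible_ball (c p) (a p) (r p)"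
    and cov: "\<And>q. \<exists>p\<in>I. q \<in> param (c p) ` ball (a p) (r p)"
    by (rule admissible_cover) blast
  define U where "U p = param (c p) ` ball (a p) (r p)" for p
  have U: "U p \<in> sets V" "emeasure V (U p) < \<infinity>" for p
    using admissible_ballD(7)[OF ab] V_ball_finite[OF ab] by (auto simp: U_def sets_V)
  have "(UNIV :: 'a set) \<subseteq> (\<Union>p\<in>I. U p)"
    using cov unfolding U_def by blast
  then have "emeasure V UNIV \<le> emeasure V (\<Union>p\<in>I. U p)"
    using I U by (intro emeasure_mono sets.finite_UN) auto
  also have "\<dots> \<le> (\<Sum>p\<in>I. emeasure V (U p))"
    using I U by (intro emeasure_subadditive_finite) auto
  also have "\<dots> < \<infinity>" using I U by (simp add: less_top[symmetric])
  finally show ?thesis .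
qed

text \<open>A small coordinate ball has positive volume because its density is positive and Lebesgue
  measure charges balls.\<close>

lemma V_open_pos:
  assumes "open U" "p \<in> U"
  shows "emeasure V U > 0"
proof (rule ccontr)
  assume "\<not> emeasure V U > 0"
  then have 0: "emeasure V U = 0" by simp
  let ?c = "chart_at p"
  obtain r where r: "admissible_ball ?c (coords ?c p) r" "param ?c ` cball (coords ?c p) r \<subseteq> U"
    using admissible_ball_exists[OF assms chart_at] by blast
  define B where "B = ball (coords ?c p) r"
  note A = admissible_ballD[OF r(1), folded B_def]
  have "emeasure V (param ?c ` B) \<le> emeasure V U"
    using r(2) A assms by (intro emeasure_mono) (auto simp: sets_V)
  then have "emeasure V (param ?c ` B) = 0" using 0 by simp
  moreover have "emeasure V (param ?c ` B) = (\<integral>\<^sup>+x\<in>coords ?c ` (param ?c ` B). ennreal (W ?c x) \<partial>lborel)"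
    using A by (intro emeasure_V_chart) auto
  moreover have "coords ?c ` (param ?c ` B) = B"
    using A by (intro coords_param_image)
  ultimately have "(\<integral>\<^sup>+x. ennreal (indicator (chart_image ?c) x * W ?c x) * indicator B x \<partial>lborel) = 0"
    using A(4) by (subst nn_integral_cong[where v="\<lambda>x. ennreal (W ?c x) * indicator B x"])
      (auto simp: indicator_def)
  moreover have [measurable]: "(\<lambda>x. ennreal (indicator (chart_image ?c) x * W ?c x)) \<in> borel_measurable borel"
    using measurable_W[OF A(1)] by measurable
  moreover have "B \<in> sets borel" by (simp add: B_def)
  ultimately have "AE x in lborel. ennreal (indicator (chart_image ?c) x * W ?c x) * indicator B x = 0"
    by (subst (asm) nn_integral_0_iff_AE) auto
  then have "AE x in lborel. x \<notin> B"
  proof eventually_elim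
    case (elim x)
    show ?case
    proof
      assume "x \<in> B"
      then have "x \<in> chart_image ?c" using A(4) by blast
      then show False using elim W_pos[OF A(1), of x] \<open>x \<in> B\<close> by (simp add: ennreal_eq_0_iff)
    qed
  qed
  then have "emeasure lborel B = 0" by (subst (asm) AE_iff_measurable[of B]) (auto simp: B_def)
  then have "measure lborel B = 0" by (simp add: measure_def)
  then show False using content_ball_pos[OF A(2), of "coords ?c p"] by (simp add: B_def)
qed

definition \<kappa> :: real where "\<kappa> = inverse (measure V UNIV)"

lemma V_measure: "emeasure V UNIV = ennreal (measure V UNIV)" "measure V UNIV > 0"
proof -
  show 1: "emeasure V UNIV = ennreal (measure V UNIV)"
    using V_finite by (intro emeasure_eq_ennreal_measure) auto
  have "emeasure V UNIV > 0" using V_open_pos[OF open_UNIV UNIV_I] .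
  then show "measure V UNIV > 0" unfolding 1 by simp
qed

lemma \<kappa>_pos: "\<kappa> > 0" using V_measure(2) by (simp add: \<kappa>_def)

lemma emeasure_\<nu>: "emeasure \<nu> B = ennreal \<kappa> * emeasure V B"
  using V_measure by (simp add: normalized normalize_measure_def space_V inverse_ennreal \<kappa>_def)

lemma prob_space_\<nu>: "prob_space \<nu>"
  by (rule prob_spaceI) (use V_measure in \<open>simp add: emeasure_\<nu> \<kappa>_def ennreal_mult[symmetric]\<close>)

sublocale \<nu>: prob_space \<nu> by (rule prob_space_\<nu>)

lemma \<nu>_open_pos: "open U \<Longrightarrow> p \<in> U \<Longrightarrow> measure \<nu> U > 0"
  using V_open_pos[of U p] \<kappa>_pos \<nu>.emeasure_eq_measure[of U]
  by (metis emeasure_\<nu> ennreal_0 ennreal_zero_less_mult_iff ennreal_less_zero_iff)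

definition dens :: "('a, 'n) chart \<Rightarrow> real ^ 'n \<Rightarrow> real" where
  "dens c x = indicator (chart_image c) x * (\<kappa> * W c x)"

lemma dens_nonneg: "c \<in> \<A> \<Longrightarrow> 0 \<le> dens c x"
  using W_pos[of c x] \<kappa>_pos by (simp add: dens_def indicator_def less_imp_le)

lemma dens_pos: "c \<in> \<A> \<Longrightarrow> x \<in> chart_image c \<Longrightarrow> 0 < dens c x"
  using W_pos[of c x] \<kappa>_pos by (simp add: dens_def)

lemma measurable_dens [measurable]: "c \<in> \<A> \<Longrightarrow> dens c \<in> borel_measurable borel"
proof -
  assume c: "c \<in> \<A>"
  have "dens c = (\<lambda>x. \<kappa> * (indicator (chart_image c) x * W c x))" by (auto simp: dens_def fun_eq_iff)
  then show ?thesis using measurable_W[OF c] by simp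
qed

text \<open>The defining property of the volume in a chart, as an equality of measures; it transports
  integrals of functions supported in the chart to Euclidean space.\<close>

lemma density_chart:
  assumes c: "c \<in> \<A>"
  shows "density \<nu> (indicator (fst c)) = distr (density lborel (\<lambda>x. ennreal (dens c x))) borel (param c)"
proof (rule measure_eqI)
  fix B assume "B \<in> sets (density \<nu> (indicator (fst c)))"
  then have B[measurable]: "B \<in> sets borel" by simp
  note [measurable] = c
  have [measurable]: "fst c \<in> sets borel" using c by measurable
  have m: "(\<lambda>x. ennreal (dens c x) * indicator (param c -` B) x) \<in> borel_measurable borel"
    using measurable_sets_borel[OF measurable_param[OF c] B] c by measurable
  have "emeasure (density \<nu> (indicator (fst c))) B = emeasure \<nu> (fst c \<inter> B)"
  proof -
    have "emeasure (density \<nu> (indicator (fst c))) B = (\<integral>\<^sup>+p. indicator (fst c) p * indicator B p \<partial>\<nu>)"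
      by (rule emeasure_density) auto
    also have "\<dots> = (\<integral>\<^sup>+p. indicator (fst c \<inter> B) p \<partial>\<nu>)" by (simp only: indicator_inter_arith)
    also have "\<dots> = emeasure \<nu> (fst c \<inter> B)" by (rule nn_integral_indicator) simp
    finally show ?thesis .
  qed
  also have "\<dots> = ennreal \<kappa> * (\<integral>\<^sup>+x\<in>coords c ` (fst c \<inter> B). ennreal (W c x) \<partial>lborel)"
    unfolding emeasure_\<nu> by (subst emeasure_V_chart[OF c]) auto
  also have "\<dots> = ennreal \<kappa> * (\<integral>\<^sup>+x. ennreal (indicator (chart_image c) x * W c x) * indicator (param c -` B) x \<partial>lborel)"
    using c by (intro arg_cong[of _ _ "\<lambda>u. _ * u"] nn_integral_cong)
      (auto simp: indicator_def coords_image_iff[OF c])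
  also have "\<dots> = (\<integral>\<^sup>+x. ennreal \<kappa> * (ennreal (indicator (chart_image c) x * W c x) * indicator (param c -` B) x) \<partial>lborel)"
    using measurable_compose[OF measurable_W[OF c] measurable_ennreal]
      measurable_sets_borel[OF measurable_param[OF c] B]
    by (intro nn_integral_cmult[symmetric] borel_measurable_times_ennreal borel_measurable_indicator) simp_all
  also have "\<dots> = (\<integral>\<^sup>+x. ennreal (dens c x) * indicator (param c -` B) x \<partial>lborel)"
    using \<kappa>_pos W_pos[OF c]
    by (intro nn_integral_cong) (auto simp: dens_def indicator_def ennreal_mult less_imp_le)
  also have "\<dots> = emeasure (distr (density lborel (\<lambda>x. ennreal (dens c x))) borel (param c)) B"
    using measurable_sets_borel[OF measurable_param[OF c] B] measurable_param[OF c] measurable_dens[OF c]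
    by (subst emeasure_distr) (auto simp: emeasure_density)
  finally show "emeasure (density \<nu> (indicator (fst c))) B
      = emeasure (distr (density lborel (\<lambda>x. ennreal (dens c x))) borel (param c)) B" .
qed simp

lemma nn_integral_chart:
  assumes c: "c \<in> \<A>" and u[measurable]: "u \<in> borel_measurable borel"
  shows "(\<integral>\<^sup>+p\<in>fst c. u p \<partial>\<nu>) = (\<integral>\<^sup>+x. ennreal (dens c x) * u (param c x) \<partial>lborel)"
proof -
  have "(\<integral>\<^sup>+p\<in>fst c. u p \<partial>\<nu>) = (\<integral>\<^sup>+p. u p \<partial>density \<nu> (indicator (fst c)))"
    using c by (subst nn_integral_density) (auto simp: mult.commute)
  also have "\<dots> = (\<integral>\<^sup>+x. ennreal (dens c x) * u (param c x) \<partial>lborel)"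
    unfolding density_chart[OF c] using c by (simp add: nn_integral_distr nn_integral_density)
  finally show ?thesis .
qed

lemma integral_chart:
  fixes u :: "'a \<Rightarrow> real"
  assumes c: "c \<in> \<A>" and u[measurable]: "u \<in> borel_measurable borel" and supp: "\<And>p. p \<notin> fst c \<Longrightarrow> u p = 0"
  shows "integrable \<nu> u \<longleftrightarrow> integrable lborel (\<lambda>x. dens c x * u (param c x))"
    "(\<integral>p. u p \<partial>\<nu>) = (\<integral>x. dens c x * u (param c x) \<partial>lborel)"
proof -
  have d: "density \<nu> (indicator (fst c)) = density \<nu> (\<lambda>p. ennreal (indicator (fst c) p))"
    by (simp add: ennreal_indicator)
  have u': "(\<lambda>p. indicator (fst c) p *\<^sub>R u p) = u" using supp by (auto simp: fun_eq_iff indicator_def)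
  have nn: "AE x in lborel. 0 \<le> dens c x" using dens_nonneg[OF c] by simp
  have [measurable]: "indicator (fst c) \<in> borel_measurable borel" using c by measurable
  have "integrable \<nu> u \<longleftrightarrow> integrable (density \<nu> (indicator (fst c))) u"
    unfolding d by (subst integrable_density) (auto simp del: real_scaleR_def simp: u')
  also have "\<dots> \<longleftrightarrow> integrable lborel (\<lambda>x. dens c x * u (param c x))"
    unfolding density_chart[OF c] using c nn by (simp add: integrable_distr_eq integrable_density)
  finally show "integrable \<nu> u \<longleftrightarrow> integrable lborel (\<lambda>x. dens c x * u (param c x))" .
  have "(\<integral>p. u p \<partial>\<nu>) = (\<integral>p. u p \<partial>density \<nu> (indicator (fst c)))"
    unfolding d by (subst integral_density) (auto simp del: real_scaleR_def simp: u')
  also have "\<dots> = (\<integral>x. dens c x * u (param c x) \<partial>lborel)"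
    unfolding density_chart[OF c] using c nn by (simp add: integral_distr integral_density)
  finally show "(\<integral>p. u p \<partial>\<nu>) = (\<integral>x. dens c x * u (param c x) \<partial>lborel)" .
qed

lemma continuous_L2:
  fixes f :: "'a \<Rightarrow> real"
  assumes "continuous_on UNIV f"
  shows "f \<in> L2 \<nu>" "integrable \<nu> f"
proof -
  have "bounded (f ` UNIV)" using compact_continuous_image[OF assms compact_M] compact_imp_bounded by blast
  then obtain B where "\<And>p. \<bar>f p\<bar> \<le> B" by (auto simp: bounded_iff)
  then show "f \<in> L2 \<nu>"
    using borel_measurable_continuous_onI[OF assms] by (intro \<nu>.L2_bounded[of f B]) auto
  then show "integrable \<nu> f" by (rule \<nu>.L2_integrable)
qed

section \<open>The Laplacian in weak form\<close>

text \<open>The partial derivatives of \<open>f\<close> in the coordinates of \<open>c\<close>, the flux \<open>W G\<^sup>i\<^sup>j \<partial>\<^sub>j f\<close> whose divergence is \<open>W \<Delta> f\<close>, and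
  the scalar product \<open>G\<^sup>i\<^sup>j \<partial>\<^sub>j f \<partial>\<^sub>i h\<close> of two gradients.\<close>

definition pd :: "('a, 'n) chart \<Rightarrow> ('a \<Rightarrow> real) \<Rightarrow> 'n \<Rightarrow> real ^ 'n \<Rightarrow> real" where
  "pd c f i x = partial_deriv i (\<lambda>x. f (param c x)) x"

definition flux :: "('a, 'n) chart \<Rightarrow> ('a \<Rightarrow> real) \<Rightarrow> 'n \<Rightarrow> real ^ 'n \<Rightarrow> real" where
  "flux c f i x = W c x * (\<Sum>j\<in>UNIV. G_inv c x i j * pd c f j x)"

definition gam :: "('a, 'n) chart \<Rightarrow> ('a \<Rightarrow> real) \<Rightarrow> ('a \<Rightarrow> real) \<Rightarrow> real ^ 'n \<Rightarrow> real" where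
  "gam c f h x = (\<Sum>i\<in>UNIV. (\<Sum>j\<in>UNIV. G_inv c x i j * pd c f j x) * pd c h i x)"

lemma laplacian_in_chart_flux:
  "laplacian_in_chart G c f p = (\<Sum>i\<in>UNIV. partial_deriv i (flux c f i) (coords c p)) / W c (coords c p)"
  by (simp add: laplacian_in_chart_def Let_def flux_def[abs_def] W_def G_inv_def pd_def[abs_def] comp_def)

lemma Ck_on_pd: "smooth_fun \<A> f \<Longrightarrow> c \<in> \<A> \<Longrightarrow> Ck_on k (chart_image c) (pd c f i)"
  using smooth_funD[of f c "Suc k"] by (simp add: pd_def[abs_def])

lemma differentiable_chart:
  "smooth_fun \<A> f \<Longrightarrow> c \<in> \<A> \<Longrightarrow> x \<in> chart_image c \<Longrightarrow> (\<lambda>x. f (param c x)) differentiable (at x)"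
  using smooth_funD[of f c 1] Ck_on_Suc_open[OF open_chart(2), of c 0 "\<lambda>x. f (param c x)"] by simp

lemma Ck_on_flux: "smooth_fun \<A> f \<Longrightarrow> c \<in> \<A> \<Longrightarrow> Ck_on k (chart_image c) (flux c f i)"
  unfolding flux_def by (intro Ck_on_mult Ck_on_sum Ck_on_W Ck_on_G_inv Ck_on_pd open_chart)

lemma continuous_on_gam:
  "smooth_fun \<A> f \<Longrightarrow> smooth_fun \<A> h \<Longrightarrow> c \<in> \<A> \<Longrightarrow> continuous_on (chart_image c) (gam c f h)"
  unfolding gam_def
  by (intro continuous_intros Ck_on_continuous[OF Ck_on_G_inv] Ck_on_continuous[OF Ck_on_pd])

text \<open>With this identity and the next one, \<open>W (\<Gamma> f h + h \<Delta> f)\<close> is the divergence of \<open>h\<close> times the flux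
  of \<open>f\<close>.\<close>

lemma W_gam: "W c x * gam c f h x = (\<Sum>i\<in>UNIV. flux c f i x * pd c h i x)"
  unfolding gam_def flux_def by (subst sum_distrib_left) (simp add: mult.assoc)

lemma W_laplacian:
  "c \<in> \<A> \<Longrightarrow> x \<in> chart_image c \<Longrightarrow>
    W c x * laplacian_in_chart G c f (param c x) = (\<Sum>i\<in>UNIV. partial_deriv i (flux c f i) x)"
  using W_pos[of c x] by (simp add: laplacian_in_chart_flux)

lemma continuous_on_laplacian_chart:
  assumes "smooth_fun \<A> f" and c: "c \<in> \<A>"
  shows "continuous_on (fst c) (laplacian_in_chart G c f)"
proof -
  have C: "continuous_on (chart_image c) (partial_deriv i (flux c f i))" for i
    using Ck_on_flux[OF assms, of 1 i] by simp
  have W0: "\<forall>x\<in>chart_image c. W c x \<noteq> 0" using W_pos[OF c] by force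
  have "continuous_on (chart_image c) (\<lambda>x. (\<Sum>i\<in>UNIV. partial_deriv i (flux c f i) x) / W c x)"
    using W0 C continuous_on_W[OF c] by (intro continuous_intros) auto
  then show ?thesis
    by (rule continuous_on_chartI[OF c]) (rule laplacian_in_chart_flux)
qed

subsection \<open>The carre du champ\<close>

lemma pd_lin:
  assumes "smooth_fun \<A> f" "smooth_fun \<A> h" "c \<in> \<A>" "x \<in> chart_image c"
  shows "pd c (\<lambda>p. a * f p + b * h p) i x = a * pd c f i x + b * pd c h i x"
  unfolding pd_def
  using has_derivative_add[OF has_derivative_mult_right[OF differentiable_chart[OF assms(1,3,4), unfolded frechet_derivative_works]]
      has_derivative_mult_right[OF differentiable_chart[OF assms(2,3,4), unfolded frechet_derivative_works]], of a b]
  by (subst partial_deriv_eq) (auto simp: partial_deriv_def)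

text \<open>Derivatives in a chart only depend on the germ at the point of the manifold. This is used to see
  that the gradient of a function vanishes outside its support.\<close>

lemma pd_local:
  assumes c: "c \<in> \<A>" "x \<in> chart_image c" and U: "open U" "param c x \<in> U" and eq: "\<And>q. q \<in> U \<Longrightarrow> f q = h q"
  shows "pd c f i x = pd c h i x"
  unfolding pd_def
proof (rule partial_deriv_cong)
  have "open (U \<inter> fst c)" using U open_chart(1)[OF c(1)] by auto
  then show "open (coords c ` (U \<inter> fst c))" by (intro open_coords_image c) auto
  show "x \<in> coords c ` (U \<inter> fst c)" using c U by (intro image_eqI[of _ _ "param c x"]) auto
  show "f (param c y) = h (param c y)" if "y \<in> coords c ` (U \<inter> fst c)" for y
    using that eq c by auto
qed

definition grad :: "('a, 'n) chart \<Rightarrow> ('a \<Rightarrow> real) \<Rightarrow> real ^ 'n \<Rightarrow> real ^ 'n" where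
  "grad c f x = (\<chi> i. pd c f i x)"

lemma gam_grad: "gam c f h x = (matrix_inv (G c (param c x)) *v grad c f x) \<bullet> grad c h x"
  by (simp add: gam_def grad_def G_inv_def inner_vec_def matrix_vector_mult_def)

lemma gam_sym:
  assumes "c \<in> \<A>" "x \<in> chart_image c"
  shows "gam c f h x = gam c h f x"
proof -
  have "pos_def (matrix_inv (G c (param c x)))" using assms by (intro pos_def_inv pos_def_G) auto
  then have "transpose (matrix_inv (G c (param c x))) = matrix_inv (G c (param c x))" by (simp add: pos_def_def)
  then show ?thesis unfolding gam_grad
    by (metis dot_lmul_matrix inner_commute transpose_matrix_vector)
qed

lemma gam_nonneg:
  assumes "c \<in> \<A>" "x \<in> chart_image c"
  shows "0 \<le> gam c f f x"
proof -
  have "pos_def (matrix_inv (G c (param c x)))" using assms by (intro pos_def_inv pos_def_G) auto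
  then show ?thesis unfolding gam_grad pos_def_def
    by (cases "grad c f x = 0") (auto simp: inner_commute less_imp_le)
qed

text \<open>If \<open>J\<close> is the derivative of the transition map, gradients transform by the transpose of \<open>J\<close> and
  \<open>G c p = J\<^sup>T G c' p J\<close>; hence \<open>w' = J w\<close> for the dual vectors \<open>w = G\<^sup>-\<^sup>1 \<nabla>f\<close>.\<close>

lemma gam_chart_independent:
  assumes f: "smooth_fun \<A> f" and h: "smooth_fun \<A> h" and c: "c \<in> \<A>" "c' \<in> \<A>" and p: "p \<in> fst c" "p \<in> fst c'"
  shows "gam c f h (coords c p) = gam c' f h (coords c' p)"
proof -
  define T where "T = transition c c'"
  define x where "x = coords c p"
  define S where "S = coords c ` (fst c \<inter> fst c')"
  have S: "open S" unfolding S_def using open_chart(1)[OF c(1)] open_chart(1)[OF c(2)]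
    by (intro open_coords_image c) auto
  have xS: "x \<in> S" unfolding S_def x_def using p by blast
  have Tx: "T x = coords c' p" using p c by (simp add: T_def x_def transition_def)
  have Td: "(\<lambda>y. T y $ a) differentiable (at x)" for a
    using transition_smooth[OF c, of "Suc 0" a] xS unfolding S_def[symmetric] T_def[symmetric] Ck_on_Suc_open[OF S]
    by blast
  define J where "J = matrix (frechet_derivative T (at x))"
  have "frechet_derivative T (at x) = (\<lambda>v. \<chi> a. frechet_derivative (\<lambda>y. T y $ a) (at x) v)"
    using frechet_derivative_at[OF has_derivative_vec_components[OF Td]] by simp
  then have Jc: "J $ a $ i = frechet_derivative (\<lambda>y. T y $ a) (at x) (axis i 1)" for a i
    by (simp add: J_def matrix_def)
  have gr: "grad c k x = transpose J *v grad c' k (coords c' p)" if k: "smooth_fun \<A> k" for k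
  proof -
    have T_in: "T x \<in> chart_image c'" using Tx p by (simp add: coords_in)
    have "((\<lambda>y. k (param c' (T y))) has_derivative
      (\<lambda>v. \<Sum>a\<in>UNIV. frechet_derivative (\<lambda>y. T y $ a) (at x) v * partial_deriv a (\<lambda>x. k (param c' x)) (T x))) (at x)"
      by (rule has_derivative_compose_partial[OF Td differentiable_chart[OF k c(2) T_in]])
    moreover have "k (param c' (T y)) = k (param c y)" if y: "y \<in> S" for y
      using y c unfolding S_def by (auto simp: T_def transition_def)
    ultimately have "((\<lambda>y. k (param c y)) has_derivative
      (\<lambda>v. \<Sum>a\<in>UNIV. frechet_derivative (\<lambda>y. T y $ a) (at x) v * partial_deriv a (\<lambda>x. k (param c' x)) (T x))) (at x)"
      using has_derivative_cong_open[OF S xS, of "\<lambda>y. k (param c' (T y))" "\<lambda>y. k (param c y)"] by simp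
    from partial_deriv_eq[OF this] have "pd c k i x = (\<Sum>a\<in>UNIV. J $ a $ i * pd c' k a (T x))" for i
      by (simp add: pd_def Jc)
    then show ?thesis
      by (simp add: vec_eq_iff grad_def matrix_vector_mult_def transpose_def Tx)
  qed
  define A where "A = G c p"
  define A' where "A' = G c' p"
  have pA: "pos_def A" and pA': "pos_def A'" using pos_def_G c p by (auto simp: A_def A'_def)
  have AJ: "A = transpose J ** A' ** J"
    using manifold c p unfolding compact_riemannian_manifold_def riemannian_metric_def Let_def
      A_def A'_def J_def T_def x_def by blast
  then have detJ: "det J \<noteq> 0" using pos_def_det_nonzero[OF pA] by (auto simp: AJ det_mul)
  define w where "w = matrix_inv A *v grad c f x"
  have "A *v w = grad c f x" by (simp add: w_def matrix_vector_mul_assoc pos_def_matrix_inv[OF pA])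
  then have "transpose J *v (A' *v (J *v w)) = transpose J *v grad c' f (coords c' p)"
    using AJ gr[OF f] by (simp add: matrix_vector_mul_assoc matrix_mul_assoc)
  moreover have "inj ((*v) (transpose J))"
    using detJ by (intro inj_matrix_vector_mult) (simp add: invertible_det_nz det_transpose)
  ultimately have "A' *v (J *v w) = grad c' f (coords c' p)" by (rule injD[rotated])
  then have Jw: "J *v w = matrix_inv A' *v grad c' f (coords c' p)"
    by (metis matrix_vector_mul_assoc matrix_vector_mul_lid pos_def_matrix_inv(2)[OF pA'])
  have "gam c f h (coords c p) = w \<bullet> (transpose J *v grad c' h (coords c' p))"
    using c p gr[OF h] by (simp add: gam_grad w_def A_def x_def)
  also have "\<dots> = (J *v w) \<bullet> grad c' h (coords c' p)"
    by (metis dot_lmul_matrix inner_commute transpose_matrix_vector transpose_transpose)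
  also have "\<dots> = gam c' f h (coords c' p)"
    using c p by (simp add: gam_grad Jw A'_def)
  finally show ?thesis .
qed

definition \<Gamma> :: "('a \<Rightarrow> real) \<Rightarrow> ('a \<Rightarrow> real) \<Rightarrow> 'a \<Rightarrow> real" where
  "\<Gamma> f h p = gam (chart_at p) f h (coords (chart_at p) p)"

lemma \<Gamma>_chart:
  "smooth_fun \<A> f \<Longrightarrow> smooth_fun \<A> h \<Longrightarrow> c \<in> \<A> \<Longrightarrow> p \<in> fst c \<Longrightarrow> \<Gamma> f h p = gam c f h (coords c p)"
  unfolding \<Gamma>_def using chart_at by (intro gam_chart_independent)

lemma continuous_\<Gamma>:
  assumes "smooth_fun \<A> f" "smooth_fun \<A> h" shows "continuous_on UNIV (\<Gamma> f h)"
proof (rule continuous_on_charts)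
  fix c assume c: "c \<in> \<A>"
  show "continuous_on (fst c) (\<Gamma> f h)"
    by (rule continuous_on_chartI[OF c continuous_on_gam[OF assms c] \<Gamma>_chart[OF assms c]])
qed

lemma \<Gamma>_sym: "\<Gamma> f h p = \<Gamma> h f p"
  unfolding \<Gamma>_def using chart_at by (intro gam_sym coords_in)

lemma \<Gamma>_nonneg: "0 \<le> \<Gamma> f f p"
  unfolding \<Gamma>_def using chart_at by (intro gam_nonneg coords_in)

lemma \<Gamma>_lin:
  assumes "smooth_fun \<A> h" "smooth_fun \<A> k"
  shows "\<Gamma> f (\<lambda>q. a * h q + b * k q) p = a * \<Gamma> f h p + b * \<Gamma> f k p"
  unfolding \<Gamma>_def gam_def using assms chart_at
  by (simp add: pd_lin coords_in distrib_left sum.distrib sum_distrib_left mult_ac)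

lemma \<Gamma>_const: "\<Gamma> f (\<lambda>q. a) p = 0"
  by (simp add: \<Gamma>_def gam_def pd_def partial_deriv_def)

lemma \<Gamma>_sum:
  "(\<And>i. i \<in> I \<Longrightarrow> smooth_fun \<A> (h i)) \<Longrightarrow> \<Gamma> f (\<lambda>q. \<Sum>i\<in>I. h i q) p = (\<Sum>i\<in>I. \<Gamma> f (h i) p)"
proof (induction I rule: infinite_finite_induct)
  case (insert i I)
  then show ?case
    using \<Gamma>_lin[of "h i" "\<lambda>q. \<Sum>i\<in>I. h i q" f 1 1 p] by (simp add: smooth_sum)
qed (simp_all add: \<Gamma>_const)

lemma gam_local:
  assumes "c \<in> \<A>" "p \<in> fst c" "open U" "p \<in> U" "\<And>q. q \<in> U \<Longrightarrow> h q = 0"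
  shows "gam c f h (coords c p) = 0"
proof -
  have "pd c h i (coords c p) = pd c (\<lambda>q. 0) i (coords c p)" for i
    using assms by (intro pd_local[of c _ U]) (auto simp: coords_in)
  then show ?thesis by (simp add: gam_def pd_def partial_deriv_def)
qed

subsection \<open>Integration by parts\<close>

text \<open>The vector field \<open>h\<close> times the flux of \<open>f\<close>, extended by zero, is continuously differentiable with
  compact support, so the integral of its divergence vanishes. The values of the integrand outside
  the chart are set to zero because the coordinate expressions mean nothing there.\<close>

lemma weak_laplacian_chart:
  assumes f: "smooth_fun \<A> f" and h: "smooth_fun \<A> h" and c: "c \<in> \<A>"
    and K: "compact K" "K \<subseteq> fst c" and supp: "\<And>p. p \<notin> K \<Longrightarrow> h p = 0"
  defines "u \<equiv> \<lambda>p. if p \<in> fst c then gam c f h (coords c p) + h p * laplacian_in_chart G c f p else 0"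
  shows "integrable \<nu> u" "(\<integral>p. u p \<partial>\<nu>) = 0"
proof -
  define L where "L = coords c ` K"
  have L: "compact L" unfolding L_def
    using continuous_on_subset[OF continuous_chart(1)[OF c] K(2)] K(1) by (rule compact_continuous_image)
  have LC: "L \<subseteq> chart_image c" using K(2) by (auto simp: L_def chart_image_def)
  define v where "v i x = (if x \<in> chart_image c then h (param c x) * flux c f i x else 0)" for i x
  have h0: "h (param c x) = 0" if "x \<in> chart_image c" "x \<notin> L" for x
  proof (rule supp)
    show "param c x \<notin> K"
    proof
      assume "param c x \<in> K"
      then have "coords c (param c x) \<in> L" unfolding L_def by (rule imageI)
      then show False using that c by simp
    qed
  qed
  have v0: "v i x = 0" if "x \<notin> L" for i x using h0 that by (auto simp: v_def)
  have "open (- L)" using compact_imp_closed[OF L] by auto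
  have C1: "Ck_on 1 UNIV (v i)" for i
  proof (rule Ck_on_local[OF open_UNIV])
    fix x
    show "\<exists>T. open T \<and> x \<in> T \<and> Ck_on 1 T (v i)"
    proof (cases "x \<in> chart_image c")
      case True
      have "Ck_on 1 (chart_image c) (\<lambda>x. h (param c x) * flux c f i x)"
        by (intro Ck_on_mult open_chart smooth_funD Ck_on_flux f h c)
      then have "Ck_on 1 (chart_image c) (v i)"
        using Ck_on_cong[OF open_chart(2)[OF c], of "v i" "\<lambda>x. h (param c x) * flux c f i x" 1]
        by (simp add: v_def del: Ck_on.simps One_nat_def)
      with True show ?thesis using open_chart(2)[OF c] by blast
    next
      case False
      then have "x \<in> - L" using LC by blast
      moreover have "Ck_on 1 (- L) (v i)"
        using Ck_on_cong[OF \<open>open (- L)\<close>, of "v i" "\<lambda>x. 0" 1] Ck_on_const[OF \<open>open (- L)\<close>, of 1 0] v0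
        by (simp del: Ck_on.simps One_nat_def)
      ultimately show ?thesis using \<open>open (- L)\<close> by blast
    qed
  qed
  have pv: "(\<Sum>i\<in>UNIV. partial_deriv i (v i) x)
      = indicator (chart_image c) x * (W c x * u (param c x))" for x
  proof (cases "x \<in> chart_image c")
    case True
    have "partial_deriv i (v i) x = h (param c x) * partial_deriv i (flux c f i) x + flux c f i x * pd c h i x" for i
    proof -
      have "partial_deriv i (v i) x = partial_deriv i (\<lambda>x. h (param c x) * flux c f i x) x"
        using True open_chart(2)[OF c] by (intro partial_deriv_cong[of "chart_image c"]) (auto simp: v_def)
      moreover have "flux c f i differentiable (at x)"
        using Ck_on_flux[OF f c, of 1 i] True Ck_on_Suc_open[OF open_chart(2)[OF c], of 0 "flux c f i"] by simp
      note has_derivative_mult[OF differentiable_chart[OF h c True, unfolded frechet_derivative_works] this[unfolded frechet_derivative_works]]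
      from partial_deriv_eq[OF this, of i]
      have "partial_deriv i (\<lambda>x. h (param c x) * flux c f i x) x
        = h (param c x) * partial_deriv i (flux c f i) x + flux c f i x * pd c h i x"
        by (simp add: partial_deriv_def pd_def mult.commute)
      ultimately show ?thesis by simp
    qed
    then have "(\<Sum>i\<in>UNIV. partial_deriv i (v i) x)
        = h (param c x) * (W c x * laplacian_in_chart G c f (param c x)) + W c x * gam c f h x"
      by (simp add: sum.distrib W_laplacian[OF c True] W_gam sum_distrib_left)
    then show ?thesis using True c by (simp add: u_def algebra_simps)
  next
    case False
    then have "x \<in> - L" using LC by blast
    then have "partial_deriv i (v i) x = partial_deriv i (\<lambda>x. 0) x" for i
      using v0 by (intro partial_deriv_cong[OF \<open>open (- L)\<close>]) auto
    then show ?thesis using False by (simp add: partial_deriv_def)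
  qed
  have D: "dens c x * u (param c x) = \<kappa> * (\<Sum>i\<in>UNIV. partial_deriv i (v i) x)" for x
    unfolding pv by (simp add: dens_def)
  have um: "u \<in> borel_measurable borel"
  proof -
    have "continuous_on (fst c) (\<lambda>p. gam c f h (coords c p))"
      by (rule continuous_on_chartI[OF c continuous_on_gam[OF f h c]]) simp
    then have "continuous_on (fst c) (\<lambda>p. gam c f h (coords c p) + h p * laplacian_in_chart G c f p)"
      using continuous_on_laplacian_chart[OF f c] continuous_on_subset[OF smooth_continuous[OF h] subset_UNIV]
      by (intro continuous_intros)
    then show ?thesis unfolding u_def
      using open_chart(1)[OF c] by (intro borel_measurable_continuous_on_if) auto
  qed
  have i: "integrable lborel (partial_deriv i (v i))" "(\<integral>x. partial_deriv i (v i) x \<partial>lborel) = 0" for i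
    using integral_partial_deriv[OF C1 L v0] by auto
  have supp_u: "u p = 0" if "p \<notin> fst c" for p using that by (simp add: u_def)
  have "integrable lborel (\<lambda>x. dens c x * u (param c x))"
    unfolding D by (intro integrable_mult_right Bochner_Integration.integrable_sum i)
  with integral_chart(1)[OF c um supp_u] show "integrable \<nu> u" by blast
  have "(\<integral>x. dens c x * u (param c x) \<partial>lborel) = 0"
    unfolding D by (simp add: i)
  with integral_chart(2)[OF c um supp_u] show "(\<integral>p. u p \<partial>\<nu>) = 0" by simp
qed

text \<open>The weak formulation determines the Laplacian in each chart and only involves the invariant \<open>\<Gamma>\<close>,
  so the two expressions agree where both are defined; testing against a bump function shows this
  without computing any second derivative of a transition map.\<close>

lemma laplacian_chart_le:
  assumes f: "smooth_fun \<A> f" and c: "c \<in> \<A>" "c' \<in> \<A>" and p: "p \<in> fst c" "p \<in> fst c'"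
  shows "laplacian_in_chart G c f p \<le> laplacian_in_chart G c' f p"
proof (rule ccontr)
  define D where "D q = laplacian_in_chart G c f q - laplacian_in_chart G c' f q" for q
  define O' where "O' = fst c \<inter> fst c'"
  define U where "U = {q \<in> O'. D q > 0}"
  assume "\<not> ?thesis"
  then have pU: "p \<in> U" using p by (simp add: U_def O'_def D_def)
  have oO: "open O'" using open_chart(1)[OF c(1)] open_chart(1)[OF c(2)] by (auto simp: O'_def)
  have "continuous_on O' D" unfolding D_def O'_def
    by (intro continuous_on_diff continuous_on_subset[OF continuous_on_laplacian_chart[OF f c(1)]]
        continuous_on_subset[OF continuous_on_laplacian_chart[OF f c(2)]]) auto
  then have "open (O' \<inter> D -` {0<..})" by (rule continuous_open_preimage[OF _ oO]) auto
  then have oU: "open U" by (simp add: U_def vimage_def Int_def)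
  obtain b K where b: "smooth_fun \<A> b" "\<And>q. 0 \<le> b q" "b p > 0" "compact K" "K \<subseteq> U" "\<And>q. q \<notin> K \<Longrightarrow> b q = 0"
    using bump_exists[OF oU pU c(1) p(1)] by metis
  have K: "K \<subseteq> fst c" "K \<subseteq> fst c'" using b(5) by (auto simp: U_def O'_def)
  have oK: "open (- K)" using compact_imp_closed[OF b(4)] by auto
  define u where "u c p = (if p \<in> fst c then gam c f b (coords c p) + b p * laplacian_in_chart G c f p else 0)" for c p
  note 1 = weak_laplacian_chart[OF f b(1) c(1) b(4) K(1) b(6), folded u_def]
  note 2 = weak_laplacian_chart[OF f b(1) c(2) b(4) K(2) b(6), folded u_def]
  \<comment> \<open>the first order parts cancel, by the invariance of the scalar product of gradients\<close>
  have eq: "u c q - u c' q = b q * D q" for q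
  proof (cases "q \<in> K")
    case True
    then have "q \<in> fst c" "q \<in> fst c'" using K by auto
    then show ?thesis
      using gam_chart_independent[OF f b(1) c, of q] by (simp add: u_def D_def algebra_simps)
  next
    case False
    then have "u c q = 0" "u c' q = 0"
      using gam_local[OF c(1) _ oK, of q b f] gam_local[OF c(2) _ oK, of q b f] b(6)
      by (auto simp: u_def)
    then show ?thesis using b(6)[OF False] by simp
  qed
  have bD: "0 \<le> b q * D q" for q
  proof (cases "q \<in> K")
    case True
    then have "D q > 0" using b(5) by (auto simp: U_def)
    then show ?thesis using b(2)[of q] by (intro mult_nonneg_nonneg) auto
  qed (use b(6) in simp)
  have int: "integrable \<nu> (\<lambda>q. b q * D q)" and zero: "(\<integral>q. b q * D q \<partial>\<nu>) = 0"
    using Bochner_Integration.integrable_diff[OF 1(1) 2(1)] Bochner_Integration.integral_diff[OF 1(1) 2(1)] 1(2) 2(2)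
    by (simp_all add: eq)
  then have "AE q in \<nu>. b q * D q = 0"
    using integral_nonneg_eq_0_iff_AE[OF int] bD by simp
  then have "AE q in \<nu>. q \<notin> {q. b q > 0}"
  proof eventually_elim
    case (elim q)
    then show ?case using b(5) b(6)[of q] by (cases "q \<in> K") (auto simp: U_def)
  qed
  moreover have op: "open {q. b q > 0}"
    using smooth_continuous[OF b(1)] by (intro open_Collect_less) auto
  ultimately have "emeasure \<nu> {q. b q > 0} = 0"
    by (subst (asm) AE_iff_measurable[of "{q. b q > 0}"]) auto
  then show False using \<nu>_open_pos[OF op, of p] b(3) by (simp add: measure_def)
qed

lemma laplacian_chart:
  assumes "smooth_fun \<A> f" "c \<in> \<A>" "p \<in> fst c"
  shows "laplacian \<A> G f p = laplacian_in_chart G c f p"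
proof -
  have "laplacian \<A> G f p = laplacian_in_chart G (chart_at p) f p" by (simp add: laplacian_def chart_at_def)
  then show ?thesis using laplacian_chart_le[OF assms(1)] assms(2,3) chart_at[of p] by (metis order_antisym)
qed

lemma continuous_laplacian:
  assumes "smooth_fun \<A> f" shows "continuous_on UNIV (laplacian \<A> G f)"
proof (rule continuous_on_charts)
  fix c assume c: "c \<in> \<A>"
  show "continuous_on (fst c) (laplacian \<A> G f)"
    using continuous_on_laplacian_chart[OF assms c] by (simp add: laplacian_chart[OF assms c] cong: continuous_on_cong)
qed

text \<open>Decompose \<open>h\<close> by a partition of unity; \<open>\<Gamma>\<close> is linear in its second argument, so the local
  identities add up.\<close>

theorem weak_laplacian:
  assumes f: "smooth_fun \<A> f" and h: "smooth_fun \<A> h"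
  shows "l2_inner \<nu> h (\<lambda>p. - laplacian \<A> G f p) = (\<integral>p. \<Gamma> f h p \<partial>\<nu>)"
proof -
  obtain I \<rho> where I: "finite (I :: 'a set)" "\<And>i. i \<in> I \<Longrightarrow> smooth_fun \<A> (\<rho> i)" "\<And>p. (\<Sum>i\<in>I. \<rho> i p) = 1"
    "\<And>i. i \<in> I \<Longrightarrow> \<exists>c K. c \<in> \<A> \<and> compact K \<and> K \<subseteq> fst c \<and> (\<forall>p. p \<notin> K \<longrightarrow> \<rho> i p = 0)"
    by (rule partition_of_unity) blast
  have loc: "integrable \<nu> (\<lambda>p. \<Gamma> f (\<lambda>q. \<rho> i q * h q) p + \<rho> i p * h p * laplacian \<A> G f p)"
    "(\<integral>p. \<Gamma> f (\<lambda>q. \<rho> i q * h q) p + \<rho> i p * h p * laplacian \<A> G f p \<partial>\<nu>) = 0" if i: "i \<in> I" for i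
  proof -
    obtain c K where c: "c \<in> \<A>" "compact K" "K \<subseteq> fst c" "\<And>p. p \<notin> K \<Longrightarrow> \<rho> i p = 0" using I(4)[OF i] by blast
    have s: "smooth_fun \<A> (\<lambda>q. \<rho> i q * h q)" by (intro smooth_mult I i h)
    have z: "\<rho> i q * h q = 0" if "q \<notin> K" for q using c(4)[OF that] by simp
    have oK: "open (- K)" using compact_imp_closed[OF c(2)] by auto
    have eq: "\<Gamma> f (\<lambda>q. \<rho> i q * h q) p + \<rho> i p * h p * laplacian \<A> G f p
      = (if p \<in> fst c then gam c f (\<lambda>q. \<rho> i q * h q) (coords c p) + \<rho> i p * h p * laplacian_in_chart G c f p else 0)" for p
    proof (cases "p \<in> fst c")
      case True
      then show ?thesis by (simp add: \<Gamma>_chart[OF f s c(1)] laplacian_chart[OF f c(1)])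
    next
      case False
      then have "p \<in> - K" using c by blast
      then have "\<Gamma> f (\<lambda>q. \<rho> i q * h q) p = 0"
        unfolding \<Gamma>_def using z chart_at by (intro gam_local[OF _ _ oK]) auto
      then show ?thesis using z False \<open>p \<in> - K\<close> by simp
    qed
    show "integrable \<nu> (\<lambda>p. \<Gamma> f (\<lambda>q. \<rho> i q * h q) p + \<rho> i p * h p * laplacian \<A> G f p)"
      "(\<integral>p. \<Gamma> f (\<lambda>q. \<rho> i q * h q) p + \<rho> i p * h p * laplacian \<A> G f p \<partial>\<nu>) = 0"
      unfolding eq using weak_laplacian_chart[OF f s c(1-3) z] by simp_all
  qed
  have "(\<Sum>i\<in>I. \<Gamma> f (\<lambda>q. \<rho> i q * h q) p + \<rho> i p * h p * laplacian \<A> G f p)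
      = \<Gamma> f h p + h p * laplacian \<A> G f p" for p
  proof -
    have "(\<Sum>i\<in>I. \<rho> i q * h q) = h q" for q by (simp add: I(3) flip: sum_distrib_right)
    then have "\<Gamma> f h p = \<Gamma> f (\<lambda>q. \<Sum>i\<in>I. \<rho> i q * h q) p" by simp
    also have "\<dots> = (\<Sum>i\<in>I. \<Gamma> f (\<lambda>q. \<rho> i q * h q) p)"
      by (intro \<Gamma>_sum smooth_mult I h)
    finally show ?thesis by (simp add: sum.distrib I(3) flip: sum_distrib_right)
  qed
  then have "(\<integral>p. \<Gamma> f h p + h p * laplacian \<A> G f p \<partial>\<nu>)
      = (\<integral>p. (\<Sum>i\<in>I. \<Gamma> f (\<lambda>q. \<rho> i q * h q) p + \<rho> i p * h p * laplacian \<A> G f p) \<partial>\<nu>)" by simp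
  also have "\<dots> = 0" using loc by (subst Bochner_Integration.integral_sum) auto
  finally have 0: "(\<integral>p. \<Gamma> f h p + h p * laplacian \<A> G f p \<partial>\<nu>) = 0" .
  have "integrable \<nu> (\<Gamma> f h)" by (intro continuous_L2 continuous_\<Gamma> f h)
  moreover have "integrable \<nu> (\<lambda>p. h p * laplacian \<A> G f p)"
    by (intro continuous_L2 continuous_on_mult smooth_continuous continuous_laplacian f h)
  ultimately show ?thesis using 0 by (simp add: l2_inner_def)
qed

section \<open>Density of the smooth functions\<close>

text \<open>The closure of the smooth functions in \<open>L\<^sup>2\<close>. It is shown to contain the indicators of open
  sets, then of Borel sets, and finally everything.\<close>

definition approximable :: "('a \<Rightarrow> real) set" where
  "approximable = {f \<in> L2 \<nu>. \<forall>e>0. \<exists>h. smooth_fun \<A> h \<and> l2_norm \<nu> (\<lambda>p. f p - h p) < e}"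

lemma smooth_L2: "smooth_fun \<A> f \<Longrightarrow> f \<in> L2 \<nu>"
  using continuous_L2 smooth_continuous by blast

lemma approximable_smooth: "smooth_fun \<A> f \<Longrightarrow> f \<in> approximable"
  unfolding approximable_def by (auto simp: smooth_L2 l2_norm_def l2_inner_def intro!: exI[of _ f])

lemma approximable_limit:
  assumes f: "f \<in> L2 \<nu>" and F: "\<And>e. e > 0 \<Longrightarrow> \<exists>h\<in>approximable. l2_norm \<nu> (\<lambda>p. f p - h p) < e"
  shows "f \<in> approximable"
  unfolding approximable_def
proof (intro CollectI conjI allI impI f)
  fix e :: real assume e: "e > 0"
  then obtain h where h: "h \<in> approximable" "l2_norm \<nu> (\<lambda>p. f p - h p) < e / 2" using F[of "e/2"] by auto
  then obtain k where k: "smooth_fun \<A> k" "l2_norm \<nu> (\<lambda>p. h p - k p) < e / 2"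
    using e unfolding approximable_def by (auto dest!: spec[of _ "e/2"])
  have "h \<in> L2 \<nu>" using h by (simp add: approximable_def)
  from l2.triangle_diff[OF f this smooth_L2[OF k(1)]]
  have "l2_norm \<nu> (\<lambda>p. f p - k p) < e" using h k by simp
  then show "\<exists>h. smooth_fun \<A> h \<and> l2_norm \<nu> (\<lambda>p. f p - h p) < e" using k by blast
qed

lemma approximable_scale:
  assumes f: "f \<in> approximable" shows "(\<lambda>p. a * f p) \<in> approximable"
proof -
  have L: "f \<in> L2 \<nu>" using f by (simp add: approximable_def)
  show ?thesis
    unfolding approximable_def
  proof (intro CollectI conjI allI impI l2.scale_mem L)
    fix e :: real assume e: "e > 0"
    then obtain h where h: "smooth_fun \<A> h" "l2_norm \<nu> (\<lambda>p. f p - h p) < e / (\<bar>a\<bar> + 1)"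
      using f unfolding approximable_def by (auto dest!: spec[of _ "e / (\<bar>a\<bar> + 1)"])
    have m: "(\<lambda>p. f p - h p) \<in> L2 \<nu>" using L smooth_L2[OF h(1)] by (rule l2.diff_mem)
    have "l2_norm \<nu> (\<lambda>p. a * f p - a * h p) = \<bar>a\<bar> * l2_norm \<nu> (\<lambda>p. f p - h p)"
      using l2.nrm_scale[OF m, of a] by (simp add: right_diff_distrib)
    also have "\<dots> \<le> (\<bar>a\<bar> + 1) * l2_norm \<nu> (\<lambda>p. f p - h p)"
      using l2.nrm_nonneg[OF m] by (intro mult_right_mono) auto
    also have "\<dots> < e" using h(2) by (simp add: field_simps)
    finally show "\<exists>k. smooth_fun \<A> k \<and> l2_norm \<nu> (\<lambda>p. a * f p - k p) < e"
      using smooth_mult[OF smooth_const h(1), of a] by blast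
  qed
qed

lemma approximable_add:
  assumes f: "f \<in> approximable" and g: "g \<in> approximable" shows "(\<lambda>p. f p + g p) \<in> approximable"
proof -
  have L: "f \<in> L2 \<nu>" "g \<in> L2 \<nu>" using f g by (auto simp: approximable_def)
  show ?thesis
    unfolding approximable_def
  proof (intro CollectI conjI allI impI l2.add_mem L)
    fix e :: real assume e: "e > 0"
    obtain h where h: "smooth_fun \<A> h" "l2_norm \<nu> (\<lambda>p. f p - h p) < e / 2"
      using e f unfolding approximable_def by (auto dest!: spec[of _ "e / 2"])
    obtain k where k: "smooth_fun \<A> k" "l2_norm \<nu> (\<lambda>p. g p - k p) < e / 2"
      using e g unfolding approximable_def by (auto dest!: spec[of _ "e / 2"])
    have "l2_norm \<nu> (\<lambda>p. (f p - h p) + (g p - k p)) < e"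
      using l2.triangle[OF l2.diff_mem[OF L(1) smooth_L2[OF h(1)]] l2.diff_mem[OF L(2) smooth_L2[OF k(1)]]] h k
      by simp
    then have "l2_norm \<nu> (\<lambda>p. (f p + g p) - (h p + k p)) < e" by (simp add: algebra_simps)
    then show "\<exists>k. smooth_fun \<A> k \<and> l2_norm \<nu> (\<lambda>p. f p + g p - k p) < e"
      using smooth_add[OF h(1) k(1)] by blast
  qed
qed

lemma approximable_sum: "(\<And>i. i \<in> I \<Longrightarrow> f i \<in> approximable) \<Longrightarrow> (\<lambda>p. \<Sum>i\<in>I. f i p) \<in> approximable"
  by (induction I rule: infinite_finite_induct)
    (auto intro: approximable_add approximable_smooth smooth_const)

lemma approximable_dominated:
  assumes F: "\<And>k. F k \<in> approximable" and [measurable]: "f \<in> borel_measurable borel" and g: "g \<in> L2 \<nu>"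
    and bnd: "\<And>k p. \<bar>F k p\<bar> \<le> g p" and lim: "\<And>p. (\<lambda>k. F k p) \<longlonglongrightarrow> f p"
  shows "f \<in> approximable"
proof -
  have FL: "F k \<in> L2 \<nu>" for k using F by (simp add: approximable_def)
  have [measurable]: "F k \<in> borel_measurable borel" "g \<in> borel_measurable borel" for k
    using FL[THEN L2_measurable] g[THEN L2_measurable] by auto
  have fg: "\<bar>f p\<bar> \<le> g p" for p
    using tendsto_rabs[OF lim[of p]] bnd by (intro LIMSEQ_le_const2) auto
  have ig: "integrable \<nu> (\<lambda>p. (g p)\<^sup>2)" using g by (simp add: L2_def)
  have fL: "f \<in> L2 \<nu>"
  proof -
    have "integrable \<nu> (\<lambda>p. (f p)\<^sup>2)"
    proof (rule Bochner_Integration.integrable_bound[OF ig])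
      show "AE p in \<nu>. norm ((f p)\<^sup>2) \<le> norm ((g p)\<^sup>2)"
      proof (rule AE_I2)
        fix p
        show "norm ((f p)\<^sup>2) \<le> norm ((g p)\<^sup>2)" using power_mono[OF fg[of p], of 2] by simp
      qed
    qed simp
    then show ?thesis by (simp add: L2_def)
  qed
  have "(\<lambda>k. \<integral>p. (f p - F k p)\<^sup>2 \<partial>\<nu>) \<longlonglongrightarrow> (\<integral>p. 0 \<partial>\<nu>)"
  proof (rule integral_dominated_convergence[where w="\<lambda>p. 4 * (g p)\<^sup>2"])
    show "AE p in \<nu>. (\<lambda>k. (f p - F k p)\<^sup>2) \<longlonglongrightarrow> 0"
    proof (rule AE_I2)
      fix p
      have "(\<lambda>k. (f p - F k p)\<^sup>2) \<longlonglongrightarrow> (f p - f p)\<^sup>2" by (intro tendsto_intros lim)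
      then show "(\<lambda>k. (f p - F k p)\<^sup>2) \<longlonglongrightarrow> 0" by simp
    qed
    show "AE p in \<nu>. norm ((f p - F k p)\<^sup>2) \<le> 4 * (g p)\<^sup>2" for k
    proof (rule AE_I2)
      fix p
      have "\<bar>f p - F k p\<bar> \<le> 2 * g p" using fg[of p] bnd[of k p] by linarith
      from power_mono[OF this, of 2] show "norm ((f p - F k p)\<^sup>2) \<le> 4 * (g p)\<^sup>2"
        by (simp add: power_mult_distrib)
    qed
  qed (use ig in auto)
  then have "(\<lambda>k. sqrt (\<integral>p. (f p - F k p)\<^sup>2 \<partial>\<nu>)) \<longlonglongrightarrow> sqrt 0" by (intro tendsto_real_sqrt) simp
  then have *: "(\<lambda>k. l2_norm \<nu> (\<lambda>p. f p - F k p)) \<longlonglongrightarrow> 0"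
    by (simp add: l2_norm_def l2_inner_def power2_eq_square)
  show ?thesis
  proof (rule approximable_limit[OF fL])
    fix e :: real assume "e > 0"
    from order_tendstoD(2)[OF * this] obtain k where "l2_norm \<nu> (\<lambda>p. f p - F k p) < e"
      by (auto simp: eventually_sequentially)
    then show "\<exists>h\<in>approximable. l2_norm \<nu> (\<lambda>p. f p - h p) < e" using F by blast
  qed
qed

text \<open>An open set is the union of the positivity sets of countably many bump functions \<open>b\<^sub>i\<close>, and
  \<open>1 - exp (- k \<Sum>\<^sub>i\<^sub><\<^sub>k b\<^sub>i)\<close> increases to its indicator.\<close>

lemma approximable_open:
  assumes U: "open U" shows "indicator U \<in> approximable"
proof (cases "U = {}")
  case True
  then have "indicator U = (\<lambda>p::'a. 0::real)" by (simp add: fun_eq_iff)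
  then show ?thesis using approximable_smooth[OF smooth_const[of 0]] by simp
next
  case False
  have "\<exists>b. smooth_fun \<A> b \<and> (\<forall>q. 0 \<le> b q) \<and> b p > 0 \<and> (\<forall>q. q \<notin> U \<longrightarrow> b q = 0)" if "p \<in> U" for p
    using bump_exists[OF U that chart_at] by (metis subsetD)
  then obtain b where b: "\<And>p. p \<in> U \<Longrightarrow> smooth_fun \<A> (b p)" "\<And>p q. p \<in> U \<Longrightarrow> 0 \<le> b p q" "\<And>p. p \<in> U \<Longrightarrow> b p p > 0"
    "\<And>p q. p \<in> U \<Longrightarrow> q \<notin> U \<Longrightarrow> b p q = 0" by metis
  define N where "N p = {q. b p q > 0}" for p
  have oN: "open (N p)" if "p \<in> U" for p
    unfolding N_def using smooth_continuous[OF b(1)[OF that]] by (intro open_Collect_less) auto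
  obtain \<F> where \<F>: "\<F> \<subseteq> N ` U" "countable \<F>" "\<Union>\<F> = \<Union>(N ` U)"
    using Lindelof[of "N ` U"] oN by blast
  then obtain C where C: "C \<subseteq> U" "countable C" "\<F> = N ` C"
    using countable_subset_image[of \<F> N U] by blast
  have cov: "\<exists>p\<in>C. b p q > 0" if "q \<in> U" for q
  proof -
    have "q \<in> \<Union>(N ` U)" using that b(3)[OF that] by (auto simp: N_def)
    then show ?thesis using \<F>(3) C(3) by (auto simp: N_def)
  qed
  then have "C \<noteq> {}" using False by blast
  define s where "s i = from_nat_into C i" for i
  have s: "s i \<in> U" for i using from_nat_into[OF \<open>C \<noteq> {}\<close>] C(1) by (auto simp: s_def)
  define F where "F k q = 1 - exp (- (real k * (\<Sum>i<k. b (s i) q)))" for k q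
  show ?thesis
  proof (rule approximable_dominated[where F=F and g="\<lambda>p. 1"])
    show "F k \<in> approximable" for k
    proof (rule approximable_smooth)
      have "smooth_fun \<A> (\<lambda>q. - 1 * (real k * (\<Sum>i<k. b (s i) q)))"
        by (intro smooth_mult smooth_const smooth_sum b(1) s)
      from smooth_diff[OF smooth_const[of 1] smooth_exp[OF this]]
      show "smooth_fun \<A> (F k)" by (simp add: F_def[abs_def])
    qed
    show "\<bar>F k p\<bar> \<le> 1" for k p
    proof -
      have "0 \<le> real k * (\<Sum>i<k. b (s i) p)" using b(2) s by (intro mult_nonneg_nonneg sum_nonneg) auto
      then show ?thesis by (simp add: F_def)
    qed
    show "(\<lambda>k. F k p) \<longlonglongrightarrow> indicator U p" for p
    proof (cases "p \<in> U")
      case False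
      then show ?thesis using b(4) s by (simp add: F_def)
    next
      case True
      then obtain z where z: "z \<in> C" "b z p > 0" using cov by blast
      then obtain i where i: "s i = z" using from_nat_into_surj[OF C(2)] by (auto simp: s_def)
      have "(\<lambda>k. exp (- (real k * (\<Sum>i<k. b (s i) p)))) \<longlonglongrightarrow> 0"
      proof (rule tendsto_sandwich[where f="\<lambda>k. 0" and h="\<lambda>k. exp (- (real k * b z p))"])
        show "\<forall>\<^sub>F k in sequentially. exp (- (real k * (\<Sum>i<k. b (s i) p))) \<le> exp (- (real k * b z p))"
          using eventually_gt_at_top[of i]
        proof eventually_elim
          case (elim k)
          have "b (s i) p \<le> (\<Sum>i<k. b (s i) p)" using elim b(2) s by (intro member_le_sum) auto
          then show ?case unfolding i by (simp add: mult_left_mono)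
        qed
        have "filterlim (\<lambda>k. real k * b z p) at_top sequentially"
          using z by (intro filterlim_at_top_mult_tendsto_pos[OF tendsto_const] filterlim_real_sequentially) auto
        then show "(\<lambda>k. exp (- (real k * b z p))) \<longlonglongrightarrow> 0"
          by (intro filterlim_compose[OF exp_at_bot] filterlim_compose[OF filterlim_uminus_at_bot_at_top])
      qed auto
      from tendsto_diff[OF tendsto_const[of 1] this] show ?thesis using True by (simp add: F_def)
    qed
    show "(\<lambda>p. 1) \<in> L2 \<nu>" by (rule \<nu>.L2_const)
  qed (use U in simp)
qed

text \<open>Open sets form a generator that is stable under intersections, and the sets with
  approximable indicator are closed under complements and disjoint countable unions.\<close>

lemma approximable_borel:
  assumes "A \<in> sets borel" shows "indicator A \<in> approximable"
proof -
  have "A \<in> sigma_sets UNIV {S. open S}" using assms by (simp add: borel_def)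
  then show ?thesis
  proof (induction rule: sigma_sets_induct_disjoint[rotated 2, consumes 1, case_names basic empty compl union])
    case (basic A) then show ?case using approximable_open by simp
  next
    case empty show ?case by (rule approximable_open) simp
  next
    case (compl A)
    have "(\<lambda>p. 1 + (-1) * indicator A p) \<in> approximable"
      by (intro approximable_add approximable_scale approximable_smooth smooth_const compl)
    also have "(\<lambda>p. 1 + (-1) * indicator A p :: real) = indicator (UNIV - A)" by (auto simp: indicator_def)
    finally show ?case .
  next
    case (union A)
    have Ab: "A i \<in> sets borel" for i using union(2) by (auto simp: borel_def)
    have eq: "indicator (\<Union>i<k. A i) = (\<lambda>p. \<Sum>i<k. indicator (A i) p :: real)" for k
      using union(1) by (intro ext indicator_UN_disjoint) (auto simp: disjoint_family_on_def)
    show ?case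
    proof (rule approximable_dominated[where F="\<lambda>k. indicator (\<Union>i<k. A i)" and g="\<lambda>p. 1"])
      show "indicator (\<Union>i<k. A i) \<in> approximable" for k
        unfolding eq by (intro approximable_sum union)
      show "(\<lambda>k. indicator (\<Union>i<k. A i) p :: real) \<longlonglongrightarrow> indicator (\<Union>(range A)) p" for p
        by (rule LIMSEQ_indicator_UN)
      show "\<bar>indicator (\<Union>i<k. A i) p\<bar> \<le> (1::real)" for k p by (simp add: indicator_def)
      show "(\<lambda>p. 1) \<in> L2 \<nu>" by (rule \<nu>.L2_const)
    qed (use Ab in simp)
  qed (auto simp: Int_stable_def)
qed

text \<open>A square-integrable function is a dominated limit of simple functions.\<close>

theorem smooth_dense:
  assumes f: "f \<in> L2 \<nu>" and e: "e > 0"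
  obtains h where "smooth_fun \<A> h" "l2_norm \<nu> (\<lambda>p. f p - h p) < e"
proof -
  have fm: "f \<in> borel_measurable \<nu>" using L2_measurable[OF f] .
  obtain F where F': "\<forall>i. simple_function \<nu> (F i)" "\<forall>p\<in>space \<nu>. (\<lambda>i. F i p) \<longlonglongrightarrow> f p"
    "\<forall>i. \<forall>p\<in>space \<nu>. norm (F i p) \<le> 2 * norm (f p)"
    using borel_measurable_implies_sequence_metric[OF fm, of 0] unfolding dist_0_norm dist_norm diff_0_right
    by (elim exE conjE)
  have F: "simple_function \<nu> (F i)" "(\<lambda>i. F i p) \<longlonglongrightarrow> f p" "norm (F i p) \<le> 2 * norm (f p)" for i p
    using F'(1) bspec[OF F'(2), of p] bspec[OF spec[OF F'(3), of i], of p] unfolding space_\<nu> by blast+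
  have "f \<in> approximable"
  proof (rule approximable_dominated[where F=F and g="\<lambda>p. 2 * \<bar>f p\<bar>"])
    show "F k \<in> approximable" for k
    proof -
      have eq: "F k = (\<lambda>p. \<Sum>y\<in>F k ` UNIV. y * indicator (F k -` {y}) p)"
      proof (rule ext)
        fix p
        have "F k p = (\<Sum>y\<in>F k ` UNIV. indicator (F k -` {y}) p *\<^sub>R y)"
          by (rule simple_function_indicator_representation_banach[OF F(1)[of k], of p,
                unfolded space_\<nu> Int_UNIV_right, OF UNIV_I])
        also have "\<dots> = (\<Sum>y\<in>F k ` UNIV. y * indicator (F k -` {y}) p)"
          unfolding real_scaleR_def mult.commute[of "indicator _ _"] by (rule refl)
        finally show "F k p = (\<Sum>y\<in>F k ` UNIV. y * indicator (F k -` {y}) p)" .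
      qed
      have m: "F k -` {y} \<in> sets borel" for y
        using simple_functionD(2)[OF F(1)[of k], of "{y}"] by simp
      show ?thesis
        by (subst eq) (intro approximable_sum approximable_scale approximable_borel m)
    qed
    show "\<bar>F k p\<bar> \<le> 2 * \<bar>f p\<bar>" for k p using F(3)[of k p] by simp
    show "(\<lambda>p. 2 * \<bar>f p\<bar>) \<in> L2 \<nu>" using f by (intro l2.scale_mem) (auto simp: L2_def)
  qed (use fm F in simp_all)
  then show thesis using e that unfolding approximable_def by blast
qed

section \<open>The Poincare inequality on the manifold\<close>

lemma param_image_measurable:
  assumes c: "c \<in> \<A>" and B: "B \<in> sets borel" "B \<subseteq> chart_image c"
  shows "param c ` B \<in> sets borel"
proof -
  define g where "g p = (if p \<in> fst c then coords c p else 0)" for p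
  have g: "g \<in> borel_measurable borel"
    unfolding g_def using open_chart(1)[OF c] continuous_chart(1)[OF c]
    by (intro borel_measurable_continuous_on_if) auto
  have "param c ` B = fst c \<inter> g -` B"
  proof (intro set_eqI iffI)
    fix p assume "p \<in> param c ` B" then show "p \<in> fst c \<inter> g -` B" using B(2) c by (auto simp: g_def)
  next
    fix p assume "p \<in> fst c \<inter> g -` B"
    then have "p = param c (coords c p)" "coords c p \<in> B" using c by (auto simp: g_def)
    then show "p \<in> param c ` B" by (rule image_eqI)
  qed
  then show ?thesis using measurable_sets_borel[OF g B(1)] open_chart(1)[OF c] by auto
qed

lemma nn_integral_param_image:
  assumes c: "c \<in> \<A>" and B: "B \<in> sets borel" "B \<subseteq> chart_image c" and g[measurable]: "g \<in> borel_measurable borel"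
  shows "(\<integral>\<^sup>+p\<in>param c ` B. g p \<partial>\<nu>) = (\<integral>\<^sup>+x\<in>B. ennreal (dens c x) * g (param c x) \<partial>lborel)"
proof -
  have sub: "param c ` B \<subseteq> fst c" using B(2) c by auto
  have [measurable]: "param c ` B \<in> sets borel" by (rule param_image_measurable[OF c B])
  have "(\<integral>\<^sup>+p\<in>param c ` B. g p \<partial>\<nu>) = (\<integral>\<^sup>+p\<in>fst c. g p * indicator (param c ` B) p \<partial>\<nu>)"
    using sub by (intro nn_integral_cong) (auto simp: indicator_def)
  also have "\<dots> = (\<integral>\<^sup>+x. ennreal (dens c x) * (g (param c x) * indicator (param c ` B) (param c x)) \<partial>lborel)"
    by (rule nn_integral_chart[OF c]) measurable
  also have "\<dots> = (\<integral>\<^sup>+x\<in>B. ennreal (dens c x) * g (param c x) \<partial>lborel)"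
  proof (rule nn_integral_cong)
    fix x
    show "ennreal (dens c x) * (g (param c x) * indicator (param c ` B) (param c x))
      = ennreal (dens c x) * g (param c x) * indicator B x"
    proof (cases "x \<in> chart_image c")
      case True
      have "param c x \<in> param c ` B \<longleftrightarrow> x \<in> B"
      proof
        assume "param c x \<in> param c ` B"
        then obtain y where y: "y \<in> B" "param c x = param c y" by blast
        have "x = coords c (param c x)" "y = coords c (param c y)" using True y(1) B(2) c by auto
        then have "x = y" using y(2) by metis
        then show "x \<in> B" using y(1) by simp
      qed simp
      then show ?thesis by (simp add: indicator_def)
    next
      case False
      then show ?thesis using B(2) by (auto simp: dens_def)
    qed
  qed
  finally show ?thesis .
qed

text \<open>Continuous positive functions on compact sets are bounded and bounded away from zero. For the
  ellipticity constant the compact set is the product of the ball with the unit sphere of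
  directions.\<close>

lemma chart_bounds:
  assumes ab: "admissible_ball c a r"
  obtains w\<^sub>0 w\<^sub>1 M where "0 < w\<^sub>0" "0 < w\<^sub>1" "0 < M" "\<And>x. x \<in> cball a r \<Longrightarrow> w\<^sub>0 \<le> dens c x"
    "\<And>x. x \<in> cball a r \<Longrightarrow> dens c x \<le> w\<^sub>1"
    "\<And>x f. x \<in> cball a r \<Longrightarrow> grad_sq (\<lambda>x. f (param c x)) x \<le> M * gam c f f x"
proof -
  note A = admissible_ballD[OF ab]
  have ne: "cball a r \<noteq> {}" using A(2) by simp
  have "continuous_on (cball a r) (\<lambda>x. \<kappa> * W c x)"
    using continuous_on_subset[OF continuous_on_W[OF A(1)] A(3)] by (intro continuous_intros)
  moreover have "continuous_on (cball a r) (\<lambda>x. \<kappa> * W c x) \<longleftrightarrow> continuous_on (cball a r) (dens c)"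
    using A(3) by (intro continuous_on_cong) (auto simp: dens_def)
  ultimately have cd: "continuous_on (cball a r) (dens c)" by simp
  obtain x0 where x0: "x0 \<in> cball a r" "\<And>x. x \<in> cball a r \<Longrightarrow> dens c x0 \<le> dens c x"
    using continuous_attains_inf[OF compact_cball ne cd] by blast
  obtain x1 where x1: "x1 \<in> cball a r" "\<And>x. x \<in> cball a r \<Longrightarrow> dens c x \<le> dens c x1"
    using continuous_attains_sup[OF compact_cball ne cd] by blast
  have pos: "0 < dens c x" if "x \<in> cball a r" for x using that A(3) by (intro dens_pos A(1)) auto
  define \<phi> where "\<phi> z = (\<Sum>i\<in>UNIV. \<Sum>j\<in>UNIV. G_inv c (fst z) i j * snd z $ j * snd z $ i)" for z :: "(real ^ 'n) \<times> (real ^ 'n)"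
  have \<phi>_eq: "\<phi> (x, v) = v \<bullet> (matrix_inv (G c (param c x)) *v v)" for x v
    by (simp add: \<phi>_def inner_vec_def matrix_vector_mult_def G_inv_def sum_distrib_left mult_ac)
  have cG: "continuous_on (cball a r \<times> sphere 0 1) (\<lambda>z. G_inv c (fst z) i j)" for i j
    using A(3) by (intro continuous_on_compose2[OF Ck_on_continuous[OF Ck_on_G_inv[OF A(1)]]] continuous_intros) auto
  have "continuous_on (cball a r \<times> sphere 0 1) \<phi>"
    unfolding \<phi>_def by (intro continuous_intros cG)
  moreover have "compact (cball a r \<times> sphere (0 :: real ^ 'n) 1)" by (intro compact_Times) auto
  moreover have "cball a r \<times> sphere (0 :: real ^ 'n) 1 \<noteq> {}" using ne by simp
  ultimately obtain z where z: "z \<in> cball a r \<times> sphere 0 1" "\<And>y. y \<in> cball a r \<times> sphere 0 1 \<Longrightarrow> \<phi> z \<le> \<phi> y"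
    using continuous_attains_inf by metis
  have pd: "pos_def (matrix_inv (G c (param c x)))" if "x \<in> cball a r" for x
    using that A(1,3) by (intro pos_def_inv pos_def_G) auto
  have mpos: "\<phi> z > 0"
  proof -
    have "fst z \<in> cball a r" "snd z \<noteq> 0" using z(1) by auto
    then have "0 < \<phi> (fst z, snd z)" using pd[of "fst z"] unfolding \<phi>_eq pos_def_def by blast
    then show ?thesis by simp
  qed
  have grad: "grad_sq (\<lambda>x. f (param c x)) x \<le> inverse (\<phi> z) * gam c f f x" if x: "x \<in> cball a r" for x f
  proof -
    define v where "v = grad c f x"
    have gs: "grad_sq (\<lambda>x. f (param c x)) x = (norm v)\<^sup>2"
      unfolding grad_sq_def v_def grad_def power2_norm_eq_inner inner_vec_def pd_def
      by (simp add: power2_eq_square)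
    have g: "gam c f f x = v \<bullet> (matrix_inv (G c (param c x)) *v v)"
      by (simp add: gam_grad v_def inner_commute)
    have "\<phi> z * (norm v)\<^sup>2 \<le> gam c f f x"
    proof (cases "v = 0")
      case False
      then have "(x, (1 / norm v) *\<^sub>R v) \<in> cball a r \<times> sphere 0 1" using x by simp
      from z(2)[OF this] have "\<phi> z \<le> (1 / norm v)\<^sup>2 * gam c f f x"
        unfolding \<phi>_eq g by (simp add: matrix_vector_mult_scaleR power2_eq_square)
      then show ?thesis using False by (simp add: field_simps)
    qed (simp add: g)
    then show ?thesis unfolding gs using mpos by (simp add: field_simps)
  qed
  show thesis
    by (rule that[OF pos[OF x0(1)] pos[OF x1(1)] _ x0(2) x1(2) grad]) (use mpos in simp_all)
qed

lemma integrable_indicator_mult: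
  fixes f :: "'a \<Rightarrow> real"
  assumes "continuous_on UNIV f" "D \<in> sets borel"
  shows "integrable \<nu> (\<lambda>p. f p * indicator D p)"
  using integrable_real_mult_indicator[OF _ continuous_L2(2)[OF assms(1)], of D] assms(2) by simp

lemma l2_inner_indicator: "l2_inner \<nu> f (indicator D) = (\<integral>p. f p * indicator D p \<partial>\<nu>)"
  by (simp add: l2_inner_def)

text \<open>Expanding the square turns the double integral of \<open>(F p - F q)\<^sup>2\<close> into the quantity
  \<open>2 (\<nu>(D) \<integral> F\<^sup>2 - (\<integral> F)\<^sup>2)\<close> that the Poincare inequality is about. The inner integral is stated
  separately because it shows that the outer integrand is measurable.\<close>

lemma double_integral_sq_diff:
  fixes F :: "'a \<Rightarrow> real"
  assumes F: "continuous_on UNIV F" and D[measurable]: "D \<in> sets borel"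
  defines "m \<equiv> measure \<nu> D" and "S1 \<equiv> l2_inner \<nu> F (indicator D)" and "S2 \<equiv> \<integral>p. (F p)\<^sup>2 * indicator D p \<partial>\<nu>"
  shows "(\<integral>\<^sup>+q\<in>D. ennreal ((F p - F q)\<^sup>2) \<partial>\<nu>) = ennreal (m * (F p)\<^sup>2 - 2 * F p * S1 + S2)"
    "(\<integral>\<^sup>+p\<in>D. (\<integral>\<^sup>+q\<in>D. ennreal ((F p - F q)\<^sup>2) \<partial>\<nu>) \<partial>\<nu>) = ennreal (2 * (m * S2 - S1\<^sup>2))"
proof -
  have i1: "integrable \<nu> (\<lambda>p. F p * indicator D p)" by (rule integrable_indicator_mult[OF F D])
  have i2: "integrable \<nu> (\<lambda>p. (F p)\<^sup>2 * indicator D p)"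
    by (rule integrable_indicator_mult[OF _ D]) (intro continuous_intros F)
  have i0: "integrable \<nu> (\<lambda>p. indicator D p :: real)"
    using integrable_indicator_mult[OF continuous_on_const[of _ 1] D] by simp
  have e: "(\<integral>\<^sup>+q\<in>D. ennreal (g q) \<partial>\<nu>) = ennreal (\<integral>q. g q * indicator D q \<partial>\<nu>)"
    if "integrable \<nu> (\<lambda>q. g q * indicator D q)" "\<And>q. 0 \<le> g q" for g
  proof -
    have "(\<integral>\<^sup>+q\<in>D. ennreal (g q) \<partial>\<nu>) = (\<integral>\<^sup>+q. ennreal (g q * indicator D q) \<partial>\<nu>)"
      by (intro nn_integral_cong) (auto simp: indicator_def)
    also have "\<dots> = ennreal (\<integral>q. g q * indicator D q \<partial>\<nu>)"
      using that by (intro nn_integral_eq_integral) auto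
    finally show ?thesis .
  qed
  have inner: "integrable \<nu> (\<lambda>q. (F p - F q)\<^sup>2 * indicator D q)"
    "(\<integral>q. (F p - F q)\<^sup>2 * indicator D q \<partial>\<nu>) = m * (F p)\<^sup>2 - 2 * F p * S1 + S2" for p
  proof -
    have eq: "(\<lambda>q. (F p - F q)\<^sup>2 * indicator D q)
      = (\<lambda>q. (F p)\<^sup>2 * indicator D q - 2 * F p * (F q * indicator D q) + (F q)\<^sup>2 * indicator D q)"
      by (auto simp: fun_eq_iff power2_diff algebra_simps)
    show "integrable \<nu> (\<lambda>q. (F p - F q)\<^sup>2 * indicator D q)" unfolding eq using i0 i1 i2 by simp
    show "(\<integral>q. (F p - F q)\<^sup>2 * indicator D q \<partial>\<nu>) = m * (F p)\<^sup>2 - 2 * F p * S1 + S2"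
      unfolding eq using i0 i1 i2 by (simp add: m_def S1_def S2_def l2_inner_indicator)
  qed
  show 1: "(\<integral>\<^sup>+q\<in>D. ennreal ((F p - F q)\<^sup>2) \<partial>\<nu>) = ennreal (m * (F p)\<^sup>2 - 2 * F p * S1 + S2)" for p
    using e[OF inner(1), of p] inner(2)[of p] by simp
  have nn: "0 \<le> m * (F p)\<^sup>2 - 2 * F p * S1 + S2" for p
    unfolding inner(2)[symmetric] by (intro Bochner_Integration.integral_nonneg) simp
  have eq: "(\<lambda>p. (m * (F p)\<^sup>2 - 2 * F p * S1 + S2) * indicator D p)
      = (\<lambda>p. m * ((F p)\<^sup>2 * indicator D p) - 2 * S1 * (F p * indicator D p) + S2 * indicator D p)"
    by (auto simp: fun_eq_iff algebra_simps)
  have "integrable \<nu> (\<lambda>p. (m * (F p)\<^sup>2 - 2 * F p * S1 + S2) * indicator D p)"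
    unfolding eq using i0 i1 i2 by simp
  moreover have "(\<integral>p. (m * (F p)\<^sup>2 - 2 * F p * S1 + S2) * indicator D p \<partial>\<nu>) = 2 * (m * S2 - S1\<^sup>2)"
  proof -
    have "(\<integral>p. m * ((F p)\<^sup>2 * indicator D p) - 2 * S1 * (F p * indicator D p) + S2 * indicator D p \<partial>\<nu>)
      = m * (\<integral>p. (F p)\<^sup>2 * indicator D p \<partial>\<nu>) - 2 * S1 * (\<integral>p. F p * indicator D p \<partial>\<nu>) + S2 * m"
      using i0 i1 i2 by (simp add: m_def)
    also have "\<dots> = 2 * (m * S2 - S1\<^sup>2)"
      unfolding S2_def[symmetric] l2_inner_indicator[symmetric] S1_def[symmetric]
      by (simp add: power2_eq_square[of S1] algebra_simps)
    finally show ?thesis unfolding eq .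
  qed
  ultimately show "(\<integral>\<^sup>+p\<in>D. (\<integral>\<^sup>+q\<in>D. ennreal ((F p - F q)\<^sup>2) \<partial>\<nu>) \<partial>\<nu>) = ennreal (2 * (m * S2 - S1\<^sup>2))"
    unfolding 1 using e[OF _ nn] by simp
qed

text \<open>The convex set \<open>B\<close> and its diameter vary while the constant is fixed: only the ball enters into
  the constant, so the energy term becomes small with the diameter.\<close>

definition poincare_const :: "('a, 'n) chart \<Rightarrow> real ^ 'n \<Rightarrow> real \<Rightarrow> real \<Rightarrow> bool" where
  "poincare_const c a r C \<longleftrightarrow> 0 < C \<and> (\<forall>B \<delta> F. B \<in> sets borel \<longrightarrow> convex B \<longrightarrow> B \<subseteq> ball a r \<longrightarrow>
    (\<forall>x\<in>B. \<forall>y\<in>B. dist x y \<le> \<delta>) \<longrightarrow> smooth_fun \<A> F \<longrightarrow>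
    measure \<nu> (param c ` B) * (\<integral>p. (F p)\<^sup>2 * indicator (param c ` B) p \<partial>\<nu>)
    \<le> (l2_inner \<nu> F (indicator (param c ` B)))\<^sup>2
      + C * \<delta>\<^sup>2 * measure \<nu> (param c ` B) * (\<integral>p. \<Gamma> F F p * indicator (param c ` B) p \<partial>\<nu>))"

text \<open>Transport to the chart, where the density lies between two positive constants and the
  Euclidean gradient is controlled by \<open>\<Gamma>\<close>, and apply the inequality on convex sets.\<close>

lemma poincare_manifold:
  assumes ab: "admissible_ball c a r"
  shows "\<exists>C. poincare_const c a r C"
proof -
  note A = admissible_ballD[OF ab]
  obtain w\<^sub>0 w\<^sub>1 M where w: "0 < w\<^sub>0" "0 < w\<^sub>1" "0 < M" and w0: "\<And>x. x \<in> cball a r \<Longrightarrow> w\<^sub>0 \<le> dens c x"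
    and w1: "\<And>x. x \<in> cball a r \<Longrightarrow> dens c x \<le> w\<^sub>1"
    and M: "\<And>x f. x \<in> cball a r \<Longrightarrow> grad_sq (\<lambda>x. f (param c x)) x \<le> M * gam c f f x"
    using chart_bounds[OF ab] by blast
  define C where "C = w\<^sub>1 * w\<^sub>1 * 2 ^ CARD('n) * (1 / w\<^sub>0) * (M / w\<^sub>0)"
  have "poincare_const c a r C"
    unfolding poincare_const_def
  proof (intro conjI allI impI)
    show "0 < C" using w by (simp add: C_def)
    fix B \<delta> F
    assume B: "B \<in> sets borel" "convex B" "B \<subseteq> ball a r" and d': "\<forall>x\<in>B. \<forall>y\<in>B. dist x y \<le> \<delta>"
      and F: "smooth_fun \<A> F"
    have d: "\<And>x y. x \<in> B \<Longrightarrow> y \<in> B \<Longrightarrow> dist x y \<le> \<delta>" using d' by blast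
    define D where "D = param c ` B"
    have Bi: "B \<subseteq> chart_image c" and Bc: "B \<subseteq> cball a r" using B(3) A(4) ball_subset_cball by blast+
    have D[measurable]: "D \<in> sets borel" unfolding D_def by (rule param_image_measurable[OF A(1) B(1) Bi])
    have [measurable]: "B \<in> sets borel" by fact
    have cF: "continuous_on UNIV F" by (rule smooth_continuous[OF F])
    have Fm[measurable]: "F \<in> borel_measurable borel" using borel_measurable_continuous_onI[OF cF] .
    have cG: "continuous_on UNIV (\<Gamma> F F)" by (rule continuous_\<Gamma>[OF F F])
    have Gm[measurable]: "\<Gamma> F F \<in> borel_measurable borel" using borel_measurable_continuous_onI[OF cG] .
    define u where "u x = F (param c x)" for x
    have um[measurable]: "u \<in> borel_measurable borel"
      unfolding u_def using measurable_compose[OF measurable_param[OF A(1)] Fm] by simp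
    define m where "m = measure \<nu> D"
    define S1 where "S1 = l2_inner \<nu> F (indicator D)"
    define S2 where "S2 = (\<integral>p. (F p)\<^sup>2 * indicator D p \<partial>\<nu>)"
    define Q where "Q = (\<integral>p. \<Gamma> F F p * indicator D p \<partial>\<nu>)"
    note dbl = double_integral_sq_diff[OF cF D, folded m_def S1_def S2_def]
    have Q0: "0 \<le> Q" unfolding Q_def using \<Gamma>_nonneg by (intro Bochner_Integration.integral_nonneg) simp
    have eQ: "(\<integral>\<^sup>+p\<in>D. ennreal (\<Gamma> F F p) \<partial>\<nu>) = ennreal Q"
    proof -
      have "(\<integral>\<^sup>+p\<in>D. ennreal (\<Gamma> F F p) \<partial>\<nu>) = (\<integral>\<^sup>+p. ennreal (\<Gamma> F F p * indicator D p) \<partial>\<nu>)"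
        by (intro nn_integral_cong) (auto simp: indicator_def)
      also have "\<dots> = ennreal Q" unfolding Q_def
        using \<Gamma>_nonneg by (intro nn_integral_eq_integral integrable_indicator_mult[OF cG D]) auto
      finally show ?thesis .
    qed
    have em: "ennreal m = emeasure \<nu> D" by (simp add: m_def \<nu>.emeasure_eq_measure)
    have vol: "ennreal w\<^sub>0 * emeasure lborel B \<le> ennreal m"
    proof -
      have "ennreal w\<^sub>0 * emeasure lborel B = (\<integral>\<^sup>+x. ennreal w\<^sub>0 * indicator B x \<partial>lborel)"
        by (rule nn_integral_cmult_indicator[symmetric]) simp
      also have "\<dots> \<le> (\<integral>\<^sup>+x\<in>B. ennreal (dens c x) * 1 \<partial>lborel)"
        using w0 Bc by (intro nn_integral_mono) (auto simp: indicator_def intro!: ennreal_leI)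
      also have "\<dots> = (\<integral>\<^sup>+p\<in>D. 1 \<partial>\<nu>)"
        unfolding D_def by (rule nn_integral_param_image[OF A(1) B(1) Bi, symmetric]) simp
      also have "\<dots> = ennreal m" by (simp add: em)
      finally show ?thesis .
    qed
    have gradb: "(\<integral>\<^sup>+x\<in>B. ennreal (grad_sq u x) \<partial>lborel) \<le> ennreal (M / w\<^sub>0) * ennreal Q"
    proof -
      have "(\<integral>\<^sup>+x\<in>B. ennreal (grad_sq u x) \<partial>lborel)
          \<le> (\<integral>\<^sup>+x. ennreal (M / w\<^sub>0) * (ennreal (dens c x) * ennreal (\<Gamma> F F (param c x)) * indicator B x) \<partial>lborel)"
      proof (rule nn_integral_mono)
        fix x
        show "ennreal (grad_sq u x) * indicator B x
          \<le> ennreal (M / w\<^sub>0) * (ennreal (dens c x) * ennreal (\<Gamma> F F (param c x)) * indicator B x)"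
        proof (cases "x \<in> B")
          case True
          then have x: "x \<in> cball a r" "x \<in> chart_image c" using Bc Bi by auto
          have g: "\<Gamma> F F (param c x) = gam c F F x"
            using \<Gamma>_chart[OF F F A(1), of "param c x"] x(2) A(1) by simp
          have "grad_sq u x \<le> M * gam c F F x" unfolding u_def by (rule M[OF x(1)])
          also have "\<dots> \<le> M / w\<^sub>0 * (dens c x * gam c F F x)"
          proof -
            have "w\<^sub>0 * gam c F F x \<le> dens c x * gam c F F x"
              using w0[OF x(1)] gam_nonneg[OF A(1) x(2)] by (intro mult_right_mono)
            then have "M * (w\<^sub>0 * gam c F F x) \<le> M * (dens c x * gam c F F x)" using w(3) by (intro mult_left_mono) auto
            then show ?thesis using w(1) by (simp add: field_simps)
          qed
          finally have "ennreal (grad_sq u x) \<le> ennreal (M / w\<^sub>0 * (dens c x * gam c F F x))" by (rule ennreal_leI)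
          also have "\<dots> = ennreal (M / w\<^sub>0) * (ennreal (dens c x) * ennreal (gam c F F x))"
            using w dens_nonneg[OF A(1), of x] gam_nonneg[OF A(1) x(2), of F] by (simp add: ennreal_mult[symmetric])
          finally show ?thesis using True by (simp add: g)
        qed simp
      qed
      also have "\<dots> = ennreal (M / w\<^sub>0) * (\<integral>\<^sup>+x\<in>B. ennreal (dens c x) * ennreal (\<Gamma> F F (param c x)) \<partial>lborel)"
        using A(1) measurable_compose[OF measurable_param[OF A(1)] Gm] measurable_dens[OF A(1)]
        by (intro nn_integral_cmult borel_measurable_times_ennreal borel_measurable_indicator) simp_all
      also have "(\<integral>\<^sup>+x\<in>B. ennreal (dens c x) * ennreal (\<Gamma> F F (param c x)) \<partial>lborel) = (\<integral>\<^sup>+p\<in>D. ennreal (\<Gamma> F F p) \<partial>\<nu>)"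
        unfolding D_def by (rule nn_integral_param_image[OF A(1) B(1) Bi, symmetric]) simp
      finally show ?thesis unfolding eQ .
    qed
    define g where "g p = (\<integral>\<^sup>+q\<in>D. ennreal ((F p - F q)\<^sup>2) \<partial>\<nu>)" for p
    have gm: "g \<in> borel_measurable borel" unfolding g_def dbl(1) by measurable
    have gB: "g (param c x) \<le> (\<integral>\<^sup>+y. ennreal w\<^sub>1 * (ennreal ((u x - u y)\<^sup>2) * indicator B y) \<partial>lborel)" for x
    proof -
      have "g (param c x) = (\<integral>\<^sup>+y\<in>B. ennreal (dens c y) * ennreal ((u x - u y)\<^sup>2) \<partial>lborel)"
        unfolding g_def D_def u_def by (rule nn_integral_param_image[OF A(1) B(1) Bi]) measurable
      also have "\<dots> \<le> (\<integral>\<^sup>+y. ennreal w\<^sub>1 * (ennreal ((u x - u y)\<^sup>2) * indicator B y) \<partial>lborel)"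
      proof (rule nn_integral_mono)
        fix y
        show "ennreal (dens c y) * ennreal ((u x - u y)\<^sup>2) * indicator B y
          \<le> ennreal w\<^sub>1 * (ennreal ((u x - u y)\<^sup>2) * indicator B y)"
          using w1[of y] Bc by (cases "y \<in> B") (auto intro!: mult_right_mono ennreal_leI)
      qed
      finally show ?thesis .
    qed
    have "ennreal (2 * (m * S2 - S1\<^sup>2)) = (\<integral>\<^sup>+p\<in>D. g p \<partial>\<nu>)" unfolding g_def dbl(2) ..
    also have "\<dots> = (\<integral>\<^sup>+x\<in>B. ennreal (dens c x) * g (param c x) \<partial>lborel)"
      unfolding D_def by (rule nn_integral_param_image[OF A(1) B(1) Bi gm])
    also have "\<dots> \<le> (\<integral>\<^sup>+x. ennreal w\<^sub>1 * ennreal w\<^sub>1 * ((\<integral>\<^sup>+y\<in>B. ennreal ((u x - u y)\<^sup>2) \<partial>lborel) * indicator B x) \<partial>lborel)"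
    proof (rule nn_integral_mono)
      fix x
      have "ennreal (dens c x) * g (param c x) * indicator B x
        \<le> ennreal w\<^sub>1 * (\<integral>\<^sup>+y. ennreal w\<^sub>1 * (ennreal ((u x - u y)\<^sup>2) * indicator B y) \<partial>lborel) * indicator B x"
        using w1[of x] Bc gB[of x] by (cases "x \<in> B") (auto intro!: mult_mono ennreal_leI)
      also have "(\<integral>\<^sup>+y. ennreal w\<^sub>1 * (ennreal ((u x - u y)\<^sup>2) * indicator B y) \<partial>lborel)
        = ennreal w\<^sub>1 * (\<integral>\<^sup>+y\<in>B. ennreal ((u x - u y)\<^sup>2) \<partial>lborel)"
        by (intro nn_integral_cmult) measurable
      finally show "ennreal (dens c x) * g (param c x) * indicator B x
        \<le> ennreal w\<^sub>1 * ennreal w\<^sub>1 * ((\<integral>\<^sup>+y\<in>B. ennreal ((u x - u y)\<^sup>2) \<partial>lborel) * indicator B x)"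
        by (simp add: mult.assoc)
    qed
    also have "\<dots> = ennreal w\<^sub>1 * ennreal w\<^sub>1 * (\<integral>\<^sup>+x\<in>B. (\<integral>\<^sup>+y\<in>B. ennreal ((u x - u y)\<^sup>2) \<partial>lborel) \<partial>lborel)"
      by (intro nn_integral_cmult) measurable
    also have "\<dots> \<le> ennreal w\<^sub>1 * ennreal w\<^sub>1 *
        (ennreal (2 ^ CARD('n) * \<delta>\<^sup>2) * emeasure lborel B * (\<integral>\<^sup>+x\<in>B. ennreal (grad_sq u x) \<partial>lborel))"
      unfolding u_def
      by (intro mult_left_mono poincare_convex[OF open_chart(2)[OF A(1)] smooth_funD[OF F A(1)] Bi B(2) B(1) d]) auto
    also have "\<dots> \<le> ennreal w\<^sub>1 * ennreal w\<^sub>1 *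
        (ennreal (2 ^ CARD('n) * \<delta>\<^sup>2) * (ennreal (1 / w\<^sub>0) * ennreal m) * (ennreal (M / w\<^sub>0) * ennreal Q))"
    proof (intro mult_left_mono mult_mono gradb)
      have "emeasure lborel B = ennreal (1 / w\<^sub>0) * (ennreal w\<^sub>0 * emeasure lborel B)"
        using w(1) by (simp add: mult.assoc[symmetric] ennreal_mult[symmetric])
      also have "\<dots> \<le> ennreal (1 / w\<^sub>0) * ennreal m" by (intro mult_left_mono vol) simp
      finally show "emeasure lborel B \<le> ennreal (1 / w\<^sub>0) * ennreal m" .
    qed auto
    also have "\<dots> = ennreal (C * \<delta>\<^sup>2 * m * Q)"
      using w Q0 by (simp add: C_def ennreal_mult[symmetric] m_def mult_ac)
    finally have "ennreal (2 * (m * S2 - S1\<^sup>2)) \<le> ennreal (C * \<delta>\<^sup>2 * m * Q)" .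
    moreover have nn: "0 \<le> C * \<delta>\<^sup>2 * m * Q"
      using w Q0 by (auto simp: C_def m_def intro!: mult_nonneg_nonneg)
    ultimately have "2 * (m * S2 - S1\<^sup>2) \<le> C * \<delta>\<^sup>2 * m * Q" by (simp add: ennreal_le_iff)
    then have "m * S2 \<le> S1\<^sup>2 + C * \<delta>\<^sup>2 * m * Q" using nn by argo
    then show "measure \<nu> (param c ` B) * (\<integral>p. (F p)\<^sup>2 * indicator (param c ` B) p \<partial>\<nu>)
      \<le> (l2_inner \<nu> F (indicator (param c ` B)))\<^sup>2
        + C * \<delta>\<^sup>2 * measure \<nu> (param c ` B) * (\<integral>p. \<Gamma> F F p * indicator (param c ` B) p \<partial>\<nu>)"
      unfolding m_def S1_def S2_def Q_def D_def .
  qed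
  then show ?thesis ..
qed

lemma poincare_constD:
  assumes "poincare_const c a r C" "B \<in> sets borel" "convex B" "B \<subseteq> ball a r"
    "\<And>x y. x \<in> B \<Longrightarrow> y \<in> B \<Longrightarrow> dist x y \<le> \<delta>" "smooth_fun \<A> F"
  shows "measure \<nu> (param c ` B) * (\<integral>p. (F p)\<^sup>2 * indicator (param c ` B) p \<partial>\<nu>)
    \<le> (l2_inner \<nu> F (indicator (param c ` B)))\<^sup>2
      + C * \<delta>\<^sup>2 * measure \<nu> (param c ` B) * (\<integral>p. \<Gamma> F F p * indicator (param c ` B) p \<partial>\<nu>)"
  using assms unfolding poincare_const_def by blast

end

section \<open>Compactness and connectedness\<close>

text \<open>The half-open cubes of side \<open>s\<close> with corners on a lattice. They partition the space, so that
  integrals over the pieces of a ball add up to the integral over the ball.\<close>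

definition cell :: "real \<Rightarrow> ('n \<Rightarrow> int) \<Rightarrow> (real ^ 'n::finite) set" where
  "cell s k = {x. \<forall>i. s * k i \<le> x $ i \<and> x $ i < s * (k i + 1)}"

lemma cell_unique: "s > 0 \<Longrightarrow> x \<in> cell s k \<longleftrightarrow> k = (\<lambda>i. \<lfloor>x $ i / s\<rfloor>)"
  by (auto simp: cell_def fun_eq_iff floor_eq_iff field_simps eq_commute[of "k _"])

lemma cell_borel: "cell s k \<in> sets borel"
proof -
  have "cell s k = (\<Inter>i\<in>UNIV. {x. s * k i \<le> x $ i} \<inter> {x. x $ i < s * (k i + 1)})" by (auto simp: cell_def)
  also have "\<dots> \<in> sets borel"
    by (intro sets.finite_INT sets.Int borel_closed closed_Collect_le borel_open open_Collect_less continuous_intros) auto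
  finally show ?thesis .
qed

lemma convex_cell: "convex (cell s k)"
proof -
  have "cell s k = (\<Inter>i. {x. axis i 1 \<bullet> x \<ge> s * k i} \<inter> {x. axis i 1 \<bullet> x < s * (k i + 1)})"
    by (auto simp: cell_def inner_axis' )
  then show ?thesis
    by (simp only:) (intro convex_INT convex_Int convex_halfspace_ge convex_halfspace_lt)
qed

lemma cell_dist:
  fixes x :: "real ^ 'n::finite"
  assumes "x \<in> cell s k" "y \<in> cell s k"
  shows "dist x y \<le> real CARD('n) * s"
proof -
  have "\<bar>(x - y) $ i\<bar> \<le> s" for i
  proof -
    have "s * k i \<le> x $ i" "x $ i < s * k i + s" "s * k i \<le> y $ i" "y $ i < s * k i + s"
      using assms by (auto simp: cell_def algebra_simps)
    then show ?thesis by (simp add: abs_le_iff)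
  qed
  then have "(\<Sum>i\<in>UNIV. \<bar>(x - y) $ i\<bar>) \<le> (\<Sum>i\<in>(UNIV :: 'n set). s)" by (intro sum_mono)
  then show ?thesis unfolding dist_norm using norm_le_l1_cart[of "x - y"] by simp
qed

lemma finite_cells_ball:
  fixes a :: "real ^ 'n::finite"
  assumes s: "s > 0"
  shows "finite {k. ball a r \<inter> cell s k \<noteq> {}}"
proof -
  define L where "L = \<lceil>(norm a + r) / s\<rceil> + 1"
  have "{k. ball a r \<inter> cell s k \<noteq> {}} \<subseteq> PiE UNIV (\<lambda>_. {- L..L})"
  proof
    fix k assume "k \<in> {k. ball a r \<inter> cell s k \<noteq> {}}"
    then obtain x where x: "x \<in> ball a r" "x \<in> cell s k" by blast
    have "\<bar>x $ i\<bar> < norm a + r" for i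
    proof -
      have "\<bar>x $ i\<bar> \<le> norm x" by (rule component_le_norm_cart)
      moreover have "norm x \<le> norm a + dist a x"
        using norm_triangle_ineq[of a "x - a"] by (simp add: dist_norm norm_minus_commute)
      ultimately show ?thesis using x(1) by simp
    qed
    then have b: "\<bar>x $ i / s\<bar> < (norm a + r) / s" for i
      using s by (simp add: divide_strict_right_mono)
    have "k i \<in> {- L..L}" for i
    proof -
      have ki: "k i = \<lfloor>x $ i / s\<rfloor>" by (rule fun_cong[OF iffD1[OF cell_unique[OF s] x(2)]])
      have "\<lfloor>x $ i / s\<rfloor> \<le> \<lceil>(norm a + r) / s\<rceil>" using b[of i] by linarith
      moreover have "- \<lceil>(norm a + r) / s\<rceil> - 1 \<le> \<lfloor>x $ i / s\<rfloor>" using b[of i] by linarith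
      ultimately show ?thesis unfolding ki L_def by simp
    qed
    then show "k \<in> PiE UNIV (\<lambda>_. {- L..L})" by (simp add: PiE_UNIV_domain)
  qed
  then show ?thesis by (rule finite_subset) (intro finite_PiE, auto)
qed

context riemannian
begin

lemma l2_norm_sq_integral: "f \<in> L2 \<nu> \<Longrightarrow> (l2_norm \<nu> f)\<^sup>2 = (\<integral>p. (f p)\<^sup>2 \<partial>\<nu>)"
  by (subst l2.nrm_sq) (auto simp: l2_inner_def power2_eq_square)

text \<open>Cut finitely many coordinate balls covering the manifold into small cells. On each cell the
  Poincare inequality controls the square integral by the mean and a small multiple of the energy.\<close>

theorem compactness:
  assumes \<epsilon>: "\<epsilon> > 0"
  obtains E C where "finite E" "E \<subseteq> L2 \<nu>" "0 \<le> C"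
    "\<And>F. smooth_fun \<A> F \<Longrightarrow> (l2_norm \<nu> F)\<^sup>2 \<le> C * (\<Sum>e\<in>E. (l2_inner \<nu> F e)\<^sup>2) + \<epsilon> * (\<integral>p. \<Gamma> F F p \<partial>\<nu>)"
proof -
  obtain I :: "'a set" and c a r where I: "finite I" and ab: "\<And>p. admissible_ball (c p) (a p) (r p)"
    and cov: "\<And>q. \<exists>p\<in>I. q \<in> param (c p) ` ball (a p) (r p)"
    by (rule admissible_cover) blast
  obtain Cp where Cpc: "\<And>p. poincare_const (c p) (a p) (r p) (Cp p)"
    using poincare_manifold[OF ab] by metis
  have Cp: "Cp p > 0" for p using Cpc[of p] by (simp add: poincare_const_def)
  define n where "n = real CARD('n)"
  have n: "n > 0" by (simp add: n_def)
  define Cm where "Cm = (\<Sum>p\<in>I. Cp p)"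
  have Cm: "0 \<le> Cm" using Cp by (auto simp: Cm_def less_imp_le intro: sum_nonneg)
  define s where "s = sqrt (\<epsilon> / (Cm + 1)) / n"
  have s: "s > 0" using \<epsilon> Cm n by (simp add: s_def)
  have ns: "Cm * (n * s)\<^sup>2 \<le> \<epsilon>"
  proof -
    have "(n * s)\<^sup>2 = \<epsilon> / (Cm + 1)" using \<epsilon> Cm n by (simp add: s_def)
    moreover have "Cm * (\<epsilon> / (Cm + 1)) \<le> \<epsilon>" using \<epsilon> Cm by (simp add: field_simps)
    ultimately show ?thesis by simp
  qed
  define Kp where "Kp p = {k. ball (a p) (r p) \<inter> cell s k \<noteq> {}}" for p
  have Kp: "finite (Kp p)" for p unfolding Kp_def by (rule finite_cells_ball[OF s])
  define B where "B p k = ball (a p) (r p) \<inter> cell s k" for p k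
  define D where "D p k = param (c p) ` B p k" for p k
  have Bb: "B p k \<in> sets borel" for p k unfolding B_def using cell_borel by (intro sets.Int) auto
  have Bs: "B p k \<subseteq> ball (a p) (r p)" for p k by (simp add: B_def)
  note A = admissible_ballD[OF ab]
  have Bi: "B p k \<subseteq> chart_image (c p)" for p k using Bs A(4) by blast
  have D: "D p k \<in> sets borel" for p k unfolding D_def by (rule param_image_measurable[OF A(1) Bb Bi])
  have D_at: "q \<in> D p k \<longleftrightarrow> q \<in> fst (c p) \<and> coords (c p) q \<in> ball (a p) (r p) \<and> k = (\<lambda>i. \<lfloor>coords (c p) q $ i / s\<rfloor>)" for p k q
  proof
    assume "q \<in> D p k"
    then obtain x where "x \<in> B p k" "q = param (c p) x" unfolding D_def by blast
    moreover from this have "x \<in> chart_image (c p)" using Bi by blast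
    ultimately show "q \<in> fst (c p) \<and> coords (c p) q \<in> ball (a p) (r p) \<and> k = (\<lambda>i. \<lfloor>coords (c p) q $ i / s\<rfloor>)"
      using A(1) cell_unique[OF s, of x k] by (simp add: B_def)
  next
    assume q: "q \<in> fst (c p) \<and> coords (c p) q \<in> ball (a p) (r p) \<and> k = (\<lambda>i. \<lfloor>coords (c p) q $ i / s\<rfloor>)"
    then have "coords (c p) q \<in> B p k" using cell_unique[OF s, of "coords (c p) q" k] by (simp add: B_def)
    moreover have "q = param (c p) (coords (c p) q)" using q A(1) by simp
    ultimately show "q \<in> D p k" unfolding D_def by (intro image_eqI)
  qed
  have sum_le: "(\<Sum>k\<in>Kp p. indicator (D p k) q) \<le> (1::real)" for p q
  proof -
    have "(\<Sum>k\<in>Kp p. indicator (D p k) q :: real) \<le> (\<Sum>k\<in>Kp p. if k = (\<lambda>i. \<lfloor>coords (c p) q $ i / s\<rfloor>) then 1 else 0)"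
      by (intro sum_mono) (auto simp: indicator_def D_at)
    also have "\<dots> \<le> 1" using Kp by (simp add: sum.delta)
    finally show ?thesis .
  qed
  have sum_ge: "1 \<le> (\<Sum>p\<in>I. \<Sum>k\<in>Kp p. indicator (D p k) q :: real)" for q
  proof -
    obtain p where p: "p \<in> I" "q \<in> param (c p) ` ball (a p) (r p)" using cov by blast
    then obtain x where x: "x \<in> ball (a p) (r p)" "q = param (c p) x" by blast
    have xi: "x \<in> chart_image (c p)" using x(1) A(4) by blast
    define k where "k = (\<lambda>i. \<lfloor>x $ i / s\<rfloor>)"
    have qD: "q \<in> D p k" using x xi A(1) by (simp add: D_at k_def)
    have "x \<in> cell s k" unfolding cell_unique[OF s] k_def ..
    then have kK: "k \<in> Kp p" using x(1) unfolding Kp_def by blast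
    have "1 = (indicator (D p k) q :: real)" using qD by simp
    also have "\<dots> \<le> (\<Sum>k\<in>Kp p. indicator (D p k) q)" using kK Kp by (intro member_le_sum) auto
    also have "\<dots> \<le> (\<Sum>p\<in>I. \<Sum>k\<in>Kp p. indicator (D p k) q)"
      using p I by (intro member_le_sum[of p I "\<lambda>p. \<Sum>k\<in>Kp p. indicator (D p k) q"]) (auto intro: sum_nonneg)
    finally show ?thesis .
  qed
  \<comment> \<open>a cell of measure zero gets the weight \<open>inverse 0 = 0\<close>; it contributes nothing to the norm\<close>
  define w where "w p k = inverse (measure \<nu> (D p k))" for p k
  have w0: "0 \<le> w p k" for p k by (simp add: w_def)
  define E where "E = (\<Union>p\<in>I. (\<lambda>k. indicator (D p k) :: 'a \<Rightarrow> real) ` Kp p)"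
  define C where "C = (\<Sum>p\<in>I. \<Sum>k\<in>Kp p. w p k)"
  show thesis
  proof (rule that[of E C])
    show "finite E" unfolding E_def using I Kp by auto
    show "E \<subseteq> L2 \<nu>"
    proof -
      have "indicator (D p k) \<in> L2 \<nu>" for p k
        using D by (intro \<nu>.L2_bounded[where B=1]) (auto simp: indicator_def)
      then show ?thesis unfolding E_def by blast
    qed
    show "0 \<le> C" unfolding C_def using w0 by (intro sum_nonneg)
    fix F assume F: "smooth_fun \<A> F"
    have cF: "continuous_on UNIV (\<lambda>p. (F p)\<^sup>2)" by (intro continuous_intros smooth_continuous F)
    have cG: "continuous_on UNIV (\<Gamma> F F)" by (rule continuous_\<Gamma>[OF F F])
    define S2 where "S2 p k = (\<integral>q. (F q)\<^sup>2 * indicator (D p k) q \<partial>\<nu>)" for p k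
    define Q where "Q p k = (\<integral>q. \<Gamma> F F q * indicator (D p k) q \<partial>\<nu>)" for p k
    have iF: "integrable \<nu> (\<lambda>q. (F q)\<^sup>2 * indicator (D p k) q)" for p k by (rule integrable_indicator_mult[OF cF D])
    have iG: "integrable \<nu> (\<lambda>q. \<Gamma> F F q * indicator (D p k) q)" for p k by (rule integrable_indicator_mult[OF cG D])
    have Q0: "0 \<le> Q p k" for p k unfolding Q_def using \<Gamma>_nonneg by (intro Bochner_Integration.integral_nonneg) simp
    have piece: "S2 p k \<le> w p k * (l2_inner \<nu> F (indicator (D p k)))\<^sup>2 + Cp p * (n * s)\<^sup>2 * Q p k" for p k
    proof -
      have P: "measure \<nu> (D p k) * S2 p k \<le> (l2_inner \<nu> F (indicator (D p k)))\<^sup>2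
        + Cp p * (n * s)\<^sup>2 * measure \<nu> (D p k) * Q p k"
        unfolding D_def S2_def Q_def
      proof (rule poincare_constD[OF Cpc Bb _ Bs _ F])
        show "convex (B p k)" unfolding B_def by (intro convex_Int convex_ball convex_cell)
        show "dist x y \<le> n * s" if "x \<in> B p k" "y \<in> B p k" for x y
          using that cell_dist[of x s k y] by (simp add: B_def n_def)
      qed
      show ?thesis
      proof (cases "measure \<nu> (D p k) = 0")
        case True
        then have "emeasure \<nu> (D p k) = 0" by (simp add: \<nu>.emeasure_eq_measure)
        then have "AE q in \<nu>. q \<notin> D p k"
          using D by (subst AE_iff_measurable[of "D p k"]) auto
        then have "AE q in \<nu>. (F q)\<^sup>2 * indicator (D p k) q = 0" by eventually_elim simp
        then have "S2 p k = 0" unfolding S2_def by (intro integral_eq_zero_AE)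
        then show ?thesis using w0 Cp[of p] Q0[of p k] by (simp add: less_imp_le)
      next
        case False
        then have m: "measure \<nu> (D p k) > 0" using measure_nonneg[of \<nu> "D p k"] by linarith
        have "S2 p k = w p k * (measure \<nu> (D p k) * S2 p k)" using m by (simp add: w_def)
        also have "\<dots> \<le> w p k * ((l2_inner \<nu> F (indicator (D p k)))\<^sup>2 + Cp p * (n * s)\<^sup>2 * measure \<nu> (D p k) * Q p k)"
          by (intro mult_left_mono P w0)
        also have "\<dots> = w p k * (l2_inner \<nu> F (indicator (D p k)))\<^sup>2 + Cp p * (n * s)\<^sup>2 * Q p k"
          using m by (simp add: w_def field_simps)
        finally show ?thesis .
      qed
    qed
    have "(l2_norm \<nu> F)\<^sup>2 = (\<integral>q. (F q)\<^sup>2 \<partial>\<nu>)" by (rule l2_norm_sq_integral[OF smooth_L2[OF F]])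
    also have "\<dots> \<le> (\<integral>q. (\<Sum>p\<in>I. \<Sum>k\<in>Kp p. (F q)\<^sup>2 * indicator (D p k) q) \<partial>\<nu>)"
    proof (rule integral_mono)
      show "integrable \<nu> (\<lambda>q. (F q)\<^sup>2)" by (rule continuous_L2(2)[OF cF])
      show "integrable \<nu> (\<lambda>q. \<Sum>p\<in>I. \<Sum>k\<in>Kp p. (F q)\<^sup>2 * indicator (D p k) q)"
        by (intro Bochner_Integration.integrable_sum iF)
      show "(F q)\<^sup>2 \<le> (\<Sum>p\<in>I. \<Sum>k\<in>Kp p. (F q)\<^sup>2 * indicator (D p k) q)" for q
        using mult_left_mono[OF sum_ge[of q], of "(F q)\<^sup>2"] by (simp add: sum_distrib_left)
    qed
    also have "\<dots> = (\<Sum>p\<in>I. \<Sum>k\<in>Kp p. S2 p k)"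
      unfolding S2_def using iF by (simp add: Bochner_Integration.integral_sum Bochner_Integration.integrable_sum)
    also have "\<dots> \<le> (\<Sum>p\<in>I. \<Sum>k\<in>Kp p. w p k * (l2_inner \<nu> F (indicator (D p k)))\<^sup>2 + Cp p * (n * s)\<^sup>2 * Q p k)"
      by (intro sum_mono piece)
    also have "\<dots> = (\<Sum>p\<in>I. \<Sum>k\<in>Kp p. w p k * (l2_inner \<nu> F (indicator (D p k)))\<^sup>2)
        + (\<Sum>p\<in>I. Cp p * (n * s)\<^sup>2 * (\<Sum>k\<in>Kp p. Q p k))"
      by (simp add: sum.distrib sum_distrib_left)
    also have "\<dots> \<le> C * (\<Sum>e\<in>E. (l2_inner \<nu> F e)\<^sup>2) + \<epsilon> * (\<integral>p. \<Gamma> F F p \<partial>\<nu>)"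
    proof (rule add_mono)
      have fE: "finite E" unfolding E_def using I Kp by auto
      have "w p k * (l2_inner \<nu> F (indicator (D p k)))\<^sup>2 \<le> w p k * (\<Sum>e\<in>E. (l2_inner \<nu> F e)\<^sup>2)"
        if "p \<in> I" "k \<in> Kp p" for p k
        using that fE w0 by (intro mult_left_mono member_le_sum[of _ E "\<lambda>e. (l2_inner \<nu> F e)\<^sup>2"]) (auto simp: E_def)
      then show "(\<Sum>p\<in>I. \<Sum>k\<in>Kp p. w p k * (l2_inner \<nu> F (indicator (D p k)))\<^sup>2) \<le> C * (\<Sum>e\<in>E. (l2_inner \<nu> F e)\<^sup>2)"
        unfolding C_def sum_distrib_right by (intro sum_mono) auto
      have q0: "0 \<le> (\<integral>p. \<Gamma> F F p \<partial>\<nu>)" using \<Gamma>_nonneg by (intro Bochner_Integration.integral_nonneg) simp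
      have Qs: "(\<Sum>k\<in>Kp p. Q p k) \<le> (\<integral>p. \<Gamma> F F p \<partial>\<nu>)" for p
      proof -
        have "(\<Sum>k\<in>Kp p. Q p k) = (\<integral>q. (\<Sum>k\<in>Kp p. \<Gamma> F F q * indicator (D p k) q) \<partial>\<nu>)"
          unfolding Q_def using iG by (simp add: Bochner_Integration.integral_sum)
        also have "\<dots> \<le> (\<integral>p. \<Gamma> F F p \<partial>\<nu>)"
        proof (rule integral_mono)
          show "integrable \<nu> (\<lambda>q. \<Sum>k\<in>Kp p. \<Gamma> F F q * indicator (D p k) q)"
            by (intro Bochner_Integration.integrable_sum iG)
          show "(\<Sum>k\<in>Kp p. \<Gamma> F F q * indicator (D p k) q) \<le> \<Gamma> F F q" for q
            using mult_left_mono[OF sum_le[of p q] \<Gamma>_nonneg[of F q]] by (simp add: sum_distrib_left)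
        qed (rule continuous_L2(2)[OF cG])
        finally show ?thesis .
      qed
      have "(\<Sum>p\<in>I. Cp p * (n * s)\<^sup>2 * (\<Sum>k\<in>Kp p. Q p k)) \<le> (\<Sum>p\<in>I. Cp p * (n * s)\<^sup>2 * (\<integral>p. \<Gamma> F F p \<partial>\<nu>))"
        using Cp by (intro sum_mono mult_left_mono Qs) (simp add: less_imp_le)
      also have "\<dots> = Cm * (n * s)\<^sup>2 * (\<integral>p. \<Gamma> F F p \<partial>\<nu>)" by (simp add: Cm_def sum_distrib_right)
      also have "\<dots> \<le> \<epsilon> * (\<integral>p. \<Gamma> F F p \<partial>\<nu>)" by (intro mult_right_mono ns q0)
      finally show "(\<Sum>p\<in>I. Cp p * (n * s)\<^sup>2 * (\<Sum>k\<in>Kp p. Q p k)) \<le> \<epsilon> * (\<integral>p. \<Gamma> F F p \<partial>\<nu>)" .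
    qed
    finally show "(l2_norm \<nu> F)\<^sup>2 \<le> C * (\<Sum>e\<in>E. (l2_inner \<nu> F e)\<^sup>2) + \<epsilon> * (\<integral>p. \<Gamma> F F p \<partial>\<nu>)" .
  qed
qed

text \<open>On a coordinate ball, vanishing energy turns the Poincare inequality into the equality case of the
  Cauchy-Schwarz inequality between \<open>f\<close> and the constants.\<close>

lemma zero_energy_local:
  assumes ab: "admissible_ball c a r"
    and f: "f \<in> L2 \<nu>" and F: "\<And>k. smooth_fun \<A> (F k)"
    and lim: "(\<lambda>k. l2_norm \<nu> (\<lambda>p. F k p - f p)) \<longlonglongrightarrow> 0"
    and energy: "(\<lambda>k. \<integral>p. \<Gamma> (F k) (F k) p \<partial>\<nu>) \<longlonglongrightarrow> 0"
  shows "\<exists>b. AE p in \<nu>. p \<in> param c ` ball a r \<longrightarrow> f p = b"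
proof -
  note A = admissible_ballD[OF ab]
  define D where "D = param c ` ball a r"
  have D: "D \<in> sets borel" "open D" using A(7) by (auto simp: D_def)
  obtain C where C: "poincare_const c a r C" using poincare_manifold[OF ab] ..
  define m where "m = measure \<nu> D"
  have m: "m > 0"
  proof -
    have "param c a \<in> D" using A(2) by (auto simp: D_def)
    then show ?thesis unfolding m_def by (rule \<nu>_open_pos[OF D(2)])
  qed
  have oneL: "indicator D \<in> L2 \<nu>" using D by (intro \<nu>.L2_bounded[where B=1]) (auto simp: indicator_def)
  have FL: "F k \<in> L2 \<nu>" for k by (rule smooth_L2[OF F])
  have cutL: "(\<lambda>p. g p * indicator D p) \<in> L2 \<nu>" and cut_le: "l2_norm \<nu> (\<lambda>p. g p * indicator D p) \<le> l2_norm \<nu> g"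
    if g: "g \<in> L2 \<nu>" for g
  proof -
    have gm[measurable]: "g \<in> borel_measurable borel" and ig: "integrable \<nu> (\<lambda>p. (g p)\<^sup>2)" using g by (auto simp: L2_def)
    have "(\<lambda>p. (g p * indicator D p)\<^sup>2) = (\<lambda>p. (g p)\<^sup>2 * indicator D p)" by (auto simp: fun_eq_iff indicator_def)
    then have i: "integrable \<nu> (\<lambda>p. (g p * indicator D p)\<^sup>2)"
      using integrable_real_mult_indicator[OF _ ig, of D] D by simp
    then show L: "(\<lambda>p. g p * indicator D p) \<in> L2 \<nu>" using D by (simp add: L2_def)
    have "(l2_norm \<nu> (\<lambda>p. g p * indicator D p))\<^sup>2 \<le> (l2_norm \<nu> g)\<^sup>2"
      unfolding l2_norm_sq_integral[OF L] l2_norm_sq_integral[OF g]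
      by (intro integral_mono i ig) (auto simp: indicator_def)
    then show "l2_norm \<nu> (\<lambda>p. g p * indicator D p) \<le> l2_norm \<nu> g"
      by (rule power2_le_imp_le) (rule l2.nrm_nonneg[OF g])
  qed
  define S1 where "S1 = l2_inner \<nu> f (indicator D)"
  define N where "N = l2_norm \<nu> (\<lambda>p. f p * indicator D p)"
  have limN: "(\<lambda>k. l2_norm \<nu> (\<lambda>p. F k p * indicator D p)) \<longlonglongrightarrow> N"
  proof (rule LIM_zero_cancel, rule Lim_null_comparison[OF _ lim], rule always_eventually, rule allI)
    fix k
    have "\<bar>l2_norm \<nu> (\<lambda>p. F k p * indicator D p) - N\<bar> \<le> l2_norm \<nu> (\<lambda>p. F k p * indicator D p - f p * indicator D p)"
      unfolding N_def by (intro l2.nrm_diff_le cutL FL f)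
    also have "\<dots> \<le> l2_norm \<nu> (\<lambda>p. F k p - f p)"
      using cut_le[OF l2.diff_mem[OF FL f], of k] by (simp add: left_diff_distrib)
    finally show "norm (l2_norm \<nu> (\<lambda>p. F k p * indicator D p) - N) \<le> l2_norm \<nu> (\<lambda>p. F k p - f p)" by simp
  qed
  have limS: "(\<lambda>k. l2_inner \<nu> (F k) (indicator D)) \<longlonglongrightarrow> S1"
    unfolding S1_def by (rule l2_inner_tendsto[OF FL f oneL lim])
  define R where "R = C * (2 * r)\<^sup>2 * m"
  have R: "R \<ge> 0" using C m by (simp add: R_def poincare_const_def less_imp_le)
  have P: "m * (l2_norm \<nu> (\<lambda>p. F k p * indicator D p))\<^sup>2
    \<le> (l2_inner \<nu> (F k) (indicator D))\<^sup>2 + R * (\<integral>p. \<Gamma> (F k) (F k) p \<partial>\<nu>)" for k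
  proof -
    have "(\<lambda>p. (F k p * indicator D p)\<^sup>2) = (\<lambda>p. (F k p)\<^sup>2 * indicator D p)" by (auto simp: fun_eq_iff indicator_def)
    then have "m * (l2_norm \<nu> (\<lambda>p. F k p * indicator D p))\<^sup>2 = m * (\<integral>p. (F k p)\<^sup>2 * indicator D p \<partial>\<nu>)"
      by (subst l2_norm_sq_integral[OF cutL[OF FL]]) simp
    also have "\<dots> \<le> (l2_inner \<nu> (F k) (indicator D))\<^sup>2 + R * (\<integral>p. \<Gamma> (F k) (F k) p * indicator D p \<partial>\<nu>)"
      unfolding R_def m_def D_def
    proof (rule poincare_constD[OF C _ convex_ball order_refl _ F])
      fix x y assume "x \<in> ball a r" "y \<in> ball a r"
      then show "dist x y \<le> 2 * r" using dist_triangle3[of x y a] by simp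
    qed simp
    also have "(\<integral>p. \<Gamma> (F k) (F k) p * indicator D p \<partial>\<nu>) \<le> (\<integral>p. \<Gamma> (F k) (F k) p \<partial>\<nu>)"
      using continuous_\<Gamma>[OF F F] D \<Gamma>_nonneg
      by (intro integral_mono integrable_indicator_mult continuous_L2) (auto simp: indicator_def)
    finally show ?thesis using R by (simp add: mult_left_mono)
  qed
  have "m * N\<^sup>2 \<le> S1\<^sup>2 + R * 0"
  proof (rule LIMSEQ_le)
    show "(\<lambda>k. m * (l2_norm \<nu> (\<lambda>p. F k p * indicator D p))\<^sup>2) \<longlonglongrightarrow> m * N\<^sup>2"
      by (intro tendsto_intros limN)
    show "(\<lambda>k. (l2_inner \<nu> (F k) (indicator D))\<^sup>2 + R * (\<integral>p. \<Gamma> (F k) (F k) p \<partial>\<nu>)) \<longlonglongrightarrow> S1\<^sup>2 + R * 0"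
      by (intro tendsto_intros limS energy)
  qed (use P in blast)
  then have ineq: "m * N\<^sup>2 \<le> S1\<^sup>2" by simp
  define b where "b = S1 / m"
  define h where "h p = f p * indicator D p - b * indicator D p" for p
  have hL: "h \<in> L2 \<nu>" unfolding h_def by (intro l2.diff_mem l2.scale_mem cutL f oneL)
  have i1: "l2_inner \<nu> (\<lambda>p. f p * indicator D p) (indicator D) = S1"
    unfolding S1_def l2_inner_def by (intro Bochner_Integration.integral_cong) (auto simp: indicator_def)
  have i2: "l2_inner \<nu> (indicator D) (indicator D) = m"
  proof -
    have "l2_inner \<nu> (indicator D) (indicator D) = (\<integral>p. indicator D p \<partial>\<nu>)"
      unfolding l2_inner_def by (intro Bochner_Integration.integral_cong) (auto simp: indicator_def)
    then show ?thesis using D by (simp add: m_def)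
  qed
  have "(l2_norm \<nu> h)\<^sup>2 = N\<^sup>2 - 2 * (b * S1) + b\<^sup>2 * m"
    unfolding h_def using f oneL
    by (simp add: l2.nrm_diff_sq cutL l2.scale_mem N_def l2.ip_scale2 i1 l2.nrm_scale power_mult_distrib
        l2.nrm_sq[of "indicator D"] i2)
  also have "\<dots> = N\<^sup>2 - S1\<^sup>2 / m" using m by (simp add: b_def power2_eq_square field_simps)
  also have "\<dots> \<le> 0" using ineq m by (simp add: field_simps)
  finally have "l2_norm \<nu> h = 0" by simp
  then have "AE p in \<nu>. h p = 0" using l2_norm_eq_0_iff[OF hL] by simp
  then have "AE p in \<nu>. p \<in> D \<longrightarrow> f p = b" by eventually_elim (auto simp: h_def)
  then show ?thesis unfolding D_def by blast
qed

text \<open>Each point has a neighbourhood on which the function is almost everywhere constant. Where two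
  such neighbourhoods meet the constants agree, since nonempty open sets have positive measure; so
  the union of those with one given constant is open and closed.\<close>

theorem zero_energy_constant:
  assumes f: "f \<in> L2 \<nu>" and F: "\<And>k. smooth_fun \<A> (F k)"
    and lim: "(\<lambda>k. l2_norm \<nu> (\<lambda>p. F k p - f p)) \<longlonglongrightarrow> 0"
    and energy: "(\<lambda>k. \<integral>p. \<Gamma> (F k) (F k) p \<partial>\<nu>) \<longlonglongrightarrow> 0"
  shows "\<exists>b. AE p in \<nu>. f p = b"
proof -
  obtain I :: "'a set" and c a r where I: "finite I" and ab: "\<And>p. admissible_ball (c p) (a p) (r p)"
    and at: "\<And>p. p \<in> param (c p) ` ball (a p) (r p)"
    and cov: "\<And>q. \<exists>p\<in>I. q \<in> param (c p) ` ball (a p) (r p)"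
    by (rule admissible_cover) blast
  define D where "D p = param (c p) ` ball (a p) (r p)" for p
  have oD: "open (D p)" for p unfolding D_def using admissible_ballD(7)[OF ab] .
  obtain b where b: "\<And>p. AE q in \<nu>. q \<in> D p \<longrightarrow> f q = b p"
    using zero_energy_local[OF ab f F lim energy] unfolding D_def[symmetric] by metis
  have same: "b p = b p'" if "q \<in> D p" "q \<in> D p'" for p p' q
  proof (rule ccontr)
    assume ne: "b p \<noteq> b p'"
    have "AE q in \<nu>. q \<notin> D p \<inter> D p'" using b[of p] b[of p'] by eventually_elim (use ne in auto)
    then have "emeasure \<nu> (D p \<inter> D p') = 0"
      using oD[of p] oD[of p'] by (subst (asm) AE_iff_measurable[of "D p \<inter> D p'"]) auto
    then show False using \<nu>_open_pos[of "D p \<inter> D p'" q] that oD by (auto simp: measure_def)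
  qed
  define p0 :: 'a where "p0 = undefined"
  define U where "U = (\<Union>p\<in>{p. b p = b p0}. D p)"
  define V' where "V' = (\<Union>p\<in>{p. b p \<noteq> b p0}. D p)"
  have "open U" "open V'" using oD by (auto simp: U_def V'_def)
  moreover have "U \<inter> V' \<inter> UNIV = {}"
  proof -
    have "b p = b p0 \<Longrightarrow> b p' \<noteq> b p0 \<Longrightarrow> D p \<inter> D p' = {}" for p p' using same[of _ p p'] by fastforce
    then show ?thesis unfolding U_def V'_def by blast
  qed
  moreover have "UNIV \<subseteq> U \<union> V'"
  proof
    fix q
    have "q \<in> D q" unfolding D_def by (rule at)
    then show "q \<in> U \<union> V'" unfolding U_def V'_def by blast
  qed
  ultimately have "U \<inter> UNIV = {} \<or> V' \<inter> UNIV = {}" by (rule connectedD[OF connected_M])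
  moreover have "p0 \<in> U" using at[of p0] unfolding U_def D_def by blast
  ultimately have "V' = {}" by blast
  then have all: "b p = b p0" for p using at[of p] unfolding V'_def D_def by blast
  have "AE q in \<nu>. \<forall>p\<in>I. q \<in> D p \<longrightarrow> f q = b p0"
  proof (intro AE_finite_allI I)
    fix p show "AE q in \<nu>. q \<in> D p \<longrightarrow> f q = b p0" using b[of p] unfolding all[of p] .
  qed
  then have "AE q in \<nu>. f q = b p0"
  proof eventually_elim
    case (elim q)
    then show ?case using cov[of q] unfolding D_def by blast
  qed
  then show ?thesis ..
qed

end

section \<open>The spectral theorem for the form closure of a symmetric operator with compact embedding\<close>

lemma mult_frac_less: "0 \<le> t \<Longrightarrow> 0 < e \<Longrightarrow> t * (e / (t + 1)) < (e :: real)"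
  by (simp add: field_simps)

lemma sq_diff_le: "(a - b)\<^sup>2 \<le> 2 * a\<^sup>2 + 2 * (b :: real)\<^sup>2"
  using zero_le_power2[of "a + b"] by (simp add: power2_diff power2_sum)

text \<open>The domain \<open>S\<close> of \<open>A\<close> is too small to contain eigenfunctions or to solve variational problems
  in. The last assumption is a quantitative form of Rellich's theorem: up to an arbitrarily small
  multiple of the energy, the norm is controlled by finitely many functionals.\<close>

locale spectral_form = finite_measure M for M :: "'a measure" +
  fixes S :: "('a \<Rightarrow> real) set" and A :: "('a \<Rightarrow> real) \<Rightarrow> 'a \<Rightarrow> real"
  assumes S_zero: "(\<lambda>x. 0) \<in> S"
    and S_lin: "F \<in> S \<Longrightarrow> H \<in> S \<Longrightarrow> (\<lambda>x. a * F x + b * H x) \<in> S"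
    and S_L2: "F \<in> S \<Longrightarrow> F \<in> L2 M"
    and A_L2: "F \<in> S \<Longrightarrow> A F \<in> L2 M"
    and A_sym: "F \<in> S \<Longrightarrow> H \<in> S \<Longrightarrow> l2_inner M F (A H) = l2_inner M H (A F)"
    and A_nonneg: "F \<in> S \<Longrightarrow> 0 \<le> l2_inner M F (A F)"
    and S_dense: "f \<in> L2 M \<Longrightarrow> e > 0 \<Longrightarrow> \<exists>F\<in>S. l2_norm M (\<lambda>x. f x - F x) < e"
    and S_compact: "\<epsilon> > 0 \<Longrightarrow> \<exists>E C. finite E \<and> E \<subseteq> L2 M \<and> 0 \<le> C \<and>
      (\<forall>F\<in>S. (l2_norm M F)\<^sup>2 \<le> C * (\<Sum>e\<in>E. (l2_inner M F e)\<^sup>2) + \<epsilon> * l2_inner M F (A F))"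
begin

definition q :: "('a \<Rightarrow> real) \<Rightarrow> ('a \<Rightarrow> real) \<Rightarrow> real" where "q F H = l2_inner M F (A H)"

sublocale qS: semi_inner S q
proof
  show "q (\<lambda>x. a * F x + b * H x) K = a * q F K + b * q H K" if "F \<in> S" "H \<in> S" "K \<in> S" for F H K a b
    unfolding q_def using that by (intro l2.ip_lin S_L2 A_L2)
qed (auto simp: S_zero S_lin A_sym A_nonneg q_def)

subsection \<open>The form domain\<close>

text \<open>\<open>appr f F\<close>: the sequence \<open>F\<close> in \<open>S\<close> converges to \<open>f\<close> in norm and is Cauchy for the form. The
  limits \<open>f\<close> make up the domain \<open>Q\<close> of the closed form.\<close>

definition appr :: "('a \<Rightarrow> real) \<Rightarrow> (nat \<Rightarrow> 'a \<Rightarrow> real) \<Rightarrow> bool" where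
  "appr f F \<longleftrightarrow> (\<forall>k. F k \<in> S) \<and> (\<lambda>k. l2_norm M (\<lambda>x. F k x - f x)) \<longlonglongrightarrow> 0 \<and>
    (\<forall>e>0. \<exists>N. \<forall>k\<ge>N. \<forall>m\<ge>N. qS.nrm (\<lambda>x. F k x - F m x) < e)"

definition Q :: "('a \<Rightarrow> real) set" where "Q = {f \<in> L2 M. \<exists>F. appr f F}"

lemma appr_S: "appr f F \<Longrightarrow> F k \<in> S"
  by (simp add: appr_def)

lemma appr_L2: "appr f F \<Longrightarrow> F k \<in> L2 M"
  by (simp add: appr_def S_L2)

lemma appr_lim: "appr f F \<Longrightarrow> (\<lambda>k. l2_norm M (\<lambda>x. F k x - f x)) \<longlonglongrightarrow> 0"
  by (simp add: appr_def)

lemma appr_cauchy: "appr f F \<Longrightarrow> e > 0 \<Longrightarrow> \<exists>N. \<forall>k\<ge>N. \<forall>m\<ge>N. qS.nrm (\<lambda>x. F k x - F m x) < e"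
  by (simp add: appr_def)

lemma appr_const: "F \<in> S \<Longrightarrow> appr F (\<lambda>_. F)"
  by (auto simp: appr_def l2_norm_def l2_inner_def qS.nrm_def qS.ip_zero[OF S_zero])

lemma S_Q: "F \<in> S \<Longrightarrow> F \<in> Q"
  using appr_const S_L2 by (auto simp: Q_def)

lemma Q_L2: "f \<in> Q \<Longrightarrow> f \<in> L2 M"
  by (simp add: Q_def)

lemma appr_bounded:
  assumes "appr f F"
  obtains B where "0 \<le> B" "\<And>k. qS.nrm (F k) \<le> B"
proof -
  obtain N where N: "\<And>k m. k \<ge> N \<Longrightarrow> m \<ge> N \<Longrightarrow> qS.nrm (\<lambda>x. F k x - F m x) < 1"
    using appr_cauchy[OF assms, of 1] by auto
  define B where "B = (\<Sum>k\<le>N. qS.nrm (F k)) + 1"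
  have nn: "0 \<le> qS.nrm (F k)" for k using appr_S[OF assms] by (rule qS.nrm_nonneg)
  have small: "qS.nrm (F k) \<le> (\<Sum>k\<le>N. qS.nrm (F k))" if "k \<le> N" for k
    using nn that by (intro member_le_sum) auto
  have "qS.nrm (F k) \<le> B" for k
  proof (cases "k \<le> N")
    case True then show ?thesis using small[of k] by (simp add: B_def)
  next
    case False
    have "\<bar>qS.nrm (F k) - qS.nrm (F N)\<bar> \<le> qS.nrm (\<lambda>x. F k x - F N x)"
      by (intro qS.nrm_diff_le appr_S[OF assms])
    also have "\<dots> < 1" using N[of k N] False by simp
    finally show ?thesis using small[of N] by (simp add: B_def)
  qed
  moreover have "0 \<le> B" using nn by (auto simp: B_def intro!: add_nonneg_nonneg sum_nonneg)
  ultimately show thesis using that by blast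
qed

lemma appr_lin:
  assumes F: "appr f F" and G: "appr g G" and fg: "f \<in> L2 M" "g \<in> L2 M"
  shows "appr (\<lambda>x. a * f x + b * g x) (\<lambda>k x. a * F k x + b * G k x)"
  unfolding appr_def
proof (intro conjI allI impI)
  note FS = appr_S[OF F] and GS = appr_S[OF G]
  show "(\<lambda>x. a * F k x + b * G k x) \<in> S" for k by (intro S_lin FS GS)
  have le: "l2_norm M (\<lambda>x. (a * F k x + b * G k x) - (a * f x + b * g x))
      \<le> \<bar>a\<bar> * l2_norm M (\<lambda>x. F k x - f x) + \<bar>b\<bar> * l2_norm M (\<lambda>x. G k x - g x)" for k
  proof -
    have d: "(\<lambda>x. F k x - f x) \<in> L2 M" "(\<lambda>x. G k x - g x) \<in> L2 M"
      using l2.diff_mem appr_L2[OF F] appr_L2[OF G] fg by blast+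
    have "l2_norm M (\<lambda>x. a * (F k x - f x) + b * (G k x - g x))
      \<le> l2_norm M (\<lambda>x. a * (F k x - f x)) + l2_norm M (\<lambda>x. b * (G k x - g x))"
      using d by (intro l2.triangle l2.scale_mem)
    then show ?thesis using l2.nrm_scale[OF d(1), of a] l2.nrm_scale[OF d(2), of b] by (simp add: algebra_simps)
  qed
  have "(\<lambda>k. \<bar>a\<bar> * l2_norm M (\<lambda>x. F k x - f x) + \<bar>b\<bar> * l2_norm M (\<lambda>x. G k x - g x)) \<longlonglongrightarrow> \<bar>a\<bar> * 0 + \<bar>b\<bar> * 0"
    by (intro tendsto_intros appr_lim F G)
  then have z: "(\<lambda>k. \<bar>a\<bar> * l2_norm M (\<lambda>x. F k x - f x) + \<bar>b\<bar> * l2_norm M (\<lambda>x. G k x - g x)) \<longlonglongrightarrow> 0" by simp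
  show "(\<lambda>k. l2_norm M (\<lambda>x. (a * F k x + b * G k x) - (a * f x + b * g x))) \<longlonglongrightarrow> 0"
  proof (rule tendsto_sandwich[OF _ _ tendsto_const z])
    show "\<forall>\<^sub>F k in sequentially. 0 \<le> l2_norm M (\<lambda>x. (a * F k x + b * G k x) - (a * f x + b * g x))"
      by (intro always_eventually allI l2.nrm_nonneg l2.diff_mem L2_lin appr_L2[OF F] appr_L2[OF G] fg)
    show "\<forall>\<^sub>F k in sequentially. l2_norm M (\<lambda>x. (a * F k x + b * G k x) - (a * f x + b * g x))
      \<le> \<bar>a\<bar> * l2_norm M (\<lambda>x. F k x - f x) + \<bar>b\<bar> * l2_norm M (\<lambda>x. G k x - g x)"
      by (intro always_eventually allI le)
  qed
  fix e :: real assume e: "e > 0"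
  define d where "d = e / (\<bar>a\<bar> + \<bar>b\<bar> + 1)"
  have d: "d > 0" using e by (simp add: d_def)
  obtain N1 where N1: "\<And>k m. k \<ge> N1 \<Longrightarrow> m \<ge> N1 \<Longrightarrow> qS.nrm (\<lambda>x. F k x - F m x) < d" using appr_cauchy[OF F d] by blast
  obtain N2 where N2: "\<And>k m. k \<ge> N2 \<Longrightarrow> m \<ge> N2 \<Longrightarrow> qS.nrm (\<lambda>x. G k x - G m x) < d" using appr_cauchy[OF G d] by blast
  show "\<exists>N. \<forall>k\<ge>N. \<forall>m\<ge>N. qS.nrm (\<lambda>x. (a * F k x + b * G k x) - (a * F m x + b * G m x)) < e"
  proof (intro exI allI impI)
    fix k m assume k: "max N1 N2 \<le> k" and m: "max N1 N2 \<le> m"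
    have D: "(\<lambda>x. F k x - F m x) \<in> S" "(\<lambda>x. G k x - G m x) \<in> S" by (intro qS.diff_mem FS GS)+
    have "qS.nrm (\<lambda>x. a * (F k x - F m x) + b * (G k x - G m x))
        \<le> \<bar>a\<bar> * qS.nrm (\<lambda>x. F k x - F m x) + \<bar>b\<bar> * qS.nrm (\<lambda>x. G k x - G m x)"
      using qS.triangle[OF qS.scale_mem[OF D(1)] qS.scale_mem[OF D(2)], of a b]
      by (simp add: qS.nrm_scale[OF D(1)] qS.nrm_scale[OF D(2)])
    also have "\<dots> \<le> \<bar>a\<bar> * d + \<bar>b\<bar> * d"
      using N1[of k m] N2[of k m] k m by (intro add_mono mult_left_mono) auto
    also have "\<dots> = (\<bar>a\<bar> + \<bar>b\<bar>) * d" by (simp add: distrib_right)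
    also have "\<dots> < e" unfolding d_def using e by (intro mult_frac_less) auto
    finally show "qS.nrm (\<lambda>x. (a * F k x + b * G k x) - (a * F m x + b * G m x)) < e" by (simp add: algebra_simps)
  qed
qed

text \<open>The form is closable: \<open>q(F\<^sub>k, F\<^sub>k) = q(F\<^sub>k, F\<^sub>k - F\<^sub>m) + \<langle>F\<^sub>m, A F\<^sub>k\<rangle>\<close>, and the last term
  disappears as \<open>m\<close> grows.\<close>

lemma closable:
  assumes F: "appr f F" and f0: "l2_norm M f = 0" "f \<in> L2 M"
  shows "(\<lambda>k. qS.nrm (F k)) \<longlonglongrightarrow> 0"
proof -
  note FS = appr_S[OF F]
  have F0: "(\<lambda>k. l2_norm M (F k)) \<longlonglongrightarrow> 0"
  proof (rule tendsto_sandwich[OF _ _ tendsto_const appr_lim[OF F]])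
    show "\<forall>\<^sub>F k in sequentially. 0 \<le> l2_norm M (F k)"
      by (intro always_eventually allI l2.nrm_nonneg appr_L2[OF F])
    show "\<forall>\<^sub>F k in sequentially. l2_norm M (F k) \<le> l2_norm M (\<lambda>x. F k x - f x)"
      using l2.nrm_diff_le[OF appr_L2[OF F] f0(2)] f0(1) by (intro always_eventually allI) (simp add: abs_le_iff)
  qed
  obtain B where B: "0 \<le> B" "\<And>k. qS.nrm (F k) \<le> B" using appr_bounded[OF F] by blast
  show ?thesis
  proof (rule LIMSEQ_I)
    fix e :: real assume e: "e > 0"
    define d where "d = e\<^sup>2 / (B + 1)"
    have d: "d > 0" using e B(1) by (simp add: d_def)
    obtain N where N: "\<And>k m. k \<ge> N \<Longrightarrow> m \<ge> N \<Longrightarrow> qS.nrm (\<lambda>x. F k x - F m x) < d" using appr_cauchy[OF F d] by blast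
    have "norm (qS.nrm (F k) - 0) < e" if k: "k \<ge> N" for k
    proof -
      have lim: "(\<lambda>m. B * d + l2_norm M (F m) * l2_norm M (A (F k))) \<longlonglongrightarrow> B * d + 0 * l2_norm M (A (F k))"
        by (intro tendsto_intros F0)
      have "(qS.nrm (F k))\<^sup>2 \<le> B * d + 0 * l2_norm M (A (F k))"
      proof (rule LIMSEQ_le_const[OF lim], intro exI allI impI)
        fix m assume m: "N \<le> m"
        have "(qS.nrm (F k))\<^sup>2 = q (F k) (F k)" by (rule qS.nrm_sq[OF FS])
        also have "\<dots> = q (F k) (\<lambda>x. F k x - F m x) + q (F m) (F k)"
          by (simp add: qS.ip_diff2 FS qS.ip_sym[of "F m" "F k"])
        also have "\<dots> \<le> qS.nrm (F k) * qS.nrm (\<lambda>x. F k x - F m x) + l2_norm M (F m) * l2_norm M (A (F k))"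
          using qS.cauchy_schwarz[OF FS qS.diff_mem[OF FS FS], of k k m]
            l2.cauchy_schwarz[OF appr_L2[OF F] A_L2[OF FS], of m k] by (simp add: q_def)
        also have "\<dots> \<le> B * d + l2_norm M (F m) * l2_norm M (A (F k))"
          using B N[OF k m] by (intro add_mono mult_mono order_refl qS.nrm_nonneg qS.diff_mem FS) auto
        finally show "(qS.nrm (F k))\<^sup>2 \<le> B * d + l2_norm M (F m) * l2_norm M (A (F k))" .
      qed
      also have "\<dots> < e\<^sup>2" unfolding d_def using mult_frac_less[OF B(1), of "e\<^sup>2"] e by simp
      finally have "qS.nrm (F k) < e" by (rule power2_less_imp_less) (use e in simp)
      then show ?thesis using qS.nrm_nonneg[OF FS] by simp
    qed
    then show "\<exists>N. \<forall>k\<ge>N. norm (qS.nrm (F k) - 0) < e" by blast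
  qed
qed

lemma form_converges:
  assumes F: "appr f F" and G: "appr g G"
  shows "convergent (\<lambda>k. q (F k) (G k))"
proof -
  note FS = appr_S[OF F] and GS = appr_S[OF G]
  obtain B where B: "0 \<le> B" "\<And>k. qS.nrm (F k) \<le> B" using appr_bounded[OF F] by blast
  obtain C where C: "0 \<le> C" "\<And>k. qS.nrm (G k) \<le> C" using appr_bounded[OF G] by blast
  have "Cauchy (\<lambda>k. q (F k) (G k))"
  proof (rule CauchyI)
    fix e :: real assume e: "e > 0"
    define d where "d = e / (B + C + 1)"
    have d: "d > 0" using e B C by (simp add: d_def)
    obtain N1 where N1: "\<And>k m. k \<ge> N1 \<Longrightarrow> m \<ge> N1 \<Longrightarrow> qS.nrm (\<lambda>x. F k x - F m x) < d" using appr_cauchy[OF F d] by blast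
    obtain N2 where N2: "\<And>k m. k \<ge> N2 \<Longrightarrow> m \<ge> N2 \<Longrightarrow> qS.nrm (\<lambda>x. G k x - G m x) < d" using appr_cauchy[OF G d] by blast
    have "norm (q (F k) (G k) - q (F m) (G m)) < e" if k: "k \<ge> max N1 N2" and m: "m \<ge> max N1 N2" for k m
    proof -
      have "q (F k) (G k) - q (F m) (G m) = q (\<lambda>x. F k x - F m x) (G k) + q (F m) (\<lambda>x. G k x - G m x)"
        by (simp add: qS.ip_diff qS.ip_diff2 FS GS)
      then have "norm (q (F k) (G k) - q (F m) (G m))
        \<le> qS.nrm (\<lambda>x. F k x - F m x) * qS.nrm (G k) + qS.nrm (F m) * qS.nrm (\<lambda>x. G k x - G m x)"
        using qS.cauchy_schwarz[OF qS.diff_mem[OF FS FS] GS, of k m k]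
          qS.cauchy_schwarz[OF FS qS.diff_mem[OF GS GS], of m k m] by simp
      also have "\<dots> \<le> d * C + B * d"
        using N1[of k m] N2[of k m] k m B C d
        by (intro add_mono mult_mono qS.nrm_nonneg qS.diff_mem FS GS) (auto simp: less_imp_le)
      also have "\<dots> = (B + C) * d" by (simp add: algebra_simps)
      also have "\<dots> < e" unfolding d_def using e B(1) C(1) by (intro mult_frac_less) auto
      finally show ?thesis .
    qed
    then show "\<exists>N. \<forall>m\<ge>N. \<forall>n\<ge>N. norm (q (F m) (G m) - q (F n) (G n)) < e" by blast
  qed
  then show ?thesis by (rule Cauchy_convergent)
qed

lemma appr_diff_null:
  assumes F: "appr f F" and F': "appr f F'" and f: "f \<in> L2 M"
  shows "(\<lambda>k. qS.nrm (\<lambda>x. F k x - F' k x)) \<longlonglongrightarrow> 0"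
proof -
  have "l2_norm M (\<lambda>x. 1 * f x + (-1) * f x) = 0" by (simp add: l2_norm_def l2_inner_def)
  from closable[OF appr_lin[OF F F' f f] this L2_lin[OF f f]] show ?thesis by simp
qed

text \<open>The closure of the form, as a limit along approximating sequences; by closability the choice of the
  sequences is immaterial.\<close>

definition form :: "('a \<Rightarrow> real) \<Rightarrow> ('a \<Rightarrow> real) \<Rightarrow> real" where
  "form f g = lim (\<lambda>k. q ((SOME F. appr f F) k) ((SOME G. appr g G) k))"

lemma form_lim:
  assumes F: "appr f F" and G: "appr g G" and fg: "f \<in> L2 M" "g \<in> L2 M"
  shows "(\<lambda>k. q (F k) (G k)) \<longlonglongrightarrow> form f g"
proof -
  define F' where "F' = (SOME F. appr f F)"
  define G' where "G' = (SOME G. appr g G)"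
  have F': "appr f F'" unfolding F'_def by (rule someI[of "appr f", OF F])
  have G': "appr g G'" unfolding G'_def by (rule someI[of "appr g", OF G])
  note S = appr_S[OF F] appr_S[OF G] appr_S[OF F'] appr_S[OF G']
  obtain B where B: "0 \<le> B" "\<And>k. qS.nrm (F' k) \<le> B" using appr_bounded[OF F'] by blast
  obtain C where C: "0 \<le> C" "\<And>k. qS.nrm (G k) \<le> C" using appr_bounded[OF G] by blast
  have 1: "(\<lambda>k. q (F' k) (G' k)) \<longlonglongrightarrow> form f g"
    unfolding form_def F'_def[symmetric] G'_def[symmetric]
    using form_converges[OF F' G'] by (simp add: convergent_LIMSEQ_iff)
  have lim: "(\<lambda>k. qS.nrm (\<lambda>x. F k x - F' k x) * C + B * qS.nrm (\<lambda>x. G k x - G' k x)) \<longlonglongrightarrow> 0 * C + B * 0"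
    by (intro tendsto_intros appr_diff_null[OF F F' fg(1)] appr_diff_null[OF G G' fg(2)])
  have "(\<lambda>k. q (F k) (G k) - q (F' k) (G' k)) \<longlonglongrightarrow> 0"
  proof (rule Lim_null_comparison[where g="\<lambda>k. qS.nrm (\<lambda>x. F k x - F' k x) * C + B * qS.nrm (\<lambda>x. G k x - G' k x)"])
    show "\<forall>\<^sub>F k in sequentially. norm (q (F k) (G k) - q (F' k) (G' k))
      \<le> qS.nrm (\<lambda>x. F k x - F' k x) * C + B * qS.nrm (\<lambda>x. G k x - G' k x)"
    proof (intro always_eventually allI)
      fix k
      have "q (F k) (G k) - q (F' k) (G' k) = q (\<lambda>x. F k x - F' k x) (G k) + q (F' k) (\<lambda>x. G k x - G' k x)"
        by (simp add: qS.ip_diff qS.ip_diff2 S)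
      then have "norm (q (F k) (G k) - q (F' k) (G' k))
        \<le> qS.nrm (\<lambda>x. F k x - F' k x) * qS.nrm (G k) + qS.nrm (F' k) * qS.nrm (\<lambda>x. G k x - G' k x)"
        using qS.cauchy_schwarz[OF qS.diff_mem[OF S(1,3)] S(2), of k k k]
          qS.cauchy_schwarz[OF S(3) qS.diff_mem[OF S(2,4)], of k k k] by simp
      also have "\<dots> \<le> qS.nrm (\<lambda>x. F k x - F' k x) * C + B * qS.nrm (\<lambda>x. G k x - G' k x)"
        using B C by (intro add_mono mult_left_mono mult_right_mono qS.nrm_nonneg qS.diff_mem S) auto
      finally show "norm (q (F k) (G k) - q (F' k) (G' k))
        \<le> qS.nrm (\<lambda>x. F k x - F' k x) * C + B * qS.nrm (\<lambda>x. G k x - G' k x)" .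
    qed
  qed (use lim in simp)
  from tendsto_add[OF this 1] show ?thesis by simp
qed

lemma Q_appr: "f \<in> Q \<Longrightarrow> \<exists>F. appr f F"
  by (simp add: Q_def)

lemma form_S: "F \<in> S \<Longrightarrow> H \<in> S \<Longrightarrow> form F H = q F H"
  using form_lim[OF appr_const appr_const S_L2 S_L2, of F H] by (simp add: LIMSEQ_const_iff)

sublocale fQ: semi_inner Q form
proof
  show "(\<lambda>x. 0) \<in> Q" by (rule S_Q[OF S_zero])
next
  fix f g a b assume fg: "f \<in> Q" "g \<in> Q"
  then obtain F G where "appr f F" "appr g G" using Q_appr by blast
  from appr_lin[OF this fg[THEN Q_L2], of a b] show "(\<lambda>x. a * f x + b * g x) \<in> Q"
    using fg[THEN Q_L2] by (auto simp: Q_def intro: L2_lin)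
next
  fix f g assume fg: "f \<in> Q" "g \<in> Q"
  then obtain F G where FG: "appr f F" "appr g G" using Q_appr by blast
  have "(\<lambda>k. q (F k) (G k)) \<longlonglongrightarrow> form g f"
    using form_lim[OF FG(2,1) fg(2,1)[THEN Q_L2]] qS.ip_sym[OF appr_S[OF FG(1)] appr_S[OF FG(2)]] by simp
  with form_lim[OF FG fg[THEN Q_L2]] show "form f g = form g f" by (rule LIMSEQ_unique)
next
  fix f g h a b assume m: "f \<in> Q" "g \<in> Q" "h \<in> Q"
  then obtain F G H where A: "appr f F" "appr g G" "appr h H" using Q_appr by metis
  note L = m[THEN Q_L2]
  have "(\<lambda>k. q (\<lambda>x. a * F k x + b * G k x) (H k)) \<longlonglongrightarrow> form (\<lambda>x. a * f x + b * g x) h"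
    by (rule form_lim[OF appr_lin[OF A(1,2) L(1,2)] A(3) L2_lin[OF L(1,2)] L(3)])
  moreover have "(\<lambda>k. q (\<lambda>x. a * F k x + b * G k x) (H k)) \<longlonglongrightarrow> a * form f h + b * form g h"
    unfolding qS.ip_lin[OF appr_S[OF A(1)] appr_S[OF A(2)] appr_S[OF A(3)]]
    by (intro tendsto_intros form_lim A L)
  ultimately show "form (\<lambda>x. a * f x + b * g x) h = a * form f h + b * form g h" by (rule LIMSEQ_unique)
next
  fix f assume f: "f \<in> Q"
  then obtain F where F: "appr f F" using Q_appr by blast
  show "0 \<le> form f f"
    by (rule LIMSEQ_le_const[OF form_lim[OF F F f[THEN Q_L2] f[THEN Q_L2]]])
      (use qS.ip_nonneg[OF appr_S[OF F]] in blast)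
qed

text \<open>For one argument in the operator domain the form is expressed by \<open>A\<close>; this identity is what turns
  the Euler equation of the variational problem into the eigenvalue equation.\<close>

lemma form_A:
  assumes f: "f \<in> Q" and H: "H \<in> S"
  shows "form f H = l2_inner M f (A H)"
proof -
  obtain F where F: "appr f F" using Q_appr[OF f] by blast
  note L = Q_L2[OF f]
  have 1: "(\<lambda>k. q (F k) H) \<longlonglongrightarrow> form f H" by (rule form_lim[OF F appr_const[OF H] L S_L2[OF H]])
  have "(\<lambda>k. q (F k) H - l2_inner M f (A H)) \<longlonglongrightarrow> 0"
  proof (rule Lim_null_comparison[OF _ tendsto_mult_left_zero[OF appr_lim[OF F]]], intro always_eventually allI)
    fix k
    show "norm (q (F k) H - l2_inner M f (A H)) \<le> l2_norm M (\<lambda>x. F k x - f x) * l2_norm M (A H)"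
      using l2.cauchy_schwarz[OF l2.diff_mem[OF appr_L2[OF F] L] A_L2[OF H], of k]
      by (simp add: q_def l2.ip_diff[OF appr_L2[OF F] L A_L2[OF H]])
  qed
  then have "(\<lambda>k. q (F k) H) \<longlonglongrightarrow> l2_inner M f (A H)" by (rule LIM_zero_cancel)
  with 1 show ?thesis by (rule LIMSEQ_unique)
qed

lemma appr_form_null:
  assumes F: "appr f F" and f: "f \<in> L2 M"
  shows "(\<lambda>k. fQ.nrm (\<lambda>x. F k x - f x)) \<longlonglongrightarrow> 0"
proof (rule LIMSEQ_I)
  have fQ: "f \<in> Q" using F f by (auto simp: Q_def)
  fix e :: real assume e: "e > 0"
  obtain N where N: "\<And>k m. k \<ge> N \<Longrightarrow> m \<ge> N \<Longrightarrow> qS.nrm (\<lambda>x. F k x - F m x) < e / 2"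
    using appr_cauchy[OF F, of "e/2"] e by auto
  have "norm (fQ.nrm (\<lambda>x. F k x - f x) - 0) < e" if k: "k \<ge> N" for k
  proof -
    have D: "(\<lambda>x. F k x - f x) \<in> Q" by (intro fQ.diff_mem S_Q appr_S[OF F] fQ)
    have ap: "appr (\<lambda>x. F k x - f x) (\<lambda>m x. F k x - F m x)"
      using appr_lin[OF appr_const[OF appr_S[OF F]] F appr_L2[OF F] f, of 1 k "-1"] by simp
    have "(\<lambda>m. q (\<lambda>x. F k x - F m x) (\<lambda>x. F k x - F m x)) \<longlonglongrightarrow> form (\<lambda>x. F k x - f x) (\<lambda>x. F k x - f x)"
      by (rule form_lim[OF ap ap]) (use D Q_L2 in blast)+
    then have "form (\<lambda>x. F k x - f x) (\<lambda>x. F k x - f x) \<le> (e / 2)\<^sup>2"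
    proof (rule LIMSEQ_le_const2, intro exI allI impI)
      fix m assume m: "N \<le> m"
      have dm: "(\<lambda>x. F k x - F m x) \<in> S" by (intro qS.diff_mem appr_S[OF F])
      have "(qS.nrm (\<lambda>x. F k x - F m x))\<^sup>2 \<le> (e / 2)\<^sup>2"
        using N[OF k m] by (intro power_mono qS.nrm_nonneg dm less_imp_le)
      then show "q (\<lambda>x. F k x - F m x) (\<lambda>x. F k x - F m x) \<le> (e / 2)\<^sup>2" by (simp only: qS.nrm_sq[OF dm])
    qed
    then have "(fQ.nrm (\<lambda>x. F k x - f x))\<^sup>2 \<le> (e / 2)\<^sup>2" by (simp only: fQ.nrm_sq[OF D])
    then have "fQ.nrm (\<lambda>x. F k x - f x) \<le> e / 2" by (rule power2_le_imp_le) (use e in simp)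
    then show ?thesis using e fQ.nrm_nonneg[OF D] by simp
  qed
  then show "\<exists>N. \<forall>k\<ge>N. norm (fQ.nrm (\<lambda>x. F k x - f x) - 0) < e" by blast
qed

lemma qS_fQ: "F \<in> S \<Longrightarrow> qS.nrm F = fQ.nrm F"
  by (simp add: qS.nrm_def fQ.nrm_def form_S)

lemma Q_approximable:
  assumes f: "f \<in> Q" and e: "e > 0"
  obtains F where "F \<in> S" "l2_norm M (\<lambda>x. F x - f x) < e" "fQ.nrm (\<lambda>x. F x - f x) < e"
proof -
  obtain F where F: "appr f F" using Q_appr[OF f] by blast
  have "\<forall>\<^sub>F k in sequentially. l2_norm M (\<lambda>x. F k x - f x) < e \<and> fQ.nrm (\<lambda>x. F k x - f x) < e"
    using order_tendstoD(2)[OF appr_lim[OF F] e] order_tendstoD(2)[OF appr_form_null[OF F Q_L2[OF f]] e]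
    by eventually_elim simp
  then obtain k where "l2_norm M (\<lambda>x. F k x - f x) < e \<and> fQ.nrm (\<lambda>x. F k x - f x) < e"
    by (auto simp: eventually_sequentially)
  then show thesis using that[OF appr_S[OF F]] by blast
qed

text \<open>The form domain is complete for the form norm: approximate each \<open>f\<^sub>k\<close> in \<open>S\<close> up to \<open>1/(k + 1)\<close>.\<close>

lemma Q_closed:
  assumes f: "\<And>k. f k \<in> Q" and g: "g \<in> L2 M" and lim: "(\<lambda>k. l2_norm M (\<lambda>x. f k x - g x)) \<longlonglongrightarrow> 0"
    and C: "\<And>e. e > 0 \<Longrightarrow> \<exists>N. \<forall>k\<ge>N. \<forall>m\<ge>N. fQ.nrm (\<lambda>x. f k x - f m x) < e"
  shows "g \<in> Q" "(\<lambda>k. fQ.nrm (\<lambda>x. f k x - g x)) \<longlonglongrightarrow> 0"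
proof -
  have "\<exists>F. F \<in> S \<and> l2_norm M (\<lambda>x. F x - f k x) < inverse (real (Suc k)) \<and> fQ.nrm (\<lambda>x. F x - f k x) < inverse (real (Suc k))" for k
    using Q_approximable[OF f[of k], of "inverse (real (Suc k))"] by (metis inverse_positive_iff_positive of_nat_0_less_iff zero_less_Suc)
  then obtain F where F: "\<And>k. F k \<in> S" "\<And>k. l2_norm M (\<lambda>x. F k x - f k x) < inverse (real (Suc k))"
    "\<And>k. fQ.nrm (\<lambda>x. F k x - f k x) < inverse (real (Suc k))" by metis
  note FQ = S_Q[OF F(1)] and FL = S_L2[OF F(1)] and fL = Q_L2[OF f]
  have inv0: "(\<lambda>k. inverse (real (Suc k))) \<longlonglongrightarrow> 0" by (rule LIMSEQ_inverse_real_of_nat)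
  have ap: "appr g F"
    unfolding appr_def
  proof (intro conjI allI impI F(1))
    show "(\<lambda>k. l2_norm M (\<lambda>x. F k x - g x)) \<longlonglongrightarrow> 0"
    proof (rule Lim_null_comparison[OF _ tendsto_add_zero[OF inv0 lim]], intro always_eventually allI)
      fix k
      show "norm (l2_norm M (\<lambda>x. F k x - g x)) \<le> inverse (real (Suc k)) + l2_norm M (\<lambda>x. f k x - g x)"
        using l2.triangle_diff[OF FL fL g, of k k] F(2)[of k] l2.nrm_nonneg[OF l2.diff_mem[OF FL g], of k] by simp
    qed
    fix e :: real assume e: "e > 0"
    obtain N1 where N1: "\<And>k m. k \<ge> N1 \<Longrightarrow> m \<ge> N1 \<Longrightarrow> fQ.nrm (\<lambda>x. f k x - f m x) < e / 3" using C[of "e/3"] e by auto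
    have "\<forall>\<^sub>F k in sequentially. inverse (real (Suc k)) < e / 3" using order_tendstoD(2)[OF inv0, of "e/3"] e by simp
    then obtain N2 where N2: "\<And>k. k \<ge> N2 \<Longrightarrow> inverse (real (Suc k)) < e / 3" by (auto simp: eventually_sequentially)
    show "\<exists>N. \<forall>k\<ge>N. \<forall>m\<ge>N. qS.nrm (\<lambda>x. F k x - F m x) < e"
    proof (intro exI allI impI)
      fix k m assume k: "max N1 N2 \<le> k" and m: "max N1 N2 \<le> m"
      have "qS.nrm (\<lambda>x. F k x - F m x) = fQ.nrm (\<lambda>x. F k x - F m x)" by (intro qS_fQ qS.diff_mem F)
      also have "\<dots> \<le> fQ.nrm (\<lambda>x. F k x - f k x) + fQ.nrm (\<lambda>x. f k x - F m x)" by (intro fQ.triangle_diff FQ f)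
      also have "fQ.nrm (\<lambda>x. f k x - F m x) \<le> fQ.nrm (\<lambda>x. f k x - f m x) + fQ.nrm (\<lambda>x. f m x - F m x)"
        by (intro fQ.triangle_diff FQ f)
      also have "fQ.nrm (\<lambda>x. f m x - F m x) = fQ.nrm (\<lambda>x. F m x - f m x)" by (rule fQ.nrm_minus_commute[OF f FQ])
      finally show "qS.nrm (\<lambda>x. F k x - F m x) < e"
        using F(3)[of k] F(3)[of m] N1[of k m] N2[of k] N2[of m] k m by simp
    qed
  qed
  then show gQ: "g \<in> Q" using g by (auto simp: Q_def)
  show "(\<lambda>k. fQ.nrm (\<lambda>x. f k x - g x)) \<longlonglongrightarrow> 0"
  proof (rule Lim_null_comparison[OF _ tendsto_add_zero[OF inv0 appr_form_null[OF ap g]]], intro always_eventually allI)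
    fix k
    show "norm (fQ.nrm (\<lambda>x. f k x - g x)) \<le> inverse (real (Suc k)) + fQ.nrm (\<lambda>x. F k x - g x)"
      using fQ.triangle_diff[OF f FQ gQ, of k k] F(3)[of k] fQ.nrm_minus_commute[OF f FQ, of k k]
        fQ.nrm_nonneg[OF fQ.diff_mem[OF f gQ], of k] by simp
  qed
qed

subsection \<open>Compact embedding of the form domain\<close>

lemma Q_compact_ineq:
  assumes \<epsilon>: "\<epsilon> > 0"
  shows "\<exists>E C. finite E \<and> E \<subseteq> L2 M \<and> 0 \<le> C \<and>
    (\<forall>f\<in>Q. (l2_norm M f)\<^sup>2 \<le> C * (\<Sum>e\<in>E. (l2_inner M f e)\<^sup>2) + \<epsilon> * form f f)"
proof -
  obtain E C where E: "finite E" "E \<subseteq> L2 M" "0 \<le> C"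
    "\<And>F. F \<in> S \<Longrightarrow> (l2_norm M F)\<^sup>2 \<le> C * (\<Sum>e\<in>E. (l2_inner M F e)\<^sup>2) + \<epsilon> * l2_inner M F (A F)"
    using S_compact[OF \<epsilon>] by blast
  have "(l2_norm M f)\<^sup>2 \<le> C * (\<Sum>e\<in>E. (l2_inner M f e)\<^sup>2) + \<epsilon> * form f f" if f: "f \<in> Q" for f
  proof -
    obtain F where F: "appr f F" using Q_appr[OF f] by blast
    note FL = appr_L2[OF F] and fL = Q_L2[OF f]
    have n: "(\<lambda>k. l2_norm M (F k)) \<longlonglongrightarrow> l2_norm M f"
      using l2_norm_tendsto[OF FL fL appr_lim[OF F]] .
    have i: "(\<lambda>k. l2_inner M (F k) e) \<longlonglongrightarrow> l2_inner M f e" if "e \<in> L2 M" for e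
      using l2_inner_tendsto[OF FL fL that appr_lim[OF F]] .
    show ?thesis
    proof (rule LIMSEQ_le)
      show "(\<lambda>k. (l2_norm M (F k))\<^sup>2) \<longlonglongrightarrow> (l2_norm M f)\<^sup>2" by (intro tendsto_intros n)
      show "(\<lambda>k. C * (\<Sum>e\<in>E. (l2_inner M (F k) e)\<^sup>2) + \<epsilon> * q (F k) (F k))
        \<longlonglongrightarrow> C * (\<Sum>e\<in>E. (l2_inner M f e)\<^sup>2) + \<epsilon> * form f f"
        using E(2) by (intro tendsto_intros form_lim F fL i) auto
      show "\<exists>N. \<forall>k\<ge>N. (l2_norm M (F k))\<^sup>2 \<le> C * (\<Sum>e\<in>E. (l2_inner M (F k) e)\<^sup>2) + \<epsilon> * q (F k) (F k)"
        using E(4)[OF appr_S[OF F]] by (auto simp: q_def)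
    qed
  qed
  then show ?thesis using E(1-3) by blast
qed

text \<open>Countably many functionals suffice to control the norm up to an arbitrarily small multiple of
  the form, and a diagonal subsequence makes all of them converge.\<close>

lemma Q_compact:
  assumes f: "\<And>k. f k \<in> Q" and B: "\<And>k. l2_norm M (f k) \<le> B" "\<And>k. fQ.nrm (f k) \<le> B"
  shows "\<exists>r :: nat \<Rightarrow> nat. strict_mono r \<and>
    (\<forall>e>0. \<exists>N. \<forall>k\<ge>N. \<forall>m\<ge>N. l2_norm M (\<lambda>x. f (r k) x - f (r m) x) < e)"
proof -
  note fL = Q_L2[OF f]
  have B0: "0 \<le> B" using order_trans[OF l2.nrm_nonneg[OF fL] B(1)] .
  have "\<exists>E C. finite E \<and> E \<subseteq> L2 M \<and> 0 \<le> C \<and>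
    (\<forall>f\<in>Q. (l2_norm M f)\<^sup>2 \<le> C * (\<Sum>e\<in>E. (l2_inner M f e)\<^sup>2) + inverse (real (Suc j)) * form f f)" for j
    by (rule Q_compact_ineq) simp
  then obtain E C where E: "\<And>j. finite (E j)" "\<And>j. E j \<subseteq> L2 M" "\<And>j. 0 \<le> C j"
    and ineq: "\<And>j f. f \<in> Q \<Longrightarrow> (l2_norm M f)\<^sup>2 \<le> C j * (\<Sum>e\<in>E j. (l2_inner M f e)\<^sup>2) + inverse (real (Suc j)) * form f f"
    by metis
  define EE where "EE = insert (\<lambda>x. 0) (\<Union>j. E j)"
  have EE: "countable EE" "EE \<subseteq> L2 M" "EE \<noteq> {}"
    using E(2) l2.zero_mem by (auto simp: EE_def intro!: countable_UN[OF countable_subset[OF subset_UNIV]] countable_finite[OF E(1)])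
  define e where "e = from_nat_into EE"
  have eL: "e n \<in> L2 M" for n using from_nat_into[OF EE(3), of n] EE(2) by (auto simp: e_def)
  define P where "P n s = convergent (\<lambda>k. l2_inner M (f (s k)) (e n))" for n and s :: "nat \<Rightarrow> nat"
  interpret subseqs P
  proof
    fix n and s :: "nat \<Rightarrow> nat"
    have "bounded (range (\<lambda>k. l2_inner M (f (s k)) (e n)))"
      unfolding bounded_iff
    proof (intro exI ballI)
      fix y assume "y \<in> range (\<lambda>k. l2_inner M (f (s k)) (e n))"
      then obtain k where y: "y = l2_inner M (f (s k)) (e n)" by blast
      have "norm y \<le> l2_norm M (f (s k)) * l2_norm M (e n)" unfolding y using l2.cauchy_schwarz[OF fL eL] by simp
      also have "\<dots> \<le> B * l2_norm M (e n)" using B(1) l2.nrm_nonneg[OF eL] by (intro mult_right_mono)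
      finally show "norm y \<le> B * l2_norm M (e n)" .
    qed
    from bounded_imp_convergent_subsequence[OF this]
    obtain l r where "strict_mono r" "((\<lambda>k. l2_inner M (f (s k)) (e n)) \<circ> r) \<longlonglongrightarrow> l" by blast
    then show "\<exists>r'. strict_mono r' \<and> P n (s \<circ> r')"
      unfolding P_def by (intro exI[of _ r]) (auto simp: o_def convergent_def)
  qed
  define r where "r = diagseq"
  have r: "strict_mono r" unfolding r_def by (rule subseq_diagseq)
  have conv: "convergent (\<lambda>k. l2_inner M (f (r k)) (e n))" for n
  proof -
    have "P n (diagseq \<circ> ((+) (Suc n)))"
    proof (rule diagseq_holds)
      fix s t :: "nat \<Rightarrow> nat" and m assume "strict_mono s" "P m t"
      then show "P m (t \<circ> s)" unfolding P_def convergent_def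
        using LIMSEQ_subseq_LIMSEQ by (fastforce simp: o_def)
    qed
    then have "convergent (\<lambda>k. l2_inner M (f (r (k + Suc n))) (e n))"
      by (simp add: P_def r_def add.commute)
    then show ?thesis using convergent_ignore_initial_segment[of "\<lambda>k. l2_inner M (f (r k)) (e n)" "Suc n"] by simp
  qed
  then obtain L where L: "\<And>n. (\<lambda>k. l2_inner M (f (r k)) (e n)) \<longlonglongrightarrow> L n"
    unfolding convergent_def by metis
  have LE: "\<exists>l. (\<lambda>k. l2_inner M (f (r k)) h) \<longlonglongrightarrow> l" if h: "h \<in> EE" for h
  proof -
    obtain n where "e n = h" using from_nat_into_surj[OF EE(1) h] by (auto simp: e_def)
    then show ?thesis using L[of n] by auto
  qed
  show ?thesis
  proof (intro exI[of _ r] conjI allI impI r)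
    fix \<delta> :: real assume \<delta>: "\<delta> > 0"
    obtain j where j: "inverse (real (Suc j)) * (2 * B)\<^sup>2 < \<delta>\<^sup>2 / 2"
    proof -
      have "(\<lambda>j. inverse (real (Suc j)) * (2 * B)\<^sup>2) \<longlonglongrightarrow> 0"
        by (rule tendsto_mult_left_zero[OF LIMSEQ_inverse_real_of_nat])
      from order_tendstoD(2)[OF this, of "\<delta>\<^sup>2 / 2"] show thesis
        using \<delta> that by (auto simp: eventually_sequentially)
    qed
    obtain l where l: "\<And>h. h \<in> E j \<Longrightarrow> (\<lambda>k. l2_inner M (f (r k)) h) \<longlonglongrightarrow> l h"
      using LE unfolding EE_def by (metis UN_I UNIV_I insertI2)
    define u where "u k = C j * (\<Sum>h\<in>E j. (l2_inner M (f (r k)) h - l h)\<^sup>2)" for k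
    have "u \<longlonglongrightarrow> C j * (\<Sum>h\<in>E j. (l h - l h)\<^sup>2)"
      unfolding u_def by (intro tendsto_intros l)
    then have "u \<longlonglongrightarrow> 0" by simp
    from order_tendstoD(2)[OF this, of "\<delta>\<^sup>2 / 8"] obtain N where N: "\<And>k. k \<ge> N \<Longrightarrow> u k < \<delta>\<^sup>2 / 8"
      using \<delta> by (auto simp: eventually_sequentially)
    show "\<exists>N. \<forall>k\<ge>N. \<forall>m\<ge>N. l2_norm M (\<lambda>x. f (r k) x - f (r m) x) < \<delta>"
    proof (intro exI allI impI)
      fix k m assume k: "N \<le> k" and m: "N \<le> m"
      define g where "g x = f (r k) x - f (r m) x" for x
      have gQ: "g \<in> Q" unfolding g_def by (intro fQ.diff_mem f)
      have "(l2_norm M g)\<^sup>2 \<le> C j * (\<Sum>h\<in>E j. (l2_inner M g h)\<^sup>2) + inverse (real (Suc j)) * form g g"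
        by (rule ineq[OF gQ])
      also have "C j * (\<Sum>h\<in>E j. (l2_inner M g h)\<^sup>2) \<le> 2 * u k + 2 * u m"
      proof -
        have "(\<Sum>h\<in>E j. (l2_inner M g h)\<^sup>2)
          \<le> (\<Sum>h\<in>E j. 2 * (l2_inner M (f (r k)) h - l h)\<^sup>2 + 2 * (l2_inner M (f (r m)) h - l h)\<^sup>2)"
        proof (rule sum_mono)
          fix h assume "h \<in> E j"
          then have hL: "h \<in> L2 M" using E(2) by blast
          have "l2_inner M g h = (l2_inner M (f (r k)) h - l h) - (l2_inner M (f (r m)) h - l h)"
            unfolding g_def by (simp add: l2.ip_diff fL hL)
          then show "(l2_inner M g h)\<^sup>2 \<le> 2 * (l2_inner M (f (r k)) h - l h)\<^sup>2 + 2 * (l2_inner M (f (r m)) h - l h)\<^sup>2"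
            by (simp only: sq_diff_le)
        qed
        then have "C j * (\<Sum>h\<in>E j. (l2_inner M g h)\<^sup>2)
          \<le> C j * (\<Sum>h\<in>E j. 2 * (l2_inner M (f (r k)) h - l h)\<^sup>2 + 2 * (l2_inner M (f (r m)) h - l h)\<^sup>2)"
          by (intro mult_left_mono E(3))
        then show ?thesis by (simp add: u_def sum.distrib sum_distrib_left[symmetric] algebra_simps)
      qed
      also have "2 * u k + 2 * u m < \<delta>\<^sup>2 / 2" using N[OF k] N[OF m] by simp
      also have "inverse (real (Suc j)) * form g g \<le> inverse (real (Suc j)) * (2 * B)\<^sup>2"
      proof (rule mult_left_mono)
        have "fQ.nrm g \<le> fQ.nrm (f (r k)) + fQ.nrm (f (r m))" unfolding g_def by (intro fQ.triangle_sub f)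
        also have "\<dots> \<le> 2 * B" using B(2)[of "r k"] B(2)[of "r m"] by simp
        finally have "(fQ.nrm g)\<^sup>2 \<le> (2 * B)\<^sup>2" by (intro power_mono fQ.nrm_nonneg gQ)
        then show "form g g \<le> (2 * B)\<^sup>2" by (simp only: fQ.nrm_sq[OF gQ])
      qed simp
      finally have "(l2_norm M g)\<^sup>2 < \<delta>\<^sup>2" using j by simp
      then show "l2_norm M (\<lambda>x. f (r k) x - f (r m) x) < \<delta>"
        unfolding g_def by (rule power2_less_imp_less) (use \<delta> in simp)
    qed
  qed
qed

subsection \<open>Eigenfunctions\<close>

text \<open>Eigenfunctions in the weak sense: only the test functions \<open>\<psi>\<close> are in the domain of \<open>A\<close>.\<close>

definition eig :: "real \<Rightarrow> ('a \<Rightarrow> real) set" where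
  "eig r = {f \<in> Q. \<forall>\<psi>\<in>S. l2_inner M f (A \<psi>) = r * l2_inner M f \<psi>}"

lemma eig_Q: "f \<in> eig r \<Longrightarrow> f \<in> Q"
  by (simp add: eig_def)

text \<open>The weak eigenvalue equation extends from test functions in \<open>S\<close> to the form domain by density.\<close>

lemma form_eig:
  assumes f: "f \<in> eig r" and g: "g \<in> Q"
  shows "form f g = r * l2_inner M f g"
proof -
  obtain G where G: "appr g G" using Q_appr[OF g] by blast
  note fQ = eig_Q[OF f] and gL = Q_L2[OF g]
  note fL = Q_L2[OF fQ]
  have eq: "form f (G k) = r * l2_inner M f (G k)" for k
    using f appr_S[OF G] by (simp add: form_A[OF fQ] eig_def)
  have "(\<lambda>k. l2_inner M (G k) f) \<longlonglongrightarrow> l2_inner M g f"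
    by (rule l2_inner_tendsto[OF appr_L2[OF G] gL fL appr_lim[OF G]])
  then have "(\<lambda>k. l2_inner M f (G k)) \<longlonglongrightarrow> l2_inner M f g"
    by (simp add: l2.ip_sym[OF fL] appr_L2[OF G] gL)
  then have 1: "(\<lambda>k. form f (G k)) \<longlonglongrightarrow> r * l2_inner M f g"
    unfolding eq by (intro tendsto_intros)
  have GQ: "G k \<in> Q" for k by (rule S_Q[OF appr_S[OF G]])
  have "(\<lambda>k. form f (G k) - form f g) \<longlonglongrightarrow> 0"
  proof (rule Lim_null_comparison[OF _ tendsto_mult_right_zero[OF appr_form_null[OF G gL]]], intro always_eventually allI)
    fix k
    show "norm (form f (G k) - form f g) \<le> fQ.nrm f * fQ.nrm (\<lambda>x. G k x - g x)"
      using fQ.cauchy_schwarz[OF fQ fQ.diff_mem[OF GQ g], of k] by (simp add: fQ.ip_diff2 fQ GQ g)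
  qed
  then have "(\<lambda>k. form f (G k)) \<longlonglongrightarrow> form f g" by (rule LIM_zero_cancel)
  from LIMSEQ_unique[OF this 1] show ?thesis .
qed

lemma eig_nonneg:
  assumes f: "f \<in> eig r" and n: "l2_norm M f \<noteq> 0"
  shows "0 \<le> r"
proof -
  have "r * (l2_norm M f)\<^sup>2 = form f f"
    using form_eig[OF f eig_Q[OF f]] l2.nrm_sq[OF Q_L2[OF eig_Q[OF f]]] by simp
  then have "0 \<le> r * (l2_norm M f)\<^sup>2" using fQ.ip_nonneg[OF eig_Q[OF f]] by simp
  then show ?thesis using n by (simp add: zero_le_mult_iff)
qed

lemma eig_orthogonal:
  assumes f: "f \<in> eig r" and g: "g \<in> eig s" and rs: "r \<noteq> s"
  shows "l2_inner M f g = 0"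
proof -
  have "r * l2_inner M f g = s * l2_inner M g f"
    using form_eig[OF f eig_Q[OF g]] form_eig[OF g eig_Q[OF f]] fQ.ip_sym[OF eig_Q[OF f] eig_Q[OF g]] by simp
  then show ?thesis using rs l2.ip_sym[OF Q_L2[OF eig_Q[OF f]] Q_L2[OF eig_Q[OF g]]] by simp
qed

end

subsection \<open>Minimizing the form on the orthogonal complement of finitely many eigenfunctions\<close>

text \<open>That \<open>\<mu>\<close> enumerates all eigenvalues in increasing order excludes an accumulation of eigenvalues below
  a later one; it is what identifies the minimal Rayleigh quotients.\<close>

locale spectral_basis = spectral_form +
  fixes \<mu> :: "nat \<Rightarrow> real" and d :: "nat \<Rightarrow> nat" and \<phi> :: "nat \<Rightarrow> nat \<Rightarrow> 'a \<Rightarrow> real"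
  assumes mu: "strict_mono \<mu>"
    and spectrum: "range \<mu> = {r. \<exists>f\<in>eig r. l2_norm M f \<noteq> 0}"
    and basis: "\<And>j. orthonormal_basis M (eig (\<mu> j)) (d j) (\<phi> j)"
begin

text \<open>A pair \<open>(j, l)\<close> stands for the \<open>l\<close>-th basis function of the \<open>j\<close>-th eigenspace.\<close>

definition indices_upto :: "nat \<Rightarrow> (nat \<times> nat) set" where "indices_upto N = Sigma {..N} (\<lambda>j. {1..d j})"

definition e :: "nat \<times> nat \<Rightarrow> 'a \<Rightarrow> real" where "e z = \<phi> (fst z) (snd z)"

definition indices :: "(nat \<times> nat) set" where "indices = Sigma UNIV (\<lambda>j. {1..d j})"

lemma finite_indices_upto: "finite (indices_upto N)" and indices_upto_subset: "indices_upto N \<subseteq> indices"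
  by (auto simp: indices_upto_def indices_def)

lemma e_eig: "z \<in> indices \<Longrightarrow> e z \<in> eig (\<mu> (fst z))"
  using basis[of "fst z"] by (auto simp: indices_def e_def orthonormal_basis_def)

lemma e_Q: "z \<in> indices \<Longrightarrow> e z \<in> Q"
  using e_eig eig_Q by blast

lemma e_L2: "z \<in> indices \<Longrightarrow> e z \<in> L2 M"
  using e_Q Q_L2 by blast

lemma e_orthonormal: "z \<in> indices \<Longrightarrow> z' \<in> indices \<Longrightarrow> l2_inner M (e z) (e z') = (if z = z' then 1 else 0)"
proof (cases "fst z = fst z'")
  case True
  assume "z \<in> indices" "z' \<in> indices"
  then show ?thesis
    using basis[of "fst z"] True by (auto simp: orthonormal_basis_def indices_def e_def prod_eq_iff)
next
  case False
  assume z: "z \<in> indices" "z' \<in> indices"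
  have "\<mu> (fst z) \<noteq> \<mu> (fst z')" using False mu by (simp add: strict_mono_eq)
  then show ?thesis using eig_orthogonal[OF e_eig[OF z(1)] e_eig[OF z(2)]] False by auto
qed

lemma mu_nonneg: "0 \<le> \<mu> j"
proof -
  have "\<mu> j \<in> {r. \<exists>f\<in>eig r. l2_norm M f \<noteq> 0}" using spectrum by blast
  then show ?thesis using eig_nonneg by blast
qed

lemma d_pos: "1 \<le> d j"
proof (rule ccontr)
  assume "\<not> 1 \<le> d j"
  then have d0: "d j = 0" by simp
  have "\<mu> j \<in> {r. \<exists>f\<in>eig r. l2_norm M f \<noteq> 0}" using spectrum by blast
  then obtain f where f: "f \<in> eig (\<mu> j)" "l2_norm M f \<noteq> 0" by blast
  then have "AE x in M. f x = 0" using basis[of j] d0 by (auto simp: orthonormal_basis_def)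
  then show False using f l2_norm_eq_0_iff[OF Q_L2[OF eig_Q[OF f(1)]]] by simp
qed

definition proj :: "nat \<Rightarrow> ('a \<Rightarrow> real) \<Rightarrow> 'a \<Rightarrow> real" where
  "proj N f x = (\<Sum>z\<in>indices_upto N. l2_inner M f (e z) * e z x)"

lemma proj_L2: "proj N f \<in> L2 M"
  unfolding proj_def using indices_upto_subset e_L2 by (intro l2.sum_mem l2.scale_mem) blast

lemma proj_Q: "proj N f \<in> Q"
  unfolding proj_def using indices_upto_subset e_Q by (intro fQ.sum_mem fQ.scale_mem) blast

lemma inner_proj:
  assumes "g \<in> L2 M"
  shows "l2_inner M g (proj N f) = (\<Sum>z\<in>indices_upto N. l2_inner M f (e z) * l2_inner M g (e z))"
proof -
  have zL: "e z \<in> L2 M" if "z \<in> indices_upto N" for z using that indices_upto_subset e_L2 by blast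
  show ?thesis unfolding proj_def
    by (subst l2.ip_sum2) (auto simp: zL l2.scale_mem assms l2.ip_scale2 intro!: sum.cong)
qed

lemma residual_orthogonal:
  assumes f: "f \<in> L2 M" and z: "z \<in> indices_upto N"
  shows "l2_inner M (\<lambda>x. f x - proj N f x) (e z) = 0"
proof -
  have zZ: "z \<in> indices" using z indices_upto_subset by blast
  have "l2_inner M (proj N f) (e z) = l2_inner M (e z) (proj N f)" by (intro l2.ip_sym proj_L2 e_L2 zZ)
  also have "\<dots> = (\<Sum>z'\<in>indices_upto N. l2_inner M f (e z') * l2_inner M (e z) (e z'))" by (rule inner_proj[OF e_L2[OF zZ]])
  also have "\<dots> = (\<Sum>z'\<in>indices_upto N. if z = z' then l2_inner M f (e z') else 0)"
    using indices_upto_subset zZ by (intro sum.cong refl) (auto simp: e_orthonormal subset_iff)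
  also have "\<dots> = l2_inner M f (e z)" using z finite_indices_upto by simp
  finally show ?thesis using f by (simp add: l2.ip_diff proj_L2 e_L2 zZ)
qed

lemma residual_norm_le:
  assumes f: "f \<in> L2 M"
  shows "l2_norm M (\<lambda>x. f x - proj N f x) \<le> l2_norm M f"
proof -
  define r where "r x = f x - proj N f x" for x
  have rL: "r \<in> L2 M" unfolding r_def by (intro l2.diff_mem f proj_L2)
  have re: "l2_inner M r (e z) = 0" if "z \<in> indices_upto N" for z
    using residual_orthogonal[OF f that] by (simp add: r_def[abs_def])
  have "l2_inner M r (proj N f) = 0"
    by (simp add: inner_proj[OF rL] re)
  then have "(l2_norm M (\<lambda>x. r x + proj N f x))\<^sup>2 = (l2_norm M r)\<^sup>2 + (l2_norm M (proj N f))\<^sup>2"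
    by (simp add: l2.nrm_add_sq rL proj_L2)
  then have "(l2_norm M r)\<^sup>2 \<le> (l2_norm M f)\<^sup>2" by (simp add: r_def)
  then show ?thesis unfolding r_def by (rule power2_le_imp_le) (rule l2.nrm_nonneg[OF f])
qed

text \<open>Projections onto eigenspaces are orthogonal for the form as well, since \<open>form (e z) r\<close> is a multiple
  of the scalar product.\<close>

lemma residual_form_le:
  assumes f: "f \<in> Q"
  shows "form (\<lambda>x. f x - proj N f x) (\<lambda>x. f x - proj N f x) \<le> form f f"
proof -
  define r where "r x = f x - proj N f x" for x
  have rQ: "r \<in> Q" unfolding r_def by (intro fQ.diff_mem f proj_Q)
  have zQ: "e z \<in> Q" if "z \<in> indices_upto N" for z using that indices_upto_subset e_Q by blast
  have "form r (e z) = 0" if z: "z \<in> indices_upto N" for z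
  proof -
    have "form r (e z) = form (e z) r" by (intro fQ.ip_sym rQ zQ z)
    also have "\<dots> = \<mu> (fst z) * l2_inner M (e z) r" using z indices_upto_subset by (intro form_eig[OF e_eig rQ]) auto
    also have "l2_inner M (e z) r = l2_inner M r (e z)" by (intro l2.ip_sym Q_L2 rQ zQ z)
    finally show ?thesis using residual_orthogonal[OF Q_L2[OF f] z] by (simp add: r_def[abs_def])
  qed
  then have "form r (proj N f) = 0"
    unfolding proj_def by (subst fQ.ip_sum2) (auto simp: zQ fQ.scale_mem rQ fQ.ip_scale2)
  then have "(fQ.nrm (\<lambda>x. r x + proj N f x))\<^sup>2 = (fQ.nrm r)\<^sup>2 + (fQ.nrm (proj N f))\<^sup>2"
    by (simp add: fQ.nrm_add_sq rQ proj_Q)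
  then have "(fQ.nrm r)\<^sup>2 \<le> (fQ.nrm f)\<^sup>2" by (simp add: r_def)
  then show ?thesis using fQ.nrm_sq[OF rQ] fQ.nrm_sq[OF f] by (simp add: r_def[abs_def])
qed

definition Q_perp :: "nat \<Rightarrow> ('a \<Rightarrow> real) set" where
  "Q_perp N = {f \<in> Q. \<forall>z\<in>indices_upto N. l2_inner M f (e z) = 0}"

lemma Q_perp_Q: "f \<in> Q_perp N \<Longrightarrow> f \<in> Q"
  by (simp add: Q_perp_def)

lemma Q_perp_lin: "f \<in> Q_perp N \<Longrightarrow> g \<in> Q_perp N \<Longrightarrow> (\<lambda>x. a * f x + b * g x) \<in> Q_perp N"
  using indices_upto_subset by (auto simp: Q_perp_def fQ.lin_mem l2.ip_lin Q_L2 e_L2 subset_iff)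

lemma residual_Q_perp: "f \<in> Q \<Longrightarrow> (\<lambda>x. f x - proj N f x) \<in> Q_perp N"
  using residual_orthogonal[OF Q_L2] by (simp add: Q_perp_def fQ.diff_mem proj_Q)

text \<open>Compactness makes a minimizing sequence converge in norm along a subsequence. Then it converges
  for the form, so the infimum is attained.\<close>

lemma minimizer_exists:
  assumes f0: "f0 \<in> Q_perp N" "l2_norm M f0 \<noteq> 0"
  obtains f \<theta> where "f \<in> Q_perp N" "l2_norm M f = 1" "form f f = \<theta>" "\<And>h. h \<in> Q_perp N \<Longrightarrow> \<theta> * (l2_norm M h)\<^sup>2 \<le> form h h"
proof -
  define R where "R = {form h h | h. h \<in> Q_perp N \<and> l2_norm M h = 1}"
  define \<theta> where "\<theta> = Inf R"
  have Q_perpL: "h \<in> L2 M" if "h \<in> Q_perp N" for h using Q_L2[OF Q_perp_Q[OF that]] .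
  have scale: "(\<lambda>x. a * h x) \<in> Q_perp N" if "h \<in> Q_perp N" for a h using Q_perp_lin[OF that that, of a 0] by simp
  have unit: "(\<lambda>x. (1 / l2_norm M h) * h x) \<in> Q_perp N" "l2_norm M (\<lambda>x. (1 / l2_norm M h) * h x) = 1"
    "form (\<lambda>x. (1 / l2_norm M h) * h x) (\<lambda>x. (1 / l2_norm M h) * h x) = form h h / (l2_norm M h)\<^sup>2"
    if h: "h \<in> Q_perp N" "l2_norm M h \<noteq> 0" for h
  proof -
    show "(\<lambda>x. (1 / l2_norm M h) * h x) \<in> Q_perp N" by (rule scale[OF h(1)])
    show "l2_norm M (\<lambda>x. (1 / l2_norm M h) * h x) = 1"
      using h l2.nrm_nonneg[OF Q_perpL[OF h(1)]] l2.nrm_scale[OF Q_perpL[OF h(1)], of "1 / l2_norm M h"] by simp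
    have "h \<in> Q" using Q_perp_Q[OF h(1)] .
    then show "form (\<lambda>x. (1 / l2_norm M h) * h x) (\<lambda>x. (1 / l2_norm M h) * h x) = form h h / (l2_norm M h)\<^sup>2"
      by (simp only: fQ.ip_scale fQ.ip_scale2 fQ.scale_mem) (simp add: power2_eq_square)
  qed
  have R0: "0 \<le> y" if "y \<in> R" for y using that fQ.ip_nonneg[OF Q_perp_Q] by (auto simp: R_def)
  have bdd: "bdd_below R" using R0 by (intro bdd_belowI[of _ 0])
  have ne: "R \<noteq> {}" using unit[OF f0] unfolding R_def by blast
  have \<theta>0: "0 \<le> \<theta>" unfolding \<theta>_def using ne R0 by (intro cInf_greatest)
  have low: "\<theta> * (l2_norm M h)\<^sup>2 \<le> form h h" if h: "h \<in> Q_perp N" for h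
  proof (cases "l2_norm M h = 0")
    case True then show ?thesis using fQ.ip_nonneg[OF Q_perp_Q[OF h]] by simp
  next
    case False
    have "form h h / (l2_norm M h)\<^sup>2 \<in> R"
      unfolding R_def unit(3)[OF h False, symmetric] using unit(1,2)[OF h False] by blast
    then have "\<theta> \<le> form h h / (l2_norm M h)\<^sup>2" unfolding \<theta>_def using bdd by (rule cInf_lower)
    then show ?thesis using False by (simp add: field_simps)
  qed
  have "\<exists>h. h \<in> Q_perp N \<and> l2_norm M h = 1 \<and> form h h < \<theta> + inverse (real (Suc k))" for k
  proof -
    have "Inf R < \<theta> + inverse (real (Suc k))" unfolding \<theta>_def by simp
    then obtain y where "y \<in> R" "y < \<theta> + inverse (real (Suc k))" using cInf_lessD[OF ne] by blast
    then show ?thesis unfolding R_def by blast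
  qed
  then obtain h where h: "\<And>k. h k \<in> Q_perp N" "\<And>k. l2_norm M (h k) = 1" "\<And>k. form (h k) (h k) < \<theta> + inverse (real (Suc k))"
    by metis
  have nb: "fQ.nrm (h k) \<le> \<theta> + 2" for k
  proof (rule power2_le_imp_le)
    have "inverse (real (Suc k)) \<le> 1" by (simp add: inverse_le_1_iff)
    then have "(fQ.nrm (h k))\<^sup>2 \<le> \<theta> + 1" using h(3)[of k] by (simp add: fQ.nrm_sq[OF Q_perp_Q[OF h(1)]])
    also have "\<dots> \<le> (\<theta> + 2)\<^sup>2" using \<theta>0 by (simp add: power2_eq_square algebra_simps)
    finally show "(fQ.nrm (h k))\<^sup>2 \<le> (\<theta> + 2)\<^sup>2" .
  qed (use \<theta>0 in simp)
  have hb: "l2_norm M (h k) \<le> \<theta> + 2" for k using h(2)[of k] \<theta>0 by simp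
  obtain r :: "nat \<Rightarrow> nat" where r: "strict_mono r" and
    r_cauchy: "\<forall>e>0. \<exists>N. \<forall>k\<ge>N. \<forall>m\<ge>N. l2_norm M (\<lambda>x. h (r k) x - h (r m) x) < e"
    using Q_compact[of h, OF Q_perp_Q[OF h(1)] hb nb] by blast
  define g where "g k = h (r k)" for k
  have g: "g k \<in> Q_perp N" "l2_norm M (g k) = 1" for k using h by (auto simp: g_def)
  note gQ = Q_perp_Q[OF g(1)] and gL = Q_perpL[OF g(1)]
  have gf: "form (g k) (g k) \<le> \<theta> + inverse (real (Suc k))" for k
  proof -
    have "inverse (real (Suc (r k))) \<le> inverse (real (Suc k))"
      using seq_suble[OF r, of k] by (intro le_imp_inverse_le) auto
    then show ?thesis unfolding g_def using h(3)[of "r k"] by linarith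
  qed
  obtain f where f: "f \<in> L2 M" "(\<lambda>k. l2_norm M (\<lambda>x. g k x - f x)) \<longlonglongrightarrow> 0"
    using L2_complete[of g, OF gL] r_cauchy unfolding g_def by blast
  have inv0: "(\<lambda>k. inverse (real (Suc k))) \<longlonglongrightarrow> 0" by (rule LIMSEQ_inverse_real_of_nat)
  \<comment> \<open>By the parallelogram law and minimality, a minimizing sequence that is Cauchy in norm is Cauchy
    for the form.\<close>
  have cauchy: "\<exists>N. \<forall>k\<ge>N. \<forall>m\<ge>N. fQ.nrm (\<lambda>x. g k x - g m x) < \<delta>" if \<delta>: "\<delta> > 0" for \<delta>
  proof -
    define \<eta> where "\<eta> = \<delta> / (\<theta> + 1)"
    have \<eta>: "\<eta> > 0" using \<delta> \<theta>0 by (simp add: \<eta>_def)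
    obtain N1 where N1: "\<And>k m. k \<ge> N1 \<Longrightarrow> m \<ge> N1 \<Longrightarrow> l2_norm M (\<lambda>x. g k x - g m x) < \<delta> / (2 * (\<theta> + 1))"
      using r_cauchy[rule_format, of "\<delta> / (2 * (\<theta> + 1))"] \<delta> \<theta>0 unfolding g_def by auto
    obtain N2 where N2: "\<And>k. k \<ge> N2 \<Longrightarrow> inverse (real (Suc k)) < \<delta>\<^sup>2 / 8"
      using order_tendstoD(2)[OF inv0, of "\<delta>\<^sup>2 / 8"] \<delta> by (auto simp: eventually_sequentially)
    show ?thesis
    proof (intro exI allI impI)
      fix k m assume k: "max N1 N2 \<le> k" and m: "max N1 N2 \<le> m"
      define s where "s x = g k x + g m x" for x
      define t where "t x = g k x - g m x" for x
      have s: "s \<in> Q_perp N" unfolding s_def using Q_perp_lin[OF g(1) g(1), of 1 k 1 m] by simp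
      have tQ: "t \<in> Q" unfolding t_def by (intro fQ.diff_mem gQ)
      have tL: "t \<in> L2 M" using Q_L2[OF tQ] .
      have p1: "(fQ.nrm s)\<^sup>2 + (fQ.nrm t)\<^sup>2 = 2 * (fQ.nrm (g k))\<^sup>2 + 2 * (fQ.nrm (g m))\<^sup>2"
        unfolding s_def t_def by (rule fQ.parallelogram[OF gQ gQ])
      have p2: "(l2_norm M s)\<^sup>2 + (l2_norm M t)\<^sup>2 = 4"
        unfolding s_def t_def using l2.parallelogram[OF gL gL, of k m] g(2) by simp
      have "\<theta> * (l2_norm M s)\<^sup>2 \<le> (fQ.nrm s)\<^sup>2" using low[OF s] by (simp add: fQ.nrm_sq[OF Q_perp_Q[OF s]])
      moreover have "\<theta> * (l2_norm M s)\<^sup>2 = \<theta> * 4 - \<theta> * (l2_norm M t)\<^sup>2"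
        using p2 by (simp add: right_diff_distrib[symmetric] eq_diff_eq)
      moreover have "(fQ.nrm (g i))\<^sup>2 \<le> \<theta> + inverse (real (Suc i))" for i
        using gf[of i] by (simp add: fQ.nrm_sq[OF gQ])
      ultimately have "(fQ.nrm t)\<^sup>2 \<le> 2 * inverse (real (Suc k)) + 2 * inverse (real (Suc m)) + \<theta> * (l2_norm M t)\<^sup>2"
        using p1 by (smt (verit))
      also have "\<dots> < \<delta>\<^sup>2 / 2 + \<delta>\<^sup>2 / 2"
      proof (rule add_less_le_mono)
        show "2 * inverse (real (Suc k)) + 2 * inverse (real (Suc m)) < \<delta>\<^sup>2 / 2" using N2[of k] N2[of m] k m by simp
        have "(l2_norm M t)\<^sup>2 \<le> (\<delta> / (2 * (\<theta> + 1)))\<^sup>2"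
          using N1[of k m] k m l2.nrm_nonneg[OF tL] unfolding t_def by (intro power_mono) auto
        then have "\<theta> * (l2_norm M t)\<^sup>2 \<le> \<theta> * (\<delta> / (2 * (\<theta> + 1)))\<^sup>2" using \<theta>0 by (rule mult_left_mono)
        also have "\<dots> \<le> \<delta>\<^sup>2 / 2"
        proof -
          have "\<theta> / (\<theta> + 1)\<^sup>2 \<le> 1" using \<theta>0 by (simp add: power2_eq_square divide_le_eq algebra_simps)
          then have "\<theta> / (\<theta> + 1)\<^sup>2 * (\<delta>\<^sup>2 / 4) \<le> 1 * (\<delta>\<^sup>2 / 4)" by (rule mult_right_mono) simp
          also have "\<dots> \<le> \<delta>\<^sup>2 / 2" by simp
          finally show ?thesis unfolding power_divide power_mult_distrib by simp
        qed
        finally show "\<theta> * (l2_norm M t)\<^sup>2 \<le> \<delta>\<^sup>2 / 2" .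
      qed
      finally have "(fQ.nrm t)\<^sup>2 < \<delta>\<^sup>2" by simp
      then show "fQ.nrm (\<lambda>x. g k x - g m x) < \<delta>" unfolding t_def by (rule power2_less_imp_less) (use \<delta> in simp)
    qed
  qed
  note fQ = Q_closed[OF gQ f cauchy]
  have n1: "l2_norm M f = 1"
    using LIMSEQ_unique[OF l2_norm_tendsto[OF gL f]] g(2) by simp
  have orth: "l2_inner M f (e z) = 0" if z: "z \<in> indices_upto N" for z
  proof -
    have "e z \<in> L2 M" using z indices_upto_subset e_L2 by blast
    from l2_inner_tendsto[OF gL f(1) this f(2)] show ?thesis
      using g(1) z by (simp add: Q_perp_def LIMSEQ_const_iff)
  qed
  have fN: "f \<in> Q_perp N" using fQ(1) orth by (simp add: Q_perp_def)
  have "form f f \<le> \<theta>"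
  proof -
    have lim: "(\<lambda>k. fQ.nrm (g k)) \<longlonglongrightarrow> fQ.nrm f"
    proof (rule LIM_zero_cancel, rule Lim_null_comparison[OF _ fQ(2)], intro always_eventually allI)
      fix k show "norm (fQ.nrm (g k) - fQ.nrm f) \<le> fQ.nrm (\<lambda>x. g k x - f x)"
        using fQ.nrm_diff_le[OF gQ fQ(1), of k] by simp
    qed
    have "(fQ.nrm f)\<^sup>2 \<le> \<theta> + 0"
    proof (rule LIMSEQ_le)
      show "(\<lambda>k. (fQ.nrm (g k))\<^sup>2) \<longlonglongrightarrow> (fQ.nrm f)\<^sup>2" by (intro tendsto_intros lim)
      show "(\<lambda>k. \<theta> + inverse (real (Suc k))) \<longlonglongrightarrow> \<theta> + 0" by (intro tendsto_intros inv0)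
      show "\<exists>N. \<forall>k\<ge>N. (fQ.nrm (g k))\<^sup>2 \<le> \<theta> + inverse (real (Suc k))"
        using gf by (simp only: fQ.nrm_sq[OF gQ]) blast
    qed
    then show ?thesis by (simp add: fQ.nrm_sq[OF fQ(1)])
  qed
  moreover have "\<theta> \<le> form f f" using low[OF fN] n1 by simp
  ultimately show thesis using that[OF fN n1 _ low] by simp
qed

text \<open>A minimizer annihilates the nonnegative form \<open>form - \<theta> \<langle>_,_\<rangle>\<close> on the complement, hence is an
  eigenfunction.\<close>

lemma spectral_gap:
  assumes f0: "f0 \<in> Q_perp N"
  shows "\<mu> (Suc N) * (l2_norm M f0)\<^sup>2 \<le> form f0 f0"
proof (cases "l2_norm M f0 = 0")
  case True then show ?thesis using fQ.ip_nonneg[OF Q_perp_Q[OF f0]] by simp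
next
  case False
  obtain f \<theta> where f: "f \<in> Q_perp N" "l2_norm M f = 1" "form f f = \<theta>"
    and low: "\<And>h. h \<in> Q_perp N \<Longrightarrow> \<theta> * (l2_norm M h)\<^sup>2 \<le> form h h"
    by (rule minimizer_exists[OF f0 False]) blast
  define c where "c u v = form u v - \<theta> * l2_inner M u v" for u v
  have Q_perpL: "h \<in> L2 M" if "h \<in> Q_perp N" for h using Q_L2[OF Q_perp_Q[OF that]] .
  interpret c: semi_inner "Q_perp N" c
  proof
    show "(\<lambda>x. 0) \<in> Q_perp N" using Q_perp_lin[OF f0 f0, of 0 0] by simp
    show "c u v = c v u" if "u \<in> Q_perp N" "v \<in> Q_perp N" for u v
      using that by (simp add: c_def fQ.ip_sym[of u v] l2.ip_sym[of u _ v] Q_perp_Q Q_perpL)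
    show "c (\<lambda>x. a * u x + b * v x) w = a * c u w + b * c v w" if "u \<in> Q_perp N" "v \<in> Q_perp N" "w \<in> Q_perp N" for u v w a b
      using that by (simp add: c_def fQ.ip_lin l2.ip_lin Q_perp_Q Q_perpL algebra_simps)
    show "0 \<le> c u u" if "u \<in> Q_perp N" for u
      using low[OF that] l2.nrm_sq[OF Q_perpL[OF that]] by (simp add: c_def)
  qed (rule Q_perp_lin)
  have "c f f = 0" using f(2,3) l2.nrm_sq[OF Q_perpL[OF f(1)]] by (simp add: c_def)
  then have c0: "c f h = 0" if "h \<in> Q_perp N" for h
    using c.cauchy_schwarz[OF f(1) that] by (simp add: c.nrm_def)
  have fQ: "f \<in> Q" and fL: "f \<in> L2 M" using Q_perp_Q[OF f(1)] Q_perpL[OF f(1)] .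
  have "f \<in> eig \<theta>"
    unfolding eig_def
  proof (intro CollectI conjI ballI fQ)
    fix \<psi> assume \<psi>: "\<psi> \<in> S"
    have \<psi>Q: "\<psi> \<in> Q" by (rule S_Q[OF \<psi>])
    define h where "h x = \<psi> x - proj N \<psi> x" for x
    have hN: "h \<in> Q_perp N" unfolding h_def by (rule residual_Q_perp[OF \<psi>Q])
    have zQ: "e z \<in> Q" "e z \<in> L2 M" if "z \<in> indices_upto N" for z using that indices_upto_subset e_Q e_L2 by blast+
    have f_e: "l2_inner M f (e z) = 0" if "z \<in> indices_upto N" for z using f(1) that by (simp add: Q_perp_def)
    have "l2_inner M f (proj N \<psi>) = 0" using f_e by (simp add: inner_proj[OF fL])
    moreover have "form f (proj N \<psi>) = 0"
    proof -
      have "form f (e z) = 0" if z: "z \<in> indices_upto N" for z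
      proof -
        have "form f (e z) = form (e z) f" by (intro fQ.ip_sym fQ zQ z)
        also have "\<dots> = \<mu> (fst z) * l2_inner M (e z) f" using z indices_upto_subset by (intro form_eig[OF e_eig fQ]) auto
        also have "l2_inner M (e z) f = 0" using f_e[OF z] l2.ip_sym[OF fL zQ(2)[OF z]] by simp
        finally show ?thesis by simp
      qed
      then show ?thesis unfolding proj_def by (subst fQ.ip_sum2) (auto simp: zQ fQ.scale_mem fQ fQ.ip_scale2)
    qed
    moreover have "form f h = form f \<psi> - form f (proj N \<psi>)"
      unfolding h_def by (intro fQ.ip_diff2 \<psi>Q proj_Q fQ)
    moreover have "l2_inner M f h = l2_inner M f \<psi> - l2_inner M f (proj N \<psi>)"
      unfolding h_def by (intro l2.ip_diff2 Q_L2[OF \<psi>Q] proj_L2 fL)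
    moreover have "form f h = \<theta> * l2_inner M f h" using c0[OF hN] by (simp add: c_def)
    ultimately show "l2_inner M f (A \<psi>) = \<theta> * l2_inner M f \<psi>" using form_A[OF fQ \<psi>] by simp
  qed
  moreover from this have "\<theta> \<in> range \<mu>" unfolding spectrum using f(2) by force
  ultimately obtain m where m: "\<theta> = \<mu> m" "f \<in> eig (\<mu> m)" by blast
  \<comment> \<open>an eigenfunction for \<open>\<mu>\<^sub>m\<close> with \<open>m \<le> N\<close> would be orthogonal to itself\<close>
  have "m > N"
  proof (rule ccontr)
    assume "\<not> m > N"
    then have mz: "(m, l) \<in> indices_upto N" if "l \<in> {1..d m}" for l using that by (simp add: indices_upto_def)
    obtain a where a: "AE x in M. f x = (\<Sum>l=1..d m. a l * \<phi> m l x)"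
      using basis[of m] m(2) unfolding orthonormal_basis_def by blast
    have \<phi>L: "\<phi> m l \<in> L2 M" if "l \<in> {1..d m}" for l
      using e_L2[of "(m, l)"] that by (simp add: indices_def e_def)
    have sL: "(\<lambda>x. \<Sum>l=1..d m. a l * \<phi> m l x) \<in> L2 M" by (intro l2.sum_mem l2.scale_mem \<phi>L)
    have "l2_inner M f f = l2_inner M f (\<lambda>x. \<Sum>l=1..d m. a l * \<phi> m l x)"
      using a fL sL by (intro l2_inner_cong_AE) (auto simp: L2_measurable)
    also have "\<dots> = (\<Sum>l=1..d m. a l * l2_inner M f (\<phi> m l))"
      by (subst l2.ip_sum2) (auto simp: \<phi>L fL l2.scale_mem l2.ip_scale2 intro!: sum.cong)
    also have "\<dots> = 0" using f(1) mz by (force simp: Q_perp_def e_def intro!: sum.neutral)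
    finally show False using f(2) by (simp add: l2_norm_def)
  qed
  then have "\<mu> (Suc N) \<le> \<theta>" using mu m(1) by (simp add: strict_mono_less_eq)
  then have "\<mu> (Suc N) * (l2_norm M f0)\<^sup>2 \<le> \<theta> * (l2_norm M f0)\<^sup>2" by (intro mult_right_mono) auto
  then show ?thesis using low[OF f0] by simp
qed

subsection \<open>Completeness of the eigenfunctions\<close>

text \<open>Otherwise an orthonormal sequence would be bounded in the form norm, but its members have
  mutual distance \<open>\<surd>2\<close>.\<close>

lemma mu_unbounded: "\<exists>j. \<mu> j > B"
proof (rule ccontr)
  assume "\<not> ?thesis"
  then have B: "\<mu> j \<le> B" for j by (simp add: not_less)
  define g where "g j = e (j, 1)" for j
  have z: "(j, 1) \<in> indices" for j using d_pos[of j] by (simp add: indices_def)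
  have gL: "g j \<in> L2 M" and gQ: "g j \<in> Q" for j using e_L2[OF z] e_Q[OF z] by (auto simp: g_def)
  have ip: "l2_inner M (g i) (g j) = (if i = j then 1 else 0)" for i j
    using e_orthonormal[OF z z, of i j] by (simp add: g_def)
  have n1: "l2_norm M (g j) = 1" for j using ip[of j j] by (simp add: l2_norm_def)
  have "form (g j) (g j) = \<mu> j" for j
    using form_eig[OF e_eig[OF z] gQ, of j] ip[of j j] by (simp add: g_def)
  then have fn: "fQ.nrm (g j) = sqrt (\<mu> j)" for j by (simp add: fQ.nrm_def)
  have g1: "l2_norm M (g k) \<le> max 1 (sqrt B)" for k by (simp add: n1)
  have g2: "fQ.nrm (g k) \<le> max 1 (sqrt B)" for k unfolding fn using B[of k] by (simp add: le_max_iff_disj)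
  obtain r :: "nat \<Rightarrow> nat" where r: "strict_mono r" and
    r_cauchy: "\<forall>e>0. \<exists>N. \<forall>k\<ge>N. \<forall>m\<ge>N. l2_norm M (\<lambda>x. g (r k) x - g (r m) x) < e"
    using Q_compact[of g, OF gQ g1 g2] by blast
  obtain N where N: "\<And>k m. k \<ge> N \<Longrightarrow> m \<ge> N \<Longrightarrow> l2_norm M (\<lambda>x. g (r k) x - g (r m) x) < 1" using r_cauchy[rule_format, of 1] by auto
  have "r N \<noteq> r (Suc N)" using r by (simp add: strict_mono_eq)
  then have "(l2_norm M (\<lambda>x. g (r N) x - g (r (Suc N)) x))\<^sup>2 = 2"
    using l2.nrm_diff_sq[OF gL gL, of "r N" "r (Suc N)"] by (simp add: n1 ip)
  moreover have "(l2_norm M (\<lambda>x. g (r N) x - g (r (Suc N)) x))\<^sup>2 \<le> 1\<^sup>2"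
    using N[of N "Suc N"] l2.nrm_nonneg[OF l2.diff_mem[OF gL gL]] by (intro power_mono) auto
  ultimately show False by simp
qed

text \<open>By the spectral gap the residual of \<open>F \<in> S\<close> satisfies \<open>\<mu>\<^sub>N\<^sub>+\<^sub>1 \<parallel>F - proj N F\<parallel>\<^sup>2 \<le> form F F\<close>. For
  general \<open>f\<close>, approximate by such \<open>F\<close>; taking residuals does not increase norms.\<close>

theorem eigenfunctions_complete:
  assumes f: "f \<in> L2 M"
  shows "(\<lambda>N. l2_norm M (\<lambda>x. f x - proj N f x)) \<longlonglongrightarrow> 0"
proof (rule LIMSEQ_I)
  fix \<delta> :: real assume \<delta>: "\<delta> > 0"
  obtain F where F: "F \<in> S" "l2_norm M (\<lambda>x. f x - F x) < \<delta> / 2" using S_dense[OF f, of "\<delta>/2"] \<delta> by auto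
  have FQ: "F \<in> Q" and FL: "F \<in> L2 M" using S_Q[OF F(1)] S_L2[OF F(1)] .
  obtain j where j: "\<mu> j > 4 * form F F / \<delta>\<^sup>2" using mu_unbounded by blast
  have "norm (l2_norm M (\<lambda>x. f x - proj N f x) - 0) < \<delta>" if N: "N \<ge> j" for N
  proof -
    define h where "h x = F x - proj N F x" for x
    have hN: "h \<in> Q_perp N" unfolding h_def by (rule residual_Q_perp[OF FQ])
    have "\<mu> j \<le> \<mu> (Suc N)" using N mu by (simp add: strict_mono_less_eq)
    then have mpos: "\<mu> (Suc N) > 4 * form F F / \<delta>\<^sup>2" using j by simp
    have "\<mu> (Suc N) * (l2_norm M h)\<^sup>2 \<le> form h h" by (rule spectral_gap[OF hN])
    also have "\<dots> \<le> form F F" unfolding h_def by (rule residual_form_le[OF FQ])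
    also have "\<dots> < \<mu> (Suc N) * (\<delta> / 2)\<^sup>2" using mpos \<delta> by (simp add: field_simps)
    finally have lt: "\<mu> (Suc N) * (l2_norm M h)\<^sup>2 < \<mu> (Suc N) * (\<delta> / 2)\<^sup>2" .
    then have "(l2_norm M h)\<^sup>2 < (\<delta> / 2)\<^sup>2" using mu_nonneg[of "Suc N"] by (rule mult_left_less_imp_less)
    then have h_small: "l2_norm M h < \<delta> / 2" by (rule power2_less_imp_less) (use \<delta> in simp)
    define u where "u x = f x - F x" for x
    have uL: "u \<in> L2 M" unfolding u_def by (intro l2.diff_mem f FL)
    have "proj N u x = proj N f x - proj N F x" for x
    proof -
      have "l2_inner M u (e z) = l2_inner M f (e z) - l2_inner M F (e z)" if "z \<in> indices_upto N" for z
        unfolding u_def using that indices_upto_subset e_L2 by (intro l2.ip_diff f FL) blast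
      then show ?thesis by (simp add: proj_def sum_subtractf[symmetric] left_diff_distrib)
    qed
    then have "(\<lambda>x. f x - proj N f x) = (\<lambda>x. (u x - proj N u x) + h x)" by (auto simp: fun_eq_iff u_def h_def)
    then have "l2_norm M (\<lambda>x. f x - proj N f x) \<le> l2_norm M (\<lambda>x. u x - proj N u x) + l2_norm M h"
      using l2.triangle[OF l2.diff_mem[OF uL proj_L2] Q_L2[OF Q_perp_Q[OF hN]]] by simp
    also have "\<dots> < \<delta> / 2 + \<delta> / 2"
      using residual_norm_le[OF uL, of N] F(2) h_small unfolding u_def by linarith
    finally show ?thesis using l2.nrm_nonneg[OF l2.diff_mem[OF f proj_L2], of N] by simp
  qed
  then show "\<exists>no. \<forall>N\<ge>no. norm (l2_norm M (\<lambda>x. f x - proj N f x) - 0) < \<delta>" by blast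
qed

end

section \<open>Metric projection and soft thresholding\<close>

text \<open>A minimizing sequence is Cauchy by the parallelogram law because midpoints stay in the convex set.\<close>

lemma (in finite_measure) nearest_point_exists:
  assumes C: "C \<subseteq> L2 M" "C \<noteq> {}" and f: "f \<in> L2 M"
    and convex: "\<And>p r t. p \<in> C \<Longrightarrow> r \<in> C \<Longrightarrow> 0 \<le> t \<Longrightarrow> t \<le> 1 \<Longrightarrow> (\<lambda>x. (1 - t) * p x + t * r x) \<in> C"
    and closed: "\<And>F p. (\<And>k. F k \<in> C) \<Longrightarrow> p \<in> L2 M \<Longrightarrow> (\<lambda>k. l2_norm M (\<lambda>x. F k x - p x)) \<longlonglongrightarrow> 0 \<Longrightarrow> p \<in> C"
  shows "\<exists>p\<in>C. \<forall>r\<in>C. l2_norm M (\<lambda>x. f x - p x) \<le> l2_norm M (\<lambda>x. f x - r x)"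
proof -
  define R where "R = (\<lambda>r. l2_norm M (\<lambda>x. f x - r x)) ` C"
  define m where "m = Inf R"
  have CL: "r \<in> L2 M" if "r \<in> C" for r using that C(1) by blast
  have R0: "0 \<le> y" if "y \<in> R" for y using that f CL by (auto simp: R_def intro!: l2.nrm_nonneg l2.diff_mem)
  have bdd: "bdd_below R" using R0 by (intro bdd_belowI[of _ 0])
  have ne: "R \<noteq> {}" using C(2) by (simp add: R_def)
  have m0: "0 \<le> m" unfolding m_def using ne R0 by (intro cInf_greatest)
  have low: "m \<le> l2_norm M (\<lambda>x. f x - r x)" if "r \<in> C" for r
    unfolding m_def using that by (intro cInf_lower bdd) (auto simp: R_def)
  have "\<exists>r. r \<in> C \<and> l2_norm M (\<lambda>x. f x - r x) < m + inverse (real (Suc k))" for k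
  proof -
    have "Inf R < m + inverse (real (Suc k))" unfolding m_def by simp
    then obtain y where "y \<in> R" "y < m + inverse (real (Suc k))" using cInf_lessD[OF ne] by blast
    then show ?thesis unfolding R_def by blast
  qed
  then obtain g where g: "\<And>k. g k \<in> C" "\<And>k. l2_norm M (\<lambda>x. f x - g k x) < m + inverse (real (Suc k))" by metis
  note gL = CL[OF g(1)]
  have inv0: "(\<lambda>k. inverse (real (Suc k))) \<longlonglongrightarrow> 0" by (rule LIMSEQ_inverse_real_of_nat)
  define D where "D k = (m + inverse (real (Suc k)))\<^sup>2 - m\<^sup>2" for k
  have D0: "D \<longlonglongrightarrow> 0"
  proof -
    have "D \<longlonglongrightarrow> (m + 0)\<^sup>2 - m\<^sup>2" unfolding D_def by (intro tendsto_intros inv0)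
    then show ?thesis by simp
  qed
  have key: "(l2_norm M (\<lambda>x. g k x - g i x))\<^sup>2 \<le> 2 * D k + 2 * D i" for k i
  proof -
    define a where "a x = f x - g k x" for x
    define b where "b x = f x - g i x" for x
    have L: "a \<in> L2 M" "b \<in> L2 M" unfolding a_def b_def by (intro l2.diff_mem f gL)+
    have "(\<lambda>x. (1 - 1/2) * g k x + 1/2 * g i x) \<in> C" by (intro convex g) auto
    from low[OF this] have "m \<le> l2_norm M (\<lambda>x. (1/2) * (a x + b x))" by (simp add: a_def b_def algebra_simps)
    then have "2 * m \<le> l2_norm M (\<lambda>x. a x + b x)" using l2.nrm_scale[OF l2.add_mem[OF L], of "1/2"] by simp
    then have "(2 * m)\<^sup>2 \<le> (l2_norm M (\<lambda>x. a x + b x))\<^sup>2" using m0 by (intro power_mono) auto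
    moreover have "(l2_norm M a)\<^sup>2 \<le> m\<^sup>2 + D k" "(l2_norm M b)\<^sup>2 \<le> m\<^sup>2 + D i"
    proof -
      have "(l2_norm M a)\<^sup>2 \<le> (m + inverse (real (Suc k)))\<^sup>2"
        using g(2)[of k] unfolding a_def[symmetric] by (intro power_mono l2.nrm_nonneg L) simp
      then show "(l2_norm M a)\<^sup>2 \<le> m\<^sup>2 + D k" by (simp add: D_def)
      have "(l2_norm M b)\<^sup>2 \<le> (m + inverse (real (Suc i)))\<^sup>2"
        using g(2)[of i] unfolding b_def[symmetric] by (intro power_mono l2.nrm_nonneg L) simp
      then show "(l2_norm M b)\<^sup>2 \<le> m\<^sup>2 + D i" by (simp add: D_def)
    qed
    moreover have "(2 * m)\<^sup>2 = 4 * m\<^sup>2" by (simp add: power_mult_distrib)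
    ultimately have "(l2_norm M (\<lambda>x. a x - b x))\<^sup>2 \<le> 2 * D k + 2 * D i"
      using l2.parallelogram[OF L] by linarith
    moreover have "l2_norm M (\<lambda>x. a x - b x) = l2_norm M (\<lambda>x. g k x - g i x)"
      using l2.nrm_minus_commute[OF gL gL, of k i] by (simp add: a_def b_def)
    ultimately show ?thesis by simp
  qed
  have cauchy: "\<exists>N. \<forall>k\<ge>N. \<forall>i\<ge>N. l2_norm M (\<lambda>x. g k x - g i x) < \<delta>" if \<delta>: "\<delta> > 0" for \<delta>
  proof -
    obtain N where N: "\<And>k. k \<ge> N \<Longrightarrow> D k < \<delta>\<^sup>2 / 4"
      using order_tendstoD(2)[OF D0, of "\<delta>\<^sup>2 / 4"] \<delta> by (auto simp: eventually_sequentially)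
    show ?thesis
    proof (intro exI allI impI)
      fix k i assume "N \<le> k" "N \<le> i"
      then have "(l2_norm M (\<lambda>x. g k x - g i x))\<^sup>2 < \<delta>\<^sup>2" using key[of k i] N[of k] N[of i] by linarith
      then show "l2_norm M (\<lambda>x. g k x - g i x) < \<delta>" by (rule power2_less_imp_less) (use \<delta> in simp)
    qed
  qed
  obtain p where p: "p \<in> L2 M" "(\<lambda>k. l2_norm M (\<lambda>x. g k x - p x)) \<longlonglongrightarrow> 0"
    using L2_complete[of g, OF gL] cauchy by blast
  have pC: "p \<in> C" by (rule closed[OF g(1) p])
  have "l2_norm M (\<lambda>x. f x - p x) \<le> m"
  proof (rule LIMSEQ_le_const)
    show "(\<lambda>k. (m + inverse (real (Suc k))) + l2_norm M (\<lambda>x. g k x - p x)) \<longlonglongrightarrow> m"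
      using tendsto_add[OF tendsto_add[OF tendsto_const[of m] inv0] p(2)] by simp
    show "\<exists>N. \<forall>k\<ge>N. l2_norm M (\<lambda>x. f x - p x) \<le> (m + inverse (real (Suc k))) + l2_norm M (\<lambda>x. g k x - p x)"
    proof (intro exI allI impI)
      fix k
      show "l2_norm M (\<lambda>x. f x - p x) \<le> (m + inverse (real (Suc k))) + l2_norm M (\<lambda>x. g k x - p x)"
        using l2.triangle_diff[OF f gL p(1), of k] g(2)[of k] by linarith
    qed
  qed
  then have "l2_norm M (\<lambda>x. f x - p x) \<le> l2_norm M (\<lambda>x. f x - r x)" if "r \<in> C" for r
    using low[OF that] by (rule order_trans)
  then show ?thesis using pC by blast
qed

text \<open>The angle at the nearest point \<open>r\<close> between \<open>f\<close> and any other point \<open>p\<close> of the convex set is not acute,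
  so \<open>r\<close> is at most as far from \<open>p\<close> as \<open>f\<close> is.\<close>

lemma (in finite_measure) metric_proj_le:
  assumes C: "C \<subseteq> L2 M" and f: "f \<in> L2 M" and p: "p \<in> C"
    and convex: "\<And>p r t. p \<in> C \<Longrightarrow> r \<in> C \<Longrightarrow> 0 \<le> t \<Longrightarrow> t \<le> 1 \<Longrightarrow> (\<lambda>x. (1 - t) * p x + t * r x) \<in> C"
    and closed: "\<And>F p. (\<And>k. F k \<in> C) \<Longrightarrow> p \<in> L2 M \<Longrightarrow> (\<lambda>k. l2_norm M (\<lambda>x. F k x - p x)) \<longlonglongrightarrow> 0 \<Longrightarrow> p \<in> C"
  shows "l2_norm M (\<lambda>x. metric_proj M C f x - p x) \<le> l2_norm M (\<lambda>x. f x - p x)"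
proof -
  define r where "r = metric_proj M C f"
  have ne: "C \<noteq> {}" using p by blast
  have "\<exists>r\<in>C. \<forall>s\<in>C. l2_norm M (\<lambda>x. f x - r x) \<le> l2_norm M (\<lambda>x. f x - s x)"
    by (rule nearest_point_exists[OF C ne f]) ((rule convex; assumption), (rule closed; assumption))
  from someI_ex[OF this[unfolded Bex_def]] have rC: "r \<in> C" and rmin: "\<And>s. s \<in> C \<Longrightarrow> l2_norm M (\<lambda>x. f x - r x) \<le> l2_norm M (\<lambda>x. f x - s x)"
    unfolding r_def metric_proj_def by auto
  define a where "a x = f x - r x" for x
  define b where "b x = p x - r x" for x
  have L: "a \<in> L2 M" "b \<in> L2 M" unfolding a_def b_def using C rC p f by (auto intro: l2.diff_mem)
  have "2 * l2_inner M a b \<le> t * (l2_norm M b)\<^sup>2" if t: "0 < t" "t \<le> 1" for t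
  proof -
    have "(\<lambda>x. (1 - t) * r x + t * p x) \<in> C" using t by (intro convex rC p) auto
    from rmin[OF this] have "l2_norm M a \<le> l2_norm M (\<lambda>x. a x - t * b x)"
      by (simp add: a_def[abs_def] b_def algebra_simps)
    then have "(l2_norm M a)\<^sup>2 \<le> (l2_norm M (\<lambda>x. a x - t * b x))\<^sup>2"
      by (intro power_mono l2.nrm_nonneg L)
    also have "\<dots> = (l2_norm M a)\<^sup>2 - 2 * (t * l2_inner M a b) + t\<^sup>2 * (l2_norm M b)\<^sup>2"
      using t by (simp add: l2.nrm_diff_sq L l2.scale_mem l2.ip_scale2 l2.nrm_scale power_mult_distrib)
    finally have "t * (2 * l2_inner M a b) \<le> t * (t * (l2_norm M b)\<^sup>2)" by (simp add: power2_eq_square)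
    then show ?thesis using t by simp
  qed
  have ab: "l2_inner M a b \<le> 0"
  proof (rule ccontr)
    assume "\<not> ?thesis"
    then have pos: "l2_inner M a b > 0" by simp
    define s where "s = (l2_norm M b)\<^sup>2"
    have s: "0 \<le> s" by (simp add: s_def)
    define t where "t = min 1 (l2_inner M a b / (s + 1))"
    have t: "0 < t" "t \<le> 1" using pos s by (auto simp: t_def)
    have "t * s \<le> l2_inner M a b / (s + 1) * s" using s by (intro mult_right_mono) (auto simp: t_def)
    also have "\<dots> \<le> l2_inner M a b" using pos s by (simp add: field_simps)
    finally show False using \<open>\<And>t. 0 < t \<Longrightarrow> t \<le> 1 \<Longrightarrow> 2 * l2_inner M a b \<le> t * (l2_norm M b)\<^sup>2\<close>[OF t] pos
      unfolding s_def by linarith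
  qed
  have "(l2_norm M b)\<^sup>2 \<le> (l2_norm M (\<lambda>x. a x - b x))\<^sup>2"
    unfolding l2.nrm_diff_sq[OF L] using ab zero_le_power2[of "l2_norm M a"] by linarith
  then have "l2_norm M b \<le> l2_norm M (\<lambda>x. a x - b x)"
    by (rule power2_le_imp_le) (intro l2.nrm_nonneg l2.diff_mem L)
  moreover have "l2_norm M b = l2_norm M (\<lambda>x. r x - p x)"
    unfolding b_def using C rC p by (intro l2.nrm_minus_commute) auto
  ultimately show ?thesis by (simp add: a_def b_def r_def)
qed

lemma densities_convex:
  assumes "p \<in> densities M" "r \<in> densities M" "0 \<le> t" "t \<le> 1" and fin: "finite_measure M"
  shows "(\<lambda>x. (1 - t) * p x + t * r x) \<in> densities M"
proof -
  interpret finite_measure M by fact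
  have L: "p \<in> L2 M" "r \<in> L2 M" and pos: "AE x in M. 0 \<le> p x" "AE x in M. 0 \<le> r x"
    and one: "(\<integral>x. p x \<partial>M) = 1" "(\<integral>x. r x \<partial>M) = 1"
    using assms by (auto simp: densities_def)
  have "AE x in M. 0 \<le> (1 - t) * p x + t * r x" using pos by eventually_elim (use assms in simp)
  moreover have "(\<integral>x. (1 - t) * p x + t * r x \<partial>M) = 1"
    using L2_integrable[OF L(1)] L2_integrable[OF L(2)] one by simp
  ultimately show ?thesis using L by (simp add: densities_def L2_lin)
qed

text \<open>The negative part \<open>h\<close> of the limit satisfies \<open>\<langle>p, h\<rangle> \<ge> 0\<close>, as a limit of nonnegative numbers, but also
  \<open>\<langle>p, h\<rangle> = - \<parallel>h\<parallel>\<^sup>2\<close>.\<close>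

lemma (in finite_measure) densities_closed:
  assumes F: "\<And>k. F k \<in> densities M" and p: "p \<in> L2 M" and lim: "(\<lambda>k. l2_norm M (\<lambda>x. F k x - p x)) \<longlonglongrightarrow> 0"
  shows "p \<in> densities M"
proof -
  have FL: "F k \<in> L2 M" for k using F by (simp add: densities_def)
  have pm[measurable]: "p \<in> borel_measurable M" using L2_measurable[OF p] .
  define h where "h x = max 0 (- p x)" for x
  have hm[measurable]: "h \<in> borel_measurable M" unfolding h_def by measurable
  have h: "h \<in> L2 M"
  proof -
    have "integrable M (\<lambda>x. (p x)\<^sup>2)" using p by (simp add: L2_def)
    then have "integrable M (\<lambda>x. (h x)\<^sup>2)"
    proof (rule Bochner_Integration.integrable_bound)
      show "AE x in M. norm ((h x)\<^sup>2) \<le> norm ((p x)\<^sup>2)" by (intro AE_I2) (auto simp: h_def max_def)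
    qed measurable
    then show ?thesis by (simp add: L2_def)
  qed
  have "0 \<le> l2_inner M p h"
  proof (rule LIMSEQ_le_const[OF l2_inner_tendsto[OF FL p h lim]], intro exI allI impI)
    fix k
    have "AE x in M. 0 \<le> F k x" using F[of k] by (simp add: densities_def)
    then have "AE x in M. 0 \<le> F k x * h x" by eventually_elim (simp add: h_def)
    then show "0 \<le> l2_inner M (F k) h" unfolding l2_inner_def by (rule integral_nonneg_AE)
  qed
  moreover have "l2_inner M p h = - l2_inner M h h"
    unfolding l2_inner_def Bochner_Integration.integral_minus[symmetric]
    by (intro Bochner_Integration.integral_cong) (auto simp: h_def max_def)
  ultimately have "l2_norm M h = 0" using l2.ip_nonneg[OF h] by (simp add: l2_norm_def)
  then have "AE x in M. h x = 0" using l2_norm_eq_0_iff[OF h] by simp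
  then have "AE x in M. 0 \<le> p x" by eventually_elim (simp add: h_def max_def split: if_splits)
  moreover have "(\<integral>x. p x \<partial>M) = 1"
  proof -
    have "(\<lambda>k. l2_inner M (F k) (\<lambda>x. 1)) \<longlonglongrightarrow> l2_inner M p (\<lambda>x. 1)"
      by (rule l2_inner_tendsto[OF FL p L2_const lim])
    moreover have "l2_inner M (F k) (\<lambda>x. 1) = 1" for k using F[of k] by (simp add: densities_def l2_inner_def)
    ultimately show ?thesis by (simp add: LIMSEQ_const_iff l2_inner_def)
  qed
  ultimately show ?thesis using p by (simp add: densities_def)
qed

lemma (in finite_measure) metric_proj_densities_le:
  assumes "f \<in> L2 M" "p \<in> densities M"
  shows "l2_norm M (\<lambda>x. metric_proj M (densities M) f x - p x) \<le> l2_norm M (\<lambda>x. f x - p x)"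
proof (rule metric_proj_le[OF _ assms])
  show "densities M \<subseteq> L2 M" by (auto simp: densities_def)
  show "(\<lambda>x. (1 - t) * p x + t * r x) \<in> densities M"
    if "p \<in> densities M" "r \<in> densities M" "0 \<le> t" "t \<le> 1" for p r t
    using densities_convex[OF that] finite_measure_axioms by blast
qed (rule densities_closed)

lemma soft_threshold_scale: "\<exists>c. soft_threshold M t g = (\<lambda>x. c * g x)"
  unfolding soft_threshold_def by (cases "l2_norm M g = 0") (auto intro: exI[of _ 0])

text \<open>Thresholding moves \<open>g\<close> by at most \<open>t\<close>, so the error is at most \<open>t + \<epsilon>\<close> in any case. For small deviation,
  either the estimate is zero and the error is \<open>\<parallel>h\<parallel>\<close>, or \<open>\<parallel>h\<parallel> \<ge> t/2\<close>; in both cases the error is at most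
  \<open>3 min \<parallel>h\<parallel> t\<close>, whence the factor 9.\<close>

lemma soft_threshold_error:
  assumes g: "g \<in> L2 M" and h: "h \<in> L2 M" and t: "t > 0"
  defines "S \<equiv> soft_threshold M t g" and "\<epsilon> \<equiv> l2_norm M (\<lambda>x. g x - h x)"
  shows "(l2_norm M (\<lambda>x. S x - h x))\<^sup>2 \<le> 9 * min ((l2_norm M h)\<^sup>2) (t\<^sup>2)
    + 2 * (if \<epsilon> > t / 2 then \<epsilon>\<^sup>2 + t\<^sup>2 else 0)"
proof -
  obtain c where c: "S = (\<lambda>x. c * g x)" using soft_threshold_scale unfolding S_def by blast
  have SL: "S \<in> L2 M" unfolding c by (rule l2.scale_mem[OF g])
  have n0: "0 \<le> l2_norm M g" "0 \<le> l2_norm M h" "0 \<le> \<epsilon>"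
    unfolding \<epsilon>_def by (intro l2.nrm_nonneg l2.diff_mem g h)+
  have Sg: "l2_norm M (\<lambda>x. S x - g x) \<le> t"
  proof (cases "l2_norm M g = 0")
    case True
    then have "l2_norm M (\<lambda>x. S x - g x) = l2_norm M (\<lambda>x. (-1) * g x)" by (simp add: S_def soft_threshold_def)
    also have "\<dots> = 0" using l2.nrm_scale[OF g, of "-1"] True by simp
    finally show ?thesis using t by simp
  next
    case False
    then have pos: "l2_norm M g > 0" using n0 by simp
    define m where "m = max 0 (1 - t / l2_norm M g)"
    have "l2_norm M (\<lambda>x. S x - g x) = l2_norm M (\<lambda>x. (m - 1) * g x)"
      using False by (simp add: S_def soft_threshold_def m_def left_diff_distrib)
    also have "\<dots> = \<bar>m - 1\<bar> * l2_norm M g" by (rule l2.nrm_scale[OF g])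
    also have "\<dots> \<le> (t / l2_norm M g) * l2_norm M g"
      using t pos by (intro mult_right_mono) (auto simp: m_def max_def abs_if field_simps)
    also have "\<dots> = t" using pos by simp
    finally show ?thesis .
  qed
  have tri: "l2_norm M (\<lambda>x. S x - h x) \<le> t + \<epsilon>"
    using l2.triangle_diff[OF SL g h] Sg by (simp add: \<epsilon>_def)
  have e0: "0 \<le> l2_norm M (\<lambda>x. S x - h x)" by (intro l2.nrm_nonneg l2.diff_mem SL h)
  show ?thesis
  proof (cases "\<epsilon> > t / 2")
    case True
    have "(l2_norm M (\<lambda>x. S x - h x))\<^sup>2 \<le> (t + \<epsilon>)\<^sup>2" using tri e0 by (intro power_mono)
    also have "\<dots> \<le> 2 * (\<epsilon>\<^sup>2 + t\<^sup>2)" using sum_squares_bound[of t \<epsilon>] by (simp add: power2_sum)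
    also have "\<dots> \<le> 9 * min ((l2_norm M h)\<^sup>2) (t\<^sup>2) + 2 * (\<epsilon>\<^sup>2 + t\<^sup>2)" by simp
    finally show ?thesis using True by simp
  next
    case False
    have "l2_norm M (\<lambda>x. S x - h x) \<le> 3 * min (l2_norm M h) t"
    proof (cases "l2_norm M g \<le> t")
      case True
      have "\<bar>l2_norm M h - l2_norm M g\<bar> \<le> \<epsilon>"
        unfolding \<epsilon>_def l2.nrm_minus_commute[OF g h] by (rule l2.nrm_diff_le[OF h g])
      then have "l2_norm M h \<le> 3 * t" using True False t by simp
      moreover have "S = (\<lambda>x. 0)"
      proof (cases "l2_norm M g = 0")
        case False
        then have "1 - t / l2_norm M g \<le> 0" using True n0 by (simp add: field_simps)
        then show ?thesis by (auto simp: S_def soft_threshold_def max_def fun_eq_iff)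
      qed (simp add: S_def soft_threshold_def)
      then have "l2_norm M (\<lambda>x. S x - h x) = l2_norm M h" using l2.nrm_scale[OF h, of "-1"] by simp
      ultimately show ?thesis using n0 by (simp add: min_def)
    next
      case big: False
      have "\<bar>l2_norm M g - l2_norm M h\<bar> \<le> \<epsilon>" unfolding \<epsilon>_def by (rule l2.nrm_diff_le[OF g h])
      then have "t / 2 \<le> l2_norm M h" using big False by (simp add: abs_le_iff)
      moreover have "l2_norm M (\<lambda>x. S x - h x) \<le> 3 * (t / 2)" using tri False by simp
      ultimately show ?thesis using t by (simp add: min_def)
    qed
    then have "(l2_norm M (\<lambda>x. S x - h x))\<^sup>2 \<le> (3 * min (l2_norm M h) t)\<^sup>2" using e0 by (intro power_mono)
    also have "\<dots> = 9 * min ((l2_norm M h)\<^sup>2) (t\<^sup>2)"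
    proof -
      have "(min (l2_norm M h) t)\<^sup>2 = min ((l2_norm M h)\<^sup>2) (t\<^sup>2)"
        using n0 t power_mono[of "l2_norm M h" t 2] power_mono[of t "l2_norm M h" 2] by (auto simp: min_def)
      then show ?thesis by (simp add: power_mult_distrib)
    qed
    finally show ?thesis using False by simp
  qed
qed

section \<open>Spectral decomposition of the Laplacian\<close>

context riemannian
begin

lemma laplacian_inner_sym:
  assumes "smooth_fun \<A> F" "smooth_fun \<A> H"
  shows "l2_inner \<nu> F (\<lambda>p. - laplacian \<A> G H p) = (\<integral>p. \<Gamma> F H p \<partial>\<nu>)"
  using weak_laplacian[OF assms(2,1)] by (simp add: \<Gamma>_sym[of H F])

sublocale form: spectral_form \<nu> "{f. smooth_fun \<A> f}" "\<lambda>\<psi> p. - laplacian \<A> G \<psi> p"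
proof (unfold_locales, goal_cases)
  case 1 show ?case using smooth_const[of 0] by simp
next
  case (2 F H a b) then show ?case by (simp add: smooth_lin)
next
  case (3 F) then show ?case by (simp add: smooth_L2)
next
  case (4 F)
  then show ?case using continuous_L2(1)[of "\<lambda>p. - laplacian \<A> G F p"] continuous_laplacian by (auto intro: continuous_intros)
next
  case (5 F H)
  then show ?case by (simp add: laplacian_inner_sym \<Gamma>_sym[of F H])
next
  case (6 F)
  then show ?case using \<Gamma>_nonneg by (simp add: laplacian_inner_sym)
next
  case (7 f e)
  then show ?case using smooth_dense[of f e] by blast
next
  case (8 \<epsilon>)
  obtain E C where "finite E" "E \<subseteq> L2 \<nu>" "0 \<le> C"
    "\<And>F. smooth_fun \<A> F \<Longrightarrow> (l2_norm \<nu> F)\<^sup>2 \<le> C * (\<Sum>e\<in>E. (l2_inner \<nu> F e)\<^sup>2) + \<epsilon> * (\<integral>p. \<Gamma> F F p \<partial>\<nu>)"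
    by (rule compactness[OF 8]) blast
  then show ?case by (intro exI[of _ E] exI[of _ C]) (simp add: laplacian_inner_sym)
qed

lemma energy_nrm: "smooth_fun \<A> F \<Longrightarrow> energy \<A> G \<nu> F = (form.qS.nrm F)\<^sup>2"
  by (subst form.qS.nrm_sq) (simp_all add: energy_def form.q_def)

text \<open>The energy is the square of the norm of the form, so the two Cauchy conditions agree.\<close>

lemma energy_domain_eq: "energy_domain \<A> G \<nu> = form.Q"
proof -
  have "form.appr f F \<longleftrightarrow> (\<forall>k. smooth_fun \<A> (F k)) \<and> (\<lambda>k. l2_norm \<nu> (\<lambda>x. F k x - f x)) \<longlonglongrightarrow> 0 \<and>
     (\<forall>e>0. \<exists>N. \<forall>k\<ge>N. \<forall>m\<ge>N. energy \<A> G \<nu> (\<lambda>x. F k x - F m x) < e)" for f F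
  proof (cases "\<forall>k. smooth_fun \<A> (F k)")
    case True
    have E: "energy \<A> G \<nu> (\<lambda>x. F k x - F m x) = (form.qS.nrm (\<lambda>x. F k x - F m x))\<^sup>2"
      and N: "0 \<le> form.qS.nrm (\<lambda>x. F k x - F m x)" for k m
      using True by (auto intro!: energy_nrm smooth_diff form.qS.nrm_nonneg)
    have "(\<forall>e>0. \<exists>N. \<forall>k\<ge>N. \<forall>m\<ge>N. form.qS.nrm (\<lambda>x. F k x - F m x) < e)
      \<longleftrightarrow> (\<forall>e>0. \<exists>N. \<forall>k\<ge>N. \<forall>m\<ge>N. energy \<A> G \<nu> (\<lambda>x. F k x - F m x) < e)"
    proof (intro iffI allI impI)
      fix e :: real assume e: "e > 0" and "\<forall>e>0. \<exists>N. \<forall>k\<ge>N. \<forall>m\<ge>N. form.qS.nrm (\<lambda>x. F k x - F m x) < e"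
      then obtain N where "\<forall>k\<ge>N. \<forall>m\<ge>N. form.qS.nrm (\<lambda>x. F k x - F m x) < sqrt e" by (metis real_sqrt_gt_0_iff)
      then show "\<exists>N. \<forall>k\<ge>N. \<forall>m\<ge>N. energy \<A> G \<nu> (\<lambda>x. F k x - F m x) < e"
        unfolding E using N e by (metis real_less_rsqrt real_sqrt_less_iff real_sqrt_pow2 less_imp_le power_strict_mono zero_less_numeral)
    next
      fix e :: real assume e: "e > 0" and "\<forall>e>0. \<exists>N. \<forall>k\<ge>N. \<forall>m\<ge>N. energy \<A> G \<nu> (\<lambda>x. F k x - F m x) < e"
      then obtain N where "\<forall>k\<ge>N. \<forall>m\<ge>N. energy \<A> G \<nu> (\<lambda>x. F k x - F m x) < e\<^sup>2" by (metis zero_less_power)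
      then show "\<exists>N. \<forall>k\<ge>N. \<forall>m\<ge>N. form.qS.nrm (\<lambda>x. F k x - F m x) < e"
        unfolding E using e by (meson less_imp_le power2_less_imp_less)
    qed
    then show ?thesis using True by (simp add: form.appr_def)
  qed (auto simp: form.appr_def)
  then show ?thesis by (simp add: energy_domain_def form.Q_def)
qed

lemma eigenspace_eq: "eigenspace \<A> G \<nu> r = form.eig r"
  unfolding eigenspace_def form.eig_def laplace_beltrami_def energy_domain_eq
  by (auto simp: l2.ip_scale form.Q_L2 smooth_L2 intro: l2.scale_mem)

text \<open>The form vanishes at a function in the kernel, so the energies of its smooth approximations
  tend to zero.\<close>

lemma eigenspace_0:
  assumes "f \<in> form.eig 0" shows "\<exists>b. AE p in \<nu>. f p = b"
proof -
  have fQ: "f \<in> form.Q" using form.eig_Q[OF assms] .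
  then obtain F where F: "form.appr f F" using form.Q_appr by blast
  have s: "smooth_fun \<A> (F k)" for k using form.appr_S[OF F] by simp
  have "(\<lambda>k. form.q (F k) (F k)) \<longlonglongrightarrow> form.form f f"
    by (rule form.form_lim[OF F F form.Q_L2[OF fQ] form.Q_L2[OF fQ]])
  then have "(\<lambda>k. \<integral>p. \<Gamma> (F k) (F k) p \<partial>\<nu>) \<longlonglongrightarrow> 0"
    using form.form_eig[OF assms fQ] by (simp add: form.q_def laplacian_inner_sym s)
  from zero_energy_constant[OF form.Q_L2[OF fQ] s form.appr_lim[OF F] this] show ?thesis .
qed

lemma one_eigenspace_0: "(\<lambda>p. 1) \<in> form.eig 0"
proof -
  have s: "smooth_fun \<A> (\<lambda>p. 1)" by (rule smooth_const)
  have "l2_inner \<nu> (\<lambda>p. 1) (\<lambda>p. - laplacian \<A> G \<psi> p) = 0" if "smooth_fun \<A> \<psi>" for \<psi>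
    using weak_laplacian[OF that s] by (simp add: \<Gamma>_const)
  then show ?thesis using s by (simp add: form.eig_def form.S_Q)
qed

end

locale riemannian_spectrum = riemannian +
  fixes \<mu> :: "nat \<Rightarrow> real" and d :: "nat \<Rightarrow> nat" and \<phi> :: "nat \<Rightarrow> nat \<Rightarrow> 'a \<Rightarrow> real"
  assumes mu_mono: "strict_mono \<mu>" and mu_0: "\<mu> 0 = 0"
    and mu_range: "range \<mu> = eigenvalues \<A> G \<nu>"
    and onb: "\<And>j. orthonormal_basis \<nu> (eigenspace \<A> G \<nu> (\<mu> j)) (d j) (\<phi> j)"
begin

sublocale sb: spectral_basis \<nu> "{f. smooth_fun \<A> f}" "\<lambda>\<psi> p. - laplacian \<A> G \<psi> p" \<mu> d \<phi>
  by unfold_locales (use mu_mono mu_range onb in \<open>simp_all add: eigenspace_eq eigenvalues_def\<close>)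

definition P :: "nat \<Rightarrow> ('a \<Rightarrow> real) \<Rightarrow> 'a \<Rightarrow> real" where
  "P j = orth_proj \<nu> (eigenspace \<A> G \<nu> (\<mu> j))"

abbreviation E :: "nat \<Rightarrow> ('a \<Rightarrow> real) set" where "E j \<equiv> form.eig (\<mu> j)"

lemma E_L2: "f \<in> E j \<Longrightarrow> f \<in> L2 \<nu>"
  using form.eig_Q form.Q_L2 by blast

lemma E_lin: "f \<in> E j \<Longrightarrow> g \<in> E j \<Longrightarrow> (\<lambda>x. a * f x + b * g x) \<in> E j"
proof -
  assume f: "f \<in> E j" and g: "g \<in> E j"
  note L = E_L2[OF f] E_L2[OF g]
  show ?thesis
    unfolding form.eig_def
  proof (intro CollectI conjI ballI)
    show "(\<lambda>x. a * f x + b * g x) \<in> form.Q" using f g form.eig_Q by (intro form.fQ.lin_mem) auto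
    fix \<psi> assume \<psi>: "\<psi> \<in> {f. smooth_fun \<A> f}"
    show "l2_inner \<nu> (\<lambda>x. a * f x + b * g x) (\<lambda>p. - laplacian \<A> G \<psi> p)
      = \<mu> j * l2_inner \<nu> (\<lambda>x. a * f x + b * g x) \<psi>"
      using f g \<psi> by (simp add: l2.ip_lin L form.A_L2 smooth_L2 form.eig_def algebra_simps)
  qed
qed

lemma E_zero: "(\<lambda>x. 0) \<in> E j"
  using form.fQ.zero_mem by (simp add: form.eig_def l2_inner_def)

lemma E_scale: "f \<in> E j \<Longrightarrow> (\<lambda>x. a * f x) \<in> E j"
  using E_lin[of f j f a 0] by simp

lemma E_diff: "f \<in> E j \<Longrightarrow> g \<in> E j \<Longrightarrow> (\<lambda>x. f x - g x) \<in> E j"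
  using E_lin[of f j g 1 "-1"] by simp

lemma E_sum: "(\<And>i. i \<in> I \<Longrightarrow> f i \<in> E j) \<Longrightarrow> (\<lambda>x. \<Sum>i\<in>I. f i x) \<in> E j"
proof (induction I rule: infinite_finite_induct)
  case (insert i I)
  then show ?case using E_lin[of "f i" j "\<lambda>x. \<Sum>i\<in>I. f i x" 1 1] by simp
qed (simp_all add: E_zero)

lemma phi_E: "l \<in> {1..d j} \<Longrightarrow> \<phi> j l \<in> E j"
  and phi_orthonormal: "l \<in> {1..d j} \<Longrightarrow> m \<in> {1..d j} \<Longrightarrow> l2_inner \<nu> (\<phi> j l) (\<phi> j m) = (if l = m then 1 else 0)"
  and phi_span: "f \<in> E j \<Longrightarrow> \<exists>a. AE x in \<nu>. f x = (\<Sum>l=1..d j. a l * \<phi> j l x)"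
  using onb[of j] by (auto simp: orthonormal_basis_def eigenspace_eq)

lemma phi_L2: "l \<in> {1..d j} \<Longrightarrow> \<phi> j l \<in> L2 \<nu>"
  using phi_E E_L2 by blast

lemma combination_E: "(\<lambda>x. \<Sum>l=1..d j. a l * \<phi> j l x) \<in> E j"
  by (intro E_sum E_scale phi_E)

lemma combination_inner:
  "m \<in> {1..d j} \<Longrightarrow> l2_inner \<nu> (\<lambda>x. \<Sum>l=1..d j. a l * \<phi> j l x) (\<phi> j m) = a m"
proof -
  assume m: "m \<in> {1..d j}"
  have "l2_inner \<nu> (\<lambda>x. \<Sum>l=1..d j. a l * \<phi> j l x) (\<phi> j m) = (\<Sum>l=1..d j. a l * l2_inner \<nu> (\<phi> j l) (\<phi> j m))"
    using phi_L2[OF m] by (subst l2.ip_sum) (auto simp: phi_L2 l2.scale_mem l2.ip_scale intro!: sum.cong)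
  also have "\<dots> = (\<Sum>l=1..d j. if l = m then a l else 0)"
    using m by (intro sum.cong) (auto simp: phi_orthonormal)
  also have "\<dots> = a m" using m by simp
  finally show ?thesis .
qed

lemma combination_norm: "(l2_norm \<nu> (\<lambda>x. \<Sum>l=1..d j. a l * \<phi> j l x))\<^sup>2 = (\<Sum>l=1..d j. (a l)\<^sup>2)"
proof -
  define f where "f x = (\<Sum>l=1..d j. a l * \<phi> j l x)" for x
  have fL: "f \<in> L2 \<nu>" unfolding f_def by (rule E_L2[OF combination_E])
  have "l2_inner \<nu> f f = (\<Sum>l=1..d j. a l * l2_inner \<nu> f (\<phi> j l))"
    by (subst (2) f_def[abs_def], subst l2.ip_sum2) (auto simp: phi_L2 fL l2.scale_mem l2.ip_scale2 intro!: sum.cong)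
  also have "\<dots> = (\<Sum>l=1..d j. (a l)\<^sup>2)"
    using combination_inner[where j=j and a=a] unfolding f_def[abs_def] by (intro sum.cong) (auto simp: power2_eq_square)
  finally show ?thesis using l2.nrm_sq[OF fL] by (simp add: f_def[abs_def])
qed

lemma E_expand:
  assumes f: "f \<in> E j"
  shows "AE x in \<nu>. f x = (\<Sum>l=1..d j. l2_inner \<nu> f (\<phi> j l) * \<phi> j l x)"
proof -
  obtain a where a: "AE x in \<nu>. f x = (\<Sum>l=1..d j. a l * \<phi> j l x)" using phi_span[OF f] by blast
  have "l2_inner \<nu> f (\<phi> j m) = a m" if m: "m \<in> {1..d j}" for m
  proof -
    have "l2_inner \<nu> f (\<phi> j m) = l2_inner \<nu> (\<lambda>x. \<Sum>l=1..d j. a l * \<phi> j l x) (\<phi> j m)"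
      using a by (intro l2_inner_cong_AE L2_measurable E_L2[OF f] E_L2[OF combination_E] phi_L2 m) auto
    then show ?thesis using combination_inner[OF m] by simp
  qed
  then have "(\<Sum>l=1..d j. l2_inner \<nu> f (\<phi> j l) * \<phi> j l x) = (\<Sum>l=1..d j. a l * \<phi> j l x)" for x
    by (intro sum.cong) auto
  with a show ?thesis by simp
qed

text \<open>The orthogonal projection is specified by a choice operator; the finite expansion in the
  orthonormal basis witnesses that the choice is possible.\<close>

lemma P_spec:
  assumes f: "f \<in> L2 \<nu>"
  shows "P j f \<in> E j" "e \<in> E j \<Longrightarrow> l2_inner \<nu> (\<lambda>x. f x - P j f x) e = 0"
proof -
  define h where "h x = (\<Sum>l=1..d j. l2_inner \<nu> f (\<phi> j l) * \<phi> j l x)" for x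
  have hE: "h \<in> E j" unfolding h_def by (rule combination_E)
  have hL: "h \<in> L2 \<nu>" by (rule E_L2[OF hE])
  have "l2_inner \<nu> (\<lambda>x. f x - h x) e = 0" if e: "e \<in> E j" for e
  proof -
    define r where "r x = f x - h x" for x
    have rL: "r \<in> L2 \<nu>" unfolding r_def by (intro l2.diff_mem f hL)
    have r0: "l2_inner \<nu> r (\<phi> j m) = 0" if m: "m \<in> {1..d j}" for m
    proof -
      have "l2_inner \<nu> h (\<phi> j m) = l2_inner \<nu> f (\<phi> j m)" unfolding h_def by (rule combination_inner[OF m])
      then show ?thesis unfolding r_def l2.ip_diff[OF f hL phi_L2[OF m]] by simp
    qed
    have "l2_inner \<nu> r e = l2_inner \<nu> r (\<lambda>x. \<Sum>l=1..d j. l2_inner \<nu> e (\<phi> j l) * \<phi> j l x)"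
      using E_expand[OF e] by (intro l2_inner_cong_AE L2_measurable rL E_L2[OF e] E_L2[OF combination_E]) auto
    also have "\<dots> = (\<Sum>l=1..d j. l2_inner \<nu> e (\<phi> j l) * l2_inner \<nu> r (\<phi> j l))"
      by (subst l2.ip_sum2) (auto simp: phi_L2 rL l2.scale_mem l2.ip_scale2 intro!: sum.cong)
    also have "\<dots> = 0" using r0 by simp
    finally show ?thesis by (simp add: r_def[abs_def])
  qed
  then have "\<exists>h. h \<in> E j \<and> (\<forall>e\<in>E j. l2_inner \<nu> (\<lambda>x. f x - h x) e = 0)" using hE by blast
  from someI_ex[OF this] show "P j f \<in> E j" "e \<in> E j \<Longrightarrow> l2_inner \<nu> (\<lambda>x. f x - P j f x) e = 0"
    unfolding P_def orth_proj_def eigenspace_eq by auto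
qed

lemma P_AE:
  assumes f: "f \<in> L2 \<nu>"
  shows "AE x in \<nu>. P j f x = (\<Sum>l=1..d j. l2_inner \<nu> f (\<phi> j l) * \<phi> j l x)"
proof -
  note PE = P_spec(1)[OF f, of j]
  have "l2_inner \<nu> (P j f) (\<phi> j l) = l2_inner \<nu> f (\<phi> j l)" if l: "l \<in> {1..d j}" for l
    using P_spec(2)[OF f phi_E[OF l]] unfolding l2.ip_diff[OF f E_L2[OF PE] phi_L2[OF l]] by simp
  then have "(\<Sum>l=1..d j. l2_inner \<nu> (P j f) (\<phi> j l) * \<phi> j l x) = (\<Sum>l=1..d j. l2_inner \<nu> f (\<phi> j l) * \<phi> j l x)" for x
    by (intro sum.cong) auto
  with E_expand[OF PE] show ?thesis by simp
qed

lemma E_orthogonal: "f \<in> E i \<Longrightarrow> g \<in> E j \<Longrightarrow> i \<noteq> j \<Longrightarrow> l2_inner \<nu> f g = 0"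
  using form.eig_orthogonal mu_mono by (metis strict_mono_eq)

lemma pythagoras:
  assumes "finite I" "\<And>j. j \<in> I \<Longrightarrow> h j \<in> E j"
  shows "(l2_norm \<nu> (\<lambda>x. \<Sum>j\<in>I. h j x))\<^sup>2 = (\<Sum>j\<in>I. (l2_norm \<nu> (h j))\<^sup>2)"
  using assms
proof (induction I rule: finite_induct)
  case empty
  then show ?case by (simp add: l2_norm_def l2_inner_def)
next
  case (insert i I)
  have L: "h j \<in> L2 \<nu>" if "j \<in> insert i I" for j using insert.prems[OF that] E_L2 by blast
  have sL: "(\<lambda>x. \<Sum>j\<in>I. h j x) \<in> L2 \<nu>" using L by (intro l2.sum_mem) auto
  have "l2_inner \<nu> (h i) (\<lambda>x. \<Sum>j\<in>I. h j x) = (\<Sum>j\<in>I. l2_inner \<nu> (h i) (h j))"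
    using L by (intro l2.ip_sum2) auto
  also have "\<dots> = 0" using insert.hyps insert.prems by (intro sum.neutral ballI E_orthogonal) auto
  finally have "(l2_norm \<nu> (\<lambda>x. h i x + (\<Sum>j\<in>I. h j x)))\<^sup>2 = (l2_norm \<nu> (h i))\<^sup>2 + (l2_norm \<nu> (\<lambda>x. \<Sum>j\<in>I. h j x))\<^sup>2"
    using L[of i] by (simp add: l2.nrm_add_sq sL)
  then show ?case using insert by simp
qed

text \<open>The projection is constant, and testing the residual with \<open>1\<close> shows that the constant is the
  integral of \<open>p\<close>.\<close>

lemma P_0_density:
  assumes p: "p \<in> densities \<nu>" shows "AE x in \<nu>. P 0 p x = 1"
proof -
  have pL: "p \<in> L2 \<nu>" and one: "(\<integral>x. p x \<partial>\<nu>) = 1" using p by (auto simp: densities_def)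
  have PE: "P 0 p \<in> E 0" by (rule P_spec(1)[OF pL])
  then obtain b where b: "AE x in \<nu>. P 0 p x = b" using eigenspace_0[of "P 0 p"] mu_0 by auto
  have PL: "P 0 p \<in> L2 \<nu>" by (rule E_L2[OF PE])
  have "(\<lambda>x. 1) \<in> E 0" using one_eigenspace_0 by (simp add: mu_0)
  from P_spec(2)[OF pL this] have "(\<integral>x. p x - P 0 p x \<partial>\<nu>) = 0" by (simp add: l2_inner_def)
  then have "1 = (\<integral>x. P 0 p x \<partial>\<nu>)"
    using one \<nu>.L2_integrable[OF pL] \<nu>.L2_integrable[OF PL] by simp
  also have "\<dots> = (\<integral>x. b \<partial>\<nu>)" using b L2_measurable[OF PL] by (intro integral_cong_AE) auto
  also have "\<dots> = b" using \<nu>.prob_space by simp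
  finally show ?thesis using b by simp
qed

lemma proj_AE:
  assumes f: "f \<in> L2 \<nu>"
  shows "AE x in \<nu>. sb.proj N f x = (\<Sum>j\<le>N. P j f x)"
proof -
  have "AE x in \<nu>. \<forall>j\<in>{..N}. P j f x = (\<Sum>l=1..d j. l2_inner \<nu> f (\<phi> j l) * \<phi> j l x)"
    using P_AE[OF f] by (intro AE_finite_allI) auto
  then show ?thesis
  proof eventually_elim
    case (elim x)
    have "sb.proj N f x = (\<Sum>j\<le>N. \<Sum>l=1..d j. l2_inner \<nu> f (\<phi> j l) * \<phi> j l x)"
      by (simp add: sb.proj_def sb.indices_upto_def sb.e_def sum.Sigma case_prod_beta)
    also have "\<dots> = (\<Sum>j\<le>N. P j f x)" using elim by (intro sum.cong) auto
    finally show ?case .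
  qed
qed

section \<open>Risk bounds\<close>

text \<open>The estimation error splits orthogonally along the eigenspaces; completeness bounds the
  contribution of the eigenspaces outside \<open>J\<close> by the tail sum.\<close>

lemma estimation_error_le:
  assumes p: "p \<in> densities \<nu>" and J: "finite J" "J \<subseteq> {1..}" and h: "\<And>j. j \<in> J \<Longrightarrow> h j \<in> E j"
  shows "ennreal ((l2_norm \<nu> (\<lambda>x. (1 + (\<Sum>j\<in>J. h j x)) - p x))\<^sup>2)
    \<le> (\<Sum>j\<in>J. ennreal ((l2_norm \<nu> (\<lambda>x. h j x - P j p x))\<^sup>2))
      + (\<Sum>\<^sub>\<infinity>j\<in>{1..} - J. ennreal ((l2_norm \<nu> (P j p))\<^sup>2))"
proof -
  define T where "T = (\<Sum>\<^sub>\<infinity>j\<in>{1..} - J. ennreal ((l2_norm \<nu> (P j p))\<^sup>2))"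
  have pL: "p \<in> L2 \<nu>" using p by (simp add: densities_def)
  note PE = P_spec(1)[OF pL]
  define a where "a = (\<Sum>j\<in>J. (l2_norm \<nu> (\<lambda>x. h j x - P j p x))\<^sup>2)"
  have a0: "0 \<le> a" by (simp add: a_def sum_nonneg)
  have hL: "h j \<in> L2 \<nu>" if "j \<in> J" for j using h[OF that] E_L2 by blast
  define u where "u x = (1 + (\<Sum>j\<in>J. h j x)) - p x" for x
  have uL: "u \<in> L2 \<nu>" unfolding u_def
    by (intro l2.diff_mem l2.add_mem l2.sum_mem hL pL \<nu>.L2_const)
  have main: "ennreal ((l2_norm \<nu> u)\<^sup>2) \<le> ennreal a + T"
  proof (cases T)
    case top then show ?thesis by simp
  next
    case (real t)
    have t: "0 \<le> t" "T = ennreal t" using real by auto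
    obtain N0 where N0: "J \<subseteq> {1..N0}"
      using J finite_nat_set_iff_bounded_le[of J] by (metis atLeastAtMost_iff atLeast_iff subset_iff)
    have bound: "l2_norm \<nu> u \<le> sqrt (a + t) + l2_norm \<nu> (\<lambda>x. p x - sb.proj N p x)" if N: "N \<ge> N0" for N
    proof -
      have JN: "J \<subseteq> {1..N}" using N0 N by force
      \<comment> \<open>\<open>u\<close> is the sum of the errors \<open>k j\<close> over \<open>1 \<le> j \<le> N\<close>, up to the residual of \<open>p\<close> beyond \<open>N\<close>\<close>
      define k where "k j x = (if j \<in> J then h j x else 0) - P j p x" for j x
      have kE: "k j \<in> E j" for j
        unfolding k_def using E_diff[OF E_zero PE, of j] E_diff[OF h PE, of j] by (cases "j \<in> J") auto
      have sL: "(\<lambda>x. \<Sum>j=1..N. k j x) \<in> L2 \<nu>" by (intro l2.sum_mem E_L2[OF kE])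
      have rL: "(\<lambda>x. p x - sb.proj N p x) \<in> L2 \<nu>" by (intro l2.diff_mem pL sb.proj_L2)
      have "AE x in \<nu>. u x = (\<Sum>j=1..N. k j x) - (p x - sb.proj N p x)"
        using proj_AE[OF pL, of N] P_0_density[OF p]
      proof eventually_elim
        case (elim x)
        have "(\<Sum>j\<le>N. P j p x) = P 0 p x + (\<Sum>j=1..N. P j p x)"
          by (simp add: atMost_atLeast0 sum.atLeast_Suc_atMost)
        moreover have "(\<Sum>j=1..N. k j x) = (\<Sum>j\<in>J. h j x) - (\<Sum>j=1..N. P j p x)"
        proof -
          have "(\<Sum>j=1..N. if j \<in> J then h j x else 0) = (\<Sum>j\<in>J. h j x)"
            using JN by (simp add: sum.If_cases Int_absorb1)
          then show ?thesis by (simp add: k_def sum_subtractf)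
        qed
        ultimately show ?case using elim by (simp add: u_def)
      qed
      then have "l2_norm \<nu> u = l2_norm \<nu> (\<lambda>x. (\<Sum>j=1..N. k j x) - (p x - sb.proj N p x))"
        by (intro l2_norm_cong_AE L2_measurable uL l2.diff_mem[OF sL rL])
      also have "\<dots> \<le> l2_norm \<nu> (\<lambda>x. \<Sum>j=1..N. k j x) + l2_norm \<nu> (\<lambda>x. p x - sb.proj N p x)"
        by (rule l2.triangle_sub[OF sL rL])
      also have "l2_norm \<nu> (\<lambda>x. \<Sum>j=1..N. k j x) \<le> sqrt (a + t)"
      proof (rule real_le_rsqrt)
        have "(l2_norm \<nu> (\<lambda>x. \<Sum>j=1..N. k j x))\<^sup>2 = (\<Sum>j=1..N. (l2_norm \<nu> (k j))\<^sup>2)"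
          by (intro pythagoras kE) simp
        also have "\<dots> = (\<Sum>j\<in>J. (l2_norm \<nu> (k j))\<^sup>2) + (\<Sum>j\<in>{1..N} - J. (l2_norm \<nu> (k j))\<^sup>2)"
          using JN by (subst sum.subset_diff[of J]) auto
        also have "(\<Sum>j\<in>J. (l2_norm \<nu> (k j))\<^sup>2) = a"
          unfolding a_def by (intro sum.cong) (auto simp: k_def[abs_def])
        also have "(\<Sum>j\<in>{1..N} - J. (l2_norm \<nu> (k j))\<^sup>2) = (\<Sum>j\<in>{1..N} - J. (l2_norm \<nu> (P j p))\<^sup>2)"
        proof (intro sum.cong refl)
          fix j assume "j \<in> {1..N} - J"
          then have "k j = (\<lambda>x. (-1) * P j p x)" by (auto simp: k_def fun_eq_iff)
          then show "(l2_norm \<nu> (k j))\<^sup>2 = (l2_norm \<nu> (P j p))\<^sup>2"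
            using l2.nrm_scale[OF E_L2[OF PE], of "-1" j] by simp
        qed
        also have "\<dots> \<le> t"
        proof -
          have "ennreal (\<Sum>j\<in>{1..N} - J. (l2_norm \<nu> (P j p))\<^sup>2) = (\<Sum>j\<in>{1..N} - J. ennreal ((l2_norm \<nu> (P j p))\<^sup>2))"
            by (simp add: sum_ennreal)
          also have "\<dots> = (\<Sum>\<^sub>\<infinity>j\<in>{1..N} - J. ennreal ((l2_norm \<nu> (P j p))\<^sup>2))" by simp
          also have "\<dots> \<le> T" unfolding T_def by (rule infsum_mono_neutral) (auto intro: nonneg_summable_on_complete)
          finally show ?thesis using t by (simp add: ennreal_le_iff)
        qed
        finally show "(l2_norm \<nu> (\<lambda>x. \<Sum>j=1..N. k j x))\<^sup>2 \<le> a + t" by simp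
      qed
      finally show ?thesis by simp
    qed
    have "l2_norm \<nu> u \<le> sqrt (a + t) + 0"
    proof (rule LIMSEQ_le_const)
      show "(\<lambda>N. sqrt (a + t) + l2_norm \<nu> (\<lambda>x. p x - sb.proj N p x)) \<longlonglongrightarrow> sqrt (a + t) + 0"
        by (intro tendsto_intros sb.eigenfunctions_complete pL)
    qed (use bound in blast)
    then have "(l2_norm \<nu> u)\<^sup>2 \<le> (sqrt (a + t))\<^sup>2" using l2.nrm_nonneg[OF uL] by (intro power_mono) auto
    then have "(l2_norm \<nu> u)\<^sup>2 \<le> a + t" using a0 t by simp
    then have "ennreal ((l2_norm \<nu> u)\<^sup>2) \<le> ennreal (a + t)" by (rule ennreal_leI)
    then show ?thesis using a0 t by (simp add: ennreal_plus)
  qed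
  have "ennreal a = (\<Sum>j\<in>J. ennreal ((l2_norm \<nu> (\<lambda>x. h j x - P j p x))\<^sup>2))"
    unfolding a_def by (simp add: sum_ennreal)
  with main show ?thesis by (simp add: u_def[abs_def] T_def)
qed

definition ghat :: "nat \<Rightarrow> (nat \<Rightarrow> 'w \<Rightarrow> 'a) \<Rightarrow> nat \<Rightarrow> 'w \<Rightarrow> 'a \<Rightarrow> real" where
  "ghat n X j = empirical_proj (spectral_kernel (d j) (\<phi> j)) n X"

text \<open>Summing over the sample first displays the empirical projection as a combination of the basis
  functions with random coefficients, so that it lies in the eigenspace.\<close>

lemma ghat_combination:
  "ghat n X j \<omega> x = (\<Sum>l=1..d j. ((\<Sum>i=1..n. \<phi> j l (X i \<omega>)) / real n) * \<phi> j l x)"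
proof -
  have "(\<Sum>i=1..n. \<Sum>l=1..d j. \<phi> j l x * \<phi> j l (X i \<omega>)) = (\<Sum>l=1..d j. \<Sum>i=1..n. \<phi> j l x * \<phi> j l (X i \<omega>))"
    by (rule sum.swap)
  then show ?thesis
    by (simp add: ghat_def empirical_proj_def spectral_kernel_def sum_divide_distrib sum_distrib_left sum_distrib_right mult.commute)
qed

lemma ghat_E: "ghat n X j \<omega> \<in> E j"
proof -
  have eq: "ghat n X j \<omega> = (\<lambda>x. \<Sum>l=1..d j. ((\<Sum>i=1..n. \<phi> j l (X i \<omega>)) / real n) * \<phi> j l x)"
    by (rule ext) (rule ghat_combination)
  show ?thesis unfolding eq by (rule combination_E)
qed

text \<open>By orthonormality the norm is a Euclidean norm of finitely many measurable coefficients.\<close>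

lemma deviation_measurable:
  assumes X: "\<And>i. i \<in> {1..n} \<Longrightarrow> X i \<in> measurable \<Omega> \<nu>" and p: "p \<in> L2 \<nu>"
  shows "(\<lambda>\<omega>. l2_norm \<nu> (\<lambda>x. ghat n X j \<omega> x - P j p x)) \<in> borel_measurable \<Omega>"
proof -
  define c where "c l \<omega> = (\<Sum>i=1..n. \<phi> j l (X i \<omega>)) / real n" for l \<omega>
  have cm: "c l \<in> borel_measurable \<Omega>" if l: "l \<in> {1..d j}" for l
    unfolding c_def using measurable_compose[OF X L2_measurable[OF phi_L2[OF l]]]
    by (intro borel_measurable_divide borel_measurable_sum) auto
  have "l2_norm \<nu> (\<lambda>x. ghat n X j \<omega> x - P j p x) = sqrt (\<Sum>l=1..d j. (c l \<omega> - l2_inner \<nu> p (\<phi> j l))\<^sup>2)" for \<omega>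
  proof -
    have dL: "(\<lambda>x. ghat n X j \<omega> x - P j p x) \<in> L2 \<nu>"
      by (intro l2.diff_mem E_L2[OF ghat_E] E_L2[OF P_spec(1)[OF p]])
    have "AE x in \<nu>. ghat n X j \<omega> x - P j p x = (\<Sum>l=1..d j. (c l \<omega> - l2_inner \<nu> p (\<phi> j l)) * \<phi> j l x)"
      using P_AE[OF p, of j]
      by eventually_elim (simp add: ghat_combination c_def left_diff_distrib sum_subtractf)
    then have "l2_norm \<nu> (\<lambda>x. ghat n X j \<omega> x - P j p x)
      = l2_norm \<nu> (\<lambda>x. \<Sum>l=1..d j. (c l \<omega> - l2_inner \<nu> p (\<phi> j l)) * \<phi> j l x)"
      by (intro l2_norm_cong_AE L2_measurable dL E_L2[OF combination_E])
    then show ?thesis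
      using combination_norm[where j=j and a="\<lambda>l. c l \<omega> - l2_inner \<nu> p (\<phi> j l)"] l2.nrm_nonneg[OF dL]
      by (metis real_sqrt_abs abs_of_nonneg)
  qed
  moreover have "(\<lambda>\<omega>. sqrt (\<Sum>l=1..d j. (c l \<omega> - l2_inner \<nu> p (\<phi> j l))\<^sup>2)) \<in> borel_measurable \<Omega>"
  proof (rule borel_measurable_continuous_on[where f=sqrt])
    show "(\<lambda>\<omega>. \<Sum>l=1..d j. (c l \<omega> - l2_inner \<nu> p (\<phi> j l))\<^sup>2) \<in> borel_measurable \<Omega>"
      using cm by (intro borel_measurable_sum borel_measurable_power borel_measurable_diff) auto
  qed (intro continuous_intros)
  ultimately show ?thesis by simp
qed

text \<open>The deterministic bounds are integrated term by term. Outside the event of a large deviation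
  an eigenspace contributes at most the oracle term, and the contribution of the event is twice the left-hand side of the hypothesis on
  the deviations.\<close>

theorem oracle_inequality:
  fixes \<Omega> :: "'w measure" and X :: "nat \<Rightarrow> 'w \<Rightarrow> 'a"
  assumes prob: "prob_space \<Omega>" and p: "p \<in> densities \<nu>" and X: "\<And>i. i \<in> {1..n} \<Longrightarrow> X i \<in> measurable \<Omega> \<nu>"
    and J: "finite J" "J \<subseteq> {1..}" and \<tau>: "\<And>j. j \<in> J \<Longrightarrow> \<tau> j > 0"
    and dev: "\<And>j. j \<in> J \<Longrightarrow>
      (\<integral>\<^sup>+\<omega>. ennreal ((l2_norm \<nu> (\<lambda>x. ghat n X j \<omega> x - P j p x))\<^sup>2)
        * indicator {\<omega> \<in> space \<Omega>. l2_norm \<nu> (\<lambda>x. ghat n X j \<omega> x - P j p x) > \<tau> j / 2} \<omega> \<partial>\<Omega>)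
      + ennreal ((\<tau> j)\<^sup>2) * emeasure \<Omega> {\<omega> \<in> space \<Omega>. l2_norm \<nu> (\<lambda>x. ghat n X j \<omega> x - P j p x) > \<tau> j / 2}
      \<le> ennreal (\<eta> j)"
  shows "risk \<nu> \<Omega> p (threshold_estimator \<nu> J \<tau> (ghat n X))
    \<le> 9 * (\<Sum>j\<in>J. ennreal (min ((l2_norm \<nu> (P j p))\<^sup>2) ((\<tau> j)\<^sup>2)))
      + (\<Sum>\<^sub>\<infinity>j\<in>{1..} - J. ennreal ((l2_norm \<nu> (P j p))\<^sup>2)) + 2 * (\<Sum>j\<in>J. ennreal (\<eta> j))"
proof -
  interpret \<Omega>: prob_space \<Omega> by fact
  have pL: "p \<in> L2 \<nu>" using p by (simp add: densities_def)
  note PL = E_L2[OF P_spec(1)[OF pL]] and gL = E_L2[OF ghat_E]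
  define N where "N j \<omega> = l2_norm \<nu> (\<lambda>x. ghat n X j \<omega> x - P j p x)" for j \<omega>
  define D where "D j = {\<omega> \<in> space \<Omega>. N j \<omega> > \<tau> j / 2}" for j
  define m where "m j = min ((l2_norm \<nu> (P j p))\<^sup>2) ((\<tau> j)\<^sup>2)" for j
  define T where "T = (\<Sum>\<^sub>\<infinity>j\<in>{1..} - J. ennreal ((l2_norm \<nu> (P j p))\<^sup>2))"
  have m0: "0 \<le> m j" for j by (simp add: m_def)
  have Nm[measurable]: "N j \<in> borel_measurable \<Omega>" for j unfolding N_def by (rule deviation_measurable[OF X pL])
  have Dm[measurable]: "D j \<in> sets \<Omega>" for j unfolding D_def by measurable
  define w where "w j \<omega> = ennreal ((N j \<omega>)\<^sup>2) * indicator (D j) \<omega> + ennreal ((\<tau> j)\<^sup>2) * indicator (D j) \<omega>" for j \<omega>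
  have wm: "w j \<in> borel_measurable \<Omega>" for j unfolding w_def by measurable
  have term_le: "ennreal ((l2_norm \<nu> (\<lambda>x. soft_threshold \<nu> (\<tau> j) (ghat n X j \<omega>) x - P j p x))\<^sup>2)
    \<le> ennreal (9 * m j) + 2 * w j \<omega>" if j: "j \<in> J" and \<omega>: "\<omega> \<in> space \<Omega>" for j \<omega>
  proof -
    have "(l2_norm \<nu> (\<lambda>x. soft_threshold \<nu> (\<tau> j) (ghat n X j \<omega>) x - P j p x))\<^sup>2
      \<le> 9 * m j + 2 * (if N j \<omega> > \<tau> j / 2 then (N j \<omega>)\<^sup>2 + (\<tau> j)\<^sup>2 else 0)"
      unfolding m_def N_def by (rule soft_threshold_error[OF gL PL \<tau>[OF j]])
    then have "ennreal ((l2_norm \<nu> (\<lambda>x. soft_threshold \<nu> (\<tau> j) (ghat n X j \<omega>) x - P j p x))\<^sup>2)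
      \<le> ennreal (9 * m j + 2 * (if N j \<omega> > \<tau> j / 2 then (N j \<omega>)\<^sup>2 + (\<tau> j)\<^sup>2 else 0))" by (rule ennreal_leI)
    also have "\<dots> = ennreal (9 * m j) + 2 * w j \<omega>"
      using m0[of j] \<omega> by (auto simp: w_def D_def ennreal_plus ennreal_mult)
    finally show ?thesis .
  qed
  have "risk \<nu> \<Omega> p (threshold_estimator \<nu> J \<tau> (ghat n X))
    \<le> (\<integral>\<^sup>+\<omega>. (\<Sum>j\<in>J. ennreal (9 * m j) + 2 * w j \<omega>) + T \<partial>\<Omega>)"
    unfolding risk_def
  proof (rule nn_integral_mono)
    fix \<omega> assume \<omega>: "\<omega> \<in> space \<Omega>"
    have E: "soft_threshold \<nu> (\<tau> j) (ghat n X j \<omega>) \<in> E j" for j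
      using soft_threshold_scale[of \<nu> "\<tau> j" "ghat n X j \<omega>"] E_scale[OF ghat_E] by auto
    have "ennreal ((l2_norm \<nu> (\<lambda>x. threshold_estimator \<nu> J \<tau> (ghat n X) \<omega> x - p x))\<^sup>2)
      \<le> (\<Sum>j\<in>J. ennreal ((l2_norm \<nu> (\<lambda>x. soft_threshold \<nu> (\<tau> j) (ghat n X j \<omega>) x - P j p x))\<^sup>2)) + T"
      unfolding T_def threshold_estimator_def by (rule estimation_error_le[OF p J E])
    also have "\<dots> \<le> (\<Sum>j\<in>J. ennreal (9 * m j) + 2 * w j \<omega>) + T"
      by (intro add_right_mono sum_mono term_le \<omega>)
    finally show "ennreal ((l2_norm \<nu> (\<lambda>x. threshold_estimator \<nu> J \<tau> (ghat n X) \<omega> x - p x))\<^sup>2)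
      \<le> (\<Sum>j\<in>J. ennreal (9 * m j) + 2 * w j \<omega>) + T" .
  qed
  also have "\<dots> = (\<Sum>j\<in>J. ennreal (9 * m j) + 2 * (\<integral>\<^sup>+\<omega>. w j \<omega> \<partial>\<Omega>)) + T"
    using wm by (simp add: nn_integral_add nn_integral_sum nn_integral_cmult \<Omega>.emeasure_space_1)
  also have "\<dots> \<le> (\<Sum>j\<in>J. ennreal (9 * m j) + 2 * ennreal (\<eta> j)) + T"
  proof (intro add_right_mono sum_mono add_left_mono mult_left_mono)
    fix j assume j: "j \<in> J"
    have "(\<integral>\<^sup>+\<omega>. w j \<omega> \<partial>\<Omega>) = (\<integral>\<^sup>+\<omega>. ennreal ((N j \<omega>)\<^sup>2) * indicator (D j) \<omega> \<partial>\<Omega>) + ennreal ((\<tau> j)\<^sup>2) * emeasure \<Omega> (D j)"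
      unfolding w_def by (simp add: nn_integral_add nn_integral_cmult_indicator)
    then show "(\<integral>\<^sup>+\<omega>. w j \<omega> \<partial>\<Omega>) \<le> ennreal (\<eta> j)" using dev[OF j] by (simp add: N_def D_def)
  qed simp
  also have "\<dots> = 9 * (\<Sum>j\<in>J. ennreal (m j)) + T + 2 * (\<Sum>j\<in>J. ennreal (\<eta> j))"
  proof -
    have "ennreal (9 * m j) = 9 * ennreal (m j)" for j using m0[of j] by (simp add: ennreal_mult)
    then show ?thesis by (simp only: sum.distrib sum_distrib_left[symmetric] add_ac)
  qed
  finally show ?thesis unfolding m_def T_def .
qed

lemma risk_metric_proj_le:
  assumes p: "p \<in> densities \<nu>"
  shows "risk \<nu> \<Omega> p (\<lambda>\<omega>. metric_proj \<nu> (densities \<nu>) (threshold_estimator \<nu> J \<tau> (ghat n X) \<omega>))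
    \<le> risk \<nu> \<Omega> p (threshold_estimator \<nu> J \<tau> (ghat n X))"
  unfolding risk_def
proof (intro nn_integral_mono ennreal_leI power_mono \<nu>.metric_proj_densities_le p)
  fix \<omega>
  have "soft_threshold \<nu> (\<tau> j) (ghat n X j \<omega>) \<in> L2 \<nu>" for j
    using soft_threshold_scale[of \<nu> "\<tau> j" "ghat n X j \<omega>"] l2.scale_mem[OF E_L2[OF ghat_E]] by auto
  then show "threshold_estimator \<nu> J \<tau> (ghat n X) \<omega> \<in> L2 \<nu>"
    unfolding threshold_estimator_def by (intro l2.add_mem l2.sum_mem \<nu>.L2_const)
next
  fix \<omega> show "0 \<le> l2_norm \<nu> (\<lambda>x. metric_proj \<nu> (densities \<nu>) (threshold_estimator \<nu> J \<tau> (ghat n X) \<omega>) x - p x)"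
    by (simp add: l2_norm_def l2_inner_def)
qed

end

theorem theorem3p2:
  fixes \<A> :: "('a::{t2_space, second_countable_topology}, 'n::finite) chart set"
    and G :: "('a, 'n) chart \<Rightarrow> 'a \<Rightarrow> real ^ 'n ^ 'n"
    and V \<nu> :: "'a measure"
    and \<mu> :: "nat \<Rightarrow> real"
    and d :: "nat \<Rightarrow> nat"
    and \<phi> :: "nat \<Rightarrow> nat \<Rightarrow> 'a \<Rightarrow> real"
    and \<Omega> :: "'w measure"
    and X :: "nat \<Rightarrow> 'w \<Rightarrow> 'a"
    and p0 :: "'a \<Rightarrow> real"
    and n :: nat
    and J :: "nat set"
    and \<tau> \<eta> :: "nat \<Rightarrow> real"
  defines "E \<equiv> \<lambda>j. eigenspace \<A> G \<nu> (\<mu> j)"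
    and "K \<equiv> \<lambda>j. spectral_kernel (d j) (\<phi> j)"
  defines "P \<equiv> \<lambda>j. orth_proj \<nu> (E j)"
    and "ghat \<equiv> \<lambda>j. empirical_proj (K j) n X"
  defines "\<epsilon> \<equiv> \<lambda>j \<omega> x. ghat j \<omega> x - P j p0 x"
    and "ptilde \<equiv> threshold_estimator \<nu> J \<tau> ghat"
  defines "ptilde_plus \<equiv> \<lambda>\<omega>. metric_proj \<nu> (densities \<nu>) (ptilde \<omega>)"
    and "bound \<equiv>
      9 * (\<Sum>j\<in>J. ennreal (min ((l2_norm \<nu> (P j p0))\<^sup>2) ((\<tau> j)\<^sup>2)))
      + (\<Sum>\<^sub>\<infinity>j\<in>{1..} - J. ennreal ((l2_norm \<nu> (P j p0))\<^sup>2))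
      + 2 * (\<Sum>j\<in>J. ennreal (\<eta> j))"
  assumes manifold: "compact_riemannian_manifold \<A> G"
    and volume: "riemannian_volume \<A> G V" "\<nu> = normalize_measure V"
    and spectrum: "strict_mono \<mu>" "\<mu> 0 = 0" "range \<mu> = eigenvalues \<A> G \<nu>"
    and basis: "\<And>j. orthonormal_basis \<nu> (E j) (d j) (\<phi> j)"
    and prob: "prob_space \<Omega>"
    and density: "p0 \<in> densities \<nu>"
    and sample_size: "n \<ge> 1"
    and law: "\<And>i. i \<in> {1..n} \<Longrightarrow> distributed \<Omega> \<nu> (X i) (\<lambda>x. ennreal (p0 x))"
    and indep: "prob_space.indep_vars \<Omega> (\<lambda>_. \<nu>) X {1..n}"
    and J: "finite J" "J \<subseteq> {1..}"
    and tau: "\<And>j. j \<in> J \<Longrightarrow> \<tau> j > 0"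
    and eta: "\<And>j. j \<in> J \<Longrightarrow> \<eta> j \<ge> 0"
    and deviation: "\<And>j. j \<in> J \<Longrightarrow>
      (\<integral>\<^sup>+\<omega>. ennreal ((l2_norm \<nu> (\<epsilon> j \<omega>))\<^sup>2)
               * indicator {\<omega> \<in> space \<Omega>. l2_norm \<nu> (\<epsilon> j \<omega>) > \<tau> j / 2} \<omega> \<partial>\<Omega>)
      + ennreal ((\<tau> j)\<^sup>2) * emeasure \<Omega> {\<omega> \<in> space \<Omega>. l2_norm \<nu> (\<epsilon> j \<omega>) > \<tau> j / 2}
      \<le> ennreal (\<eta> j)"
  shows "risk \<nu> \<Omega> p0 ptilde \<le> bound \<and> risk \<nu> \<Omega> p0 ptilde_plus \<le> bound"
proof -
  interpret R: riemannian_spectrum \<A> G V \<nu> \<mu> d \<phi>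
    using manifold volume spectrum basis unfolding E_def by unfold_locales
  have P_eq: "P = R.P" by (simp add: P_def R.P_def E_def fun_eq_iff)
  have ghat_eq: "ghat = R.ghat n X" by (simp add: ghat_def K_def R.ghat_def fun_eq_iff)
  have X: "X i \<in> measurable \<Omega> \<nu>" if "i \<in> {1..n}" for i
    using law[OF that] by (rule distributed_measurable)
  have 1: "risk \<nu> \<Omega> p0 ptilde \<le> bound"
    unfolding ptilde_def bound_def P_eq ghat_eq
    by (rule R.oracle_inequality[OF prob density X J tau])
      (use deviation in \<open>simp_all add: \<epsilon>_def P_eq ghat_eq\<close>)
  moreover have "risk \<nu> \<Omega> p0 ptilde_plus \<le> risk \<nu> \<Omega> p0 ptilde"
    unfolding ptilde_plus_def ptilde_def ghat_eq by (rule R.risk_metric_proj_le[OF density])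
  ultimately show ?thesis by (blast intro: order_trans)
qed

end
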